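(* Let $0<p<1$ and $m_1,m_2\in\mathbb{R}$, and let $Y$ be the skew Brownian motion with two-valued drift, i.e. the solution of $$dY_t=dB_t+m(Y_t)\,dt+(2p-1)\,dL^0_t,\qquad m(x)=m_1\mathbf 1_{\{x\ge 0\}}+m_2\mathbf 1_{\{x<0\}},$$ where $B$ is a standard Brownian motion and $L^0$ is the symmetric semimartingale local time of $Y$ at $0$. Let $m_*:=|m_1|\wedge|m_2|$ and $m^*:=|m_1|\vee|m_2|$, and denote the transition densities of $Y$ with respect to Lebesgue measure by $p(t,x,y)$. Then for all $t>0$: (i) For $x>0$, $y\le 0$, $$\frac{2(1-p)}{\sqrt{2\pi t^3}}\,e^{-m_1x+m_2y-\frac{(m^* )^2t}{2}}\int_0^\infty (l-y+x)\,e^{-lpm_1+l(1-p)m_2-\frac{(l-y+x)^2}{2t}}\,dl\ \le\ p(t,x,y)$$ $$\le\ \frac{2(1-p)}{\sqrt{2\pi t^3}}\,e^{-m_1x+m_2y-\frac{m_*^2t}{2}}\int_0^\infty (l-y+x)\,e^{-lpm_1+l(1-p)m_2-\frac{(l-y+x)^2}{2t}}\,dl.$$ (ii) For $x>0$, $y>0$, $$\frac{2p}{\sqrt{2\pi t^3}}\,e^{m_1(y-x)-\frac{(m^* )^2t}{2}}\int_0^\infty (l+y+x)\,e^{-lm_1p+lm_2(1-p)-\frac{(l+y+x)^2}{2t}}\,dl+\frac{e^{-\frac{m_1^2t}{2}+m_1(y-x)}}{\sqrt{2\pi t}}\left(e^{-\frac{|x-y|^2}{2t}}-e^{-\frac{|x+y|^2}{2t}}\right)\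 \le\ p(t,x,y)$$ $$\le\ \frac{2p}{\sqrt{2\pi t^3}}\,e^{m_1(y-x)-\frac{m_*^2t}{2}}\int_0^\infty (l+y+x)\,e^{-lm_1p+lm_2(1-p)-\frac{(l+y+x)^2}{2t}}\,dl+\frac{e^{-\frac{m_1^2t}{2}+m_1(y-x)}}{\sqrt{2\pi t}}\left(e^{-\frac{|x-y|^2}{2t}}-e^{-\frac{|x+y|^2}{2t}}\right).$$ (iii) For $x<0$, $y\ge 0$, $$\frac{2p}{\sqrt{2\pi t^3}}\,e^{-m_2x+m_1y-\frac{(m^* )^2t}{2}}\int_0^\infty (l+y-x)\,e^{-lpm_1+l(1-p)m_2-\frac{(l+y-x)^2}{2t}}\,dl\ \le\ p(t,x,y)$$ $$\le\ \frac{2p}{\sqrt{2\pi t^3}}\,e^{-m_2x+m_1y-\frac{m_*^2t}{2}}\int_0^\infty (l+y-x)\,e^{-lpm_1+l(1-p)m_2-\frac{(l+y-x)^2}{2t}}\,dl.$$ (iv) For $x<0$, $y<0$, $$\frac{2(1-p)}{\sqrt{2\pi t^3}}\,e^{m_2(y-x)-\frac{(m^* )^2t}{2}}\int_0^\infty (l-y-x)\,e^{-lm_1p+lm_2(1-p)-\frac{(l-y-x)^2}{2t}}\,dl+\frac{e^{-\frac{m_2^2t}{2}+m_2(y-x)}}{\sqrt{2\pi t}}\left(e^{-\frac{|x-y|^2}{2t}}-e^{-\frac{|x+y|^2}{2t}}\right)\ \le\ p(t,x,y)$$ $$\le\ \frac{2(1-p)}{\sqrt{2\pi t^3}}\,e^{m_2(y-x)-\frac{m_*^2t}{2}}\int_0^\infty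 (l-y-x)\,e^{-lm_1p+lm_2(1-p)-\frac{(l-y-x)^2}{2t}}\,dl+\frac{e^{-\frac{m_2^2t}{2}+m_2(y-x)}}{\sqrt{2\pi t}}\left(e^{-\frac{|x-y|^2}{2t}}-e^{-\frac{|x+y|^2}{2t}}\right).$$
   Context: The symmetric semimartingale local time of $Y$ at $0$ is $$L^0_t=\lim_{\epsilon\downarrow 0}\frac{1}{2\epsilon}\int_0^t\mathbf 1_{\{Y_s\in[-\epsilon,\epsilon]\}}\,ds.$$ The SDE is well-posed and its solution is a strong Markov process; $\mathbb{P}^x$ denotes the law of $Y$ started from $Y_0=x$. The transition density satisfies $\int_A p(t,x,y)\,dy=\mathbb{P}^x[Y_t\in A]$ for all Borel sets $A\subset\mathbb{R}$, $t>0$, $x\in\mathbb{R}$. As a density in $y$ it is determined up to Lebesgue-null sets, so pointwise bounds in $y$ are understood for a suitable version (equivalently, for Lebesgue-a.e. $y$ in the stated range). The number $p\in(0,1)$ is the skewness parameter, not to be confused with the density $p(t,x,y)$; $a\wedge b=\min(a,b)$, $a\vee b=\max(a,b)$. *)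

theory Defs
  imports "HOL-Probability.Probability"
begin

text \<open>
  Time is indexed by \<open>real\<close> and only \<open>t \<ge> 0\<close> is meaningful. The library's notion of filtration
  quantifies over all of \<open>real\<close>; this is harmless, as any filtration on \<open>[0, \<infinity>)\<close> extends to negative
  times by \<open>F t = F 0\<close>. The usual conditions on the filtration are not imposed.
\<close>

locale filtered_prob_space = prob_space M + filtration "space M" F
  for M :: "'a measure" and F :: "real \<Rightarrow> 'a measure" +
  assumes sub: "\<And>t. t \<ge> 0 \<Longrightarrow> subalgebra M (F t)"

locale brownian_motion = filtered_prob_space M F
  for M :: "'a measure" and F :: "real \<Rightarrow> 'a measure" +
  fixes B :: "real \<Rightarrow> 'a \<Rightarrow> real"
  assumes B_adapted: "\<And>t. t \<ge> 0 \<Longrightarrow> B t \<in> borel_measurable (F t)"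
    and B_continuous: "\<And>\<omega>. \<omega> \<in> space M \<Longrightarrow> continuous_on {0..} (\<lambda>t. B t \<omega>)"
    and B_zero: "AE \<omega> in M. B 0 \<omega> = 0"
    and B_increment: "\<And>s t. 0 \<le> s \<Longrightarrow> s < t \<Longrightarrow>
          distributed M lborel (\<lambda>\<omega>. B t \<omega> - B s \<omega>) (normal_density 0 (sqrt (t - s)))"
    and B_indep: "\<And>s t. 0 \<le> s \<Longrightarrow> s < t \<Longrightarrow>
          indep_set (sets (F s))
            {(\<lambda>\<omega>. B t \<omega> - B s \<omega>) -` A \<inter> space M | A. A \<in> sets borel}"

text \<open>
  For the processes considered here the bracket of \<open>Y\<close> is \<open>t\<close>, so the symmetric semimartingale local
  time at 0 is the almost sure limit of normalised Lebesgue occupation times.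
\<close>

definition is_symmetric_local_time ::
    "'a measure \<Rightarrow> (real \<Rightarrow> 'a \<Rightarrow> real) \<Rightarrow> (real \<Rightarrow> 'a \<Rightarrow> real) \<Rightarrow> bool" where
  "is_symmetric_local_time M Y L \<longleftrightarrow>
     (\<forall>t\<ge>0. AE \<omega> in M.
        ((\<lambda>\<epsilon>. 1 / (2 * \<epsilon>) * (LBINT s:{0..t}. indicator {-\<epsilon>..\<epsilon>} (Y s \<omega>)))
           \<longlongrightarrow> L t \<omega>) (at_right 0))"

definition two_valued_drift :: "real \<Rightarrow> real \<Rightarrow> real \<Rightarrow> real" where
  "two_valued_drift m1 m2 x = m1 * indicator {0..} x + m2 * indicator {..<0} x"

locale skew_bm_two_valued_drift = brownian_motion M F B
  for M :: "'a measure" and F :: "real \<Rightarrow> 'a measure" and B :: "real \<Rightarrow> 'a \<Rightarrow> real" +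
  fixes Y L :: "real \<Rightarrow> 'a \<Rightarrow> real" and p m1 m2 x :: real
  assumes Y_adapted: "\<And>t. t \<ge> 0 \<Longrightarrow> Y t \<in> borel_measurable (F t)"
    and Y_continuous: "\<And>\<omega>. \<omega> \<in> space M \<Longrightarrow> continuous_on {0..} (\<lambda>t. Y t \<omega>)"
    and Y_start: "AE \<omega> in M. Y 0 \<omega> = x"
    and L_local_time: "is_symmetric_local_time M Y L"
    and Y_sde: "AE \<omega> in M. \<forall>t\<ge>0.
          Y t \<omega> = Y 0 \<omega> + B t \<omega> + (LBINT s:{0..t}. two_valued_drift m1 m2 (Y s \<omega>))
                  + (2 * p - 1) * L t \<omega>"

text \<open>
  \<open>M x\<close> and \<open>Y x\<close> are the probability space and the process for the starting point \<open>x\<close>; a single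
  process under a family of laws is the special case of constant \<open>Y\<close>.
\<close>

definition is_transition_density ::
    "(real \<Rightarrow> 'a measure) \<Rightarrow> (real \<Rightarrow> real \<Rightarrow> 'a \<Rightarrow> real) \<Rightarrow> (real \<Rightarrow> real \<Rightarrow> real \<Rightarrow> real) \<Rightarrow> bool"
  where
  "is_transition_density M Y q \<longleftrightarrow>
     (\<forall>t>0. \<forall>x. \<forall>A\<in>sets borel.
        set_integrable lborel A (q t x) \<and>
        (LBINT y:A. q t x y) = measure (M x) {\<omega> \<in> space (M x). Y x t \<omega> \<in> A})"

end

theory Submission
  imports Defs
begin

text \<open>
  Upper and lower bound are the same kernel, with \<open>exp (- k t / 2)\<close> for \<open>k = m\<^sub>*\<^sup>2\<close> and \<open>k = m\<^sup>*\<^sup>2\<close>. As a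
  function \<open>v\<close> of time and starting point, this kernel satisfies both the backward equation
  \<open>v\<^sub>t = v'' / 2 + m v'\<close> and the transmission condition \<open>p v' (0+) = (1 - p) v' (0-)\<close> up to error terms whose
  sign is determined by that of \<open>k - m1\<^sup>2\<close> and \<open>k - m2\<^sup>2\<close>; so it is a supersolution for \<open>k = m\<^sub>*\<^sup>2\<close> and a
  subsolution for \<open>k = m\<^sup>*\<^sup>2\<close>. Ito's formula for \<open>v (t + r - s) (Y s)\<close>, \<open>0 \<le> s \<le> t\<close>, then compares the mean of
  the short-time kernel \<open>v r\<close> at \<open>Y t\<close> with \<open>v (t + r)\<close> at the starting point. As \<open>r\<close> tends to 0 the
  short-time kernel is an approximate identity, and Lebesgue differentiation gives the bound on the density.

  Ito's formula is needed in expectation only and is obtained by discretising the Brownian increments.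
  The local time enters through its mean, which is identified with the limit of mean normalised
  occupation times: these are bounded in \<open>L\<^sup>2\<close>, because the conditional expected occupation
  time after any given time is bounded. The case \<open>y < 0\<close> is the reflection \<open>p \<mapsto> 1 - p\<close>, \<open>m1 \<mapsto> - m2\<close>, \<open>m2 \<mapsto> - m1\<close>.
\<close>

text \<open>The kernel comes from a change of measure. For driftless skew Brownian motion the joint
  density of position and local time is explicit. By Tanaka's formula the Girsanov weight is
  \<open>exp (F (Y t) - F x - c * l)\<close> times \<open>exp\<close> of minus half the integral of
  the squared drift, where \<open>F\<close> is the primitive of the drift vanishing at 0,
  \<open>l\<close> the local time and \<open>c = p * m1 - (1 - p) * m2\<close>. Replacing the
  squared drift by a constant \<open>k\<close> gives the two bounds. Paths that avoid 0 see a single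
  value of the drift, so their share, the killed kernel, is exact. The proof takes only the formula
  from there and verifies it analytically. Two obstacles shape this verification. The kernel in
  general has a kink at 0, also for \<open>p = 1/2\<close>, where the equation carries no local
  time; hence \<open>mean_local_time\<close> is built from a test function of its own. And the local
  time is given only as an almost sure limit at each time, which says nothing about means; this
  forces the integrability and second moment estimates.\<close>

section \<open>Gaussian increments of functions with Lipschitz derivative\<close>

text \<open>
  \<open>f2\<close> is a second derivative of \<open>f\<close> off the finite set \<open>N\<close>, in the strict sense that makes difference
  quotients of \<open>f1\<close> converge uniformly near each point. Its values on \<open>N\<close> are irrelevant, since the
  process to which \<open>f\<close> is applied has laws without atoms.
\<close>

definition C11 :: "real set \<Rightarrow> (real \<Rightarrow> real) \<Rightarrow> (real \<Rightarrow> real) \<Rightarrow> (real \<Rightarrow> real) \<Rightarrow> real \<Rightarrow> bool" where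
  "C11 N f f1 f2 C \<longleftrightarrow> finite N \<and> (\<forall>z. \<bar>f z\<bar> \<le> C) \<and> (\<forall>z. (f has_real_derivative f1 z) (at z)) \<and>
     (\<forall>z. \<bar>f1 z\<bar> \<le> C) \<and> (\<forall>a b. \<bar>f1 a - f1 b\<bar> \<le> C * \<bar>a - b\<bar>) \<and>
     f2 \<in> borel_measurable borel \<and> (\<forall>z. \<bar>f2 z\<bar> \<le> C) \<and>
     (\<forall>z. z \<notin> N \<longrightarrow> (\<forall>e>0. \<exists>d>0. \<forall>a b. \<bar>a - z\<bar> < d \<longrightarrow> \<bar>b - z\<bar> < d \<longrightarrow>
        \<bar>f1 a - f1 b - f2 z * (a - b)\<bar> \<le> e * \<bar>a - b\<bar>))"

text \<open>The finitely many exceptional points do no harm: \<open>f1\<close> is continuous across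
  them, so the fundamental theorem of calculus makes it Lipschitz. Off \<open>N\<close>, the mean
  value inequality for \<open>f1 u - f2 z * u\<close> on a small ball turns continuity of
  \<open>f2\<close> into the strict differentiability that \<open>C11\<close> asks for.\<close>

lemma C11I:
  assumes N: "finite N" and f: "\<And>z. \<bar>f z\<bar> \<le> C" and f1: "\<And>z. \<bar>f1 z\<bar> \<le> C" and f2: "\<And>z. \<bar>f2 z\<bar> \<le> C"
    and df: "\<And>z. (f has_real_derivative f1 z) (at z)"
    and cf1: "continuous_on UNIV f1"
    and df1: "\<And>z. z \<notin> N \<Longrightarrow> (f1 has_real_derivative f2 z) (at z)"
    and cf2: "\<And>z. z \<notin> N \<Longrightarrow> isCont f2 z"
    and m: "f2 \<in> borel_measurable borel"
  shows "C11 N f f1 f2 C"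
proof -
  have C: "0 \<le> C" using f[of 0] by linarith
  have lip: "\<bar>f1 b - f1 a\<bar> \<le> C * (b - a)" if "a \<le> b" for a b
  proof -
    have "(f2 has_integral f1 b - f1 a) {a..b}"
    proof (rule fundamental_theorem_of_calculus_interior_strong[OF N that])
      show "(f1 has_vector_derivative f2 x) (at x)" if "x \<in> {a<..<b} - N" for x
        using df1[of x] that by (auto simp: has_real_derivative_iff_has_vector_derivative)
      show "continuous_on {a..b} f1" using cf1 continuous_on_subset by blast
    qed
    from has_integral_bound[OF C, of f2 _ a b] this f2 that show ?thesis
      by (auto simp: content_real)
  qed
  have lip': "\<bar>f1 a - f1 b\<bar> \<le> C * \<bar>a - b\<bar>" for a b
    using lip[of a b] lip[of b a] by (cases "a \<le> b") (auto simp: abs_minus_commute)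
  have strict: "\<exists>d>0. \<forall>a b. \<bar>a - z\<bar> < d \<longrightarrow> \<bar>b - z\<bar> < d \<longrightarrow> \<bar>f1 a - f1 b - f2 z * (a - b)\<bar> \<le> e * \<bar>a - b\<bar>"
    if z: "z \<notin> N" and e: "0 < e" for z e
  proof -
    have "open (- N)" using N by (simp add: finite_imp_closed open_Compl)
    then obtain d1 where d1: "d1 > 0" "ball z d1 \<subseteq> - N"
      using z by (metis ComplI openE)
    from cf2[OF z] e obtain d2 where d2: "d2 > 0" "\<And>u. dist u z < d2 \<Longrightarrow> dist (f2 u) (f2 z) < e"
      unfolding continuous_at_eps_delta by blast
    define d where "d = min d1 d2"
    have "\<bar>f1 a - f1 b - f2 z * (a - b)\<bar> \<le> e * \<bar>a - b\<bar>" if ab: "\<bar>a - z\<bar> < d" "\<bar>b - z\<bar> < d" for a b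
    proof -
      have "norm ((f1 a - f2 z * a) - (f1 b - f2 z * b)) \<le> e * norm (a - b)"
      proof (rule field_differentiable_bound[of "ball z d" "\<lambda>u. f1 u - f2 z * u" "\<lambda>u. f2 u - f2 z"])
        fix u assume u: "u \<in> ball z d"
        then have "u \<notin> N" using d1 by (auto simp: d_def)
        then show "((\<lambda>u. f1 u - f2 z * u) has_field_derivative f2 u - f2 z) (at u within ball z d)"
          by (auto intro!: derivative_eq_intros DERIV_subset[OF df1])
        show "norm (f2 u - f2 z) \<le> e"
          using d2(2)[of u] u by (auto simp: d_def dist_real_def abs_minus_commute)
      qed (use ab in \<open>auto simp: dist_real_def abs_minus_commute\<close>)
      then show ?thesis by (simp add: algebra_simps)
    qed
    moreover have "d > 0" using d1 d2 by (simp add: d_def)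
    ultimately show ?thesis by blast
  qed
  show ?thesis unfolding C11_def using assms lip' strict by blast
qed

lemma C11D:
  assumes "C11 N f f1 f2 C"
  shows "finite N" "\<bar>f z\<bar> \<le> C" "(f has_real_derivative f1 z) (at z)" "\<bar>f1 z\<bar> \<le> C"
    "\<bar>f1 a - f1 b\<bar> \<le> C * \<bar>a - b\<bar>" "f2 \<in> borel_measurable borel" "\<bar>f2 z\<bar> \<le> C" "0 \<le> C"
  using assms unfolding C11_def by (auto intro: order_trans[OF abs_ge_zero])

lemma C11_cont: assumes "C11 N f f1 f2 C" shows "continuous_on UNIV f" "continuous_on UNIV f1"
proof -
  show "continuous_on UNIV f"
    using C11D(3)[OF assms] by (meson DERIV_isCont continuous_at_imp_continuous_on)
  have "C-lipschitz_on UNIV f1"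
    using C11D[OF assms] by (auto simp: lipschitz_on_def dist_real_def)
  then show "continuous_on UNIV f1" by (rule lipschitz_on_continuous_on)
qed

lemma C11_measurable: assumes "C11 N f f1 f2 C"
  shows "f \<in> borel_measurable borel" "f1 \<in> borel_measurable borel"
  using C11_cont[OF assms] by (auto intro: borel_measurable_continuous_onI)

text \<open>The mean value inequality for \<open>f u - f1 z * u\<close> is enough; it loses the
  factor 1/2 of the sharp remainder, but only the order of magnitude matters.\<close>

lemma C11_taylor:
  assumes n: "C11 N f f1 f2 C"
  shows "\<bar>f (z + w) - f z - f1 z * w\<bar> \<le> C * w\<^sup>2"
proof -
  have "norm ((f (z+w) - f1 z * (z+w)) - (f z - f1 z * z)) \<le> (C * \<bar>w\<bar>) * norm ((z+w) - z)"
  proof (rule field_differentiable_bound[of "closed_segment z (z+w)" "\<lambda>u. f u - f1 z * u" "\<lambda>u. f1 u - f1 z"])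
    fix u assume u: "u \<in> closed_segment z (z+w)"
    show "((\<lambda>u. f u - f1 z * u) has_field_derivative f1 u - f1 z) (at u within closed_segment z (z+w))"
      by (auto intro!: derivative_eq_intros DERIV_subset[OF C11D(3)[OF n]])
    have "\<bar>u - z\<bar> \<le> \<bar>w\<bar>" using u by (auto simp: closed_segment_eq_real_ivl split: if_splits)
    with C11D(5)[OF n, of u z] C11D(8)[OF n] show "norm (f1 u - f1 z) \<le> C * \<bar>w\<bar>"
      by (smt (verit) mult_left_mono real_norm_def)
  qed auto
  then show ?thesis by (simp add: algebra_simps power2_eq_square)
qed

text \<open>The expansion point \<open>a\<close> moves while the coefficient \<open>f2 z\<close>
  stays fixed. This is the form needed along a path, whose grid values only converge to
  \<open>z\<close>, and the reason for strict differentiability in \<open>C11\<close>.\<close>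

lemma C11_taylor2:
  assumes n: "C11 N f f1 f2 C" and z: "z \<notin> N" and e: "0 < e"
  shows "\<exists>d>0. \<forall>a w. \<bar>a - z\<bar> < d \<longrightarrow> \<bar>w\<bar> < d \<longrightarrow>
    \<bar>f (a + w) - f a - f1 a * w - f2 z * w\<^sup>2 / 2\<bar> \<le> e * w\<^sup>2"
proof -
  obtain d where d: "d > 0" "\<And>a b. \<bar>a - z\<bar> < d \<Longrightarrow> \<bar>b - z\<bar> < d \<Longrightarrow> \<bar>f1 a - f1 b - f2 z * (a - b)\<bar> \<le> e * \<bar>a - b\<bar>"
    using n z e unfolding C11_def by blast
  \<comment> \<open>Halving \<open>d\<close> puts both \<open>a\<close> and \<open>a + v\<close>
    into the \<open>d\<close>-neighbourhood of \<open>z\<close>.\<close>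
  have "\<bar>f (a + w) - f a - f1 a * w - f2 z * w\<^sup>2 / 2\<bar> \<le> e * w\<^sup>2" if ab: "\<bar>a - z\<bar> < d/2" "\<bar>w\<bar> < d/2" for a w
  proof -
    have "norm ((f (a+w) - f1 a * w - f2 z * w\<^sup>2 / 2) - (f (a+0) - f1 a * 0 - f2 z * 0\<^sup>2/2)) \<le> (e * \<bar>w\<bar>) * norm (w - 0)"
    proof (rule field_differentiable_bound[of "closed_segment 0 w" "\<lambda>v. f (a+v) - f1 a * v - f2 z * v\<^sup>2 / 2"
        "\<lambda>v. f1 (a+v) - f1 a - f2 z * v"])
      fix v assume u: "v \<in> closed_segment 0 w"
      show "((\<lambda>v. f (a+v) - f1 a * v - f2 z * v\<^sup>2 / 2) has_field_derivative f1 (a+v) - f1 a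
          - f2 z * v) (at v within closed_segment 0 w)"
        by (auto intro!: derivative_eq_intros DERIV_chain2[OF C11D(3)[OF n]])
      have v: "\<bar>v\<bar> \<le> \<bar>w\<bar>" using u by (auto simp: closed_segment_eq_real_ivl split: if_splits)
      have "\<bar>f1 (a+v) - f1 a - f2 z * ((a+v) - a)\<bar> \<le> e * \<bar>(a+v) - a\<bar>"
        by (rule d(2)) (use ab v in linarith)+
      also have "\<dots> \<le> e * \<bar>w\<bar>" using v e by simp
      finally show "norm (f1 (a+v) - f1 a - f2 z * v) \<le> e * \<bar>w\<bar>" by simp
    qed auto
    then show ?thesis by (simp add: algebra_simps power2_eq_square)
  qed
  with d(1) show ?thesis by (intro exI[of _ "d/2"]) auto
qed

section \<open>Short-time increments of the heat semigroup\<close>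

definition gauss_diff :: "(real \<Rightarrow> real) \<Rightarrow> real \<Rightarrow> real \<Rightarrow> real" where
  "gauss_diff f h z = (\<integral>u. std_normal_density u * (f (z + sqrt h * u) - f z) \<partial>lborel)"

lemma std_int:
  "integrable lborel (\<lambda>u. std_normal_density u * u)" "(\<integral>u. std_normal_density u * u \<partial>lborel) = 0"
  "integrable lborel (\<lambda>u. std_normal_density u * u\<^sup>2)" "(\<integral>u. std_normal_density u * u\<^sup>2 \<partial>lborel) = 1"
  "integrable lborel std_normal_density" "(\<integral>u. std_normal_density u \<partial>lborel) = 1"
  using integrable_std_normal_moment[of 1] integrable_std_normal_moment[of 2] integrable_std_normal_moment[of 0]
    integral_std_normal_moment_odd[of 0] integral_std_normal_moment_even[of 1] integral_std_normal_moment_even[of 0]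
  by (simp_all add: numeral_eq_Suc)

text \<open>The linear term has mean zero by symmetry. Subtracting it lowers the integrand from
  order \<open>sqrt h\<close> to order \<open>h\<close>, which both the bound and the limit of
  \<open>gauss_diff\<close> rest on.\<close>

lemma gauss_diff_eq:
  assumes n: "C11 N f f1 f2 C" and h: "h > 0"
  shows "gauss_diff f h z = (\<integral>u. std_normal_density u * (f (z + sqrt h * u) - f z - f1 z * (sqrt h * u)) \<partial>lborel)"
proof -
  note [measurable] = C11_measurable[OF n]
  have 1: "integrable lborel (\<lambda>u. std_normal_density u * (f (z + sqrt h * u) - f z))"
  proof (rule Bochner_Integration.integrable_bound[OF integrable_mult_right[OF std_int(5), of "2 * C"]])
    show "AE u in lborel. norm (std_normal_density u * (f (z + sqrt h * u) - f z))
        \<le> norm (2 * C * std_normal_density u)"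
    proof (intro AE_I2)
      fix u
      have "\<bar>f (z + sqrt h * u) - f z\<bar> \<le> 2 * C"
        using C11D(2)[OF n, of "z + sqrt h * u"] C11D(2)[OF n, of z] by linarith
      then show "norm (std_normal_density u * (f (z + sqrt h * u) - f z)) \<le> norm (2 * C * std_normal_density u)"
        using C11D(8)[OF n] by (simp add: abs_mult mult_left_mono mult.commute)
    qed
  qed simp
  have "(\<integral>u. std_normal_density u * (f (z + sqrt h * u) - f z - f1 z * (sqrt h * u)) \<partial>lborel)
     = (\<integral>u. std_normal_density u * (f (z + sqrt h * u) - f z) - (f1 z * sqrt h) * (std_normal_density u * u) \<partial>lborel)"
    by (intro Bochner_Integration.integral_cong) (auto simp: algebra_simps)
  also have "\<dots> = gauss_diff f h z - (f1 z * sqrt h) * (\<integral>u. std_normal_density u * u \<partial>lborel)"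
    unfolding gauss_diff_def using 1 std_int(1) by (subst Bochner_Integration.integral_diff) auto
  finally show ?thesis using std_int(2) by simp
qed

lemma gauss_diff_bound:
  assumes n: "C11 N f f1 f2 C" and h: "h > 0"
  shows "\<bar>gauss_diff f h z\<bar> \<le> C * h"
proof -
  note [measurable] = C11_measurable[OF n]
  have "\<bar>gauss_diff f h z\<bar> \<le> (\<integral>u. C * h * (std_normal_density u * u\<^sup>2) \<partial>lborel)"
    unfolding gauss_diff_eq[OF n h] real_norm_def[symmetric]
  proof (rule Bochner_Integration.integral_norm_bound_integral)
    fix u
    have "\<bar>f (z + sqrt h * u) - f z - f1 z * (sqrt h * u)\<bar> \<le> C * (sqrt h * u)\<^sup>2"
      by (rule C11_taylor[OF n])
    then show "norm (std_normal_density u * (f (z + sqrt h * u) - f z - f1 z * (sqrt h * u)))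
        \<le> C * h * (std_normal_density u * u\<^sup>2)"
      using h mult_left_mono[of "\<bar>f (z + sqrt h * u) - f z - f1 z * (sqrt h * u)\<bar>" "C * (sqrt h * u)\<^sup>2"
          "std_normal_density u"]
      by (simp add: abs_mult power_mult_distrib mult.assoc mult.left_commute)
    show *: "integrable lborel (\<lambda>u. C * h * (std_normal_density u * u\<^sup>2))" using std_int(3) by simp
    show "integrable lborel (\<lambda>u. std_normal_density u * (f (z + sqrt h * u) - f z - f1 z * (sqrt h * u)))"
    proof (rule Bochner_Integration.integrable_bound[OF *])
      show "AE u in lborel. norm (std_normal_density u * (f (z + sqrt h * u) - f z - f1 z * (sqrt h * u)))
          \<le> norm (C * h * (std_normal_density u * u\<^sup>2))"
      proof (intro AE_I2)
        fix u
        have "\<bar>f (z + sqrt h * u) - f z - f1 z * (sqrt h * u)\<bar> \<le> C * (sqrt h * u)\<^sup>2"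
          by (rule C11_taylor[OF n])
        then show "norm (std_normal_density u * (f (z + sqrt h * u) - f z - f1 z * (sqrt h * u)))
            \<le> norm (C * h * (std_normal_density u * u\<^sup>2))"
          using h C11D(8)[OF n] mult_left_mono[of "\<bar>f (z + sqrt h * u) - f z - f1 z * (sqrt h * u)\<bar>"
              "C * (sqrt h * u)\<^sup>2" "std_normal_density u"]
          by (simp add: abs_mult power_mult_distrib mult.assoc mult.left_commute)
      qed
    qed simp
  qed
  also have "\<dots> = C * h" using std_int(4) by simp
  finally show ?thesis .
qed

text \<open>The generator of the heat semigroup, along base points that move with the time step.
  After division by \<open>h i\<close> the integrand of \<open>gauss_diff_eq\<close> is dominated by
  \<open>C * u\<^sup>2\<close> and converges by \<open>C11_taylor2\<close>; the standard normal
  second moment is 1.\<close>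

lemma gauss_diff_lim:
  assumes n: "C11 N f f1 f2 C" and h: "\<And>i. h i > 0" "h \<longlonglongrightarrow> 0" and z: "z \<notin> N" "a \<longlonglongrightarrow> z"
  shows "(\<lambda>i. gauss_diff f (h i) (a i) / h i) \<longlonglongrightarrow> f2 z / 2"
proof -
  note [measurable] = C11_measurable[OF n]
  let ?g = "\<lambda>i u. std_normal_density u * ((f (a i + sqrt (h i) * u) - f (a i) - f1 (a i) * (sqrt (h i) * u)) / h i)"
  have "(\<lambda>i. \<integral>u. ?g i u \<partial>lborel) \<longlonglongrightarrow> (\<integral>u. std_normal_density u * (f2 z / 2 * u\<^sup>2) \<partial>lborel)"
  proof (rule integral_dominated_convergence[where w="\<lambda>u. C * (std_normal_density u * u\<^sup>2)"])
    show "integrable lborel (\<lambda>u. C * (std_normal_density u * u\<^sup>2))" using std_int(3) by simp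
    show "AE u in lborel. (\<lambda>i. ?g i u) \<longlonglongrightarrow> std_normal_density u * (f2 z / 2 * u\<^sup>2)"
    proof (intro AE_I2 tendsto_mult tendsto_const)
      fix u :: real
      have su: "(\<lambda>i. sqrt (h i) * u) \<longlonglongrightarrow> 0"
        using tendsto_mult_left_zero[OF tendsto_real_sqrt[OF h(2), simplified]] by simp
      show "(\<lambda>i. (f (a i + sqrt (h i) * u) - f (a i) - f1 (a i) * (sqrt (h i) * u)) / h i) \<longlonglongrightarrow> f2 z / 2 * u\<^sup>2"
      proof (rule LIMSEQ_I)
        fix r :: real assume r: "r > 0"
        \<comment> \<open>Chosen so that \<open>e * u\<^sup>2 \<le> r / 2\<close>; the added 1
          covers \<open>u = 0\<close>.\<close>
        define e where "e = r / (2 * (u\<^sup>2 + 1))"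
        have u1: "u\<^sup>2 + 1 > 0" by (simp add: add_nonneg_pos)
        have e: "e > 0" using r u1 by (simp add: e_def)
        obtain d where d: "d > 0" "\<And>a w. \<bar>a - z\<bar> < d \<Longrightarrow> \<bar>w\<bar> < d \<Longrightarrow>
            \<bar>f (a + w) - f a - f1 a * w - f2 z * w\<^sup>2 / 2\<bar> \<le> e * w\<^sup>2"
          using C11_taylor2[OF n z(1) e] by blast
        have "eventually (\<lambda>i. \<bar>a i - z\<bar> < d) sequentially"
          using z(2) d(1) by (auto simp: tendsto_iff dist_real_def)
        moreover have "eventually (\<lambda>i. \<bar>sqrt (h i) * u\<bar> < d) sequentially"
          using su d(1) unfolding tendsto_iff dist_real_def by (simp only: diff_zero)
        ultimately have "eventually (\<lambda>i. norm ((f (a i + sqrt (h i) * u) - f (a i)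
            - f1 (a i) * (sqrt (h i) * u)) / h i - f2 z / 2 * u\<^sup>2) < r) sequentially"
        proof eventually_elim
          case (elim i)
          have hi: "h i > 0" by (rule h)
          have "(sqrt (h i) * u)\<^sup>2 = h i * u\<^sup>2" using hi by (simp add: power_mult_distrib)
          then have "\<bar>f (a i + sqrt (h i) * u) - f (a i) - f1 (a i) * (sqrt (h i) * u) - f2 z * (h i * u\<^sup>2) / 2\<bar>
              \<le> e * (h i * u\<^sup>2)"
            using d(2)[OF elim] by simp
          then have "\<bar>f (a i + sqrt (h i) * u) - f (a i) - f1 (a i) * (sqrt (h i) * u)
              - f2 z * (h i * u\<^sup>2) / 2\<bar> / h i \<le> e * u\<^sup>2"
            using hi by (simp add: field_simps)
          moreover have "(f (a i + sqrt (h i) * u) - f (a i) - f1 (a i) * (sqrt (h i) * u)) / h i - f2 z / 2 * u\<^sup>2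
             = (f (a i + sqrt (h i) * u) - f (a i) - f1 (a i) * (sqrt (h i) * u) - f2 z * (h i * u\<^sup>2) / 2) / h i"
            using hi by (simp add: field_simps)
          ultimately have "norm ((f (a i + sqrt (h i) * u) - f (a i) - f1 (a i) * (sqrt (h i) * u)) / h i
              - f2 z / 2 * u\<^sup>2) \<le> e * u\<^sup>2"
            using hi by (simp add: abs_divide)
          also have "e * u\<^sup>2 \<le> r / 2"
          proof -
            have "e * u\<^sup>2 \<le> e * (u\<^sup>2 + 1)" using e by simp
            also have "\<dots> = r / 2"
            proof -
              have "r / (2 * D) * D = r / 2" if "D > 0" for D :: real using that by simp
              from this[OF u1] show ?thesis by (simp only: e_def)
            qed
            finally show ?thesis .
          qed
          finally show ?case using r by linarith
        qed
        then show "\<exists>no. \<forall>i\<ge>no. norm ((f (a i + sqrt (h i) * u) - f (a i) - f1 (a i) * (sqrt (h i) * u)) / h i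
            - f2 z / 2 * u\<^sup>2) < r"
          by (simp add: eventually_sequentially)
      qed
    qed
    show "AE u in lborel. norm (?g i u) \<le> C * (std_normal_density u * u\<^sup>2)" for i
    proof (intro AE_I2)
      fix u
      have hi: "h i > 0" by (rule h)
      have "(sqrt (h i) * u)\<^sup>2 = h i * u\<^sup>2" using hi by (simp add: power_mult_distrib)
      then have "\<bar>f (a i + sqrt (h i) * u) - f (a i) - f1 (a i) * (sqrt (h i) * u)\<bar> \<le> C * (h i * u\<^sup>2)"
        using C11_taylor[OF n, of "a i" "sqrt (h i) * u"] by simp
      then have "\<bar>(f (a i + sqrt (h i) * u) - f (a i) - f1 (a i) * (sqrt (h i) * u)) / h i\<bar> \<le> C * u\<^sup>2"
        using hi by (simp add: field_simps abs_divide)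
      then show "norm (?g i u) \<le> C * (std_normal_density u * u\<^sup>2)"
        unfolding real_norm_def abs_mult[of "std_normal_density u"] mult.left_commute[of C]
        by (intro mult_mono) auto
    qed
  qed auto
  moreover have "(\<integral>u. std_normal_density u * (f2 z / 2 * u\<^sup>2) \<partial>lborel) = f2 z / 2"
  proof -
    have "(\<integral>u. std_normal_density u * (f2 z / 2 * u\<^sup>2) \<partial>lborel) = (\<integral>u. f2 z / 2 * (std_normal_density u * u\<^sup>2) \<partial>lborel)"
      by (intro Bochner_Integration.integral_cong) auto
    then show ?thesis using std_int(4) by simp
  qed
  moreover have "(\<integral>u. ?g i u \<partial>lborel) = gauss_diff f (h i) (a i) / h i" for i
    unfolding gauss_diff_eq[OF n h(1)] by (subst integral_divide_zero[symmetric])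
        (auto intro!: Bochner_Integration.integral_cong)
  ultimately show ?thesis by (simp only:)
qed

section \<open>Riemann sums along a path\<close>

definition grid :: "real \<Rightarrow> real \<Rightarrow> nat \<Rightarrow> nat \<Rightarrow> real" where
  "grid s t n k = s + real k * ((t - s) / real n)"

lemma grid_0[simp]: "grid s t n 0 = s" by (simp add: grid_def)
lemma grid_n[simp]: "n > 0 \<Longrightarrow> grid s t n n = t" by (simp add: grid_def)
lemma grid_Suc: "grid s t n (Suc k) = grid s t n k + (t - s) / real n"
  by (simp add: grid_def distrib_right add_divide_distrib)

lemma grid_step: "s < t \<Longrightarrow> n > 0 \<Longrightarrow> grid s t n k < grid s t n (Suc k)"
  by (simp add: grid_Suc)

lemma grid_mono: "s \<le> t \<Longrightarrow> i \<le> j \<Longrightarrow> grid s t n i \<le> grid s t n j"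
  unfolding grid_def by (intro add_left_mono mult_right_mono) auto

lemma grid_bounds: assumes "s \<le> t" "k \<le> n" "n > 0" shows "s \<le> grid s t n k" "grid s t n k \<le> t"
  using grid_mono[OF assms(1), of 0 k n] grid_mono[OF assms(1,2), of n] assms(3) by auto

definition grid_index :: "real \<Rightarrow> real \<Rightarrow> nat \<Rightarrow> real \<Rightarrow> nat" where
  "grid_index s t n r = nat \<lfloor>(r - s) * real n / (t - s)\<rfloor>"

lemma grid_index_iff:
  assumes "s < t" "n > 0" "s \<le> r"
  shows "grid s t n k \<le> r \<and> r < grid s t n (Suc k) \<longleftrightarrow> k = grid_index s t n r"
proof -
  let ?v = "(r - s) * real n / (t - s)"
  have v: "0 \<le> ?v" using assms by simp
  have a: "grid s t n j \<le> r \<longleftrightarrow> real j \<le> ?v" for j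
    unfolding grid_def using assms by (simp add: field_simps)
  have "grid s t n k \<le> r \<and> r < grid s t n (Suc k) \<longleftrightarrow> real k \<le> ?v \<and> \<not> real (Suc k) \<le> ?v"
    using a[of k] a[of "Suc k"] by auto
  also have "\<dots> \<longleftrightarrow> \<lfloor>?v\<rfloor> = int k" by (auto simp: floor_eq_iff)
  also have "\<dots> \<longleftrightarrow> k = grid_index s t n r"
    unfolding grid_index_def using v by auto
  finally show ?thesis .
qed

lemma grid_index_bounds:
  assumes "s < t" "n > 0" "s \<le> r"
  shows "grid s t n (grid_index s t n r) \<le> r" "r < grid s t n (Suc (grid_index s t n r))"
  using grid_index_iff[OF assms, of "grid_index s t n r"] by auto

lemma grid_index_less: assumes "s < t" "n > 0" "s \<le> r" "r < t" shows "grid_index s t n r < n"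
proof (rule ccontr)
  assume "\<not> grid_index s t n r < n"
  then have "grid s t n n \<le> grid s t n (grid_index s t n r)" using assms by (intro grid_mono) auto
  then show False using grid_index_bounds(1)[OF assms(1-3)] assms by simp
qed

lemma mesh_tendsto: "(\<lambda>n. (t - s) / real n) \<longlonglongrightarrow> 0"
  by real_asymp

lemma grid_index_tendsto:
  assumes "s < t" "s \<le> r" "\<And>n. n > 0 \<Longrightarrow> grid s t n (grid_index s t n r) \<le> \<xi> n \<and> \<xi> n
      \<le> grid s t n (Suc (grid_index s t n r))"
  shows "\<xi> \<longlonglongrightarrow> r"
proof -
  have "\<bar>\<xi> n - r\<bar> \<le> (t - s) / real n" if "n > 0" for n
    using assms(3)[OF that] grid_index_bounds[OF assms(1) that assms(2)] grid_Suc[of s t n "grid_index s t n r"]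
        by linarith
  then have "eventually (\<lambda>n. norm (\<xi> n - r) \<le> (t - s) / real n) sequentially"
    by (intro eventually_sequentiallyI[of 1]) auto
  from Lim_null_comparison[OF this mesh_tendsto] show ?thesis
    by (simp add: LIM_zero_iff)
qed

section \<open>Time integrals and their approximation cell by cell\<close>

lemma set_lint_Icc_Ico:
  fixes f :: "real \<Rightarrow> real"
  assumes "f \<in> borel_measurable borel"
  shows "(LBINT r:{a..b}. f r) = (LBINT r:{a..<b}. f r)"
  unfolding set_lebesgue_integral_def
proof (rule integral_cong_AE)
  show "AE r in lborel. indicator {a..b} r *\<^sub>R f r = indicator {a..<b} r *\<^sub>R f r"
    using AE_lborel_singleton[of b] by eventually_elim (auto simp: indicator_def)
qed (use assms in auto)

lemma bounded_set_integrable: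
  fixes f :: "real \<Rightarrow> real"
  assumes "f \<in> borel_measurable borel" "\<And>r. r \<in> {a..b} \<Longrightarrow> \<bar>f r\<bar> \<le> C"
  shows "set_integrable lborel {a..b} f"
  unfolding set_integrable_def
proof (rule Bochner_Integration.integrable_bound[where f="\<lambda>r. indicator {a..b} r *\<^sub>R C"])
  show "integrable lborel (\<lambda>r. indicator {a..b} r *\<^sub>R C)"
    by (cases "a \<le> b") (auto simp: integrable_indicator_iff)
  show "AE r in lborel. norm (indicator {a..b} r *\<^sub>R f r) \<le> norm (indicator {a..b} r *\<^sub>R C)"
    by (intro AE_I2) (auto simp: indicator_def intro!: order_trans[OF assms(2) abs_ge_self])
qed (use assms in auto)

lemma set_lint_bound:
  fixes f :: "real \<Rightarrow> real"
  assumes "a \<le> b" "\<And>r. r \<in> {a..b} \<Longrightarrow> \<bar>f r\<bar> \<le> C"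
  shows "\<bar>LBINT r:{a..b}. f r\<bar> \<le> C * (b - a)"
proof (cases "set_integrable lborel {a..b} f")
  case True
  have "norm (LBINT r:{a..b}. f r) \<le> (LBINT r:{a..b}. C)"
    unfolding set_lebesgue_integral_def
  proof (rule Bochner_Integration.integral_norm_bound_integral)
    show "integrable lborel (\<lambda>r. indicator {a..b} r *\<^sub>R f r)" using True by (simp add: set_integrable_def)
    show "integrable lborel (\<lambda>r. indicator {a..b} r *\<^sub>R C)"
      using assms(1) by (auto simp: integrable_indicator_iff)
  qed (use assms(2) in \<open>auto simp: indicator_def\<close>)
  also have "\<dots> = C * (b - a)" using assms(1) by (simp add: set_lebesgue_integral_def mult.commute)
  finally show ?thesis by simp
next
  case False
  moreover have "0 \<le> C * (b - a)" using assms(2)[of a] assms(1) by (auto intro: order_trans[OF abs_ge_zero])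
  ultimately show ?thesis unfolding set_lebesgue_integral_def set_integrable_def
    by (simp add: not_integrable_integral_eq)
qed

text \<open>The integrand may change from cell to cell. Half-open cells contain each time exactly
  once, so the sum is a single integral of \<open>b n (grid_index s t n r) r\<close>, and dominated
  convergence applies. Closed cells in the statement make no difference, since points are
  null.\<close>

lemma sum_integral_limit:
  fixes b :: "nat \<Rightarrow> nat \<Rightarrow> real \<Rightarrow> real"
  assumes st: "s < t" and m: "\<And>n k. b n k \<in> borel_measurable borel" "g \<in> borel_measurable borel"
    and bd: "\<And>n k r. k < n \<Longrightarrow> r \<in> {grid s t n k..<grid s t n (Suc k)} \<Longrightarrow> \<bar>b n k r\<bar> \<le> C"
    and lim: "AE r in lborel. s < r \<longrightarrow> r < t \<longrightarrow> (\<lambda>n. b n (grid_index s t n r) r) \<longlonglongrightarrow> g r"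
  shows "(\<lambda>n. \<Sum>k<n. LBINT r:{grid s t n k..grid s t n (Suc k)}. b n k r) \<longlonglongrightarrow> (LBINT r:{s..t}. g r)"
proof -
  note [measurable] = m
  let ?f = "\<lambda>n r. \<Sum>k<n. indicator {grid s t n k..<grid s t n (Suc k)} r *\<^sub>R b n k r"
  have f_eq: "?f n r = indicator {s..<t} r *\<^sub>R b n (grid_index s t n r) r" if n: "n > 0" for n r
  proof (cases "s \<le> r \<and> r < t")
    case True
    have i: "grid_index s t n r < n" by (rule grid_index_less[OF st n]) (use True in auto)
    have "?f n r = (\<Sum>k<n. if k = grid_index s t n r then b n k r else 0)"
      using grid_index_iff[OF st n, of r] True by (intro sum.cong) (auto simp: indicator_def)
    also have "\<dots> = b n (grid_index s t n r) r" using i by simp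
    finally show ?thesis using True by simp
  next
    case False
    have "indicator {grid s t n k..<grid s t n (Suc k)} r = (0::real)" if "k < n" for k
      using grid_bounds[of s t k n] grid_bounds[of s t "Suc k" n] st n that False by (auto simp: indicator_def)
    then have "?f n r = 0" by (intro sum.neutral) auto
    then show ?thesis using False by (auto simp: indicator_def)
  qed
  have int: "integrable lborel (\<lambda>r. indicator {grid s t n k..<grid s t n (Suc k)} r *\<^sub>R b n k r)" if "k < n" for n k
  proof (rule Bochner_Integration.integrable_bound[where
      f="\<lambda>r. indicator {grid s t n k..<grid s t n (Suc k)} r *\<^sub>R C"])
    show "AE r in lborel. norm (indicator {grid s t n k..<grid s t n (Suc k)} r *\<^sub>R b n k r)
        \<le> norm (indicator {grid s t n k..<grid s t n (Suc k)} r *\<^sub>R C)"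
      by (intro AE_I2) (auto simp: indicator_def intro!: order_trans[OF bd[OF that] abs_ge_self])
    show "integrable lborel (\<lambda>r. indicator {grid s t n k..<grid s t n (Suc k)} r *\<^sub>R C)"
      using grid_step[OF st, of n k] that by (simp add: integrable_indicator_iff)
  qed (use m in auto)
  have "(\<Sum>k<n. LBINT r:{grid s t n k..grid s t n (Suc k)}. b n k r) = (\<integral>r. ?f n r \<partial>lborel)" for n
    unfolding set_lint_Icc_Ico[OF m(1)] unfolding set_lebesgue_integral_def
    using int by (subst Bochner_Integration.integral_sum) auto
  moreover have "(\<lambda>n. \<integral>r. ?f n r \<partial>lborel) \<longlonglongrightarrow> (\<integral>r. indicator {s..<t} r *\<^sub>R g r \<partial>lborel)"
  proof (rule integral_dominated_convergence[where w="\<lambda>r. indicator {s..<t} r *\<^sub>R C"])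
    show "integrable lborel (\<lambda>r. indicator {s..<t} r *\<^sub>R C)" using st by (simp add: integrable_indicator_iff)
    show "AE r in lborel. (\<lambda>n. ?f n r) \<longlonglongrightarrow> indicator {s..<t} r *\<^sub>R g r"
      using lim AE_lborel_singleton[of s]
    proof eventually_elim
      case (elim r)
      have "(\<lambda>n. indicator {s..<t} r *\<^sub>R b n (grid_index s t n r) r) \<longlonglongrightarrow> indicator {s..<t} r *\<^sub>R g r"
        using elim by (cases "s < r \<and> r < t") (auto simp: indicator_def)
      then show ?case
        by (rule Lim_transform_eventually)
          (use f_eq in \<open>auto intro!: eventually_sequentiallyI[of 1]\<close>)
    qed
    show "AE r in lborel. norm (?f n r) \<le> indicator {s..<t} r *\<^sub>R C" for n
    proof (intro AE_I2)
      fix r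
      show "norm (?f n r) \<le> indicator {s..<t} r *\<^sub>R C"
      proof (cases "n > 0 \<and> s \<le> r \<and> r < t")
        case True
        then have "\<bar>b n (grid_index s t n r) r\<bar> \<le> C"
          using grid_index_less[OF st, of n r] grid_index_bounds[OF st, of n r] by (intro bd) auto
        then show ?thesis using f_eq[of n r] True by simp
      next
        case False
        \<comment> \<open>That \<open>C\<close> is nonnegative comes from the bound on the single
          cell of the one-step grid.\<close>
        have "indicator {s..<t} r *\<^sub>R C \<ge> 0"
        proof (cases "s \<le> r \<and> r < t")
          case True
          have "\<bar>b 1 (grid_index s t 1 r) r\<bar> \<le> C"
            using True grid_index_less[OF st, of 1 r] grid_index_bounds[OF st, of 1 r] by (intro bd) auto
          then show ?thesis by (simp add: indicator_def)
        qed (auto simp: indicator_def)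
        moreover have "?f n r = 0"
        proof (cases "n = 0")
          case n: False
          then show ?thesis using f_eq[of n r] False by (auto simp: indicator_def)
        qed simp
        ultimately show ?thesis by simp
      qed
    qed
  qed measurable
  moreover have "(\<integral>r. indicator {s..<t} r *\<^sub>R g r \<partial>lborel) = (LBINT r:{s..t}. g r)"
    unfolding set_lint_Icc_Ico[OF m(2)] unfolding set_lebesgue_integral_def by simp
  ultimately show ?thesis by simp
qed

section \<open>Change of variables along a single path\<close>

lemma mvt_between:
  fixes f :: "real \<Rightarrow> real"
  assumes "\<And>z. (f has_real_derivative f1 z) (at z)"
  shows "\<exists>\<xi>. min p q \<le> \<xi> \<and> \<xi> \<le> max p q \<and> f p - f q = f1 \<xi> * (p - q)"
proof (cases p q rule: linorder_cases)
  case less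
  from MVT2[OF less, of f f1] assms obtain z where "p < z" "z < q" "f q - f p = (q - p) * f1 z" by blast
  then show ?thesis by (intro exI[of _ z]) (auto simp: algebra_simps)
next
  case greater
  from MVT2[OF greater, of f f1] assms obtain z where "q < z" "z < p" "f p - f q = (p - q) * f1 z" by blast
  then show ?thesis by (intro exI[of _ z]) (auto simp: algebra_simps)
qed auto

lemma grid_osc:
  fixes y :: "real \<Rightarrow> real"
  assumes st: "s < t" and y: "continuous_on UNIV y" and e: "e > 0"
  shows "eventually (\<lambda>n. \<forall>k<n. \<forall>u\<in>{grid s t n k..grid s t n (Suc k)}. \<forall>v\<in>{grid s t n k..grid s t n (Suc k)}.
      \<bar>y u - y v\<bar> < e) sequentially"
proof -
  have "uniformly_continuous_on {s..t} y"
    using y by (intro compact_uniformly_continuous) (auto intro: continuous_on_subset)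
  then obtain d where d: "d > 0" "\<And>u v. u \<in> {s..t} \<Longrightarrow> v \<in> {s..t} \<Longrightarrow> dist v u < d \<Longrightarrow> dist (y v) (y u) < e"
    using e unfolding uniformly_continuous_on_def by metis
  have "eventually (\<lambda>n. (t - s) / real n < d) sequentially"
    using mesh_tendsto[of t s] d(1) by (rule order_tendstoD)
  then show ?thesis using eventually_gt_at_top[of 0]
  proof eventually_elim
    case (elim n)
    show ?case
    proof (intro allI impI ballI)
      fix k u v assume k: "k < n" and uv: "u \<in> {grid s t n k..grid s t n (Suc k)}"
          "v \<in> {grid s t n k..grid s t n (Suc k)}"
      have "dist u v < d" using uv elim grid_Suc[of s t n k] by (auto simp: dist_real_def)
      moreover have "u \<in> {s..t}" "v \<in> {s..t}"
        using uv grid_bounds[of s t k n] grid_bounds[of s t "Suc k" n] k st by auto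
      ultimately show "\<bar>y u - y v\<bar> < e" using d(2)[of v u] by (auto simp: dist_real_def)
    qed
  qed
qed

text \<open>In each summand the noise \<open>\<beta>\<close> has been removed, so by the mean value
  theorem it is \<open>f1\<close> at an intermediate point times the increments of drift and
  \<open>w\<close> only. The drift part is covered by \<open>sum_integral_limit\<close>. The
  \<open>w\<close> part lives on cells that contain a zero of \<open>y\<close>, where
  \<open>f1\<close> is close to \<open>f1 0\<close>, and monotonicity bounds the total variation of
  \<open>w\<close> by \<open>\<bar>w t - w s\<bar>\<close>. The second claim supplies the dominating
  function for Ito's formula; the third, one-sided one is for the moment when nothing is known yet
  about the integrability of \<open>w\<close>.\<close>

lemma path_sum_limit:
  fixes y \<beta> w :: "real \<Rightarrow> real"
  assumes st: "s < t" and cy: "continuous_on UNIV y" and cb: "continuous_on UNIV \<beta>"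
    and n: "C11 N f f1 f2 C" and b: "b \<in> borel_measurable borel" "\<And>z. \<bar>b z\<bar> \<le> K"
    and \<sigma>: "\<sigma> \<in> {-1, 1}"
    and wmono: "\<And>u v. s \<le> u \<Longrightarrow> u \<le> v \<Longrightarrow> v \<le> t \<Longrightarrow> \<sigma> * w u \<le> \<sigma> * w v"
    and wflat: "\<And>u v. s \<le> u \<Longrightarrow> u \<le> v \<Longrightarrow> v \<le> t \<Longrightarrow> (\<And>r. r \<in> {u..v} \<Longrightarrow> y r \<noteq> 0) \<Longrightarrow> w u = w v"
    and eq: "\<And>u v. s \<le> u \<Longrightarrow> u \<le> v \<Longrightarrow> v \<le> t \<Longrightarrow> y v - y u = \<beta> v - \<beta> u + (LBINT r:{u..v}. b (y r)) + (w v - w u)"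
  shows "(\<lambda>n. \<Sum>k<n. f (y (grid s t n (Suc k))) - f (y (grid s t n k) + (\<beta> (grid s t n (Suc k)) - \<beta> (grid s t n k))))
     \<longlonglongrightarrow> (LBINT r:{s..t}. f1 (y r) * b (y r)) + f1 0 * (w t - w s)"
    and "\<And>n. n > 0 \<Longrightarrow> \<bar>\<Sum>k<n. f (y (grid s t n (Suc k))) - f (y (grid s t n k)
        + (\<beta> (grid s t n (Suc k)) - \<beta> (grid s t n k)))\<bar>
      \<le> C * (K * (t - s) + \<bar>w t - w s\<bar>)"
    and "\<And>n k. k < n \<Longrightarrow> (\<And>z. 0 \<le> f1 z) \<Longrightarrow>
      - C * K * ((t - s) / n) \<le> \<sigma> * (f (y (grid s t n (Suc k)))
          - f (y (grid s t n k) + (\<beta> (grid s t n (Suc k)) - \<beta> (grid s t n k))))"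
proof -
  define p where "p n k = y (grid s t n (Suc k))" for n k
  define q where "q n k = y (grid s t n k) + (\<beta> (grid s t n (Suc k)) - \<beta> (grid s t n k))" for n k
  have "\<exists>\<xi>. min (p n k) (q n k) \<le> \<xi> \<and> \<xi> \<le> max (p n k) (q n k) \<and> f (p n k) - f (q n k)
      = f1 \<xi> * (p n k - q n k)" for n k
    by (rule mvt_between[OF C11D(3)[OF n]])
  then obtain \<xi> where \<xi>: "\<And>n k. min (p n k) (q n k) \<le> \<xi> n k" "\<And>n k. \<xi> n k \<le> max (p n k) (q n k)"
      "\<And>n k. f (p n k) - f (q n k) = f1 (\<xi> n k) * (p n k - q n k)" by metis
  define dw where "dw n k = w (grid s t n (Suc k)) - w (grid s t n k)" for n k
  define dr where "dr n k = (LBINT r:{grid s t n k..grid s t n (Suc k)}. b (y r))" for n k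
  note C = C11D(8)[OF n]
  have gb: "s \<le> grid s t n k" "grid s t n k \<le> grid s t n (Suc k)" "grid s t n (Suc k) \<le> t" if "k < n" for n k
    using grid_bounds[of s t k n] grid_bounds[of s t "Suc k" n] grid_mono[of s t k "Suc k" n] st that by auto
  have pq: "p n k - q n k = dr n k + dw n k" if "k < n" for n k
    using eq[OF gb[OF that]] by (simp add: p_def q_def dr_def dw_def)
  have dws: "0 \<le> \<sigma> * dw n k" if "k < n" for n k
    using wmono[OF gb[OF that]] by (simp add: dw_def algebra_simps)
  have adw: "\<bar>dw n k\<bar> = \<sigma> * dw n k" if "k < n" for n k
    using dws[OF that] \<sigma> by auto
  have sdw: "(\<Sum>k<n. dw n k) = w t - w s" if "n > 0" for n
    using sum_lessThan_telescope[of "\<lambda>k. w (grid s t n k)" n] that by (simp add: dw_def)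
  have sadw: "(\<Sum>k<n. \<bar>dw n k\<bar>) = \<bar>w t - w s\<bar>" if "n > 0" for n
  proof -
    have "(\<Sum>k<n. \<bar>dw n k\<bar>) = \<sigma> * (w t - w s)"
      using sdw[OF that] adw by (simp add: sum_distrib_left[symmetric])
    moreover have "0 \<le> \<sigma> * (w t - w s)" using wmono[of s t] st by (simp add: algebra_simps)
    ultimately show ?thesis using \<sigma> by auto
  qed
  have my: "y \<in> borel_measurable borel" using cy by (rule borel_measurable_continuous_onI)
  have adr: "\<bar>dr n k\<bar> \<le> K * ((t - s) / n)" if "k < n" for n k
    using set_lint_bound[of "grid s t n k" "grid s t n (Suc k)" "\<lambda>r. b (y r)" K] gb[OF that] b
    by (simp add: dr_def grid_Suc)
  show "\<bar>\<Sum>k<n. f (y (grid s t n (Suc k))) - f (y (grid s t n k) + (\<beta> (grid s t n (Suc k)) - \<beta> (grid s t n k)))\<bar>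
      \<le> C * (K * (t - s) + \<bar>w t - w s\<bar>)" if n0: "n > 0" for n
  proof -
    have "\<bar>\<Sum>k<n. f (p n k) - f (q n k)\<bar> \<le> (\<Sum>k<n. C * (K * ((t - s) / n) + \<bar>dw n k\<bar>))"
    proof (rule order_trans[OF sum_abs sum_mono])
      fix k assume "k \<in> {..<n}"
      then have k: "k < n" by simp
      have "\<bar>f (p n k) - f (q n k)\<bar> \<le> C * \<bar>p n k - q n k\<bar>"
        using \<xi>(3)[of n k] C11D(4)[OF n, of "\<xi> n k"] by (simp add: abs_mult mult_right_mono)
      also have "\<dots> \<le> C * (K * ((t - s) / n) + \<bar>dw n k\<bar>)"
        using pq[OF k] adr[OF k] C by (intro mult_left_mono) auto
      finally show "\<bar>f (p n k) - f (q n k)\<bar> \<le> C * (K * ((t - s) / n) + \<bar>dw n k\<bar>)" .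
    qed
    also have "\<dots> = C * (K * (t - s) + \<bar>w t - w s\<bar>)"
      using sadw[OF n0] n0 by (simp add: sum_distrib_left[symmetric] sum.distrib)
    finally show ?thesis by (simp add: p_def q_def)
  qed
  show "- C * K * ((t - s) / n) \<le> \<sigma> * (f (y (grid s t n (Suc k)))
      - f (y (grid s t n k) + (\<beta> (grid s t n (Suc k)) - \<beta> (grid s t n k))))"
    if k: "k < n" and pos: "\<And>z. 0 \<le> f1 z" for n k
  proof -
    have "\<bar>f1 (\<xi> n k) * dr n k\<bar> \<le> C * (K * ((t - s) / n))"
      unfolding abs_mult by (intro mult_mono adr[OF k] C11D(4)[OF n] C) auto
    then have "- (C * (K * ((t - s) / n))) \<le> \<sigma> * (f1 (\<xi> n k) * dr n k)" using \<sigma> by auto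
    also have "\<dots> \<le> \<sigma> * (f1 (\<xi> n k) * dr n k) + f1 (\<xi> n k) * (\<sigma> * dw n k)"
      using dws[OF k] pos by simp
    also have "\<dots> = \<sigma> * (f (p n k) - f (q n k))" using pq[OF k] \<xi>(3)[of n k] by (simp add: algebra_simps)
    finally show ?thesis by (simp add: p_def q_def mult.assoc)
  qed
  have drift: "(\<lambda>n. \<Sum>k<n. LBINT r:{grid s t n k..grid s t n (Suc k)}. f1 (\<xi> n k) * b (y r))
      \<longlonglongrightarrow> (LBINT r:{s..t}. f1 (y r) * b (y r))"
  proof (rule sum_integral_limit[OF st, where C="C * K"])
    note [measurable] = my b(1) C11_measurable[OF n]
    show "(\<lambda>r. f1 (\<xi> n k) * b (y r)) \<in> borel_measurable borel" for n k by measurable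
    show "(\<lambda>r. f1 (y r) * b (y r)) \<in> borel_measurable borel" by measurable
    show "\<bar>f1 (\<xi> n k) * b (y r)\<bar> \<le> C * K" for n k r
      unfolding abs_mult by (intro mult_mono C11D(4)[OF n] b C) auto
    show "AE r in lborel. s < r \<longrightarrow> r < t \<longrightarrow> (\<lambda>n. f1 (\<xi> n (grid_index s t n r)) * b (y r)) \<longlonglongrightarrow> f1 (y r) * b (y r)"
    proof (intro AE_I2 impI tendsto_mult tendsto_const)
      fix r assume r: "s < r" "r < t"
      have iy: "isCont y r" for r using cy by (simp add: continuous_on_eq_continuous_at)
      have ib: "isCont \<beta> r" for r using cb by (simp add: continuous_on_eq_continuous_at)
      have l1: "(\<lambda>n. grid s t n (grid_index s t n r)) \<longlonglongrightarrow> r" "(\<lambda>n. grid s t n (Suc (grid_index s t n r))) \<longlonglongrightarrow> r"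
        using grid_index_tendsto[OF st, of r] r grid_mono[of s t "grid_index s t _ r"
            "Suc (grid_index s t _ r)"] st by auto
      have pl: "(\<lambda>n. p n (grid_index s t n r)) \<longlonglongrightarrow> y r"
        unfolding p_def by (rule isCont_tendsto_compose[OF iy l1(2)])
      have "(\<lambda>n. q n (grid_index s t n r)) \<longlonglongrightarrow> y r + (\<beta> r - \<beta> r)"
        unfolding q_def by (intro tendsto_add tendsto_diff isCont_tendsto_compose[OF iy]
            isCont_tendsto_compose[OF ib] l1)
      then have ql: "(\<lambda>n. q n (grid_index s t n r)) \<longlonglongrightarrow> y r" by simp
      have "(\<lambda>n. \<xi> n (grid_index s t n r)) \<longlonglongrightarrow> y r"
      proof (rule tendsto_sandwich)
        show "(\<lambda>n. min (p n (grid_index s t n r)) (q n (grid_index s t n r))) \<longlonglongrightarrow> y r" using tendsto_min[OF pl ql]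
            by simp
        show "(\<lambda>n. max (p n (grid_index s t n r)) (q n (grid_index s t n r))) \<longlonglongrightarrow> y r" using tendsto_max[OF pl ql]
            by simp
      qed (use \<xi> in auto)
      moreover have "isCont f1 (y r)" using C11_cont(2)[OF n] by (simp add: continuous_on_eq_continuous_at)
      ultimately show "(\<lambda>n. f1 (\<xi> n (grid_index s t n r))) \<longlonglongrightarrow> f1 (y r)" by (metis isCont_tendsto_compose)
    qed
  qed
  have wpart: "(\<lambda>n. \<Sum>k<n. (f1 (\<xi> n k) - f1 0) * dw n k) \<longlonglongrightarrow> 0"
  proof (rule LIMSEQ_I)
    fix r :: real assume r: "r > 0"
    \<comment> \<open>With \<open>e = r / D\<close> the final estimate
      \<open>2 * C * e * \<bar>w t - w s\<bar>\<close> equals \<open>e * (D - 1)\<close>, which is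
      below \<open>r\<close>; the added 1 keeps \<open>D\<close> positive when \<open>w\<close> does
      not move.\<close>
    define D where "D = 2 * C * \<bar>w t - w s\<bar> + 1"
    have D: "D > 0" using C by (simp add: D_def add_nonneg_pos)
    define e where "e = r / D"
    have e: "e > 0" using r D by (simp add: e_def)
    have "eventually (\<lambda>n. norm ((\<Sum>k<n. (f1 (\<xi> n k) - f1 0) * dw n k) - 0) < r) sequentially"
      using grid_osc[OF st cy e] grid_osc[OF st cb e] eventually_gt_at_top[of 0]
    proof eventually_elim
      case (elim n)
      have "\<bar>\<Sum>k<n. (f1 (\<xi> n k) - f1 0) * dw n k\<bar> \<le> (\<Sum>k<n. C * (2 * e) * \<bar>dw n k\<bar>)"
      proof (rule order_trans[OF sum_abs sum_mono])
        fix k assume "k \<in> {..<n}"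
        then have k: "k < n" by simp
        show "\<bar>(f1 (\<xi> n k) - f1 0) * dw n k\<bar> \<le> C * (2 * e) * \<bar>dw n k\<bar>"
        proof (cases "dw n k = 0")
          case False
          \<comment> \<open>By flatness off the zeros of \<open>y\<close>, a cell in which
            \<open>w\<close> moves contains a zero, so \<open>p\<close> and \<open>q\<close>, and
            \<open>\<xi>\<close> between them, are near 0.\<close>
          then obtain u where u: "u \<in> {grid s t n k..grid s t n (Suc k)}" "y u = 0"
            using wflat[OF gb[OF k]] by (auto simp: dw_def)
          have "\<bar>p n k\<bar> < e" using elim(1) k u gb[OF k] unfolding p_def
            by (metis abs_minus_commute atLeastAtMost_iff diff_0_right order_refl)
          moreover have "\<bar>q n k\<bar> < 2 * e"
          proof -
            have "\<bar>y (grid s t n k)\<bar> < e" using elim(1) k u gb[OF k]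
              by (metis abs_minus_commute atLeastAtMost_iff diff_0_right order_refl)
            moreover have "\<bar>\<beta> (grid s t n (Suc k)) - \<beta> (grid s t n k)\<bar> < e"
              using elim(2) k gb[OF k] by auto
            ultimately show ?thesis unfolding q_def by linarith
          qed
          ultimately have "\<bar>\<xi> n k\<bar> \<le> 2 * e" using \<xi>(1,2)[of n k] e by (auto simp: min_def max_def split: if_splits)
          then have "\<bar>f1 (\<xi> n k) - f1 0\<bar> \<le> C * (2 * e)"
            using C11D(5)[OF n, of "\<xi> n k" 0] C by (smt (verit) mult_left_mono)
          then show ?thesis unfolding abs_mult by (intro mult_right_mono) auto
        qed simp
      qed
      also have "\<dots> = e * (D - 1)" using sadw elim by (simp add: sum_distrib_left[symmetric] D_def)
      also have "\<dots> < r" using D e r by (simp add: e_def field_simps)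
      finally show ?case by simp
    qed
    then show "\<exists>no. \<forall>n\<ge>no. norm ((\<Sum>k<n. (f1 (\<xi> n k) - f1 0) * dw n k) - 0) < r"
      by (simp add: eventually_sequentially)
  qed
  have "(\<lambda>n. (\<Sum>k<n. LBINT r:{grid s t n k..grid s t n (Suc k)}. f1 (\<xi> n k) * b (y r))
      + (\<Sum>k<n. (f1 (\<xi> n k) - f1 0) * dw n k) + f1 0 * (w t - w s))
     \<longlonglongrightarrow> (LBINT r:{s..t}. f1 (y r) * b (y r)) + 0 + f1 0 * (w t - w s)"
    by (intro tendsto_add drift wpart tendsto_const)
  moreover have "eventually (\<lambda>n. (\<Sum>k<n. LBINT r:{grid s t n k..grid s t n (Suc k)}. f1 (\<xi> n k) * b (y r))
      + (\<Sum>k<n. (f1 (\<xi> n k) - f1 0) * dw n k) + f1 0 * (w t - w s)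
     = (\<Sum>k<n. f (p n k) - f (q n k))) sequentially"
    using eventually_gt_at_top[of 0]
  proof eventually_elim
    case (elim n)
    have "f1 0 * (w t - w s) = (\<Sum>k<n. f1 0 * dw n k)"
      unfolding sdw[OF elim, symmetric] by (rule sum_distrib_left)
    then have "(\<Sum>k<n. LBINT r:{grid s t n k..grid s t n (Suc k)}. f1 (\<xi> n k) * b (y r))
        + (\<Sum>k<n. (f1 (\<xi> n k) - f1 0) * dw n k) + f1 0 * (w t - w s)
      = (\<Sum>k<n. f1 (\<xi> n k) * dr n k + (f1 (\<xi> n k) - f1 0) * dw n k + f1 0 * dw n k)"
      by (simp add: sum.distrib dr_def)
    also have "\<dots> = (\<Sum>k<n. f (p n k) - f (q n k))"
      unfolding \<xi>(3) using pq by (intro sum.cong refl) (simp add: distrib_left left_diff_distrib)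
    finally show ?case .
  qed
  ultimately show "(\<lambda>n. \<Sum>k<n. f (y (grid s t n (Suc k)))
      - f (y (grid s t n k) + (\<beta> (grid s t n (Suc k)) - \<beta> (grid s t n k))))
     \<longlonglongrightarrow> (LBINT r:{s..t}. f1 (y r) * b (y r)) + f1 0 * (w t - w s)"
    unfolding p_def[symmetric] q_def[symmetric] using Lim_transform_eventually by force
qed

lemma set_lint_split:
  fixes f :: "real \<Rightarrow> real"
  assumes f: "f \<in> borel_measurable borel" "\<And>r. \<bar>f r\<bar> \<le> C" and ab: "a \<le> c" "c \<le> d"
  shows "(LBINT r:{a..d}. f r) = (LBINT r:{a..c}. f r) + (LBINT r:{c..d}. f r)"
proof -
  have i: "set_integrable lborel {u..<v} f" for u v
    by (rule set_integrable_subset[OF bounded_set_integrable[of f u v C]]) (use f in auto)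
  have "{a..<d} = {a..<c} \<union> {c..<d}" using ab by auto
  then show ?thesis unfolding set_lint_Icc_Ico[OF f(1)]
    using set_integral_Un[OF _ i i, of a c c d] by (simp add: Int_def)
qed

lemma set_lint_const: "a \<le> d \<Longrightarrow> (LBINT r:{a..d}. c) = (d - a) * (c::real)"
  by (simp add: set_lebesgue_integral_def)

section \<open>Ito's formula in expectation\<close>

text \<open>
  Along a solution of the equation this is \<open>(2 * p - 1) * L\<close>. Unlike \<open>L\<close>, it is visibly adapted
  and continuous.
\<close>

definition drift_corrector :: "(real \<Rightarrow> 'a \<Rightarrow> real) \<Rightarrow> (real \<Rightarrow> 'a \<Rightarrow> real) \<Rightarrow> (real \<Rightarrow> real) \<Rightarrow> real \<Rightarrow> 'a \<Rightarrow> real" where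
  "drift_corrector B Y b t \<omega> = Y t \<omega> - Y 0 \<omega> - (B t \<omega> - B 0 \<omega>) - (LBINT r:{0..t}. b (Y r \<omega>))"

text \<open>
  Paths are extended to negative times by their value at \<open>0\<close>, which makes them continuous on the whole
  line; \<open>\<sigma>\<close> is the sign of \<open>2 * p - 1\<close>.
\<close>

locale skew_core = prob_space M + filtration "space M" F
  for M :: "'a measure" and F :: "real \<Rightarrow> 'a measure" +
  fixes B Y :: "real \<Rightarrow> 'a \<Rightarrow> real" and b :: "real \<Rightarrow> real" and K x p \<sigma> :: real
  assumes subF: "\<And>t. t \<ge> 0 \<Longrightarrow> subalgebra M (F t)"
    and Y_F: "\<And>t. t \<ge> 0 \<Longrightarrow> Y t \<in> borel_measurable (F t)"
    and B_F: "\<And>t. t \<ge> 0 \<Longrightarrow> B t \<in> borel_measurable (F t)"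
    and Y_cont: "\<And>\<omega>. \<omega> \<in> space M \<Longrightarrow> continuous_on UNIV (\<lambda>t. Y t \<omega>)"
    and B_cont: "\<And>\<omega>. \<omega> \<in> space M \<Longrightarrow> continuous_on UNIV (\<lambda>t. B t \<omega>)"
    and Y_neg: "\<And>t \<omega>. t < 0 \<Longrightarrow> Y t \<omega> = Y 0 \<omega>"
    and b_meas: "b \<in> borel_measurable borel" and b_bd: "\<And>z. \<bar>b z\<bar> \<le> K"
    and B_inc: "\<And>s t. 0 \<le> s \<Longrightarrow> s < t \<Longrightarrow>
          distributed M lborel (\<lambda>\<omega>. B t \<omega> - B s \<omega>) (normal_density 0 (sqrt (t - s)))"
    and B_ind: "\<And>s t. 0 \<le> s \<Longrightarrow> s < t \<Longrightarrow>
          indep_set (sets (F s)) {(\<lambda>\<omega>. B t \<omega> - B s \<omega>) -` A \<inter> space M | A. A \<in> sets borel}"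
    and Y_start: "AE \<omega> in M. Y 0 \<omega> = x"
    and no_atom: "\<And>t z. t > 0 \<Longrightarrow> AE \<omega> in M. Y t \<omega> \<noteq> z"
    and \<sigma>: "\<sigma> \<in> {-1, 1}"
    and W_mono: "AE \<omega> in M. \<forall>u v. 0 \<le> u \<longrightarrow> u \<le> v \<longrightarrow> \<sigma> * drift_corrector B Y b u \<omega> \<le> \<sigma> * drift_corrector B Y b v \<omega>"
    and W_flat: "AE \<omega> in M. \<forall>u v. 0 \<le> u \<longrightarrow> u \<le> v \<longrightarrow> (\<forall>r\<in>{u..v}. Y r \<omega> \<noteq> 0) \<longrightarrow>
        drift_corrector B Y b u \<omega> = drift_corrector B Y b v \<omega>"
    and W_local: "\<And>t. t \<ge> 0 \<Longrightarrow> AE \<omega> in M.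
        ((\<lambda>\<epsilon>. (2 * p - 1) * (1 / (2 * \<epsilon>) * (LBINT s:{0..t}. indicator {-\<epsilon>..\<epsilon>} (Y s \<omega>))))
           \<longlongrightarrow> drift_corrector B Y b t \<omega>) (at_right 0)"
begin

abbreviation "W \<equiv> drift_corrector B Y b"

section \<open>Measurability, exceptional times and independence\<close>

lemma K_nonneg: "0 \<le> K" using b_bd[of 0] by linarith

lemma F_M: "0 \<le> t \<Longrightarrow> f \<in> borel_measurable (F t) \<Longrightarrow> f \<in> borel_measurable M"
  using subF measurable_from_subalg by blast

lemma F_sets: "0 \<le> t \<Longrightarrow> G \<in> sets (F t) \<Longrightarrow> G \<in> sets M"
  using subF unfolding subalgebra_def by blast

lemma Y_M[measurable]: "Y t \<in> borel_measurable M"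
proof (cases "t \<ge> 0")
  case False
  then have "Y t = Y 0" using Y_neg by (intro ext) simp
  then show ?thesis using F_M[OF _ Y_F, of 0] by simp
qed (use F_M Y_F in blast)

lemma B_M: "0 \<le> t \<Longrightarrow> B t \<in> borel_measurable M"
  using F_M B_F by blast

text \<open>Rounding time down to multiples of \<open>1 / Suc n\<close> leaves countably many
  values, hence a jointly measurable process; continuity of the paths gives the limit.\<close>

lemma Y_joint: "(\<lambda>q. Y (snd q) (fst q)) \<in> borel_measurable (M \<Otimes>\<^sub>M borel)"
proof (rule borel_measurable_LIMSEQ_metric)
  fix n :: nat
  show "(\<lambda>q. Y (real_of_int \<lfloor>snd q * real (Suc n)\<rfloor> / real (Suc n)) (fst q)) \<in> borel_measurable (M \<Otimes>\<^sub>M borel)"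
  proof (rule measurable_compose_countable[where f="\<lambda>i q. Y (real_of_int i / real (Suc n)) (fst q)"])
    show "(\<lambda>q. Y (real_of_int i / real (Suc n)) (fst q)) \<in> borel_measurable (M \<Otimes>\<^sub>M borel)" for i
      by (rule measurable_compose[OF measurable_fst Y_M])
    show "(\<lambda>q. \<lfloor>snd q * real (Suc n)\<rfloor>) \<in> measurable (M \<Otimes>\<^sub>M borel) (count_space UNIV)"
      by measurable
  qed
next
  fix q assume "q \<in> space (M \<Otimes>\<^sub>M (borel :: real measure))"
  then have w: "fst q \<in> space M" by (auto simp: space_pair_measure)
  have "(\<lambda>n. real_of_int \<lfloor>snd q * real (Suc n)\<rfloor> / real (Suc n)) \<longlonglongrightarrow> snd q"
  proof -
    have "\<bar>real_of_int \<lfloor>snd q * real (Suc n)\<rfloor> / real (Suc n) - snd q\<bar> \<le> 1 / real (Suc n)" for n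
    proof -
      have "\<bar>real_of_int \<lfloor>snd q * real (Suc n)\<rfloor> - snd q * real (Suc n)\<bar> \<le> 1" by linarith
      then have "\<bar>(real_of_int \<lfloor>snd q * real (Suc n)\<rfloor> - snd q * real (Suc n)) / real (Suc n)\<bar> \<le> 1 / real (Suc n)"
        by (simp add: abs_divide divide_right_mono)
      then show ?thesis by (simp add: diff_divide_distrib)
    qed
    then have "eventually (\<lambda>n. norm (real_of_int \<lfloor>snd q * real (Suc n)\<rfloor> / real (Suc n) - snd q)
        \<le> 1 / real (Suc n)) sequentially"
      by simp
    moreover have "(\<lambda>n. 1 / real (Suc n)) \<longlonglongrightarrow> 0" by real_asymp
    ultimately show ?thesis by (rule LIM_zero_cancel[OF Lim_null_comparison])
  qed
  moreover have "isCont (\<lambda>t. Y t (fst q)) (snd q)"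
    using Y_cont[OF w] by (simp add: continuous_on_eq_continuous_at)
  ultimately show "(\<lambda>n. Y (real_of_int \<lfloor>snd q * real (Suc n)\<rfloor> / real (Suc n)) (fst q)) \<longlonglongrightarrow> Y (snd q) (fst q)"
    by (intro isCont_tendsto_compose[of "snd q" "\<lambda>t. Y t (fst q)"])
qed

lemma Y_jointl: "(\<lambda>q. Y (snd q) (fst q)) \<in> borel_measurable (M \<Otimes>\<^sub>M lborel)"
  using Y_joint measurable_cong_sets[OF sets_pair_measure_cong[OF refl sets_lborel] refl] by blast

lemma path_meas: "\<omega> \<in> space M \<Longrightarrow> (\<lambda>r. Y r \<omega>) \<in> borel_measurable borel"
  using Y_cont by (rule borel_measurable_continuous_onI)

lemma int_meas:
  fixes f :: "real \<Rightarrow> real"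
  assumes [measurable]: "f \<in> borel_measurable borel"
  shows "(\<lambda>\<omega>. LBINT r:{s..t}. f (Y r \<omega>)) \<in> borel_measurable M"
  unfolding set_lebesgue_integral_def
proof (rule lborel.borel_measurable_lebesgue_integral)
  note [measurable] = measurable_compose[OF Y_jointl assms]
  show "(\<lambda>(\<omega>, r). indicator {s..t} r *\<^sub>R f (Y r \<omega>)) \<in> borel_measurable (M \<Otimes>\<^sub>M lborel)"
    unfolding split_beta' by measurable
qed

lemma W_M: assumes "0 \<le> t" shows "W t \<in> borel_measurable M"
proof -
  note [measurable] = B_M[OF assms] B_M[of 0, simplified] int_meas[OF b_meas]
  show ?thesis unfolding drift_corrector_def[abs_def] by measurable
qed

lemma W_0: "W 0 \<omega> = 0"
proof -
  have "(LBINT r:{0..0}. b (Y r \<omega>)) = 0"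
    unfolding set_lebesgue_integral_def
    by (rule integral_eq_zero_AE) (use AE_lborel_singleton[of 0] in \<open>eventually_elim, auto simp: indicator_def\<close>)
  then show ?thesis by (simp add: drift_corrector_def)
qed

text \<open>Fubini exchanges the two null sets: for each positive time a null set of outcomes is
  excluded, hence for almost every outcome a null set of times. Time integrals along such a path do
  not see \<open>N\<close>.\<close>

lemma AE_avoid:
  assumes N: "finite N"
  shows "AE \<omega> in M. AE r in lborel. 0 < r \<longrightarrow> Y r \<omega> \<notin> N"
proof -
  interpret P: pair_sigma_finite M lborel ..
  have [measurable]: "N \<in> sets borel" using N by (simp add: finite_imp_closed borel_closed)
  have "AE r in lborel. AE \<omega> in M. 0 < r \<longrightarrow> Y r \<omega> \<notin> N"
  proof (rule AE_I2)
    fix r :: real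
    show "AE \<omega> in M. 0 < r \<longrightarrow> Y r \<omega> \<notin> N"
    proof (cases "0 < r")
      case True
      have "AE \<omega> in M. \<forall>z\<in>N. Y r \<omega> \<noteq> z"
        using no_atom[OF True] N by (intro AE_finite_allI) auto
      then show ?thesis by eventually_elim auto
    qed auto
  qed
  moreover have "{q \<in> space (M \<Otimes>\<^sub>M lborel). 0 < snd q \<longrightarrow> Y (snd q) (fst q) \<notin> N} \<in> sets (M \<Otimes>\<^sub>M lborel)"
  proof -
    note [measurable] = Y_jointl
    show ?thesis by measurable
  qed
  ultimately show ?thesis
    by (subst P.AE_commute) auto
qed

lemma increment_eq:
  assumes w: "\<omega> \<in> space M" and uv: "0 \<le> u" "u \<le> v"
  shows "Y v \<omega> - Y u \<omega> = B v \<omega> - B u \<omega> + (LBINT r:{u..v}. b (Y r \<omega>)) + (W v \<omega> - W u \<omega>)"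
proof -
  note [measurable] = path_meas[OF w] b_meas
  have "(LBINT r:{0..v}. b (Y r \<omega>)) = (LBINT r:{0..u}. b (Y r \<omega>)) + (LBINT r:{u..v}. b (Y r \<omega>))"
    by (rule set_lint_split[of _ K]) (use b_bd uv in auto)
  then show ?thesis by (simp add: drift_corrector_def)
qed

text \<open>Given \<open>F s\<close>, the Brownian increment is an independent centred normal
  variable, so it can be integrated out with \<open>Y s\<close> held fixed. Testing against
  indicators of events in \<open>F s\<close> replaces conditional expectations throughout.\<close>

lemma freeze:
  assumes st: "0 \<le> s" "s < t" and G: "G \<in> sets (F s)"
    and Phi[measurable]: "\<Phi> \<in> borel_measurable (borel \<Otimes>\<^sub>M borel)" and bd: "\<And>q. \<bar>\<Phi> q\<bar> \<le> (D::real)"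
  shows "(\<integral>\<omega>. indicator G \<omega> * \<Phi> (Y s \<omega>, B t \<omega> - B s \<omega>) \<partial>M)
    = (\<integral>\<omega>. indicator G \<omega> * (\<integral>u. std_normal_density u * \<Phi> (Y s \<omega>, sqrt (t - s) * u) \<partial>lborel) \<partial>M)"
proof -
  define h where "h = sqrt (t - s)"
  have h: "h > 0" using st by (simp add: h_def)
  define X1 where "X1 \<omega> = (indicator G \<omega> :: real, Y s \<omega>)" for \<omega>
  define X2 where "X2 \<omega> = (B t \<omega> - B s \<omega>) / h" for \<omega>
  note [measurable] = B_M[OF st(1)] B_M[of t] F_sets[OF st(1) G]
  have X1F: "X1 \<in> measurable (F s) (borel \<Otimes>\<^sub>M borel)"
    unfolding X1_def using G Y_F[OF st(1)] by (intro measurable_Pair) auto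
  have X1[measurable]: "X1 \<in> measurable M (borel \<Otimes>\<^sub>M borel)" unfolding X1_def by measurable
  have t0: "0 \<le> t" using st by simp
  have X2[measurable]: "X2 \<in> borel_measurable M" unfolding X2_def using B_M[OF st(1)] B_M[OF t0] by measurable
  \<comment> \<open>Padding with 0 gives the increment the same value space as \<open>X1\<close>, as
    \<open>indep_var\<close> demands.\<close>
  define X3 where "X3 \<omega> = (X2 \<omega>, 0 :: real)" for \<omega>
  have X3[measurable]: "X3 \<in> measurable M (borel \<Otimes>\<^sub>M borel)" unfolding X3_def by measurable
  have ind: "indep_var (borel \<Otimes>\<^sub>M borel) X1 (borel \<Otimes>\<^sub>M borel) X3"
    unfolding indep_var_eq
  proof (intro conjI X1 X3 indep_setI)
    let ?S1 = "sigma_sets (space M) {X1 -` A \<inter> space M |A. A \<in> sets (borel \<Otimes>\<^sub>M borel)}"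
    let ?S2 = "sigma_sets (space M) {X3 -` A \<inter> space M |A. A \<in> sets (borel \<Otimes>\<^sub>M borel)}"
    have s1: "?S1 \<subseteq> sets (F s)"
    proof -
      have "{X1 -` A \<inter> space M |A. A \<in> sets (borel \<Otimes>\<^sub>M borel)} \<subseteq> sets (F s)"
        using measurable_sets[OF X1F] space_F[of s] by auto
      from sets.sigma_sets_subset[OF this] show ?thesis by (simp add: space_F)
    qed
    have "X3 \<in> space M \<rightarrow> space (borel \<Otimes>\<^sub>M borel)" by (simp add: space_pair_measure)
    then have s2: "?S2 = {X3 -` A \<inter> space M |A. A \<in> sets (borel \<Otimes>\<^sub>M borel)}"
      using sets_vimage_algebra2[of X3 "space M" "borel \<Otimes>\<^sub>M borel"] sets_vimage_algebra[of "space M" X3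
          "borel \<Otimes>\<^sub>M borel"] by simp
    have s2': "?S2 \<subseteq> {(\<lambda>\<omega>. B t \<omega> - B s \<omega>) -` A \<inter> space M | A. A \<in> sets borel}"
    proof
      fix a assume "a \<in> ?S2"
      then obtain A where A: "A \<in> sets (borel \<Otimes>\<^sub>M borel)" "a = X3 -` A \<inter> space M" using s2 by auto
      have "(\<lambda>v. (v / h, 0)) -` A \<inter> space borel \<in> sets borel"
        by (rule measurable_sets[OF _ A(1)]) measurable
      then show "a \<in> {(\<lambda>\<omega>. B t \<omega> - B s \<omega>) -` A \<inter> space M | A. A \<in> sets borel}"
        using A(2) by (auto simp: X3_def X2_def intro!: exI[of _ "(\<lambda>v. (v / h, 0)) -` A"])
    qed
    show "?S1 \<subseteq> events" using s1 F_sets[OF st(1)] by auto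
    show "?S2 \<subseteq> events" using s2' indep_setD_ev2[OF B_ind[OF st]] by auto
    fix a c assume "a \<in> ?S1" "c \<in> ?S2"
    then show "prob (a \<inter> c) = prob a * prob c"
      using indep_setD[OF B_ind[OF st], of a c] s1 s2' by auto
  qed
  have D2: "distr M borel X2 = density lborel std_normal_density"
  proof -
    have "distributed M lborel X2 std_normal_density"
      using B_inc[OF st] normal_standard_normal_convert[of h "\<lambda>\<omega>. B t \<omega> - B s \<omega>" 0] h
      by (simp add: h_def X2_def[abs_def])
    then have "distr M lborel X2 = density lborel std_normal_density" by (rule distributed_distr_eq_density)
    moreover have "distr M lborel X2 = distr M borel X2" by (rule distr_cong) auto
    ultimately show ?thesis by simp
  qed
  let ?R = "borel \<Otimes>\<^sub>M borel :: (real \<times> real) measure"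
  \<comment> \<open>The test against 1 recovers the indicator of \<open>G\<close> from the first
    coordinate of \<open>X1\<close>; the factor \<open>h\<close> undoes the normalisation of the
    increment.\<close>
  define \<Psi> where "\<Psi> q = (if fst (fst q) = 1 then \<Phi> (snd (fst q), h * fst (snd q)) else 0)" for q ::
      "(real \<times> real) \<times> (real \<times> real)"
  have Psi[measurable]: "\<Psi> \<in> borel_measurable (?R \<Otimes>\<^sub>M ?R)"
    unfolding \<Psi>_def by measurable
  have D0: "0 \<le> D" using bd[of undefined] by linarith
  have Psi_bd: "\<bar>\<Psi> q\<bar> \<le> D" for q
    using bd D0 by (auto simp: \<Psi>_def)
  have D1: "distr M ?R X1 \<Otimes>\<^sub>M distr M ?R X3 = distr M (?R \<Otimes>\<^sub>M ?R) (\<lambda>\<omega>. (X1 \<omega>, X3 \<omega>))"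
    using ind unfolding indep_var_distribution_eq by auto
  interpret P1: prob_space "distr M ?R X1" by (rule prob_space_distr) simp
  interpret P2: prob_space "distr M ?R X3" by (rule prob_space_distr) simp
  interpret PP: pair_prob_space "distr M ?R X1" "distr M ?R X3" ..
  have "\<Psi> \<in> borel_measurable (distr M ?R X1 \<Otimes>\<^sub>M distr M ?R X3)"
    using Psi measurable_cong_sets[OF sets_pair_measure_cong[OF sets_distr sets_distr] refl] by blast
  then have ii: "integrable (distr M ?R X1 \<Otimes>\<^sub>M distr M ?R X3) \<Psi>"
    by (intro PP.integrable_const_bound[of _ D]) (use Psi_bd in auto)
  have in3: "(\<integral>v. \<Psi> (a, v) \<partial>distr M ?R X3) = (\<integral>u. std_normal_density u * \<Psi> (a, (u, 0)) \<partial>lborel)" for a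
  proof -
    have "(\<integral>v. \<Psi> (a, v) \<partial>distr M ?R X3) = (\<integral>\<omega>. \<Psi> (a, X3 \<omega>) \<partial>M)"
      by (subst integral_distr) (auto simp: space_pair_measure)
    also have "\<dots> = (\<integral>u. \<Psi> (a, (u, 0)) \<partial>distr M borel X2)"
      by (subst integral_distr) (auto simp: X3_def space_pair_measure)
    also have "\<dots> = (\<integral>u. std_normal_density u * \<Psi> (a, (u, 0)) \<partial>lborel)"
      unfolding D2 by (subst integral_density) (auto simp: space_pair_measure)
    finally show ?thesis .
  qed
  have "(\<integral>\<omega>. indicator G \<omega> * \<Phi> (Y s \<omega>, B t \<omega> - B s \<omega>) \<partial>M) = (\<integral>\<omega>. \<Psi> (X1 \<omega>, X3 \<omega>) \<partial>M)"
    using h by (intro Bochner_Integration.integral_cong) (auto simp: \<Psi>_def X1_def X2_def X3_def indicator_def)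
  also have "\<dots> = (\<integral>q. \<Psi> q \<partial>distr M (?R \<Otimes>\<^sub>M ?R) (\<lambda>\<omega>. (X1 \<omega>, X3 \<omega>)))"
    by (subst integral_distr) auto
  also have "\<dots> = (\<integral>q. \<Psi> q \<partial>(distr M ?R X1 \<Otimes>\<^sub>M distr M ?R X3))" using D1 by simp
  also have "\<dots> = (\<integral>a. (\<integral>v. \<Psi> (a, v) \<partial>distr M ?R X3) \<partial>distr M ?R X1)"
    by (rule PP.integral_fst'[OF ii, symmetric])
  also have "\<dots> = (\<integral>a. (\<integral>u. std_normal_density u * \<Psi> (a, (u, 0)) \<partial>lborel) \<partial>distr M ?R X1)"
    unfolding in3 ..
  also have "\<dots> = (\<integral>\<omega>. (\<integral>u. std_normal_density u * \<Psi> (X1 \<omega>, (u, 0)) \<partial>lborel) \<partial>M)"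
    by (subst integral_distr) auto
  also have "\<dots> = (\<integral>\<omega>. indicator G \<omega> * (\<integral>u. std_normal_density u * \<Phi> (Y s \<omega>, sqrt (t - s) * u) \<partial>lborel) \<partial>M)"
    by (intro Bochner_Integration.integral_cong) (auto simp: \<Psi>_def X1_def h_def indicator_def)
  finally show ?thesis .
qed

end

section \<open>Discretised increments and integrability of the corrector\<close>

lemma gauss_diff_meas:
  assumes [measurable]: "f \<in> borel_measurable borel"
  shows "gauss_diff f h \<in> borel_measurable borel"
  unfolding gauss_diff_def[abs_def] by measurable

context skew_core begin

text \<open>
  Over one step of the grid, \<open>f (Y t)\<close> changes by the effect of the Brownian increment, whose mean is
  given by \<open>gauss_diff\<close>, and by a remainder collected in \<open>drift_sum\<close>. The corrector moves only when
  the path visits \<open>0\<close>, so that it contributes \<open>f1 0\<close> times its increment to the limit.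
\<close>

definition drift_sum :: "(real \<Rightarrow> real) \<Rightarrow> real \<Rightarrow> real \<Rightarrow> nat \<Rightarrow> 'a \<Rightarrow> real" where
  "drift_sum f s t n \<omega> = (\<Sum>k<n. f (Y (grid s t n (Suc k)) \<omega>)
      - f (Y (grid s t n k) \<omega> + (B (grid s t n (Suc k)) \<omega> - B (grid s t n k) \<omega>)))"

definition heat_sum :: "(real \<Rightarrow> real) \<Rightarrow> real \<Rightarrow> real \<Rightarrow> nat \<Rightarrow> 'a \<Rightarrow> real" where
  "heat_sum f s t n \<omega> = (\<Sum>k<n. gauss_diff f ((t - s) / n) (Y (grid s t n k) \<omega>))"

lemma mart_step:
  assumes st: "0 \<le> s" "s < t" and G: "G \<in> sets (F s)" and n: "C11 N f f1 f2 C" and k: "k < n"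
  shows "(\<integral>\<omega>. indicator G \<omega> * (f (Y (grid s t n k) \<omega> + (B (grid s t n (Suc k)) \<omega> - B (grid s t n k) \<omega>))
      - f (Y (grid s t n k) \<omega>)) \<partial>M)
    = (\<integral>\<omega>. indicator G \<omega> * gauss_diff f ((t - s) / n) (Y (grid s t n k) \<omega>) \<partial>M)"
proof -
  note [measurable] = C11_measurable[OF n]
  have g: "s \<le> grid s t n k" using grid_bounds[of s t k n] st k by simp
  have G': "G \<in> sets (F (grid s t n k))" using G sets_F_mono[OF g] by blast
  have "(\<integral>\<omega>. indicator G \<omega> * (\<lambda>q. f (fst q + snd q) - f (fst q)) (Y (grid s t n k) \<omega>, B (grid s t n (Suc k)) \<omega>
      - B (grid s t n k) \<omega>) \<partial>M)
    = (\<integral>\<omega>. indicator G \<omega> * (\<integral>u. std_normal_density u * (\<lambda>q. f (fst q + snd q)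
        - f (fst q)) (Y (grid s t n k) \<omega>, sqrt (grid s t n (Suc k) - grid s t n k) * u) \<partial>lborel) \<partial>M)"
  proof (rule freeze[OF _ _ G', of _ _ "2 * C"])
    show "\<bar>f (fst q + snd q) - f (fst q)\<bar> \<le> 2 * C" for q
      using C11D(2)[OF n, of "fst q + snd q"] C11D(2)[OF n, of "fst q"] by linarith
  qed (use g st grid_step[OF st(2), of n k] k in auto)
  then show ?thesis by (simp add: gauss_diff_def grid_Suc)
qed

lemma drift_sum_M:
  assumes st: "0 \<le> s" "s < t" and n: "C11 N f f1 f2 C"
  shows "drift_sum f s t n \<in> borel_measurable M"
proof -
  note [measurable] = C11_measurable[OF n]
  have "(\<lambda>\<omega>. f (Y (grid s t n (Suc k)) \<omega>)
      - f (Y (grid s t n k) \<omega> + (B (grid s t n (Suc k)) \<omega> - B (grid s t n k) \<omega>))) \<in> borel_measurable M" if "k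
          < n" for k
  proof -
    have "0 \<le> grid s t n k" "0 \<le> grid s t n (Suc k)"
      using grid_bounds[of s t k n] grid_bounds[of s t "Suc k" n] st that by auto
    note [measurable] = B_M[OF this(1)] B_M[OF this(2)]
    show ?thesis by measurable
  qed
  then show ?thesis unfolding drift_sum_def[abs_def] by (intro borel_measurable_sum) auto
qed

text \<open>Telescoping \<open>f (Y t) - f (Y s)\<close> over the grid splits every step into a
  summand of \<open>drift_sum\<close> and a Brownian step, whose mean is given by
  \<open>mart_step\<close>. The identity is exact for every grid; limits are taken
  afterwards.\<close>

lemma E_drift_sum:
  assumes st: "0 \<le> s" "s < t" and G: "G \<in> sets (F s)" and n: "C11 N f f1 f2 C" and n0: "0 < (n::nat)"
  shows "integrable M (\<lambda>\<omega>. indicator G \<omega> * drift_sum f s t n \<omega>)"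
    "integrable M (\<lambda>\<omega>. indicator G \<omega> * heat_sum f s t n \<omega>)"
    "(\<integral>\<omega>. indicator G \<omega> * drift_sum f s t n \<omega> \<partial>M) =
      (\<integral>\<omega>. indicator G \<omega> * (f (Y t \<omega>) - f (Y s \<omega>)) \<partial>M) - (\<integral>\<omega>. indicator G \<omega> * heat_sum f s t n \<omega> \<partial>M)"
proof -
  note [measurable] = C11_measurable[OF n] F_sets[OF st(1) G] gauss_diff_meas[OF C11_measurable(1)[OF n]]
  note C = C11D(8)[OF n]
  define h where "h = (t - s) / n"
  have h: "h > 0" using st n0 by (simp add: h_def)
  let ?d = "\<lambda>k \<omega>. f (Y (grid s t n k) \<omega> + (B (grid s t n (Suc k)) \<omega> - B (grid s t n k) \<omega>)) - f (Y (grid s t n k) \<omega>)"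
  have bdd: "\<bar>f a - f c\<bar> \<le> 2 * C" for a c
    using C11D(2)[OF n, of a] C11D(2)[OF n, of c] by linarith
  have i0: "integrable M (\<lambda>\<omega>. indicator G \<omega> * (f (Y t \<omega>) - f (Y s \<omega>)))"
    by (rule integrable_const_bound[of _ "2 * C"]) (use bdd C in \<open>auto simp: indicator_def\<close>)
  have i1: "integrable M (\<lambda>\<omega>. indicator G \<omega> * ?d k \<omega>)" if "k < n" for k
  proof -
    have "0 \<le> grid s t n k" "0 \<le> grid s t n (Suc k)"
      using grid_bounds[of s t k n] grid_bounds[of s t "Suc k" n] st that by auto
    note [measurable] = B_M[OF this(1)] B_M[OF this(2)]
    show ?thesis
      by (rule integrable_const_bound[of _ "2 * C"]) (use bdd C in \<open>auto simp: indicator_def\<close>)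
  qed
  have i2: "integrable M (\<lambda>\<omega>. indicator G \<omega> * gauss_diff f h (Y (grid s t n k) \<omega>))" for k
    by (rule integrable_const_bound[of _ "C * h"]) (use gauss_diff_bound[OF n h] C h in \<open>auto simp: indicator_def\<close>)
  have A: "drift_sum f s t n \<omega> = (f (Y t \<omega>) - f (Y s \<omega>)) - (\<Sum>k<n. ?d k \<omega>)" for \<omega>
  proof -
    have "f (Y t \<omega>) - f (Y s \<omega>) = (\<Sum>k<n. f (Y (grid s t n (Suc k)) \<omega>) - f (Y (grid s t n k) \<omega>))"
      using sum_lessThan_telescope[of "\<lambda>k. f (Y (grid s t n k) \<omega>)" n] n0 by simp
    then show ?thesis by (simp add: drift_sum_def sum_subtractf)
  qed
  have A': "indicator G \<omega> * drift_sum f s t n \<omega> = indicator G \<omega> * (f (Y t \<omega>) - f (Y s \<omega>))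
      - (\<Sum>k<n. indicator G \<omega> * ?d k \<omega>)" for \<omega>
    unfolding A by (simp add: right_diff_distrib sum_distrib_left)
  have isum: "integrable M (\<lambda>\<omega>. \<Sum>k<n. indicator G \<omega> * ?d k \<omega>)" using i1
      by (intro Bochner_Integration.integrable_sum) auto
  show "integrable M (\<lambda>\<omega>. indicator G \<omega> * drift_sum f s t n \<omega>)"
    unfolding A' using i0 isum by (rule Bochner_Integration.integrable_diff)
  have M': "indicator G \<omega> * heat_sum f s t n \<omega> = (\<Sum>k<n. indicator G \<omega> * gauss_diff f h (Y (grid s t n k) \<omega>))" for \<omega>
    unfolding heat_sum_def h_def by (simp add: sum_distrib_left)
  show "integrable M (\<lambda>\<omega>. indicator G \<omega> * heat_sum f s t n \<omega>)"
    unfolding M' using i2 by (intro Bochner_Integration.integrable_sum) auto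
  have "(\<integral>\<omega>. (\<Sum>k<n. indicator G \<omega> * ?d k \<omega>) \<partial>M) = (\<Sum>k<n. \<integral>\<omega>. indicator G \<omega> * ?d k \<omega> \<partial>M)"
    using i1 by (intro Bochner_Integration.integral_sum) auto
  also have "\<dots> = (\<Sum>k<n. \<integral>\<omega>. indicator G \<omega> * gauss_diff f h (Y (grid s t n k) \<omega>) \<partial>M)"
    unfolding h_def using mart_step[OF st G n] by (intro sum.cong) auto
  also have "\<dots> = (\<integral>\<omega>. indicator G \<omega> * heat_sum f s t n \<omega> \<partial>M)"
    unfolding M' using i2 by (intro Bochner_Integration.integral_sum[symmetric]) auto
  finally have e: "(\<integral>\<omega>. (\<Sum>k<n. indicator G \<omega> * ?d k \<omega>) \<partial>M) = (\<integral>\<omega>. indicator G \<omega> * heat_sum f s t n \<omega> \<partial>M)" .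
  show "(\<integral>\<omega>. indicator G \<omega> * drift_sum f s t n \<omega> \<partial>M) =
      (\<integral>\<omega>. indicator G \<omega> * (f (Y t \<omega>) - f (Y s \<omega>)) \<partial>M) - (\<integral>\<omega>. indicator G \<omega> * heat_sum f s t n \<omega> \<partial>M)"
    unfolding A' using Bochner_Integration.integral_diff[OF i0 isum] e by simp
qed

lemma drift_sum_path:
  assumes st: "0 \<le> s" "s < t" and n: "C11 N f f1 f2 C"
  shows "AE \<omega> in M. (\<lambda>n. drift_sum f s t n \<omega>) \<longlonglongrightarrow> (LBINT r:{s..t}. f1 (Y r \<omega>) * b (Y r \<omega>)) + f1 0 * (W t \<omega> - W s \<omega>)"
    "AE \<omega> in M. \<forall>n>0. \<bar>drift_sum f s t n \<omega>\<bar> \<le> C * (K * (t - s) + \<bar>W t \<omega> - W s \<omega>\<bar>)"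
    "(\<And>z. 0 \<le> f1 z) \<Longrightarrow> AE \<omega> in M. \<forall>n>0. - C * K * (t - s) \<le> \<sigma> * drift_sum f s t n \<omega>"
proof -
  show "AE \<omega> in M. (\<lambda>n. drift_sum f s t n \<omega>) \<longlonglongrightarrow> (LBINT r:{s..t}. f1 (Y r \<omega>) * b (Y r \<omega>)) + f1 0 * (W t \<omega> - W s \<omega>)"
    using W_mono W_flat AE_space
  proof eventually_elim
    case (elim \<omega>)
    show ?case unfolding drift_sum_def
      by (rule path_sum_limit(1)[OF st(2) Y_cont B_cont n b_meas b_bd \<sigma>])
        (use elim st increment_eq[OF elim(3)] in auto)
  qed
  show "AE \<omega> in M. \<forall>n>0. \<bar>drift_sum f s t n \<omega>\<bar> \<le> C * (K * (t - s) + \<bar>W t \<omega> - W s \<omega>\<bar>)"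
    using W_mono W_flat AE_space
  proof eventually_elim
    case (elim \<omega>)
    show ?case unfolding drift_sum_def
      by (intro allI impI, rule path_sum_limit(2)[OF st(2) Y_cont B_cont n b_meas b_bd \<sigma>])
        (use elim st increment_eq[OF elim(3)] in auto)
  qed
  assume pos: "\<And>z. 0 \<le> f1 z"
  show "AE \<omega> in M. \<forall>n>0. - C * K * (t - s) \<le> \<sigma> * drift_sum f s t n \<omega>"
    using W_mono W_flat AE_space
  proof eventually_elim
    case (elim \<omega>)
    show ?case
    proof (intro allI impI)
      fix n :: nat assume n0: "0 < n"
      have "(\<Sum>k<n. - C * K * ((t - s) / n)) \<le> (\<Sum>k<n. \<sigma> * (f (Y (grid s t n (Suc k)) \<omega>)
          - f (Y (grid s t n k) \<omega> + (B (grid s t n (Suc k)) \<omega> - B (grid s t n k) \<omega>))))"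
        by (intro sum_mono, rule path_sum_limit(3)[OF st(2) Y_cont B_cont n b_meas b_bd \<sigma>, where w="\<lambda>u. W u \<omega>"])
          (use elim st increment_eq[OF elim(3)] pos in auto)
      then show "- C * K * (t - s) \<le> \<sigma> * drift_sum f s t n \<omega>"
        using n0 by (simp add: drift_sum_def sum_distrib_left)
    qed
  qed
qed

text \<open>Each \<open>gauss_diff\<close> is of the order of the mesh. Divided by the mesh it
  becomes a cell-wise constant integrand, converging to \<open>f2 / 2\<close> at every time at which
  the path is off \<open>N\<close>, that is, at almost every time.\<close>

lemma heat_sum_path:
  assumes st: "0 \<le> s" "s < t" and n: "C11 N f f1 f2 C"
  shows "AE \<omega> in M. (\<lambda>n. heat_sum f s t n \<omega>) \<longlonglongrightarrow> (LBINT r:{s..t}. f2 (Y r \<omega>) / 2)"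
    "\<And>n \<omega>. n > 0 \<Longrightarrow> \<bar>heat_sum f s t n \<omega>\<bar> \<le> C * (t - s)"
proof -
  show "\<bar>heat_sum f s t n \<omega>\<bar> \<le> C * (t - s)" if n0: "n > 0" for n \<omega>
  proof -
    have "\<bar>heat_sum f s t n \<omega>\<bar> \<le> (\<Sum>k<n. C * ((t - s) / n))"
      unfolding heat_sum_def using gauss_diff_bound[OF n, of "(t - s) / n"] st n0
          by (intro order_trans[OF sum_abs sum_mono]) auto
    also have "\<dots> = C * (t - s)" using n0 by simp
    finally show ?thesis .
  qed
  show "AE \<omega> in M. (\<lambda>n. heat_sum f s t n \<omega>) \<longlonglongrightarrow> (LBINT r:{s..t}. f2 (Y r \<omega>) / 2)"
    using AE_avoid[OF C11D(1)[OF n]] AE_space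
  proof eventually_elim
    case (elim \<omega>)
    note [measurable] = path_meas[OF elim(2)] C11D(6)[OF n]
    let ?a = "\<lambda>n k. gauss_diff f ((t - s) / n) (Y (grid s t n k) \<omega>) / ((t - s) / n)"
    have "(\<lambda>n. \<Sum>k<n. LBINT r:{grid s t n k..grid s t n (Suc k)}. ?a n k) \<longlonglongrightarrow> (LBINT r:{s..t}. f2 (Y r \<omega>) / 2)"
    proof (rule sum_integral_limit[OF st(2), where C=C])
      show "\<bar>?a n k\<bar> \<le> C" if "k < n" for n k
      proof -
        have h: "(t - s) / n > 0" using st that by simp
        have "\<bar>?a n k\<bar> = \<bar>gauss_diff f ((t - s) / n) (Y (grid s t n k) \<omega>)\<bar> / ((t - s) / n)"
          using abs_divide[of "gauss_diff f ((t - s) / n) (Y (grid s t n k) \<omega>)" "(t - s) / n"]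
              by (simp only: abs_of_pos[OF h])
        then show ?thesis using gauss_diff_bound[OF n h, of "Y (grid s t n k) \<omega>"]
            by (simp only: pos_divide_le_eq[OF h])
      qed
      show "AE r in lborel. s < r \<longrightarrow> r < t \<longrightarrow> (\<lambda>n. ?a n (grid_index s t n r)) \<longlonglongrightarrow> f2 (Y r \<omega>) / 2"
        using elim(1)
      proof eventually_elim
        case (elim r)
        show ?case
        proof (intro impI)
          assume r: "s < r" "r < t"
          then have z: "Y r \<omega> \<notin> N" using elim st by simp
          have "(\<lambda>n. grid s t n (grid_index s t n r)) \<longlonglongrightarrow> r"
            using r st grid_mono[of s t "grid_index s t _ r" "Suc (grid_index s t _ r)"]
            by (intro grid_index_tendsto[OF st(2), of r]) auto
          moreover have "isCont (\<lambda>t. Y t \<omega>) r" using Y_cont[OF \<open>\<omega> \<in> space M\<close>]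
              by (simp add: continuous_on_eq_continuous_at)
          ultimately have y: "(\<lambda>n. Y (grid s t n (grid_index s t n r)) \<omega>) \<longlonglongrightarrow> Y r \<omega>"
            by (intro isCont_tendsto_compose[of r "\<lambda>t. Y t \<omega>"])
          have "(\<lambda>n. ?a (Suc n) (grid_index s t (Suc n) r)) \<longlonglongrightarrow> f2 (Y r \<omega>) / 2"
            by (rule gauss_diff_lim[OF n _ _ z])
              (use st LIMSEQ_Suc[OF mesh_tendsto[of t s]] LIMSEQ_Suc[OF y] in auto)
          then show "(\<lambda>n. ?a n (grid_index s t n r)) \<longlonglongrightarrow> f2 (Y r \<omega>) / 2" by (rule LIMSEQ_imp_Suc)
        qed
      qed
    qed (measurable)
    moreover have "(\<Sum>k<n. LBINT r:{grid s t n k..grid s t n (Suc k)}. ?a n k) = heat_sum f s t n \<omega>" for n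
    proof -
      have "(LBINT r:{grid s t n k..grid s t n (Suc k)}. ?a n k)
          = gauss_diff f ((t - s) / n) (Y (grid s t n k) \<omega>)" if "k < n" for k
        using grid_step[OF st(2), of n k] st that by (subst set_lint_const) (auto simp: grid_Suc)
      then show ?thesis unfolding heat_sum_def by (intro sum.cong) auto
    qed
    ultimately show ?case by simp
  qed
qed

text \<open>The probe for the corrector: bounded, with nonnegative derivative, so that the one-sided
  bound of \<open>drift_sum_path\<close> applies, and with derivative 1 at 0, so that the corrector
  appears in the limit with coefficient 1.\<close>

lemma arctan_C11: "C11 {} arctan (\<lambda>z. 1 / (1 + z\<^sup>2)) (\<lambda>z. - (2 * z) / (1 + z\<^sup>2)\<^sup>2) 2"
proof (rule C11I)
  have p: "1 + z\<^sup>2 > 0" for z :: real by (simp add: add_pos_nonneg)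
  show "\<bar>arctan z\<bar> \<le> 2" for z using arctan_bounded[of z] pi_less_4 by auto
  show "\<bar>1 / (1 + z\<^sup>2)\<bar> \<le> 2" for z :: real using p[of z] by (simp add: divide_le_eq)
  show "\<bar>- (2 * z) / (1 + z\<^sup>2)\<^sup>2\<bar> \<le> 2" for z :: real
  proof -
    have "2 * \<bar>z\<bar> \<le> 1 + z\<^sup>2" using zero_le_power2[of "\<bar>z\<bar> - 1"] by (simp add: power2_eq_square algebra_simps)
    also have "\<dots> \<le> (1 + z\<^sup>2) * (1 + z\<^sup>2)" using p[of z] mult_left_mono[of 1 "1 + z\<^sup>2" "1 + z\<^sup>2"] by simp
    finally have "2 * \<bar>z\<bar> \<le> (1 + z\<^sup>2)\<^sup>2" by (simp add: power2_eq_square)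
    then have "\<bar>- (2 * z) / (1 + z\<^sup>2)\<^sup>2\<bar> \<le> 1" using p[of z] by (simp add: abs_mult divide_le_eq)
    then show ?thesis by linarith
  qed
  show "(arctan has_real_derivative 1 / (1 + z\<^sup>2)) (at z)" for z
    by (auto intro!: derivative_eq_intros simp: field_simps)
  show "continuous_on UNIV (\<lambda>z::real. 1 / (1 + z\<^sup>2))"
    using p by (intro continuous_intros) (metis less_irrefl)
  show "((\<lambda>z. 1 / (1 + z\<^sup>2)) has_real_derivative - (2 * z) / (1 + z\<^sup>2)\<^sup>2) (at z)" for z :: real
    using p[of z] by (auto intro!: derivative_eq_intros simp: power2_eq_square)
  show "isCont (\<lambda>z. - (2 * z) / (1 + z\<^sup>2)\<^sup>2) z" for z :: real
    using p[of z] by (intro continuous_intros) auto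
qed auto

text \<open>Ito's formula cannot be used yet, since its dominating function contains the corrector.
  But the drift sums of \<open>arctan\<close> are bounded below after multiplication by
  \<open>\<sigma>\<close>, and their means are bounded by \<open>E_drift_sum\<close>, so Fatou's
  lemma controls the mean of the limit.\<close>

lemma W_integrable:
  assumes t: "0 \<le> t"
  shows "integrable M (W t)"
proof (cases "t = 0")
  case True
  then have "W t = (\<lambda>\<omega>. 0)" using W_0 by auto
  then show ?thesis by simp
next
  case False
  then have t: "0 < t" using t by simp
  define f1 where "f1 z = 1 / (1 + z\<^sup>2)" for z :: real
  have n: "C11 {} arctan f1 (\<lambda>z. - (2 * z) / (1 + z\<^sup>2)\<^sup>2) 2" unfolding f1_def[abs_def] by (rule arctan_C11)
  have pos: "0 \<le> f1 z" for z by (simp add: f1_def add_nonneg_nonneg)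
  note [measurable] = drift_sum_M[OF order_refl t n] W_M[OF less_imp_le[OF t]] C11_measurable[OF n] b_meas
  have Gs: "space M \<in> sets (F 0)" using space_F[of 0] by (metis sets.top)
  note E = E_drift_sum[OF order_refl t Gs n]
  define I where "I \<omega> = (LBINT r:{0..t}. f1 (Y r \<omega>) * b (Y r \<omega>))" for \<omega>
  have [measurable]: "I \<in> borel_measurable M" unfolding I_def[abs_def]
    by (rule int_meas[of "\<lambda>z. f1 z * b z"]) measurable
  have I_bd: "\<bar>I \<omega>\<bar> \<le> (2 * K) * (t - 0)" for \<omega>
    unfolding I_def
  proof (rule set_lint_bound)
    show "\<bar>f1 (Y r \<omega>) * b (Y r \<omega>)\<bar> \<le> 2 * K" for r
      unfolding abs_mult by (intro mult_mono C11D(4)[OF n] b_bd) auto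
  qed (use t in auto)
  \<comment> \<open>Minus the lower bound in \<open>drift_sum_path\<close>, with the constant 2 of
    \<open>arctan_C11\<close>; adding it makes the sums nonnegative, as Fatou's lemma
    requires.\<close>
  define D where "D = 2 * K * t"
  define T where "T n \<omega> = ennreal (\<sigma> * drift_sum arctan 0 t n \<omega> + D)" for n \<omega>
  \<comment> \<open>By \<open>E_drift_sum\<close> the mean is that of an increment of
    \<open>arctan\<close>, at most 4 in absolute value, minus that of \<open>heat_sum\<close>, at
    most \<open>2 * t\<close>.\<close>
  have T_bd: "(\<integral>\<^sup>+\<omega>. T n \<omega> \<partial>M) \<le> ennreal (4 + 2 * t + D)" if n0: "n > 0" for n
  proof -
    have iA: "integrable M (drift_sum arctan 0 t n)"
      using E(1)[OF n0] by (rule Bochner_Integration.integrable_cong[THEN iffD1, rotated -1]) auto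
    have nn: "AE \<omega> in M. 0 \<le> \<sigma> * drift_sum arctan 0 t n \<omega> + D"
      using drift_sum_path(3)[OF order_refl t n pos]
    proof eventually_elim
      case (elim \<omega>)
      then have "- 2 * K * (t - 0) \<le> \<sigma> * drift_sum arctan 0 t n \<omega>" using n0 by blast
      then show ?case by (simp add: D_def)
    qed
    have "(\<integral>\<^sup>+\<omega>. T n \<omega> \<partial>M) = ennreal (\<integral>\<omega>. \<sigma> * drift_sum arctan 0 t n \<omega> + D \<partial>M)"
      unfolding T_def using iA nn by (intro nn_integral_eq_integral) auto
    also have "(\<integral>\<omega>. \<sigma> * drift_sum arctan 0 t n \<omega> + D \<partial>M) = \<sigma> * (\<integral>\<omega>. drift_sum arctan 0 t n \<omega> \<partial>M) + D"
      using iA by (simp add: prob_space)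
    also have "\<dots> \<le> \<bar>\<integral>\<omega>. drift_sum arctan 0 t n \<omega> \<partial>M\<bar> + D" using \<sigma> by auto
    also have "(\<integral>\<omega>. drift_sum arctan 0 t n \<omega> \<partial>M) = (\<integral>\<omega>. indicator (space M) \<omega> * drift_sum arctan 0 t n \<omega> \<partial>M)"
      by (intro Bochner_Integration.integral_cong) auto
    also have "\<bar>\<dots>\<bar> \<le> 4 + 2 * t"
    proof -
      have b1: "\<bar>\<integral>\<omega>. g \<omega> \<partial>M\<bar> \<le> c" if "\<And>\<omega>. \<bar>g \<omega>\<bar> \<le> c" "integrable M g" for g and c :: real
        using order_trans[OF integral_abs_bound integral_mono[of M "\<lambda>\<omega>. \<bar>g \<omega>\<bar>" "\<lambda>_. c"]] that
            by (simp add: prob_space)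
      have "\<bar>\<integral>\<omega>. indicator (space M) \<omega> * (arctan (Y t \<omega>) - arctan (Y 0 \<omega>)) \<partial>M\<bar> \<le> 4"
      proof (rule b1)
        show *: "\<bar>indicator (space M) \<omega> * (arctan (Y t \<omega>) - arctan (Y 0 \<omega>))\<bar> \<le> 4" for \<omega>
          using C11D(2)[OF n, of "Y t \<omega>"] C11D(2)[OF n, of "Y 0 \<omega>"] by (auto simp: indicator_def)
        show "integrable M (\<lambda>\<omega>. indicator (space M) \<omega> * (arctan (Y t \<omega>) - arctan (Y 0 \<omega>)))"
          by (rule integrable_const_bound[of _ 4], rule AE_I2, unfold real_norm_def, rule *) measurable
      qed
      moreover have "\<bar>\<integral>\<omega>. indicator (space M) \<omega> * heat_sum arctan 0 t n \<omega> \<partial>M\<bar> \<le> 2 * (t - 0)"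
        by (rule b1) (use E(2)[OF n0] heat_sum_path(2)[OF order_refl t n n0] t in \<open>auto simp: indicator_def\<close>)
      ultimately show ?thesis unfolding E(3)[OF n0] by simp
    qed
    finally show ?thesis by (simp add: ennreal_leI)
  qed
  define T0 where "T0 \<omega> = \<sigma> * (I \<omega> + W t \<omega>) + D" for \<omega>
  have lim: "AE \<omega> in M. (\<lambda>n. T n \<omega>) \<longlonglongrightarrow> ennreal (T0 \<omega>)"
    using drift_sum_path(1)[OF order_refl t n]
  proof eventually_elim
    case (elim \<omega>)
    have "(\<lambda>n. drift_sum arctan 0 t n \<omega>) \<longlonglongrightarrow> I \<omega> + W t \<omega>"
      using elim by (simp add: I_def W_0 f1_def)
    then show ?case unfolding T_def T0_def by (intro tendsto_ennrealI tendsto_intros)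
  qed
  have "(\<integral>\<^sup>+\<omega>. ennreal (T0 \<omega>) \<partial>M) = (\<integral>\<^sup>+\<omega>. liminf (\<lambda>n. T n \<omega>) \<partial>M)"
  proof (rule nn_integral_cong_AE)
    show "AE \<omega> in M. ennreal (T0 \<omega>) = liminf (\<lambda>n. T n \<omega>)"
      using lim by eventually_elim (simp add: lim_imp_Liminf)
  qed
  also have "\<dots> \<le> liminf (\<lambda>n. \<integral>\<^sup>+\<omega>. T n \<omega> \<partial>M)"
    by (rule nn_integral_liminf) (simp add: T_def)
  also have "\<dots> \<le> ennreal (4 + 2 * t + D)"
    using T_bd by (intro Liminf_le) (auto intro!: eventually_sequentiallyI[of 1])
  finally have fin: "(\<integral>\<^sup>+\<omega>. ennreal (T0 \<omega>) \<partial>M) < \<infinity>" by (simp add: le_less_trans)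
  have T0nn: "AE \<omega> in M. 0 \<le> T0 \<omega>"
    using drift_sum_path(3)[OF order_refl t n pos] drift_sum_path(1)[OF order_refl t n]
  proof eventually_elim
    case (elim \<omega>)
    have "(\<lambda>n. \<sigma> * drift_sum arctan 0 t n \<omega> + D) \<longlonglongrightarrow> T0 \<omega>"
      unfolding T0_def using elim(2) by (intro tendsto_intros) (simp add: I_def W_0 f1_def)
    moreover have "0 \<le> \<sigma> * drift_sum arctan 0 t n \<omega> + D" if "n \<ge> 1" for n
    proof -
      have "- 2 * K * (t - 0) \<le> \<sigma> * drift_sum arctan 0 t n \<omega>" using elim(1) that by auto
      then show ?thesis by (simp add: D_def)
    qed
    ultimately show ?case
      by (intro tendsto_lowerbound[where F=sequentially and a=0]) (auto intro!: eventually_sequentiallyI[of 1])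
  qed
  have T0m[measurable]: "T0 \<in> borel_measurable M" unfolding T0_def[abs_def] by measurable
  have iT: "integrable M T0"
    by (rule integrableI_nonneg) (use fin T0nn in \<open>auto simp: T0_def\<close>)
  have iI: "integrable M I" by (rule integrable_const_bound[of _ "2 * K * t"]) (use I_bd in auto)
  have "W t = (\<lambda>\<omega>. \<sigma> * (T0 \<omega> - D) - I \<omega>)" using \<sigma> by (auto simp: T0_def fun_eq_iff)
  moreover have "integrable M (\<lambda>\<omega>. \<sigma> * (T0 \<omega> - D) - I \<omega>)"
    using iT iI by (intro Bochner_Integration.integrable_diff integrable_mult_right integrable_const)
  ultimately show ?thesis by simp
qed

text \<open>Dominated convergence in the exact identity \<open>E_drift_sum\<close>. The dominating
  function \<open>C * (K * (t - s) + \<bar>W t \<omega> - W s \<omega>\<bar>)\<close> is integrable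
  because of \<open>W_integrable\<close>. Keeping an event \<open>G\<close> of \<open>F s\<close> is
  what later yields conditional bounds on occupation times.\<close>

theorem ito:
  assumes st: "0 \<le> s" "s < t" and G: "G \<in> sets (F s)" and n: "C11 N f f1 f2 C"
  shows "(\<integral>\<omega>. indicator G \<omega> * (f (Y t \<omega>) - f (Y s \<omega>)) \<partial>M) =
     (\<integral>\<omega>. indicator G \<omega> * (LBINT r:{s..t}. f2 (Y r \<omega>) / 2) \<partial>M) +
     (\<integral>\<omega>. indicator G \<omega> * (LBINT r:{s..t}. f1 (Y r \<omega>) * b (Y r \<omega>)) \<partial>M) +
     f1 0 * (\<integral>\<omega>. indicator G \<omega> * (W t \<omega> - W s \<omega>) \<partial>M)"
proof -
  have t: "0 \<le> t" using st by simp
  note C = C11D(8)[OF n]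
  note [measurable] = F_sets[OF st(1) G] W_M[OF t] W_M[OF st(1)] C11_measurable[OF n] C11D(6)[OF n] b_meas
      drift_sum_M[OF st n]
    gauss_diff_meas[OF C11_measurable(1)[OF n]] int_meas[of "\<lambda>z. f1 z * b z"] int_meas[of "\<lambda>z. f2 z / 2"]
  have iW: "integrable M (\<lambda>\<omega>. W t \<omega> - W s \<omega>)" using W_integrable[OF t] W_integrable[OF st(1)] by simp
  have iGW: "integrable M (\<lambda>\<omega>. indicator G \<omega> * (W t \<omega> - W s \<omega>))"
    using iW by (rule Bochner_Integration.integrable_bound) (auto simp: indicator_def)
  have A: "(\<lambda>n. \<integral>\<omega>. indicator G \<omega> * drift_sum f s t n \<omega> \<partial>M) \<longlonglongrightarrow>
      (\<integral>\<omega>. indicator G \<omega> * ((LBINT r:{s..t}. f1 (Y r \<omega>) * b (Y r \<omega>)) + f1 0 * (W t \<omega> - W s \<omega>)) \<partial>M)"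
  \<comment> \<open>The shift to \<open>Suc n\<close> leaves out \<open>n = 0\<close>, which the
    pathwise bound does not cover.\<close>
  proof (rule LIMSEQ_imp_Suc, rule integral_dominated_convergence[where w="\<lambda>\<omega>. C * (K * (t - s) + \<bar>W t \<omega> - W s \<omega>\<bar>)"])
    show "integrable M (\<lambda>\<omega>. C * (K * (t - s) + \<bar>W t \<omega> - W s \<omega>\<bar>))" using iW by simp
    show "AE \<omega> in M. (\<lambda>n. indicator G \<omega> * drift_sum f s t (Suc n) \<omega>)
        \<longlonglongrightarrow> indicator G \<omega> * ((LBINT r:{s..t}. f1 (Y r \<omega>) * b (Y r \<omega>)) + f1 0 * (W t \<omega> - W s \<omega>))"
      using drift_sum_path(1)[OF st n] by eventually_elim (intro tendsto_mult tendsto_const LIMSEQ_Suc)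
    show "AE \<omega> in M. norm (indicator G \<omega> * drift_sum f s t (Suc n) \<omega>) \<le> C * (K * (t - s) + \<bar>W t \<omega> - W s \<omega>\<bar>)" for n
      using drift_sum_path(2)[OF st n]
    proof eventually_elim
      case (elim \<omega>)
      have "0 \<le> C * (K * (t - s) + \<bar>W t \<omega> - W s \<omega>\<bar>)" using C K_nonneg st by simp
      then show ?case using elim by (auto simp: indicator_def)
    qed
  qed measurable
  have B: "(\<lambda>n. \<integral>\<omega>. indicator G \<omega> * heat_sum f s t n \<omega> \<partial>M)
      \<longlonglongrightarrow> (\<integral>\<omega>. indicator G \<omega> * (LBINT r:{s..t}. f2 (Y r \<omega>) / 2) \<partial>M)"
  proof (rule LIMSEQ_imp_Suc, rule integral_dominated_convergence[where w="\<lambda>\<omega>. C * (t - s)"])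
    show "AE \<omega> in M. (\<lambda>n. indicator G \<omega> * heat_sum f s t (Suc n) \<omega>)
        \<longlonglongrightarrow> indicator G \<omega> * (LBINT r:{s..t}. f2 (Y r \<omega>) / 2)"
      using heat_sum_path(1)[OF st n] by eventually_elim (intro tendsto_mult tendsto_const LIMSEQ_Suc)
    show "AE \<omega> in M. norm (indicator G \<omega> * heat_sum f s t (Suc n) \<omega>) \<le> C * (t - s)" for n
      using heat_sum_path(2)[OF st n, of "Suc n"] C st by (intro AE_I2) (auto simp: indicator_def)
    show "(\<lambda>\<omega>. indicator G \<omega> * heat_sum f s t (Suc n) \<omega>) \<in> borel_measurable M" for n
      unfolding heat_sum_def by measurable
    show "(\<lambda>\<omega>. indicator G \<omega> * (LBINT r:{s..t}. f2 (Y r \<omega>) / 2)) \<in> borel_measurable M"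
      by measurable
  qed simp
  have "(\<lambda>n. (\<integral>\<omega>. indicator G \<omega> * drift_sum f s t n \<omega> \<partial>M) + (\<integral>\<omega>. indicator G \<omega> * heat_sum f s t n \<omega> \<partial>M)) \<longlonglongrightarrow>
     (\<integral>\<omega>. indicator G \<omega> * (f (Y t \<omega>) - f (Y s \<omega>)) \<partial>M)"
    by (rule tendsto_eventually) (use E_drift_sum(3)[OF st G n] in \<open>auto intro!: eventually_sequentiallyI[of 1]\<close>)
  from LIMSEQ_unique[OF this tendsto_add[OF A B]]
  have eq: "(\<integral>\<omega>. indicator G \<omega> * (f (Y t \<omega>) - f (Y s \<omega>)) \<partial>M) =
    (\<integral>\<omega>. indicator G \<omega> * ((LBINT r:{s..t}. f1 (Y r \<omega>) * b (Y r \<omega>)) + f1 0 * (W t \<omega> - W s \<omega>)) \<partial>M)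
     + (\<integral>\<omega>. indicator G \<omega> * (LBINT r:{s..t}. f2 (Y r \<omega>) / 2) \<partial>M)" .
  have bI: "\<bar>LBINT r:{s..t}. f1 (Y r \<omega>) * b (Y r \<omega>)\<bar> \<le> (C * K) * (t - s)" for \<omega>
  proof (rule set_lint_bound)
    show "\<bar>f1 (Y r \<omega>) * b (Y r \<omega>)\<bar> \<le> C * K" for r
      unfolding abs_mult by (intro mult_mono C11D(4)[OF n] b_bd C) auto
  qed (use st in auto)
  have iI: "integrable M (\<lambda>\<omega>. indicator G \<omega> * (LBINT r:{s..t}. f1 (Y r \<omega>) * b (Y r \<omega>)))"
  proof (rule integrable_const_bound[of _ "(C * K) * (t - s)"])
    have "0 \<le> (C * K) * (t - s)" using C K_nonneg st by simp
    then show "AE \<omega> in M. norm (indicator G \<omega> * (LBINT r:{s..t}. f1 (Y r \<omega>) * b (Y r \<omega>))) \<le> (C * K) * (t - s)"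
      using bI by (intro AE_I2) (auto simp: indicator_def)
  qed measurable
  have "(\<integral>\<omega>. indicator G \<omega> * ((LBINT r:{s..t}. f1 (Y r \<omega>) * b (Y r \<omega>)) + f1 0 * (W t \<omega> - W s \<omega>)) \<partial>M)
    = (\<integral>\<omega>. indicator G \<omega> * (LBINT r:{s..t}. f1 (Y r \<omega>) * b (Y r \<omega>)) + f1 0 * (indicator G \<omega> * (W t \<omega> - W s \<omega>)) \<partial>M)"
    by (intro Bochner_Integration.integral_cong) (auto simp: algebra_simps)
  also have "\<dots> = (\<integral>\<omega>. indicator G \<omega> * (LBINT r:{s..t}. f1 (Y r \<omega>) * b (Y r \<omega>)) \<partial>M)
      + f1 0 * (\<integral>\<omega>. indicator G \<omega> * (W t \<omega> - W s \<omega>) \<partial>M)"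
    using iI iGW by (subst Bochner_Integration.integral_add) auto
  finally show ?thesis using eq by simp
qed

end

text \<open>The average of \<open>\<bar>z + v\<bar>\<close> over \<open>v\<close> uniform on
  \<open>[-e, e]\<close>, written without case distinction by means of the primitive
  \<open>z * \<bar>z\<bar> / 2\<close> of \<open>\<bar>z\<bar>\<close>. It is quadratic on the
  window and equals \<open>\<bar>z\<bar>\<close> outside.\<close>

definition smooth_abs :: "real \<Rightarrow> real \<Rightarrow> real" where
  "smooth_abs e z = ((z + e) * \<bar>z + e\<bar> - (z - e) * \<bar>z - e\<bar>) / (4 * e)"
definition smooth_abs1 :: "real \<Rightarrow> real \<Rightarrow> real" where
  "smooth_abs1 e z = (\<bar>z + e\<bar> - \<bar>z - e\<bar>) / (2 * e)"
definition smooth_abs2 :: "real \<Rightarrow> real \<Rightarrow> real" where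
  "smooth_abs2 e z = (sgn (z + e) - sgn (z - e)) / (2 * e)"

section \<open>The mean local time\<close>

lemma deriv_signed_square: "((\<lambda>z::real. z * \<bar>z\<bar>) has_real_derivative 2 * \<bar>z\<bar>) (at z)"
proof (cases z "0 :: real" rule: linorder_cases)
  case greater
  have "((\<lambda>z::real. z * z) has_real_derivative 2 * \<bar>z\<bar>) (at z)"
    using greater by (auto intro!: derivative_eq_intros)
  moreover have "eventually (\<lambda>z. z * z = z * \<bar>z\<bar>) (nhds z)"
    using eventually_nhds_in_open[of "{0<..}" z] greater by (auto elim!: eventually_mono)
  ultimately show ?thesis by (rule DERIV_cong_ev[THEN iffD1, rotated 3, OF _ refl _ refl])
next
  case less
  have "((\<lambda>z::real. - (z * z)) has_real_derivative 2 * \<bar>z\<bar>) (at z)"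
    using less by (auto intro!: derivative_eq_intros)
  moreover have "eventually (\<lambda>z. - (z * z) = z * \<bar>z\<bar>) (nhds z)"
    using eventually_nhds_in_open[of "{..<0}" z] less by (auto elim!: eventually_mono)
  ultimately show ?thesis by (rule DERIV_cong_ev[THEN iffD1, rotated 3, OF _ refl _ refl])
next
  case equal
  have "((\<lambda>h::real. \<bar>h\<bar>) \<longlongrightarrow> 0) (at 0)" by (rule tendsto_rabs_zero) (rule tendsto_ident_at)
  then have "((\<lambda>h::real. ((0 + h) * \<bar>0 + h\<bar> - 0 * \<bar>0\<bar>) / h) \<longlongrightarrow> 0) (at 0)"
    by (rule Lim_transform_eventually) (auto simp: eventually_at intro!: exI[of _ 1])
  then show ?thesis using equal by (simp add: DERIV_def)
qed

lemma deriv_abs_real: "z \<noteq> 0 \<Longrightarrow> ((\<lambda>z::real. \<bar>z\<bar>) has_real_derivative sgn z) (at z)"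
proof (cases z "0 :: real" rule: linorder_cases)
  case greater
  have "((\<lambda>z::real. z) has_real_derivative sgn z) (at z)"
    using greater by (auto intro!: derivative_eq_intros)
  moreover have "eventually (\<lambda>z. z = \<bar>z\<bar>) (nhds z)"
    using eventually_nhds_in_open[of "{0<..}" z] greater by (auto elim!: eventually_mono)
  ultimately show ?thesis by (rule DERIV_cong_ev[THEN iffD1, rotated 3, OF _ refl _ refl])
next
  case less
  have "((\<lambda>z::real. - z) has_real_derivative sgn z) (at z)"
    using less by (auto intro!: derivative_eq_intros)
  moreover have "eventually (\<lambda>z. - z = \<bar>z\<bar>) (nhds z)"
    using eventually_nhds_in_open[of "{..<0}" z] less by (auto elim!: eventually_mono)
  ultimately show ?thesis by (rule DERIV_cong_ev[THEN iffD1, rotated 3, OF _ refl _ refl])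
qed auto

lemma smooth_abs_deriv: assumes "e > 0" shows "(smooth_abs e has_real_derivative smooth_abs1 e z) (at z)"
proof -
  have 1: "((\<lambda>z. (z + c) * \<bar>z + c\<bar>) has_real_derivative 2 * \<bar>z + c\<bar> * 1) (at z)" for c
    by (rule DERIV_chain2[OF deriv_signed_square]) (auto intro!: derivative_eq_intros)
  have "((\<lambda>z. ((z + e) * \<bar>z + e\<bar> - (z - e) * \<bar>z - e\<bar>) / (4 * e)) has_real_derivative (2 * \<bar>z + e\<bar> * 1
      - 2 * \<bar>z - e\<bar> * 1) / (4 * e)) (at z)"
    using 1[of e] 1[of "- e"] by (intro DERIV_cdivide DERIV_diff) auto
  moreover have "(2 * \<bar>z + e\<bar> * 1 - 2 * \<bar>z - e\<bar> * 1) / (4 * e) = (\<bar>z + e\<bar> - \<bar>z - e\<bar>) / (2 * e)"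
    using assms by (simp add: field_simps)
  ultimately show ?thesis unfolding smooth_abs_def[abs_def] smooth_abs1_def by simp
qed

lemma smooth_abs1_deriv: "e > 0 \<Longrightarrow> z \<notin> {-e, e} \<Longrightarrow> (smooth_abs1 e has_real_derivative smooth_abs2 e z) (at z)"
  unfolding smooth_abs1_def[abs_def] smooth_abs2_def
  by (auto intro!: derivative_eq_intros DERIV_chain2[OF deriv_abs_real] simp: field_simps)

lemma smooth_abs_outside: "e > 0 \<Longrightarrow> e \<le> \<bar>z\<bar> \<Longrightarrow> smooth_abs e z = \<bar>z\<bar>"
proof (cases "z \<ge> 0")
  case False
  assume "e > 0" "e \<le> \<bar>z\<bar>"
  then have "\<bar>z + e\<bar> = - (z + e)" "\<bar>z - e\<bar> = - (z - e)" using False by auto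
  then show ?thesis unfolding smooth_abs_def using \<open>e > 0\<close> False by (simp add: field_simps)
qed (auto simp: smooth_abs_def field_simps abs_if)

lemma smooth_abs_inside: "e > 0 \<Longrightarrow> \<bar>z\<bar> \<le> e \<Longrightarrow> smooth_abs e z = (z\<^sup>2 + e\<^sup>2) / (2 * e)"
  unfolding smooth_abs_def by (auto simp: field_simps abs_if power2_eq_square)

lemma smooth_abs_bounds: assumes "e > 0" shows "\<bar>z\<bar> \<le> smooth_abs e z" "smooth_abs e z \<le> \<bar>z\<bar> + e"
    "\<bar>z\<bar> \<le> e \<Longrightarrow> smooth_abs e z \<le> e"
proof -
  have in': "\<bar>z\<bar> \<le> smooth_abs e z \<and> smooth_abs e z \<le> e" if z: "\<bar>z\<bar> \<le> e"
  proof -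
    have "0 \<le> (\<bar>z\<bar> - e)\<^sup>2" by simp
    then have "2 * e * \<bar>z\<bar> \<le> z\<^sup>2 + e\<^sup>2" by (simp add: power2_eq_square algebra_simps)
    moreover have "z\<^sup>2 \<le> e\<^sup>2" using z assms by (metis abs_le_square_iff abs_of_pos)
    then have "z\<^sup>2 + e\<^sup>2 \<le> 2 * e * e" by (simp add: power2_eq_square)
    ultimately show ?thesis using assms by (simp add: smooth_abs_inside[OF assms z] field_simps)
  qed
  show "\<bar>z\<bar> \<le> smooth_abs e z" "smooth_abs e z \<le> \<bar>z\<bar> + e" "\<bar>z\<bar> \<le> e \<Longrightarrow> smooth_abs e z \<le> e"
    using in' smooth_abs_outside[OF assms, of z] assms by (cases "\<bar>z\<bar> \<le> e"; auto)+
qed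

lemma smooth_abs1_bound: "e > 0 \<Longrightarrow> \<bar>smooth_abs1 e z\<bar> \<le> 1"
  unfolding smooth_abs1_def by (auto simp: field_simps abs_if)

lemma smooth_abs1_0[simp]: "smooth_abs1 e 0 = 0" by (simp add: smooth_abs1_def)

lemma smooth_abs1_outside: "e > 0 \<Longrightarrow> e \<le> \<bar>z\<bar> \<Longrightarrow> smooth_abs1 e z = sgn z"
  unfolding smooth_abs1_def by (cases "z \<ge> 0") (auto simp: field_simps abs_if sgn_if)

lemma smooth_abs2_bound: "e > 0 \<Longrightarrow> \<bar>smooth_abs2 e z\<bar> \<le> 1 / e"
  unfolding smooth_abs2_def by (auto simp: field_simps sgn_if)

lemma smooth_abs2_eq: "e > 0 \<Longrightarrow> z \<notin> {-e, e} \<Longrightarrow> smooth_abs2 e z = indicator {-e..e} z / e"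
  unfolding smooth_abs2_def by (auto simp: sgn_if indicator_def)

text \<open>
  \<open>exp_test e\<close> tends to \<open>1 - exp (- \<bar>z\<bar>)\<close> as \<open>e\<close> tends to 0, has derivative 0 at the origin and is therefore
  blind to the corrector; its second derivative carries the normalised occupation density of \<open>{-e..e}\<close>.
\<close>

definition exp_test :: "real \<Rightarrow> real \<Rightarrow> real" where "exp_test e z = 1 - exp (- smooth_abs e z)"
definition exp_test1 :: "real \<Rightarrow> real \<Rightarrow> real" where "exp_test1 e z = exp (- smooth_abs e z) * smooth_abs1 e z"
definition exp_test2 :: "real \<Rightarrow> real \<Rightarrow> real" where "exp_test2 e z
    = exp (- smooth_abs e z) * (smooth_abs2 e z - (smooth_abs1 e z)\<^sup>2)"

lemma smooth_abs_meas[measurable]: "smooth_abs e \<in> borel_measurable borel" unfolding smooth_abs_def[abs_def]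
    by measurable
lemma smooth_abs1_meas[measurable]: "smooth_abs1 e \<in> borel_measurable borel" unfolding smooth_abs1_def[abs_def]
    by measurable
lemma smooth_abs2_meas[measurable]: "smooth_abs2 e \<in> borel_measurable borel" unfolding smooth_abs2_def[abs_def]
    by measurable
lemma exp_test_meas[measurable]: "exp_test e \<in> borel_measurable borel" unfolding exp_test_def[abs_def] by measurable

lemma exp_smooth_abs: assumes "e > 0" shows "0 < exp (- smooth_abs e z)" "exp (- smooth_abs e z) \<le> 1"
  using smooth_abs_bounds(1)[OF assms, of z] by auto

lemma exp_test_bounds: "e > 0 \<Longrightarrow> 0 \<le> exp_test e z" "e > 0 \<Longrightarrow> exp_test e z \<le> 1"
  using exp_smooth_abs[of e z] by (auto simp: exp_test_def)

lemma exp_test1_bound: "e > 0 \<Longrightarrow> \<bar>exp_test1 e z\<bar> \<le> 1"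
  unfolding exp_test1_def abs_mult using exp_smooth_abs[of e z] smooth_abs1_bound[of e z]
      by (auto intro!: mult_le_one)

lemma smooth_abs1_sq: "e > 0 \<Longrightarrow> (smooth_abs1 e z)\<^sup>2 \<le> 1"
  using smooth_abs1_bound[of e z] by (simp add: abs_square_le_1)

lemma exp_test_C11: assumes e: "e > 0" shows "C11 {-e, e} (exp_test e) (exp_test1 e) (exp_test2 e) (1 / e + 1)"
proof (rule C11I)
  have e1: "1 / e + 1 \<ge> 1" using e by simp
  show "\<bar>exp_test e z\<bar> \<le> 1 / e + 1" for z using exp_test_bounds[OF e, of z] e1 by linarith
  show "\<bar>exp_test1 e z\<bar> \<le> 1 / e + 1" for z using exp_test1_bound[OF e, of z] e1 by linarith
  show "\<bar>exp_test2 e z\<bar> \<le> 1 / e + 1" for z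
  proof -
    have "\<bar>smooth_abs2 e z - (smooth_abs1 e z)\<^sup>2\<bar> \<le> 1 / e + 1"
      using smooth_abs2_bound[OF e, of z] smooth_abs1_sq[OF e, of z] zero_le_power2[of "smooth_abs1 e z"] by linarith
    then have "\<bar>exp_test2 e z\<bar> \<le> 1 * (1 / e + 1)"
      unfolding exp_test2_def abs_mult using exp_smooth_abs[OF e, of z] by (intro mult_mono) auto
    then show ?thesis by simp
  qed
  show "(exp_test e has_real_derivative exp_test1 e z) (at z)" for z
    unfolding exp_test_def[abs_def] exp_test1_def
    by (auto intro!: derivative_eq_intros smooth_abs_deriv[OF e])
  show "continuous_on UNIV (exp_test1 e)"
    unfolding exp_test1_def[abs_def] smooth_abs_def smooth_abs1_def by (intro continuous_intros) (use e in auto)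
  show "(exp_test1 e has_real_derivative exp_test2 e z) (at z)" if "z \<notin> {-e, e}" for z
    unfolding exp_test1_def[abs_def] exp_test2_def
    by (auto intro!: derivative_eq_intros smooth_abs_deriv[OF e] smooth_abs1_deriv[OF e that] simp:
        power2_eq_square algebra_simps)
  show "isCont (exp_test2 e) z" if "z \<notin> {-e, e}" for z
    unfolding exp_test2_def[abs_def] smooth_abs_def smooth_abs1_def smooth_abs2_def
        by (intro continuous_intros) (use e that in auto)
qed (auto simp: exp_test2_def[abs_def])

text \<open>Unlike \<open>sgn\<close> it takes the value 1 at 0. This matches the convention of
  \<open>glue\<close>, so that the decomposition of the generator in \<open>kink_ito\<close> holds
  at every point, 0 included.\<close>

definition rsgn :: "real \<Rightarrow> real" where "rsgn z = (if z \<ge> 0 then 1 else -1)"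

lemma rsgn_meas[measurable]: "rsgn \<in> borel_measurable borel" unfolding rsgn_def[abs_def] by measurable

lemma rsgn_abs[simp]: "\<bar>rsgn z\<bar> = 1" by (simp add: rsgn_def)

section \<open>Occupation times near 0\<close>

context skew_core begin

lemma int_ind_space: "(\<integral>\<omega>. indicator (space M) \<omega> * f \<omega> \<partial>M) = (\<integral>\<omega>. f \<omega> \<partial>M)" for f :: "'a \<Rightarrow> real"
  by (intro Bochner_Integration.integral_cong) auto

lemma space_in_F: "space M \<in> sets (F t)"
  using space_F[of t] by (metis sets.top)

lemma E_bound:
  assumes "\<And>\<omega>. \<bar>g \<omega>\<bar> \<le> (c::real)" "g \<in> borel_measurable M"
  shows "integrable M g" "\<bar>\<integral>\<omega>. g \<omega> \<partial>M\<bar> \<le> c"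
proof -
  show i: "integrable M g" by (rule integrable_const_bound[of _ c]) (use assms in auto)
  show "\<bar>\<integral>\<omega>. g \<omega> \<partial>M\<bar> \<le> c"
    using order_trans[OF integral_abs_bound integral_mono[of M "\<lambda>\<omega>. \<bar>g \<omega>\<bar>" "\<lambda>_. c"]] i assms(1)
    by (simp add: prob_space)
qed

definition occ :: "real \<Rightarrow> real \<Rightarrow> real \<Rightarrow> 'a \<Rightarrow> real" where
  "occ e s t \<omega> = (LBINT r:{s..t}. indicator {-e..e} (Y r \<omega>) / (2 * e))"
definition damped_occ :: "real \<Rightarrow> real \<Rightarrow> real \<Rightarrow> 'a \<Rightarrow> real" where
  "damped_occ e s t \<omega> = (LBINT r:{s..t}. exp (- smooth_abs e (Y r \<omega>)) * (indicator {-e..e} (Y r \<omega>) / (2 * e)))"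
text \<open>The regular part of the generator, with reversed sign: off the two points
  \<open>-e\<close> and \<open>e\<close>, \<open>exp_test2 e / 2 + exp_test1 e * b\<close> is the
  integrand of \<open>damped_occ\<close> minus this function, which is bounded uniformly in
  \<open>e\<close>.\<close>

definition damped_gen :: "real \<Rightarrow> real \<Rightarrow> real" where
  "damped_gen e z = exp (- smooth_abs e z) * (smooth_abs1 e z)\<^sup>2 / 2 - exp_test1 e z * b z"

lemma damped_gen_meas[measurable]: "damped_gen e \<in> borel_measurable borel"
  unfolding damped_gen_def[abs_def] exp_test1_def using b_meas by measurable

lemma damped_gen_bound: assumes e: "e > 0" shows "\<bar>damped_gen e z\<bar> \<le> 1 / 2 + K"
proof -
  have "exp (- smooth_abs e z) * (smooth_abs1 e z)\<^sup>2 \<le> 1 * 1"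
    using exp_smooth_abs[OF e, of z] smooth_abs1_sq[OF e, of z] by (intro mult_mono) auto
  moreover have "0 \<le> exp (- smooth_abs e z) * (smooth_abs1 e z)\<^sup>2" by simp
  moreover have "\<bar>exp_test1 e z * b z\<bar> \<le> 1 * K"
    unfolding abs_mult using exp_test1_bound[OF e, of z] b_bd[of z] by (intro mult_mono) auto
  ultimately show ?thesis unfolding damped_gen_def by linarith
qed

lemma ind_bd: fixes z :: real assumes e: "e > 0" shows "\<bar>indicator {-e..e} z / (2 * e)\<bar> \<le> 1 / (2 * e)"
  using e by (auto simp: indicator_def)

lemma ind_bd': assumes e: "e > 0" shows "\<bar>exp (- smooth_abs e z) * (indicator {-e..e} z / (2 * e))\<bar> \<le> 1 / (2 * e)"
proof -
  have "\<bar>exp (- smooth_abs e z) * (indicator {-e..e} z / (2 * e))\<bar> \<le> 1 * (1 / (2 * e))"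
    unfolding abs_mult using exp_smooth_abs[OF e, of z] ind_bd[OF e, of z] by (intro mult_mono) auto
  then show ?thesis by simp
qed

lemma exp_test2_half: assumes e: "e > 0" shows "\<bar>exp_test2 e z / 2\<bar> \<le> 1 / e + 1"
proof -
  have "\<bar>exp_test2 e z / 2\<bar> \<le> \<bar>exp_test2 e z\<bar>" by (simp only: abs_divide)
  then show ?thesis using C11D(7)[OF exp_test_C11[OF e], of z] by linarith
qed

lemma path_int: assumes w: "\<omega> \<in> space M" and f: "f \<in> borel_measurable borel" "\<And>z. \<bar>f z\<bar> \<le> (C::real)"
  shows "set_integrable lborel {s..t} (\<lambda>r. f (Y r \<omega>))"
  by (rule bounded_set_integrable[of _ _ _ C]) (use f measurable_compose[OF path_meas[OF w] f(1)] in auto)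

lemma occ_M[measurable]: "occ e s t \<in> borel_measurable M"
  unfolding occ_def[abs_def] by (rule int_meas[of "\<lambda>z. indicator {-e..e} z / (2 * e)"]) measurable
lemma damped_occ_M[measurable]: "damped_occ e s t \<in> borel_measurable M"
  unfolding damped_occ_def[abs_def] by (rule int_meas[of
      "\<lambda>z. exp (- smooth_abs e z) * (indicator {-e..e} z / (2 * e))"]) measurable

lemma occ_bounds: assumes e: "e > 0" and st: "s \<le> t" shows "\<bar>occ e s t \<omega>\<bar> \<le> 1 / (2 * e) * (t - s)"
  unfolding occ_def by (rule set_lint_bound[OF st]) (use ind_bd[OF e] in auto)
lemma damped_occ_bounds: assumes e: "e > 0" and st: "s \<le> t" shows "\<bar>damped_occ e s t \<omega>\<bar> \<le> 1 / (2 * e) * (t - s)"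
  unfolding damped_occ_def by (rule set_lint_bound[OF st]) (use ind_bd'[OF e] in auto)

lemma occ_nonneg: "e > 0 \<Longrightarrow> 0 \<le> occ e s t \<omega>"
  unfolding occ_def set_lebesgue_integral_def by (intro Bochner_Integration.integral_nonneg)
      (auto simp: indicator_def)

lemma damped_occ_occ: assumes e: "e > 0" and w: "\<omega> \<in> space M"
  shows "damped_occ e s t \<omega> \<le> occ e s t \<omega>" "exp (- e) * occ e s t \<omega> \<le> damped_occ e s t \<omega>"
proof -
  have i1: "set_integrable lborel {s..t} (\<lambda>r. indicator {-e..e} (Y r \<omega>) / (2 * e))"
    by (rule path_int[OF w, of "\<lambda>z. indicator {-e..e} z / (2 * e)"]) (use ind_bd[OF e] in auto)
  have i2: "set_integrable lborel {s..t} (\<lambda>r. exp (- smooth_abs e (Y r \<omega>)) * (indicator {-e..e} (Y r \<omega>) / (2 * e)))"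
    by (rule path_int[OF w, of "\<lambda>z. exp (- smooth_abs e z) * (indicator {-e..e} z / (2 * e))"])
        (use ind_bd'[OF e] in auto)
  show "damped_occ e s t \<omega> \<le> occ e s t \<omega>" unfolding damped_occ_def occ_def
    by (rule set_integral_mono[OF i2 i1]) (use e exp_smooth_abs[OF e] in \<open>auto simp: indicator_def divide_right_mono\<close>)
  have "exp (- e) * occ e s t \<omega> = (LBINT r:{s..t}. exp (- e) * (indicator {-e..e} (Y r \<omega>) / (2 * e)))"
    unfolding occ_def by simp
  also have "\<dots> \<le> damped_occ e s t \<omega>" unfolding damped_occ_def
  proof (rule set_integral_mono[OF _ i2])
    show "set_integrable lborel {s..t} (\<lambda>r. exp (- e) * (indicator {-e..e} (Y r \<omega>) / (2 * e)))"
      using i1 by (intro set_integrable_mult_right) auto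
    show "exp (- e) * (indicator {-e..e} (Y r \<omega>) / (2 * e))
        \<le> exp (- smooth_abs e (Y r \<omega>)) * (indicator {-e..e} (Y r \<omega>) / (2 * e))" for r
    proof (cases "\<bar>Y r \<omega>\<bar> \<le> e")
      case True
      then show ?thesis using smooth_abs_bounds(3)[OF e, of "Y r \<omega>"] e by (intro mult_right_mono) auto
    qed (auto simp: indicator_def)
  qed
  finally show "exp (- e) * occ e s t \<omega> \<le> damped_occ e s t \<omega>" .
qed

lemma damped_occ_path: assumes e: "e > 0" and st: "0 \<le> s" "s < t"
  shows "AE \<omega> in M. (LBINT r:{s..t}. exp_test2 e (Y r \<omega>) / 2) + (LBINT r:{s..t}. exp_test1 e (Y r \<omega>) * b (Y r \<omega>))
     = damped_occ e s t \<omega> - (LBINT r:{s..t}. damped_gen e (Y r \<omega>))"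
  using AE_avoid[of "{-e, e}", simplified] AE_space
proof eventually_elim
  case (elim \<omega>)
  note w = elim(2)
  note n = exp_test_C11[OF e]
  note [measurable] = path_meas[OF w] C11D(6)[OF n] C11_measurable[OF n] b_meas
  have i0: "set_integrable lborel {s..t} (\<lambda>r. exp_test2 e (Y r \<omega>) / 2)"
    by (rule path_int[OF w, of "\<lambda>z. exp_test2 e z / 2" "1 / e + 1"]) (measurable, rule exp_test2_half[OF e])
  have i1: "set_integrable lborel {s..t} (\<lambda>r. exp_test1 e (Y r \<omega>) * b (Y r \<omega>))"
  proof (rule path_int[OF w, of "\<lambda>z. exp_test1 e z * b z" "1 * K"])
    show "\<bar>exp_test1 e z * b z\<bar> \<le> 1 * K" for z
      unfolding abs_mult using exp_test1_bound[OF e, of z] b_bd[of z] by (intro mult_mono) auto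
  qed measurable
  have i2: "set_integrable lborel {s..t} (\<lambda>r. exp (- smooth_abs e (Y r \<omega>)) * (indicator {-e..e} (Y r \<omega>) / (2 * e)))"
    by (rule path_int[OF w, of "\<lambda>z. exp (- smooth_abs e z) * (indicator {-e..e} z / (2 * e))"])
        (use ind_bd'[OF e] in auto)
  have i3: "set_integrable lborel {s..t} (\<lambda>r. damped_gen e (Y r \<omega>))"
    by (rule path_int[OF w, of "damped_gen e"]) (use damped_gen_bound[OF e] in auto)
  have "(LBINT r:{s..t}. exp_test2 e (Y r \<omega>) / 2) + (LBINT r:{s..t}. exp_test1 e (Y r \<omega>) * b (Y r \<omega>))
    = (LBINT r:{s..t}. exp_test2 e (Y r \<omega>) / 2 + exp_test1 e (Y r \<omega>) * b (Y r \<omega>))"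
    by (rule set_integral_add(2)[OF i0 i1, symmetric])
  also have "\<dots> = (LBINT r:{s..t}. exp (- smooth_abs e (Y r \<omega>)) * (indicator {-e..e} (Y r \<omega>) / (2 * e))
      - damped_gen e (Y r \<omega>))"
    unfolding set_lebesgue_integral_def
  proof (rule integral_cong_AE)
    show "AE r in lborel. indicator {s..t} r *\<^sub>R (exp_test2 e (Y r \<omega>) / 2 + exp_test1 e (Y r \<omega>) * b (Y r \<omega>)) =
       indicator {s..t} r *\<^sub>R (exp (- smooth_abs e (Y r \<omega>)) * (indicator {-e..e} (Y r \<omega>) / (2 * e))
           - damped_gen e (Y r \<omega>))"
      using elim(1) AE_lborel_singleton[of 0]
    proof eventually_elim
      case (elim r)
      show ?case
      proof (cases "r \<in> {s..t}")
        case True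
        then have "Y r \<omega> \<notin> {-e, e}" using elim st by auto
        then have "exp_test2 e (Y r \<omega>) / 2 + exp_test1 e (Y r \<omega>) * b (Y r \<omega>)
            = exp (- smooth_abs e (Y r \<omega>)) * (indicator {-e..e} (Y r \<omega>) / (2 * e)) - damped_gen e (Y r \<omega>)"
          unfolding damped_gen_def exp_test2_def smooth_abs2_eq[OF e \<open>Y r \<omega> \<notin> {-e, e}\<close>]
              by (simp add: algebra_simps diff_divide_distrib)
        then show ?thesis by simp
      qed simp
    qed
  qed measurable
  also have "\<dots> = damped_occ e s t \<omega> - (LBINT r:{s..t}. damped_gen e (Y r \<omega>))"
    unfolding damped_occ_def by (rule set_integral_diff(2)[OF i2 i3])
  finally show ?case .
qed

text \<open>Ito's formula for \<open>exp_test e\<close>, whose derivative at 0 vanishes, solved for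
  the occupation term. All terms on the right are bounded uniformly in \<open>e\<close>, although
  the normalisation \<open>1 / (2 * e)\<close> on the left is not.\<close>

lemma damped_occ_formula: assumes e: "e > 0" and st: "0 \<le> s" "s < t" and G: "G \<in> sets (F s)"
  shows "(\<integral>\<omega>. indicator G \<omega> * damped_occ e s t \<omega> \<partial>M) = (\<integral>\<omega>. indicator G \<omega>
      * (exp_test e (Y t \<omega>) - exp_test e (Y s \<omega>)) \<partial>M)
     + (\<integral>\<omega>. indicator G \<omega> * (LBINT r:{s..t}. damped_gen e (Y r \<omega>)) \<partial>M)"
proof -
  note n = exp_test_C11[OF e]
  note [measurable] = F_sets[OF st(1) G] C11D(6)[OF n] C11_measurable[OF n] b_meas
     int_meas[of "\<lambda>z. exp_test2 e z / 2"] int_meas[of "\<lambda>z. exp_test1 e z * b z"] int_meas[of "damped_gen e"]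
  let ?a = "\<lambda>\<omega>. LBINT r:{s..t}. exp_test2 e (Y r \<omega>) / 2" and ?c
      = "\<lambda>\<omega>. LBINT r:{s..t}. exp_test1 e (Y r \<omega>) * b (Y r \<omega>)"
    and ?h = "\<lambda>\<omega>. LBINT r:{s..t}. damped_gen e (Y r \<omega>)"
  have ma: "?a \<in> borel_measurable M" by (rule int_meas[of "\<lambda>z. exp_test2 e z / 2"]) measurable
  have mc: "?c \<in> borel_measurable M" by (rule int_meas[of "\<lambda>z. exp_test1 e z * b z"]) measurable
  have mh: "?h \<in> borel_measurable M" by (rule int_meas[of "damped_gen e"]) measurable
  note [measurable] = ma mc mh
  have bda: "\<bar>?a \<omega>\<bar> \<le> (1 / e + 1) * (t - s)" for \<omega>
    by (rule set_lint_bound[OF _ exp_test2_half[OF e]]) (use st in auto)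
  have bdc: "\<bar>?c \<omega>\<bar> \<le> (1 * K) * (t - s)" for \<omega>
  proof (rule set_lint_bound)
    show "\<bar>exp_test1 e (Y r \<omega>) * b (Y r \<omega>)\<bar> \<le> 1 * K" for r
      unfolding abs_mult using exp_test1_bound[OF e] b_bd by (intro mult_mono) auto
  qed (use st in auto)
  have bdh: "\<bar>?h \<omega>\<bar> \<le> (1 / 2 + K) * (t - s)" for \<omega>
    by (rule set_lint_bound) (use st damped_gen_bound[OF e] in auto)
  have iG: "integrable M (\<lambda>\<omega>. indicator G \<omega> * g \<omega>)" if "\<And>\<omega>. \<bar>g \<omega>\<bar> \<le> c" "g \<in> borel_measurable M" for g and c :: real
    using E_bound(1)[OF that] by (rule Bochner_Integration.integrable_bound) (use that in \<open>auto simp: indicator_def\<close>)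
  have i1: "integrable M (\<lambda>\<omega>. indicator G \<omega> * ?a \<omega>)" by (rule iG[OF bda ma])
  have i2: "integrable M (\<lambda>\<omega>. indicator G \<omega> * ?c \<omega>)" by (rule iG[OF bdc mc])
  have i3: "integrable M (\<lambda>\<omega>. indicator G \<omega> * ?h \<omega>)" by (rule iG[OF bdh mh])
  have i4: "integrable M (\<lambda>\<omega>. indicator G \<omega> * damped_occ e s t \<omega>)"
      by (rule iG[OF damped_occ_bounds[OF e]]) (use st in auto)
  have "(\<integral>\<omega>. indicator G \<omega> * (exp_test e (Y t \<omega>) - exp_test e (Y s \<omega>)) \<partial>M)
      = (\<integral>\<omega>. indicator G \<omega> * ?a \<omega> \<partial>M) + (\<integral>\<omega>. indicator G \<omega> * ?c \<omega> \<partial>M)"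
    using ito[OF st G n] by (simp add: exp_test1_def)
  also have "\<dots> = (\<integral>\<omega>. indicator G \<omega> * ?a \<omega> + indicator G \<omega> * ?c \<omega> \<partial>M)"
    by (rule Bochner_Integration.integral_add[OF i1 i2, symmetric])
  also have "\<dots> = (\<integral>\<omega>. indicator G \<omega> * damped_occ e s t \<omega> - indicator G \<omega> * ?h \<omega> \<partial>M)"
  proof (rule integral_cong_AE)
    show "AE \<omega> in M. indicator G \<omega> * ?a \<omega> + indicator G \<omega> * ?c \<omega>
        = indicator G \<omega> * damped_occ e s t \<omega> - indicator G \<omega> * ?h \<omega>"
      using damped_occ_path[OF e st] by eventually_elim
          (simp only: distrib_left[symmetric] right_diff_distrib[symmetric])
  qed measurable
  also have "\<dots> = (\<integral>\<omega>. indicator G \<omega> * damped_occ e s t \<omega> \<partial>M) - (\<integral>\<omega>. indicator G \<omega> * ?h \<omega> \<partial>M)"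
    by (rule Bochner_Integration.integral_diff[OF i4 i3])
  finally show ?thesis by simp
qed

text \<open>In the bound, 1 is the oscillation of \<open>exp_test e\<close>,
  \<open>1 / 2 + K\<close> bounds \<open>damped_gen e\<close>, and \<open>exp e\<close> undoes the
  damping. Proportionality to \<open>prob G\<close> expresses a bound on the conditional expectation
  given \<open>F s\<close>, uniform for small \<open>e\<close>.\<close>

lemma conditional_occ_le: assumes e: "e > 0" and st: "0 \<le> s" "s < t" and G: "G \<in> sets (F s)"
  shows "(\<integral>\<omega>. indicator G \<omega> * occ e s t \<omega> \<partial>M) \<le> exp e * (1 + (1 / 2 + K) * (t - s)) * prob G"
proof -
  have mh[measurable]: "(\<lambda>\<omega>. LBINT r:{s..t}. damped_gen e (Y r \<omega>)) \<in> borel_measurable M"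
      by (rule int_meas[of "damped_gen e"]) measurable
  note [measurable] = F_sets[OF st(1) G]
  have iG: "integrable M (\<lambda>\<omega>. indicator G \<omega> * g \<omega>)" if "\<And>\<omega>. \<bar>g \<omega>\<bar> \<le> c" "g \<in> borel_measurable M" for g and c :: real
    using E_bound(1)[OF that] by (rule Bochner_Integration.integrable_bound) (use that in \<open>auto simp: indicator_def\<close>)
  have le: "(\<integral>\<omega>. indicator G \<omega> * g \<omega> \<partial>M) \<le> c * prob G" if "\<And>\<omega>. \<bar>g \<omega>\<bar> \<le> c" "g \<in> borel_measurable M" for g c
  proof -
    have "(\<integral>\<omega>. indicator G \<omega> * g \<omega> \<partial>M) \<le> (\<integral>\<omega>. c * indicator G \<omega> \<partial>M)"
    proof (rule integral_mono[OF iG[OF that]])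
      show "integrable M (\<lambda>\<omega>. c * indicator G \<omega>)"
        by (rule E_bound(1)[of _ "\<bar>c\<bar>"]) (auto simp: indicator_def)
    qed (use that(1) in \<open>auto simp: indicator_def abs_le_iff\<close>)
    also have "\<dots> = c * prob G" using F_sets[OF st(1) G] by simp
    finally show ?thesis .
  qed
  have iQ: "integrable M (\<lambda>\<omega>. indicator G \<omega> * damped_occ e s t \<omega>)"
      by (rule iG[OF damped_occ_bounds[OF e]]) (use st in auto)
  have iX: "integrable M (\<lambda>\<omega>. indicator G \<omega> * occ e s t \<omega>)" by (rule iG[OF occ_bounds[OF e]]) (use st in auto)
  have "(\<integral>\<omega>. indicator G \<omega> * occ e s t \<omega> \<partial>M) \<le> (\<integral>\<omega>. exp e * (indicator G \<omega> * damped_occ e s t \<omega>) \<partial>M)"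
  proof (rule integral_mono[OF iX])
    show "integrable M (\<lambda>\<omega>. exp e * (indicator G \<omega> * damped_occ e s t \<omega>))" using iQ by simp
    show "indicator G \<omega> * occ e s t \<omega> \<le> exp e * (indicator G \<omega> * damped_occ e s t \<omega>)" if "\<omega> \<in> space M" for \<omega>
      using damped_occ_occ(2)[OF e that, of s t] by (auto simp: indicator_def exp_minus field_simps)
  qed
  also have "\<dots> = exp e * (\<integral>\<omega>. indicator G \<omega> * damped_occ e s t \<omega> \<partial>M)" by simp
  also have "\<dots> \<le> exp e * (1 * prob G + ((1 / 2 + K) * (t - s)) * prob G)"
    unfolding damped_occ_formula[OF e st G]
  proof (intro mult_left_mono add_mono le)
    show "\<bar>exp_test e (Y t \<omega>) - exp_test e (Y s \<omega>)\<bar> \<le> 1" for \<omega>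
      using exp_test_bounds[OF e, of "Y t \<omega>"] exp_test_bounds[OF e, of "Y s \<omega>"] by linarith
    show "\<bar>LBINT r:{s..t}. damped_gen e (Y r \<omega>)\<bar> \<le> (1 / 2 + K) * (t - s)" for \<omega>
      by (rule set_lint_bound) (use st damped_gen_bound[OF e] in auto)
  qed (auto)
  finally show ?thesis by (simp add: algebra_simps)
qed

definition limit_gen :: "real \<Rightarrow> real" where "limit_gen z = exp (- \<bar>z\<bar>) / 2 - exp (- \<bar>z\<bar>) * rsgn z * b z"
text \<open>What the Ito-Tanaka formula for \<open>1 - exp (- \<bar>z\<bar>)\<close> says about the
  expected local time at 0; \<open>limit_gen\<close> is minus the generator applied to that function
  off 0. The formula involves neither the local time nor the corrector, so it keeps its meaning for
  \<open>p = 1/2\<close>, where the corrector vanishes.\<close>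

definition mean_local_time :: "real \<Rightarrow> real" where
  "mean_local_time t = (\<integral>\<omega>. 1 - exp (- \<bar>Y t \<omega>\<bar>) \<partial>M) - (\<integral>\<omega>. 1 - exp (- \<bar>Y 0 \<omega>\<bar>) \<partial>M)
      + (\<integral>\<omega>. (LBINT r:{0..t}. limit_gen (Y r \<omega>)) \<partial>M)"

lemma limit_gen_meas[measurable]: "limit_gen \<in> borel_measurable borel"
  unfolding limit_gen_def[abs_def] using b_meas by measurable

lemma limit_gen_bound: "\<bar>limit_gen z\<bar> \<le> 1 / 2 + K"
proof -
  have "\<bar>exp (- \<bar>z\<bar>) * rsgn z * b z\<bar> \<le> 1 * 1 * K"
    unfolding abs_mult using b_bd[of z] K_nonneg by (intro mult_mono) auto
  moreover have "0 \<le> exp (- \<bar>z\<bar>)" "exp (- \<bar>z\<bar>) \<le> 1" by auto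
  ultimately show ?thesis unfolding limit_gen_def by linarith
qed

abbreviation "eps n \<equiv> 1 / real (Suc n)"

lemma eps_lim: "eps \<longlonglongrightarrow> 0" by real_asymp

lemma smooth_abs_lim: "(\<lambda>n. smooth_abs (eps n) z) \<longlonglongrightarrow> \<bar>z\<bar>"
proof (rule tendsto_sandwich)
  show "eventually (\<lambda>n. \<bar>z\<bar> \<le> smooth_abs (eps n) z) sequentially" using smooth_abs_bounds(1)
      by (intro eventuallyI) simp
  show "eventually (\<lambda>n. smooth_abs (eps n) z \<le> \<bar>z\<bar> + eps n) sequentially"
      by (intro eventuallyI smooth_abs_bounds(2)) simp
  show "(\<lambda>n. \<bar>z\<bar>) \<longlonglongrightarrow> \<bar>z\<bar>" by simp
  show "(\<lambda>n. \<bar>z\<bar> + eps n) \<longlonglongrightarrow> \<bar>z\<bar>" using tendsto_add[OF tendsto_const eps_lim, of "\<bar>z\<bar>"] by simp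
qed

lemma damped_gen_lim: assumes "z \<noteq> 0" shows "(\<lambda>n. damped_gen (eps n) z) \<longlonglongrightarrow> limit_gen z"
proof (rule tendsto_eventually)
  have "eventually (\<lambda>n. eps n < \<bar>z\<bar>) sequentially"
    using eps_lim assms by (intro order_tendstoD(2)[of _ 0]) auto
  then show "eventually (\<lambda>n. damped_gen (eps n) z = limit_gen z) sequentially"
  proof eventually_elim
    case (elim n)
    have p: "eps n > 0" and le: "eps n \<le> \<bar>z\<bar>" using elim by auto
    show ?case unfolding damped_gen_def exp_test1_def limit_gen_def smooth_abs_outside[OF p le]
        smooth_abs1_outside[OF p le]
      using assms by (auto simp: rsgn_def sgn_if)
  qed
qed

lemma damped_occ_lim: assumes t: "0 < t" shows "(\<lambda>n. \<integral>\<omega>. damped_occ (eps n) 0 t \<omega> \<partial>M) \<longlonglongrightarrow> mean_local_time t"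
proof -
  have p: "eps n > 0" for n by simp
  have eq: "(\<integral>\<omega>. damped_occ (eps n) 0 t \<omega> \<partial>M) = (\<integral>\<omega>. exp_test (eps n) (Y t \<omega>) \<partial>M)
      - (\<integral>\<omega>. exp_test (eps n) (Y 0 \<omega>) \<partial>M) + (\<integral>\<omega>. (LBINT r:{0..t}. damped_gen (eps n) (Y r \<omega>)) \<partial>M)" for n
  proof -
    have "integrable M (\<lambda>\<omega>. exp_test (eps n) (Y u \<omega>))" for u
      by (rule E_bound(1)[of _ 1]) (use exp_test_bounds[OF p[of n]] in \<open>auto simp: abs_le_iff intro:
          order_trans[of _ 0]\<close>)
    then show ?thesis
      using damped_occ_formula[OF p order_refl t space_in_F, of n] by (simp add: int_ind_space)
  qed
  have thl: "(\<lambda>n. \<integral>\<omega>. exp_test (eps n) (Y u \<omega>) \<partial>M) \<longlonglongrightarrow> (\<integral>\<omega>. 1 - exp (- \<bar>Y u \<omega>\<bar>) \<partial>M)" for u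
  proof (rule integral_dominated_convergence[where w="\<lambda>_. 1"])
    show "AE \<omega> in M. (\<lambda>n. exp_test (eps n) (Y u \<omega>)) \<longlonglongrightarrow> 1 - exp (- \<bar>Y u \<omega>\<bar>)"
      unfolding exp_test_def by (intro AE_I2 tendsto_intros smooth_abs_lim)
    show "AE \<omega> in M. norm (exp_test (eps n) (Y u \<omega>)) \<le> 1" for n
      using exp_test_bounds[OF p[of n]] by (intro AE_I2) (auto simp: abs_le_iff intro: order_trans[of _ 0])
  qed auto
  have Hl: "(\<lambda>n. \<integral>\<omega>. (LBINT r:{0..t}. damped_gen (eps n) (Y r \<omega>)) \<partial>M) \<longlonglongrightarrow> (\<integral>\<omega>. (LBINT r:{0..t}. limit_gen (Y r \<omega>)) \<partial>M)"
  proof (rule integral_dominated_convergence[where w="\<lambda>_. (1 / 2 + K) * (t - 0)"])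
    show "AE \<omega> in M. (\<lambda>n. LBINT r:{0..t}. damped_gen (eps n) (Y r \<omega>)) \<longlonglongrightarrow> (LBINT r:{0..t}. limit_gen (Y r \<omega>))"
      using AE_avoid[of "{0}", simplified] AE_space
    proof eventually_elim
      case (elim \<omega>)
      note [measurable] = path_meas[OF elim(2)]
      show ?case unfolding set_lebesgue_integral_def
      proof (rule integral_dominated_convergence[where w="\<lambda>r. indicator {0..t} r *\<^sub>R (1 / 2 + K)"])
        show "integrable lborel (\<lambda>r. indicator {0..t} r *\<^sub>R (1 / 2 + K))"
          using t by (simp add: integrable_indicator_iff)
        show "AE r in lborel. (\<lambda>n. indicator {0..t} r *\<^sub>R damped_gen (eps n) (Y r \<omega>))
            \<longlonglongrightarrow> indicator {0..t} r *\<^sub>R limit_gen (Y r \<omega>)"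
          using elim(1) AE_lborel_singleton[of 0]
        proof eventually_elim
          case (elim r)
          then show ?case using damped_gen_lim[of "Y r \<omega>"] by (cases "r \<in> {0..t}") auto
        qed
        show "AE r in lborel. norm (indicator {0..t} r *\<^sub>R damped_gen (eps n) (Y r \<omega>))
            \<le> indicator {0..t} r *\<^sub>R (1 / 2 + K)" for n
          using damped_gen_bound[OF p[of n]] by (intro AE_I2) (auto simp: indicator_def)
      qed measurable
    qed
    show "AE \<omega> in M. norm (LBINT r:{0..t}. damped_gen (eps n) (Y r \<omega>)) \<le> (1 / 2 + K) * (t - 0)" for n
      unfolding real_norm_def by (intro AE_I2 set_lint_bound) (use t damped_gen_bound[OF p[of n]] in auto)
  qed (auto intro!: int_meas)
  show ?thesis unfolding eq mean_local_time_def by (intro tendsto_add tendsto_diff thl Hl)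
qed

text \<open>The damped and the undamped occupation time differ at most by the factor
  \<open>exp (eps n)\<close>, which tends to 1.\<close>

lemma occ_lim: assumes t: "0 \<le> t" shows "(\<lambda>n. \<integral>\<omega>. occ (eps n) 0 t \<omega> \<partial>M) \<longlonglongrightarrow> mean_local_time t"
proof (cases "t = 0")
  case True
  have z: "(LBINT r:{0..0}. f r) = 0" for f :: "real \<Rightarrow> real"
    unfolding set_lebesgue_integral_def
    by (rule integral_eq_zero_AE) (use AE_lborel_singleton[of 0] in \<open>eventually_elim, auto simp: indicator_def\<close>)
  then show ?thesis using True by (simp add: occ_def mean_local_time_def)
next
  case False
  then have t: "0 < t" using t by simp
  have p: "eps n > 0" for n by simp
  have iQ: "integrable M (damped_occ (eps n) 0 t)" for n
      by (rule E_bound(1)[OF damped_occ_bounds[OF p]]) (use t in auto)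
  have iX: "integrable M (occ (eps n) 0 t)" for n by (rule E_bound(1)[OF occ_bounds[OF p]]) (use t in auto)
  show ?thesis
  proof (rule tendsto_sandwich)
    show "eventually (\<lambda>n. (\<integral>\<omega>. damped_occ (eps n) 0 t \<omega> \<partial>M) \<le> (\<integral>\<omega>. occ (eps n) 0 t \<omega> \<partial>M)) sequentially"
      using iQ iX damped_occ_occ(1)[OF p] by (intro eventuallyI integral_mono) auto
    show "eventually (\<lambda>n. (\<integral>\<omega>. occ (eps n) 0 t \<omega> \<partial>M) \<le> exp (eps n) * (\<integral>\<omega>. damped_occ (eps n) 0 t \<omega> \<partial>M)) sequentially"
    proof (rule eventuallyI)
      fix n
      have "(\<integral>\<omega>. occ (eps n) 0 t \<omega> \<partial>M) \<le> (\<integral>\<omega>. exp (eps n) * damped_occ (eps n) 0 t \<omega> \<partial>M)"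
      proof (rule integral_mono[OF iX])
        show "integrable M (\<lambda>\<omega>. exp (eps n) * damped_occ (eps n) 0 t \<omega>)" using iQ by simp
        show "occ (eps n) 0 t \<omega> \<le> exp (eps n) * damped_occ (eps n) 0 t \<omega>" if "\<omega> \<in> space M" for \<omega>
          using damped_occ_occ(2)[OF p that, of n 0 t] by (simp add: exp_minus field_simps)
      qed
      then show "(\<integral>\<omega>. occ (eps n) 0 t \<omega> \<partial>M) \<le> exp (eps n) * (\<integral>\<omega>. damped_occ (eps n) 0 t \<omega> \<partial>M)" by simp
    qed
    show "(\<lambda>n. \<integral>\<omega>. damped_occ (eps n) 0 t \<omega> \<partial>M) \<longlonglongrightarrow> mean_local_time t" by (rule damped_occ_lim[OF t])
    show "(\<lambda>n. exp (eps n) * (\<integral>\<omega>. damped_occ (eps n) 0 t \<omega> \<partial>M)) \<longlonglongrightarrow> mean_local_time t"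
      using tendsto_mult[OF tendsto_exp[OF eps_lim] damped_occ_lim[OF t]] by simp
  qed
qed

text \<open>Not visible from the definition; it is inherited from the occupation times, which
  increase with time. The sign of the kink in the comparison argument is useful only because of
  it.\<close>

lemma mean_local_time_mono: assumes "0 \<le> s" "s \<le> t" shows "mean_local_time s \<le> mean_local_time t"
proof (rule LIMSEQ_le[OF occ_lim occ_lim])
  have p: "eps n > 0" for n by simp
  have iX: "integrable M (occ (eps n) 0 t)" if "0 \<le> t" for n t by (rule E_bound(1)[OF occ_bounds[OF p that]]) auto
  have "(\<integral>\<omega>. occ (eps n) 0 s \<omega> \<partial>M) \<le> (\<integral>\<omega>. occ (eps n) 0 t \<omega> \<partial>M)" for n
  proof (rule integral_mono)
    fix \<omega> assume w: "\<omega> \<in> space M"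
    show "occ (eps n) 0 s \<omega> \<le> occ (eps n) 0 t \<omega>"
    proof -
      have "(LBINT r:{0..t}. indicator {-(eps n)..eps n} (Y r \<omega>) / (2 * eps n))
          = occ (eps n) 0 s \<omega> + occ (eps n) s t \<omega>"
        unfolding occ_def
        by (rule set_lint_split[where C="1 / (2 * eps n)"])
          (use assms ind_bd[OF p] measurable_compose[OF path_meas[OF w], of
              "\<lambda>z. indicator {-(eps n)..eps n} z / (2 * eps n)" borel] in auto)
      then show ?thesis using occ_nonneg[OF p, of n s t \<omega>] by (simp add: occ_def)
    qed
  qed (use iX assms in auto)
  then show "\<exists>N. \<forall>n\<ge>N. (\<integral>\<omega>. occ (eps n) 0 s \<omega> \<partial>M) \<le> (\<integral>\<omega>. occ (eps n) 0 t \<omega> \<partial>M)" by blast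
qed (use assms in auto)

end

text \<open>Boundedness in \<open>L\<^sup>2\<close> gives uniform integrability, here by truncation:
  cutting off at \<open>k\<close> changes the means by at most \<open>D / k\<close> uniformly in
  \<open>n\<close>, because \<open>X - min X k \<le> X\<^sup>2 / k\<close> for nonnegative
  \<open>X\<close>.\<close>

lemma (in prob_space) limit_mean_of_bounded_second_moment:
  fixes Xn :: "nat \<Rightarrow> 'a \<Rightarrow> real"
  assumes i: "\<And>n. integrable M (Xn n)" and nn: "\<And>n \<omega>. 0 \<le> Xn n \<omega>"
    and sq: "\<And>n. (\<integral>\<^sup>+\<omega>. ennreal ((Xn n \<omega>)\<^sup>2) \<partial>M) \<le> ennreal D" and D: "0 \<le> D"
    and lim: "AE \<omega> in M. (\<lambda>n. Xn n \<omega>) \<longlonglongrightarrow> Z \<omega>" and Z: "integrable M Z"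
    and L: "(\<lambda>n. \<integral>\<omega>. Xn n \<omega> \<partial>M) \<longlonglongrightarrow> L"
  shows "(\<integral>\<omega>. Z \<omega> \<partial>M) = L"
proof -
  note [measurable] = borel_measurable_integrable[OF i] borel_measurable_integrable[OF Z]
  have Z0: "AE \<omega> in M. 0 \<le> Z \<omega>"
    using lim by eventually_elim (rule LIMSEQ_le_const, auto simp: nn)
  have isq: "integrable M (\<lambda>\<omega>. (Xn n \<omega>)\<^sup>2)" for n
    by (rule integrableI_nonneg) (use sq[of n] in \<open>auto simp: le_less_trans[OF _ ennreal_less_top]\<close>)
  have esq: "(\<integral>\<omega>. (Xn n \<omega>)\<^sup>2 \<partial>M) \<le> D" for n
    using sq[of n] D by (subst (asm) nn_integral_eq_integral[OF isq]) (auto simp: ennreal_le_iff)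
  have k: "\<bar>L - (\<integral>\<omega>. min (Z \<omega>) k \<partial>M)\<bar> \<le> D / k" if k: "k > 0" for k
  proof -
    have im: "integrable M (\<lambda>\<omega>. min (Xn n \<omega>) k)" for n
      by (rule integrable_const_bound[of _ k]) (use nn k in \<open>auto simp: abs_of_nonneg min_def\<close>)
    have 1: "(\<lambda>n. \<integral>\<omega>. min (Xn n \<omega>) k \<partial>M) \<longlonglongrightarrow> (\<integral>\<omega>. min (Z \<omega>) k \<partial>M)"
    proof (rule integral_dominated_convergence[where w="\<lambda>_. k"])
      show "AE \<omega> in M. (\<lambda>n. min (Xn n \<omega>) k) \<longlonglongrightarrow> min (Z \<omega>) k"
        using lim by eventually_elim (intro tendsto_min tendsto_const)
      show "AE \<omega> in M. norm (min (Xn n \<omega>) k) \<le> k" for n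
        using nn[of n] k by (intro AE_I2) (auto simp: min_def)
    qed auto
    have 2: "(\<lambda>n. \<bar>(\<integral>\<omega>. Xn n \<omega> \<partial>M) - (\<integral>\<omega>. min (Xn n \<omega>) k \<partial>M)\<bar>) \<longlonglongrightarrow> \<bar>L - (\<integral>\<omega>. min (Z \<omega>) k \<partial>M)\<bar>"
      by (intro tendsto_rabs tendsto_diff L 1)
    have "\<bar>(\<integral>\<omega>. Xn n \<omega> \<partial>M) - (\<integral>\<omega>. min (Xn n \<omega>) k \<partial>M)\<bar> \<le> D / k" for n
    proof -
      have "(\<integral>\<omega>. Xn n \<omega> \<partial>M) - (\<integral>\<omega>. min (Xn n \<omega>) k \<partial>M) = (\<integral>\<omega>. Xn n \<omega> - min (Xn n \<omega>) k \<partial>M)"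
        using i im by simp
      also have "\<dots> \<le> (\<integral>\<omega>. (Xn n \<omega>)\<^sup>2 / k \<partial>M)"
      proof (rule integral_mono)
        show "integrable M (\<lambda>\<omega>. Xn n \<omega> - min (Xn n \<omega>) k)" using i im by simp
        show "integrable M (\<lambda>\<omega>. (Xn n \<omega>)\<^sup>2 / k)" using isq by simp
        show "Xn n \<omega> - min (Xn n \<omega>) k \<le> (Xn n \<omega>)\<^sup>2 / k" for \<omega>
        proof (cases "Xn n \<omega> \<le> k")
          case True
          then show ?thesis using k by simp
        next
          case False
          have "Xn n \<omega> * k \<le> Xn n \<omega> * Xn n \<omega>" using False nn[of n \<omega>] by (intro mult_left_mono) auto
          then have "Xn n \<omega> \<le> (Xn n \<omega>)\<^sup>2 / k" using k by (simp add: pos_le_divide_eq power2_eq_square)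
          then show ?thesis using False k by simp
        qed
      qed
      also have "\<dots> = (\<integral>\<omega>. (Xn n \<omega>)\<^sup>2 \<partial>M) / k" by simp
      also have "\<dots> \<le> D / k" using esq[of n] k by (intro divide_right_mono) auto
      finally have "(\<integral>\<omega>. Xn n \<omega> \<partial>M) - (\<integral>\<omega>. min (Xn n \<omega>) k \<partial>M) \<le> D / k" .
      moreover have "(\<integral>\<omega>. min (Xn n \<omega>) k \<partial>M) \<le> (\<integral>\<omega>. Xn n \<omega> \<partial>M)"
        by (rule integral_mono[OF im i]) simp
      ultimately show ?thesis by linarith
    qed
    then show ?thesis by (intro LIMSEQ_le_const2[OF 2]) auto
  qed
  have 3: "(\<lambda>j. \<integral>\<omega>. min (Z \<omega>) (real (Suc j)) \<partial>M) \<longlonglongrightarrow> (\<integral>\<omega>. Z \<omega> \<partial>M)"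
  proof (rule integral_dominated_convergence[where w="\<lambda>\<omega>. \<bar>Z \<omega>\<bar>"])
    show "AE \<omega> in M. (\<lambda>j. min (Z \<omega>) (real (Suc j))) \<longlonglongrightarrow> Z \<omega>"
    proof (rule AE_I2, rule tendsto_eventually)
      fix \<omega>
      obtain m where "Z \<omega> \<le> real m" using real_arch_simple by blast
      then show "eventually (\<lambda>j. min (Z \<omega>) (real (Suc j)) = Z \<omega>) sequentially"
        by (intro eventually_sequentiallyI[of m]) auto
    qed
    show "AE \<omega> in M. norm (min (Z \<omega>) (real (Suc j))) \<le> \<bar>Z \<omega>\<bar>" for j
      using Z0 by eventually_elim (auto simp: min_def)
  qed (use Z in auto)
  have "(\<lambda>j. \<bar>L - (\<integral>\<omega>. min (Z \<omega>) (real (Suc j)) \<partial>M)\<bar>) \<longlonglongrightarrow> \<bar>L - (\<integral>\<omega>. Z \<omega> \<partial>M)\<bar>"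
    by (intro tendsto_rabs tendsto_diff tendsto_const 3)
  moreover have "(\<lambda>j. D / real (Suc j)) \<longlonglongrightarrow> 0" by real_asymp
  ultimately have "\<bar>L - (\<integral>\<omega>. Z \<omega> \<partial>M)\<bar> \<le> 0"
    by (rule LIMSEQ_le) (intro exI[of _ 0] allI impI k, simp)
  then show ?thesis by simp
qed

text \<open>The square of the integral is a double integral over the plane; the diagonal cuts it
  into two half planes with equal integrals. Counting the diagonal in both leaves an inequality,
  which is all that is needed.\<close>

lemma nn_square_le:
  fixes f :: "real \<Rightarrow> ennreal"
  assumes [measurable]: "f \<in> borel_measurable borel"
  shows "(\<integral>\<^sup>+r. f r \<partial>lborel) * (\<integral>\<^sup>+r. f r \<partial>lborel) \<le> 2 * (\<integral>\<^sup>+r. f r * (\<integral>\<^sup>+u. indicator {r..} u * f u \<partial>lborel) \<partial>lborel)"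
proof -
  let ?A = "\<integral>\<^sup>+r. \<integral>\<^sup>+u. f r * (indicator {r..} u * f u) \<partial>lborel \<partial>lborel"
  have m: "(\<lambda>(r, u). f r * (indicator {r..} u * f u)) \<in> borel_measurable (lborel \<Otimes>\<^sub>M lborel)"
  proof -
    have "(\<lambda>q. f (fst q) * ((if fst q \<le> snd q then 1 else 0) * f (snd q))) \<in> borel_measurable (lborel \<Otimes>\<^sub>M lborel)"
      by measurable
    then show ?thesis by (simp add: split_beta' indicator_def if_distrib cong: if_cong)
  qed
  note [measurable] = m
  have "(\<integral>\<^sup>+r. f r \<partial>lborel) * (\<integral>\<^sup>+r. f r \<partial>lborel) = (\<integral>\<^sup>+r. \<integral>\<^sup>+u. f r * f u \<partial>lborel \<partial>lborel)"
    by (simp add: nn_integral_cmult nn_integral_multc)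
  also have "\<dots> \<le> (\<integral>\<^sup>+r. \<integral>\<^sup>+u. f r * (indicator {r..} u * f u) + f u * (indicator {u..} r * f r) \<partial>lborel \<partial>lborel)"
    by (intro nn_integral_mono) (auto simp: indicator_def mult.commute)
  also have "\<dots> = (\<integral>\<^sup>+r. (\<integral>\<^sup>+u. f r * (indicator {r..} u * f u) \<partial>lborel)
      + (\<integral>\<^sup>+u. f u * (indicator {u..} r * f r) \<partial>lborel) \<partial>lborel)"
  proof (intro nn_integral_cong nn_integral_add)
    fix r
    show "(\<lambda>u. f r * (indicator {r..} u * f u)) \<in> borel_measurable lborel" by measurable
    have "(\<lambda>u. f u * (indicator {..r} u * f r)) \<in> borel_measurable lborel" by measurable
    moreover have "indicator {u..} r = (indicator {..r} u :: ennreal)" for u by (auto simp: indicator_def)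
    ultimately show "(\<lambda>u. f u * (indicator {u..} r * f r)) \<in> borel_measurable lborel" by simp
  qed
  also have "\<dots> = ?A + (\<integral>\<^sup>+r. \<integral>\<^sup>+u. f u * (indicator {u..} r * f r) \<partial>lborel \<partial>lborel)"
  proof (rule nn_integral_add)
    show "(\<lambda>r. \<integral>\<^sup>+u. f r * (indicator {r..} u * f u) \<partial>lborel) \<in> borel_measurable lborel"
      using m by (rule lborel.borel_measurable_nn_integral)
    show "(\<lambda>r. \<integral>\<^sup>+u. f u * (indicator {u..} r * f r) \<partial>lborel) \<in> borel_measurable lborel"
      using measurable_compose[OF measurable_pair_swap' m]
          by (intro lborel.borel_measurable_nn_integral) (simp add: split_beta')
  qed
  also have "(\<integral>\<^sup>+r. \<integral>\<^sup>+u. f u * (indicator {u..} r * f r) \<partial>lborel \<partial>lborel) = ?A"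
    by (rule lborel_pair.Fubini'[OF m])
  also have "?A + ?A = 2 * ?A" by (simp add: mult_2)
  also have "?A = (\<integral>\<^sup>+r. f r * (\<integral>\<^sup>+u. indicator {r..} u * f u \<partial>lborel) \<partial>lborel)"
  proof (intro nn_integral_cong nn_integral_cmult)
    show "(\<lambda>u. indicator {r..} u * f u) \<in> borel_measurable lborel" for r by measurable
  qed
  finally show ?thesis .
qed

context skew_core begin

text \<open>An argument in the manner of Khasminskii. By \<open>nn_square_le\<close> the square is
  at most twice an integral over ordered pairs of times; conditionally on the earlier time
  \<open>r\<close>, the occupation after \<open>r\<close> has mean at most \<open>D\<close>. Hence
  the second moment is at most \<open>2 * D\<close> times the first, which is itself at most
  \<open>D\<close>.\<close>

lemma occ_second_moment:
  assumes e: "0 < e" "e \<le> 1" and t: "0 < t"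
  shows "(\<integral>\<^sup>+\<omega>. ennreal ((occ e 0 t \<omega>)\<^sup>2) \<partial>M) \<le> ennreal (2 * (exp 1 * (1 + (1 / 2 + K) * t))\<^sup>2)"
proof -
  \<comment> \<open>The bound of \<open>conditional_occ_le\<close> with \<open>e\<close> replaced by
    1 and the elapsed time by \<open>t\<close>, so that one constant serves all starting times and
    all \<open>e \<le> 1\<close>.\<close>
  define D where "D = exp 1 * (1 + (1 / 2 + K) * t)"
  have D: "0 \<le> D" using K_nonneg t by (simp add: D_def)
  have occ_le: "(\<integral>\<omega>. indicator G \<omega> * occ e s t \<omega> \<partial>M) \<le> D * prob G" if "0 \<le> s" "s < t" "G \<in> sets (F s)" for s G
  proof -
    have "exp e * (1 + (1 / 2 + K) * (t - s)) \<le> D"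
      unfolding D_def using e K_nonneg that by (intro mult_mono add_mono mult_left_mono) auto
    then show ?thesis
      using conditional_occ_le[OF e(1) that] by (meson measure_nonneg mult_right_mono order_trans)
  qed
  define f where "f r \<omega> = ennreal (indicator {0..t} r * (indicator {-e..e} (Y r \<omega>) / (2 * e)))" for r \<omega>
  have fm: "(\<lambda>q. f (snd q) (fst q)) \<in> borel_measurable (M \<Otimes>\<^sub>M lborel)"
    unfolding f_def using Y_jointl by measurable
  have fm2: "(\<lambda>r. f r \<omega>) \<in> borel_measurable borel" if "\<omega> \<in> space M" for \<omega>
    unfolding f_def using path_meas[OF that] by measurable
  have occ_eq: "(\<integral>\<^sup>+u. indicator {r..} u * f u \<omega> \<partial>lborel) = ennreal (occ e r t \<omega>)"
      if w: "\<omega> \<in> space M" and r: "0 \<le> r" for r \<omega>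
  proof -
    have "(\<integral>\<^sup>+u. indicator {r..} u * f u \<omega> \<partial>lborel) = (\<integral>\<^sup>+u. ennreal
        (indicator {r..t} u *\<^sub>R (indicator {-e..e} (Y u \<omega>) / (2 * e))) \<partial>lborel)"
      using r by (intro nn_integral_cong) (auto simp: f_def indicator_def)
    also have "\<dots> = ennreal (occ e r t \<omega>)"
      unfolding occ_def set_lebesgue_integral_def
    proof (rule nn_integral_eq_integral)
      show "integrable lborel (\<lambda>u. indicator {r..t} u *\<^sub>R (indicator {-e..e} (Y u \<omega>) / (2 * e)))"
        using path_int[OF w, of "\<lambda>z. indicator {-e..e} z / (2 * e)" "1 / (2 * e)" r t] ind_bd[OF e(1)]
        by (auto simp: set_integrable_def)
    qed (use e in \<open>auto simp: indicator_def\<close>)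
    finally show ?thesis .
  qed
  have occ_eq0: "(\<integral>\<^sup>+u. f u \<omega> \<partial>lborel) = ennreal (occ e 0 t \<omega>)" if w: "\<omega> \<in> space M" for \<omega>
  proof -
    have "(\<integral>\<^sup>+u. f u \<omega> \<partial>lborel) = (\<integral>\<^sup>+u. indicator {0..} u * f u \<omega> \<partial>lborel)"
      by (intro nn_integral_cong) (auto simp: f_def indicator_def)
    then show ?thesis using occ_eq[OF w, of 0] by simp
  qed
  interpret P: pair_sigma_finite M lborel ..
  let ?g = "\<lambda>\<omega> r. f r \<omega> * ennreal (occ e r t \<omega>)"
  have XJ: "(\<lambda>q. ennreal (occ e (snd q) t (fst q))) \<in> borel_measurable (M \<Otimes>\<^sub>M lborel)"
  proof -
    have Y3: "(\<lambda>q. Y (snd q) (fst (fst q))) \<in> borel_measurable ((M \<Otimes>\<^sub>M lborel) \<Otimes>\<^sub>M lborel)"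
      using measurable_compose[OF _ Y_jointl, of "\<lambda>q. (fst (fst q), snd q)" "(M \<Otimes>\<^sub>M lborel) \<Otimes>\<^sub>M lborel"] by simp
    have "(\<lambda>q. (if snd (fst q) \<le> snd q \<and> snd q \<le> t then 1 else 0) *\<^sub>R
        (indicator {-e..e} (Y (snd q) (fst (fst q))) / (2
        * e) :: real)) \<in> borel_measurable ((M \<Otimes>\<^sub>M lborel) \<Otimes>\<^sub>M lborel)"
      using Y3 by measurable
    also have "(\<lambda>q. (if snd (fst q) \<le> snd q \<and> snd q \<le> t then 1 else 0) *\<^sub>R
        (indicator {-e..e} (Y (snd q) (fst (fst q))) / (2 * e) :: real))
       = (\<lambda>(q, u). indicator {snd q..t} u *\<^sub>R (indicator {-e..e} (Y u (fst q)) / (2 * e)))"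
      by (auto simp: fun_eq_iff indicator_def)
    finally have "(\<lambda>(q, u). indicator {snd q..t} u *\<^sub>R (indicator {-e..e} (Y u (fst q)) / (2
        * e) :: real)) \<in> borel_measurable ((M \<Otimes>\<^sub>M lborel) \<Otimes>\<^sub>M lborel)" .
    from lborel.borel_measurable_lebesgue_integral[OF this] show ?thesis
      unfolding occ_def set_lebesgue_integral_def by measurable
  qed
  have gm: "(\<lambda>(\<omega>, r). ?g \<omega> r) \<in> borel_measurable (M \<Otimes>\<^sub>M lborel)"
    using fm XJ unfolding split_beta' by measurable
  have "(\<integral>\<^sup>+\<omega>. ennreal ((occ e 0 t \<omega>)\<^sup>2) \<partial>M) \<le> (\<integral>\<^sup>+\<omega>. 2 * (\<integral>\<^sup>+r. ?g \<omega> r \<partial>lborel) \<partial>M)"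
  proof (rule nn_integral_mono)
    fix \<omega> assume w: "\<omega> \<in> space M"
    have "ennreal ((occ e 0 t \<omega>)\<^sup>2) = ennreal (occ e 0 t \<omega>) * ennreal (occ e 0 t \<omega>)"
      using occ_nonneg[OF e(1)] by (simp add: power2_eq_square ennreal_mult)
    also have "\<dots> \<le> 2 * (\<integral>\<^sup>+r. f r \<omega> * (\<integral>\<^sup>+u. indicator {r..} u * f u \<omega> \<partial>lborel) \<partial>lborel)"
      using nn_square_le[OF fm2[OF w]] occ_eq0[OF w] by simp
    also have "(\<integral>\<^sup>+r. f r \<omega> * (\<integral>\<^sup>+u. indicator {r..} u * f u \<omega> \<partial>lborel) \<partial>lborel) = (\<integral>\<^sup>+r. ?g \<omega> r \<partial>lborel)"
    proof (rule nn_integral_cong)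
      fix r
      show "f r \<omega> * (\<integral>\<^sup>+u. indicator {r..} u * f u \<omega> \<partial>lborel) = ?g \<omega> r"
        using occ_eq[OF w, of r] by (cases "0 \<le> r") (auto simp: f_def)
    qed
    finally show "ennreal ((occ e 0 t \<omega>)\<^sup>2) \<le> 2 * (\<integral>\<^sup>+r. ?g \<omega> r \<partial>lborel)" .
  qed
  also have "\<dots> = 2 * (\<integral>\<^sup>+\<omega>. (\<integral>\<^sup>+r. ?g \<omega> r \<partial>lborel) \<partial>M)"
    by (rule nn_integral_cmult) (rule lborel.borel_measurable_nn_integral[OF gm])
  also have "(\<integral>\<^sup>+\<omega>. (\<integral>\<^sup>+r. ?g \<omega> r \<partial>lborel) \<partial>M) = (\<integral>\<^sup>+r. (\<integral>\<^sup>+\<omega>. ?g \<omega> r \<partial>M) \<partial>lborel)"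
    by (rule P.Fubini'[OF gm, symmetric])
  also have "\<dots> \<le> (\<integral>\<^sup>+r. ennreal D * (\<integral>\<^sup>+\<omega>. f r \<omega> \<partial>M) \<partial>lborel)"
  proof (rule nn_integral_mono_AE)
    show "AE r in lborel. (\<integral>\<^sup>+\<omega>. ?g \<omega> r \<partial>M) \<le> ennreal D * (\<integral>\<^sup>+\<omega>. f r \<omega> \<partial>M)"
      using AE_lborel_singleton[of t]
    proof eventually_elim
      case (elim r)
      show ?case
      proof (cases "0 \<le> r \<and> r < t")
        case False
        then show ?thesis using elim by (auto simp: f_def indicator_def)
      next
        case True
        \<comment> \<open>The event that \<open>Y r\<close> is in the window belongs to
          \<open>F r\<close>, so the conditional bound applies to the occupation after
          \<open>r\<close>.\<close>
        define G where "G = Y r -` {-e..e} \<inter> space M"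
        have GF: "G \<in> sets (F r)"
          using measurable_sets[OF Y_F[of r], of "{-e..e}"] True by (simp add: G_def space_F)
        have GM[measurable]: "G \<in> sets M" using F_sets[OF _ GF] True by simp
        have fr: "f r \<omega> = ennreal (indicator G \<omega> / (2 * e))" if "\<omega> \<in> space M" for \<omega>
          using True that by (auto simp: f_def G_def indicator_def)
        have iG: "integrable M (\<lambda>\<omega>. indicator G \<omega> / (2 * e) * occ e r t \<omega>)"
        proof (rule E_bound(1)[of _ "1 / (2 * e) * (1 / (2 * e) * (t - r))"])
          show "\<bar>indicator G \<omega> / (2 * e) * occ e r t \<omega>\<bar> \<le> 1 / (2 * e) * (1 / (2 * e) * (t - r))" for \<omega>
            unfolding abs_mult using occ_bounds[OF e(1), of r t \<omega>] True e
                by (intro mult_mono) (auto simp: indicator_def)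
        qed measurable
        have "(\<integral>\<^sup>+\<omega>. ?g \<omega> r \<partial>M) = (\<integral>\<^sup>+\<omega>. ennreal (indicator G \<omega> / (2 * e) * occ e r t \<omega>) \<partial>M)"
          using occ_nonneg[OF e(1)] e by (intro nn_integral_cong) (simp add: fr ennreal_mult[symmetric])
        also have "\<dots> = ennreal (\<integral>\<omega>. indicator G \<omega> / (2 * e) * occ e r t \<omega> \<partial>M)"
          using iG occ_nonneg[OF e(1)] e by (intro nn_integral_eq_integral) auto
        also have "(\<integral>\<omega>. indicator G \<omega> / (2 * e) * occ e r t \<omega> \<partial>M) = (\<integral>\<omega>. indicator G \<omega> * occ e r t \<omega> \<partial>M) / (2 * e)"
          by (subst integral_divide_zero[symmetric]) (auto intro!: Bochner_Integration.integral_cong)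
        also have "\<dots> \<le> D * (prob G / (2 * e))"
          using occ_le[of r G] True GF e by (simp add: divide_right_mono)
        also have "ennreal (D * (prob G / (2 * e))) = ennreal D * ennreal (prob G / (2 * e))"
          using D e by (intro ennreal_mult) auto
        also have "ennreal (prob G / (2 * e)) = (\<integral>\<^sup>+\<omega>. f r \<omega> \<partial>M)"
        proof -
          have "(\<integral>\<^sup>+\<omega>. f r \<omega> \<partial>M) = (\<integral>\<^sup>+\<omega>. ennreal (1 / (2 * e)) * indicator G \<omega> \<partial>M)"
            using fr by (intro nn_integral_cong) (auto simp: indicator_def)
          also have "\<dots> = ennreal (1 / (2 * e)) * ennreal (prob G)"
            by (simp add: nn_integral_cmult emeasure_eq_measure)
          also have "\<dots> = ennreal (prob G / (2 * e))"
            using e by (subst ennreal_mult[symmetric]) auto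
          finally show ?thesis by simp
        qed
        finally show ?thesis by (simp add: ennreal_leI)
      qed
    qed
  qed
  also have "\<dots> = ennreal D * (\<integral>\<^sup>+r. (\<integral>\<^sup>+\<omega>. f r \<omega> \<partial>M) \<partial>lborel)"
  proof (rule nn_integral_cmult)
    have "(\<lambda>(r, \<omega>). f r \<omega>) \<in> borel_measurable (lborel \<Otimes>\<^sub>M M)"
      using measurable_compose[OF measurable_pair_swap' fm] by (simp add: split_beta')
    then show "(\<lambda>r. \<integral>\<^sup>+\<omega>. f r \<omega> \<partial>M) \<in> borel_measurable lborel" by (rule borel_measurable_nn_integral)
  qed
  also have "(\<integral>\<^sup>+r. (\<integral>\<^sup>+\<omega>. f r \<omega> \<partial>M) \<partial>lborel) = (\<integral>\<^sup>+\<omega>. (\<integral>\<^sup>+r. f r \<omega> \<partial>lborel) \<partial>M)"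
    by (rule P.Fubini') (use fm in \<open>simp add: split_beta'\<close>)
  also have "\<dots> = (\<integral>\<^sup>+\<omega>. ennreal (occ e 0 t \<omega>) \<partial>M)" using occ_eq0 by (intro nn_integral_cong) auto
  also have "\<dots> = ennreal (\<integral>\<omega>. occ e 0 t \<omega> \<partial>M)"
  proof (rule nn_integral_eq_integral)
    show "integrable M (occ e 0 t)" by (rule E_bound(1)[OF occ_bounds[OF e(1)]]) (use t in auto)
  qed (simp add: occ_nonneg[OF e(1)])
  also have "\<dots> \<le> ennreal D"
    by (rule ennreal_leI) (use occ_le[OF order_refl t space_in_F] in \<open>simp add: int_ind_space prob_space\<close>)
  finally have "(\<integral>\<^sup>+\<omega>. ennreal ((occ e 0 t \<omega>)\<^sup>2) \<partial>M) \<le> 2 * (ennreal D * ennreal D)"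
    by (simp add: mult_left_mono)
  also have "\<dots> = ennreal (2 * D\<^sup>2)"
    using D by (simp add: ennreal_mult power2_eq_square)
  finally show ?thesis by (simp add: D_def)
qed

text \<open>Divided by \<open>2 * p - 1\<close>, the corrector is the almost sure limit of the
  normalised occupation times, and the second moment bound lets means converge along. For
  \<open>p = 1/2\<close> the division is impossible, but then the corrector vanishes almost
  surely.\<close>

lemma E_W: assumes t: "0 \<le> t" shows "(\<integral>\<omega>. W t \<omega> \<partial>M) = (2 * p - 1) * mean_local_time t"
proof (cases "t = 0 \<or> 2 * p - 1 = 0")
  case True
  then show ?thesis
  proof
    assume "t = 0"
    moreover have "mean_local_time 0 = 0"
    proof -
      have z: "(LBINT r:{0}. f r) = 0" for f :: "real \<Rightarrow> real"
        unfolding set_lebesgue_integral_def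
        by (rule integral_eq_zero_AE) (use AE_lborel_singleton[of 0] in \<open>eventually_elim, auto simp: indicator_def\<close>)
      show ?thesis by (simp add: mean_local_time_def z)
    qed
    ultimately show ?thesis by (simp add: W_0)
  next
    assume p: "2 * p - 1 = 0"
    have "AE \<omega> in M. W t \<omega> = 0"
      using W_local[OF t] unfolding p
    proof eventually_elim
      case (elim \<omega>)
      then have "((\<lambda>\<epsilon>. 0) \<longlongrightarrow> W t \<omega>) (at_right (0::real))" by simp
      then show ?case by (simp add: tendsto_const_iff)
    qed
    then show ?thesis unfolding p using integral_eq_zero_AE by simp
  qed
next
  case False
  define c where "c = 2 * p - 1"
  have c: "c \<noteq> 0" using False by (simp add: c_def)
  have t: "0 < t" using t False by simp
  have p: "eps n > 0" "eps n \<le> 1" for n by auto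
  have "(\<integral>\<omega>. W t \<omega> / c \<partial>M) = mean_local_time t"
  proof (rule limit_mean_of_bounded_second_moment)
    show "integrable M (occ (eps n) 0 t)" for n
      by (rule E_bound(1)[OF occ_bounds[OF p(1)]]) (use t in auto)
    show "0 \<le> occ (eps n) 0 t \<omega>" for n \<omega> by (rule occ_nonneg[OF p(1)])
    show "(\<integral>\<^sup>+\<omega>. ennreal ((occ (eps n) 0 t \<omega>)\<^sup>2) \<partial>M) \<le> ennreal (2 * (exp 1 * (1 + (1 / 2 + K) * t))\<^sup>2)" for n
      by (rule occ_second_moment[OF p t])
    show "(\<lambda>n. \<integral>\<omega>. occ (eps n) 0 t \<omega> \<partial>M) \<longlonglongrightarrow> mean_local_time t" using occ_lim[of t] t by simp
    show "integrable M (\<lambda>\<omega>. W t \<omega> / c)" using W_integrable[of t] t by simp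
    have eps_r: "filterlim eps (at_right 0) sequentially"
      using eps_lim by (auto simp: filterlim_at)
    show "AE \<omega> in M. (\<lambda>n. occ (eps n) 0 t \<omega>) \<longlonglongrightarrow> W t \<omega> / c"
      using W_local[OF less_imp_le[OF t]]
    proof eventually_elim
      case (elim \<omega>)
      have "(\<lambda>n. c * (1 / (2 * eps n) * (LBINT s:{0..t}. indicator {-(eps n)..eps n} (Y s \<omega>)))) \<longlonglongrightarrow> W t \<omega>"
        using filterlim_compose[OF elim eps_r] by (simp only: c_def)
      moreover have "1 / (2 * eps n) * (LBINT s:{0..t}. indicator {-(eps n)..eps n} (Y s \<omega>))
          = occ (eps n) 0 t \<omega>" for n
      proof -
        have "occ (eps n) 0 t \<omega> = (LBINT s:{0..t}. 1 / (2 * eps n) * indicator {-(eps n)..eps n} (Y s \<omega>))"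
          unfolding occ_def by (intro set_lebesgue_integral_cong) auto
        then show ?thesis by (simp only: set_integral_mult_right)
      qed
      ultimately have "(\<lambda>n. c * occ (eps n) 0 t \<omega>) \<longlonglongrightarrow> W t \<omega>" by (simp only:)
      then have "(\<lambda>n. c * occ (eps n) 0 t \<omega> / c) \<longlonglongrightarrow> W t \<omega> / c" by (intro tendsto_divide tendsto_const c)
      then show ?case using c by simp
    qed
  qed auto
  then have "(\<integral>\<omega>. W t \<omega> \<partial>M) / c = mean_local_time t" by simp
  then show ?thesis using c by (simp add: c_def field_simps)
qed

end

section \<open>Supersolutions with a transmission condition\<close>

definition glue :: "(real \<Rightarrow> real) \<Rightarrow> (real \<Rightarrow> real) \<Rightarrow> real \<Rightarrow> real" where
  "glue f g z = (if 0 \<le> z then f z else g z)"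

definition C2_on :: "real \<Rightarrow> real set \<Rightarrow> (real \<Rightarrow> real) \<Rightarrow> (real \<Rightarrow> real) \<Rightarrow> (real \<Rightarrow> real) \<Rightarrow> bool" where
  "C2_on C S f f1 f2 \<longleftrightarrow> (\<forall>z. (f has_real_derivative f1 z) (at z)) \<and> (\<forall>z. (f1 has_real_derivative f2 z) (at z)) \<and>
     continuous_on UNIV f2 \<and> (\<forall>z\<in>S. \<bar>f z\<bar> \<le> C \<and> \<bar>f1 z\<bar> \<le> C \<and> \<bar>f2 z\<bar> \<le> C)"

lemma C2_onD:
  assumes "C2_on C S f f1 f2"
  shows "(f has_real_derivative f1 z) (at z)" "(f1 has_real_derivative f2 z) (at z)" "continuous_on UNIV f2"
    "z \<in> S \<Longrightarrow> \<bar>f z\<bar> \<le> C" "z \<in> S \<Longrightarrow> \<bar>f1 z\<bar> \<le> C" "z \<in> S \<Longrightarrow> \<bar>f2 z\<bar> \<le> C"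
    "continuous_on UNIV f" "continuous_on UNIV f1"
  using assms unfolding C2_on_def by (auto intro: DERIV_isCont continuous_at_imp_continuous_on)

lemma glue_cong_ev:
  "0 < z \<Longrightarrow> eventually (\<lambda>w. f w = glue f g w) (nhds z)"
  "z < 0 \<Longrightarrow> eventually (\<lambda>w. g w = glue f g w) (nhds z)"
  using eventually_nhds_in_open[of "{0<..}" z] eventually_nhds_in_open[of "{..<0}" z]
  by (auto simp: glue_def elim!: eventually_mono)

lemma glue_cont: assumes "continuous_on UNIV f" "continuous_on UNIV g" "f 0 = g 0"
  shows "continuous_on UNIV (glue f g)"
proof -
  have "continuous_on ({0..} \<union> {..0}) (\<lambda>z. if 0 \<le> z then f z else g z)"
    by (rule continuous_on_If) (use assms in \<open>auto intro: continuous_on_subset\<close>)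
  moreover have "{0..} \<union> {..0} = (UNIV :: real set)" by auto
  ultimately show ?thesis by (simp add: glue_def[abs_def])
qed

lemma glue_deriv_nz:
  assumes "\<And>z. (f has_real_derivative f1 z) (at z)" "\<And>z. (g has_real_derivative g1 z) (at z)" "z \<noteq> 0"
  shows "(glue f g has_real_derivative glue f1 g1 z) (at z)"
proof (cases "0 < z")
  case True
  then have "glue f1 g1 z = f1 z" by (simp add: glue_def)
  then show ?thesis using iffD1[OF DERIV_cong_ev[OF refl glue_cong_ev(1)[OF True, of f g] refl] assms(1)] by simp
next
  case False
  then have z: "z < 0" using assms by simp
  then have "glue f1 g1 z = g1 z" by (simp add: glue_def)
  then show ?thesis using iffD1[OF DERIV_cong_ev[OF refl glue_cong_ev(2)[OF z, of g f] refl] assms(2)] by simp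
qed

lemma glue_deriv:
  assumes f: "\<And>z. (f has_real_derivative f1 z) (at z)" and g: "\<And>z. (g has_real_derivative g1 z) (at z)"
    and 0: "f 0 = g 0" "f1 0 = g1 0"
  shows "(glue f g has_real_derivative glue f1 g1 z) (at z)"
proof (cases "z = 0")
  case True
  have "((\<lambda>h. (glue f g (0 + h) - glue f g 0) / h) \<longlongrightarrow> f1 0) (at 0)"
  proof (rule filterlim_split_at)
    have "((\<lambda>h. (g (0 + h) - g 0) / h) \<longlongrightarrow> f1 0) (at_left 0)"
      using g[of 0] unfolding DERIV_def 0 by (rule filterlim_mono) (auto simp: at_within_le_at)
    then show "((\<lambda>h. (glue f g (0 + h) - glue f g 0) / h) \<longlongrightarrow> f1 0) (at_left 0)"
      by (rule Lim_transform_eventually) (auto simp: eventually_at_filter glue_def 0 intro!: always_eventually)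
    have "((\<lambda>h. (f (0 + h) - f 0) / h) \<longlongrightarrow> f1 0) (at_right 0)"
      using f[of 0] unfolding DERIV_def by (rule filterlim_mono) (auto simp: at_within_le_at)
    then show "((\<lambda>h. (glue f g (0 + h) - glue f g 0) / h) \<longlongrightarrow> f1 0) (at_right 0)"
      by (rule Lim_transform_eventually) (auto simp: eventually_at_filter glue_def intro!: always_eventually)
  qed
  then show ?thesis using True by (simp add: DERIV_def glue_def)
qed (rule glue_deriv_nz[OF f g])

lemma glue_bound:
  assumes "\<And>z. z \<ge> 0 \<Longrightarrow> \<bar>f z\<bar> \<le> C" "\<And>z. z \<le> 0 \<Longrightarrow> \<bar>g z\<bar> \<le> C"
  shows "\<bar>glue f g z\<bar> \<le> C"
  using assms by (auto simp: glue_def)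

lemma glue_meas:
  assumes "continuous_on UNIV f" "continuous_on UNIV g"
  shows "glue f g \<in> borel_measurable borel"
  using assms[THEN borel_measurable_continuous_onI] unfolding glue_def[abs_def] by measurable

lemma glue_C11:
  assumes f: "C2_on C {0..} f f1 f2" and g: "C2_on C {..0} g g1 g2" and 0: "f 0 = g 0" "f1 0 = g1 0"
  shows "C11 {0} (glue f g) (glue f1 g1) (glue f2 g2) C"
proof (rule C11I)
  note F = C2_onD[OF f] and G = C2_onD[OF g]
  show "\<bar>glue f g z\<bar> \<le> C" "\<bar>glue f1 g1 z\<bar> \<le> C" "\<bar>glue f2 g2 z\<bar> \<le> C" for z
    by (rule glue_bound; use F G in auto)+
  show "(glue f g has_real_derivative glue f1 g1 z) (at z)" for z by (rule glue_deriv[OF F(1) G(1) 0])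
  show "continuous_on UNIV (glue f1 g1)" by (rule glue_cont[OF F(8) G(8) 0(2)])
  show "(glue f1 g1 has_real_derivative glue f2 g2 z) (at z)" if "z \<notin> {0}" for z
    using that by (intro glue_deriv_nz F G) auto
  show "isCont (glue f2 g2) z" if "z \<notin> {0}" for z
  proof -
    have "isCont f2 z" "isCont g2 z" using F(3) G(3) by (auto simp: continuous_on_eq_continuous_at)
    then show ?thesis
      using isCont_cong[OF glue_cong_ev(1)[of z f2 g2]] isCont_cong[OF glue_cong_ev(2)[of z g2 f2]] that
          by (cases "0 < z") auto
  qed
  show "glue f2 g2 \<in> borel_measurable borel" by (rule glue_meas[OF F(3) G(3)])
qed simp

section \<open>Ito's formula for functions with a kink at 0\<close>

context skew_core begin

text \<open>A multiple of \<open>1 - exp (- \<bar>z\<bar>)\<close> removes the kink. The remainder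
  falls under \<open>ito\<close>, with the mean of the corrector given by \<open>E_W\<close>; for
  the removed function the formula holds by the definition of
  \<open>mean_local_time\<close>.\<close>

lemma kink_ito:
  assumes st: "0 \<le> s" "s < t" and f: "C2_on C {0..} f f1 f2" and g: "C2_on C {..0} g g1 g2" and fg: "f 0 = g 0"
  shows "(\<integral>\<omega>. glue f g (Y t \<omega>) \<partial>M) - (\<integral>\<omega>. glue f g (Y s \<omega>) \<partial>M) =
     (\<integral>\<omega>. (LBINT r:{s..t}. glue f2 g2 (Y r \<omega>) / 2 + glue f1 g1 (Y r \<omega>) * b (Y r \<omega>)) \<partial>M)
     + (p * f1 0 - (1 - p) * g1 0) * (mean_local_time t - mean_local_time s)"
proof -
  note F = C2_onD[OF f] and G = C2_onD[OF g]
  \<comment> \<open>Half the jump of the slope, since \<open>1 - exp (- \<bar>z\<bar>)\<close> has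
    one-sided slopes 1 and -1 at 0.\<close>
  define k where "k = (f1 0 - g1 0) / 2"
  define C' where "C' = C + \<bar>k\<bar>"
  have C: "0 \<le> C" using F(4)[of 0] by simp
  have C': "0 \<le> C'" using C by (simp add: C'_def)
  let ?u = "\<lambda>z. f z - k * (1 - exp (- z))" and ?u1 = "\<lambda>z. f1 z - k * exp (- z)" and ?u2 = "\<lambda>z. f2 z + k * exp (- z)"
  let ?v = "\<lambda>z. g z - k * (1 - exp z)" and ?v1 = "\<lambda>z. g1 z + k * exp z" and ?v2 = "\<lambda>z. g2 z + k * exp z"
  have kb: "\<bar>k * c\<bar> \<le> \<bar>k\<bar>" if "0 \<le> c" "c \<le> 1" for c
    using mult_left_mono[of c 1 "\<bar>k\<bar>"] that by (simp add: abs_mult)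
  have pu: "C2_on C' {0..} ?u ?u1 ?u2"
    unfolding C2_on_def
  proof (intro conjI allI ballI)
    fix z :: real
    show "(?u has_real_derivative ?u1 z) (at z)" by (auto intro!: derivative_eq_intros F(1))
    show "(?u1 has_real_derivative ?u2 z) (at z)" by (auto intro!: derivative_eq_intros F(2))
    show "continuous_on UNIV ?u2" by (intro continuous_intros F(3))
    assume z: "z \<in> {0..}"
    show "\<bar>?u z\<bar> \<le> C'" using F(4)[OF z] kb[of "1 - exp (- z)"] z unfolding C'_def by (simp; linarith)
    show "\<bar>?u1 z\<bar> \<le> C'" using F(5)[OF z] kb[of "exp (- z)"] z unfolding C'_def by (simp; linarith)
    show "\<bar>?u2 z\<bar> \<le> C'" using F(6)[OF z] kb[of "exp (- z)"] z unfolding C'_def by (simp; linarith)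
  qed
  have pv: "C2_on C' {..0} ?v ?v1 ?v2"
    unfolding C2_on_def
  proof (intro conjI allI ballI)
    fix z :: real
    show "(?v has_real_derivative ?v1 z) (at z)" by (auto intro!: derivative_eq_intros G(1))
    show "(?v1 has_real_derivative ?v2 z) (at z)" by (auto intro!: derivative_eq_intros G(2))
    show "continuous_on UNIV ?v2" by (intro continuous_intros G(3))
    assume z: "z \<in> {..0}"
    show "\<bar>?v z\<bar> \<le> C'" using G(4)[OF z] kb[of "1 - exp z"] z unfolding C'_def by (simp; linarith)
    show "\<bar>?v1 z\<bar> \<le> C'" using G(5)[OF z] kb[of "exp z"] z unfolding C'_def by (simp; linarith)
    show "\<bar>?v2 z\<bar> \<le> C'" using G(6)[OF z] kb[of "exp z"] z unfolding C'_def by (simp; linarith)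
  qed
  have n: "C11 {0} (glue ?u ?v) (glue ?u1 ?v1) (glue ?u2 ?v2) C'"
    by (rule glue_C11[OF pu pv]) (auto simp: fg k_def field_simps)
  have t: "0 \<le> t" using st by simp
  note [measurable] = C11_measurable[OF n] C11D(6)[OF n] b_meas glue_meas[OF F(7) G(7)] glue_meas[OF F(8) G(8)]
      glue_meas[OF F(3) G(3)]
  have u0: "glue ?u1 ?v1 0 = (f1 0 + g1 0) / 2" by (simp add: glue_def k_def field_simps)
  have dec: "glue f g z = glue ?u ?v z + k * (1 - exp (- \<bar>z\<bar>))" for z by (auto simp: glue_def)
  have dec2: "glue f2 g2 z / 2 + glue f1 g1 z * b z = glue ?u2 ?v2 z / 2 + glue ?u1 ?v1 z * b z
      - k * limit_gen z" for z
    by (auto simp: glue_def limit_gen_def rsgn_def field_simps)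
  have iu: "integrable M (\<lambda>\<omega>. glue ?u ?v (Y r \<omega>))" for r
    by (rule E_bound(1)[OF C11D(2)[OF n]]) measurable
  have ie: "integrable M (\<lambda>\<omega>. 1 - exp (- \<bar>Y r \<omega>\<bar>))" for r
    by (rule E_bound(1)[of _ 1]) auto
  have Eg: "(\<integral>\<omega>. glue f g (Y r \<omega>) \<partial>M) = (\<integral>\<omega>. glue ?u ?v (Y r \<omega>) \<partial>M) + k * (\<integral>\<omega>. 1 - exp (- \<bar>Y r \<omega>\<bar>) \<partial>M)" for r
    unfolding dec using iu[of r] ie[of r] by simp
  have u1b: "\<bar>glue ?u1 ?v1 z * b z\<bar> \<le> C' * K" for z
    unfolding abs_mult by (intro mult_mono C11D(4)[OF n] b_bd C') auto
  have u2b: "\<bar>glue ?u2 ?v2 z / 2\<bar> \<le> C'" for z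
    using C11D(7)[OF n, of z] C' by linarith
  have iI: "integrable M (\<lambda>\<omega>. LBINT r:{s..t}. F (Y r \<omega>))"
      if "\<And>z. \<bar>F z\<bar> \<le> c" "F \<in> borel_measurable borel" for F and c :: real and s t
  proof (cases "s \<le> t")
    case True
    show ?thesis by (rule E_bound(1)[OF set_lint_bound[OF True]]) (use that int_meas[OF that(2)] in auto)
  qed (simp add: set_lebesgue_integral_def)
  have L: "mean_local_time t - mean_local_time s = (\<integral>\<omega>. 1 - exp (- \<bar>Y t \<omega>\<bar>) \<partial>M) - (\<integral>\<omega>. 1 - exp (- \<bar>Y s \<omega>\<bar>) \<partial>M)
      + (\<integral>\<omega>. (LBINT r:{s..t}. limit_gen (Y r \<omega>)) \<partial>M)"
  proof -
    have "(\<integral>\<omega>. (LBINT r:{0..t}. limit_gen (Y r \<omega>)) \<partial>M) = (\<integral>\<omega>. (LBINT r:{0..s}. limit_gen (Y r \<omega>))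
        + (LBINT r:{s..t}. limit_gen (Y r \<omega>)) \<partial>M)"
    proof (rule Bochner_Integration.integral_cong[OF refl])
      fix \<omega> assume w: "\<omega> \<in> space M"
      show "(LBINT r:{0..t}. limit_gen (Y r \<omega>)) = (LBINT r:{0..s}. limit_gen (Y r \<omega>))
          + (LBINT r:{s..t}. limit_gen (Y r \<omega>))"
        by (rule set_lint_split[of _ "1 / 2 + K"]) (use st limit_gen_bound
            measurable_compose[OF path_meas[OF w] limit_gen_meas] in auto)
    qed
    also have "\<dots> = (\<integral>\<omega>. (LBINT r:{0..s}. limit_gen (Y r \<omega>)) \<partial>M) + (\<integral>\<omega>. (LBINT r:{s..t}. limit_gen (Y r \<omega>)) \<partial>M)"
      by (rule Bochner_Integration.integral_add; rule iI[OF limit_gen_bound limit_gen_meas])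
    finally show ?thesis by (simp add: mean_local_time_def)
  qed
  have I: "(\<integral>\<omega>. (LBINT r:{s..t}. glue f2 g2 (Y r \<omega>) / 2 + glue f1 g1 (Y r \<omega>) * b (Y r \<omega>)) \<partial>M)
    = (\<integral>\<omega>. (LBINT r:{s..t}. glue ?u2 ?v2 (Y r \<omega>) / 2) \<partial>M)
        + (\<integral>\<omega>. (LBINT r:{s..t}. glue ?u1 ?v1 (Y r \<omega>) * b (Y r \<omega>)) \<partial>M)
      - k * (\<integral>\<omega>. (LBINT r:{s..t}. limit_gen (Y r \<omega>)) \<partial>M)"
  proof -
    have "(\<integral>\<omega>. (LBINT r:{s..t}. glue f2 g2 (Y r \<omega>) / 2 + glue f1 g1 (Y r \<omega>) * b (Y r \<omega>)) \<partial>M)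
      = (\<integral>\<omega>. (LBINT r:{s..t}. glue ?u2 ?v2 (Y r \<omega>) / 2) + (LBINT r:{s..t}. glue ?u1 ?v1 (Y r \<omega>) * b (Y r \<omega>))
          - k * (LBINT r:{s..t}. limit_gen (Y r \<omega>)) \<partial>M)"
    proof (rule Bochner_Integration.integral_cong[OF refl])
      fix \<omega> assume w: "\<omega> \<in> space M"
      have i1: "set_integrable lborel {s..t} (\<lambda>r. glue ?u2 ?v2 (Y r \<omega>) / 2)"
        by (rule path_int[OF w _ u2b]) measurable
      have i2: "set_integrable lborel {s..t} (\<lambda>r. glue ?u1 ?v1 (Y r \<omega>) * b (Y r \<omega>))"
        by (rule path_int[OF w _ u1b]) measurable
      have i3: "set_integrable lborel {s..t} (\<lambda>r. k * limit_gen (Y r \<omega>))"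
        using path_int[OF w limit_gen_meas limit_gen_bound] by (intro set_integrable_mult_right) auto
      show "(LBINT r:{s..t}. glue f2 g2 (Y r \<omega>) / 2 + glue f1 g1 (Y r \<omega>) * b (Y r \<omega>)) =
        (LBINT r:{s..t}. glue ?u2 ?v2 (Y r \<omega>) / 2) + (LBINT r:{s..t}. glue ?u1 ?v1 (Y r \<omega>) * b (Y r \<omega>))
            - k * (LBINT r:{s..t}. limit_gen (Y r \<omega>))"
        unfolding dec2 set_integral_diff(2)[OF set_integral_add(1)[OF i1 i2] i3] set_integral_add(2)[OF i1 i2] by simp
    qed
    also have "\<dots> = (\<integral>\<omega>. (LBINT r:{s..t}. glue ?u2 ?v2 (Y r \<omega>) / 2) \<partial>M)
        + (\<integral>\<omega>. (LBINT r:{s..t}. glue ?u1 ?v1 (Y r \<omega>) * b (Y r \<omega>)) \<partial>M)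
      - k * (\<integral>\<omega>. (LBINT r:{s..t}. limit_gen (Y r \<omega>)) \<partial>M)"
    proof -
      have a: "integrable M (\<lambda>\<omega>. LBINT r:{s..t}. glue ?u2 ?v2 (Y r \<omega>) / 2)" by (rule iI[OF u2b]) measurable
      have c: "integrable M (\<lambda>\<omega>. LBINT r:{s..t}. glue ?u1 ?v1 (Y r \<omega>) * b (Y r \<omega>))" by (rule iI[OF u1b]) measurable
      have d: "integrable M (\<lambda>\<omega>. k * (LBINT r:{s..t}. limit_gen (Y r \<omega>)))"
          using iI[OF limit_gen_bound limit_gen_meas] by simp
      show ?thesis
        unfolding Bochner_Integration.integral_diff[OF Bochner_Integration.integrable_add[OF a c] d]
            Bochner_Integration.integral_add[OF a c] by simp
    qed
    finally show ?thesis .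
  qed
  have W: "(\<integral>\<omega>. W t \<omega> - W s \<omega> \<partial>M) = (2 * p - 1) * (mean_local_time t - mean_local_time s)"
    using E_W[OF t] E_W[OF st(1)] W_integrable[OF t] W_integrable[OF st(1)] by (simp add: algebra_simps)
  have It: "(\<integral>\<omega>. glue ?u ?v (Y t \<omega>) \<partial>M) - (\<integral>\<omega>. glue ?u ?v (Y s \<omega>) \<partial>M) =
     (\<integral>\<omega>. (LBINT r:{s..t}. glue ?u2 ?v2 (Y r \<omega>) / 2) \<partial>M) + (\<integral>\<omega>. (LBINT r:{s..t}. glue ?u1 ?v1 (Y r \<omega>) * b (Y r \<omega>)) \<partial>M)
     + glue ?u1 ?v1 0 * ((2 * p - 1) * (mean_local_time t - mean_local_time s))"
    using ito[OF st space_in_F n] unfolding int_ind_space W using iu by simp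
  have "(\<integral>\<omega>. glue f g (Y t \<omega>) \<partial>M) - (\<integral>\<omega>. glue f g (Y s \<omega>) \<partial>M)
     = ((\<integral>\<omega>. glue ?u ?v (Y t \<omega>) \<partial>M) - (\<integral>\<omega>. glue ?u ?v (Y s \<omega>) \<partial>M))
       + k * ((mean_local_time t - mean_local_time s) - (\<integral>\<omega>. (LBINT r:{s..t}. limit_gen (Y r \<omega>)) \<partial>M))"
    unfolding Eg L by (simp add: algebra_simps)
  also have "\<dots> = (\<integral>\<omega>. (LBINT r:{s..t}. glue f2 g2 (Y r \<omega>) / 2 + glue f1 g1 (Y r \<omega>) * b (Y r \<omega>)) \<partial>M)
       + (glue ?u1 ?v1 0 * (2 * p - 1) + k) * (mean_local_time t - mean_local_time s)"
    unfolding It I by (simp add: algebra_simps)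
  \<comment> \<open>The corrector contributes \<open>2 * p - 1\<close> times the mean slope, the
    removed function half the jump; together the one-sided slopes receive the weights
    \<open>p\<close> and \<open>1 - p\<close> of the transmission condition.\<close>
  also have "glue ?u1 ?v1 0 * (2 * p - 1) + k = p * f1 0 - (1 - p) * g1 0"
    unfolding u0 by (simp add: k_def field_simps)
  finally show ?thesis .
qed

end

text \<open>The variable \<open>s\<close> runs forward along the process, so the inequality is that
  of a supermartingale while the process stays in the half line. \<open>S\<close> is the open and
  \<open>S'\<close> the closed half line: the differential inequality is asked off the kink, while
  regularity and bounds reach up to it.\<close>

definition half_super :: "real \<Rightarrow> real set \<Rightarrow> real set \<Rightarrow> real \<Rightarrow> real \<Rightarrow> (real \<Rightarrow> real \<Rightarrow> real) \<Rightarrow> (real \<Rightarrow> real \<Rightarrow> real) \<Rightarrow>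
    (real \<Rightarrow> real \<Rightarrow> real) \<Rightarrow> (real \<Rightarrow> real \<Rightarrow> real) \<Rightarrow> bool" where
  "half_super \<beta> S S' t C u u1 u2 ut \<longleftrightarrow>
     (\<forall>s\<in>{0..t}. C2_on C S' (u s) (u1 s) (u2 s)) \<and>
     (\<forall>s\<in>{0..t}. \<forall>z\<in>S'. ((\<lambda>s. u s z) has_real_derivative ut s z) (at s) \<and> \<bar>ut s z\<bar> \<le> C) \<and>
     continuous_on ({0..t} \<times> S) (\<lambda>q. u1 (fst q) (snd q)) \<and>
     continuous_on ({0..t} \<times> S) (\<lambda>q. u2 (fst q) (snd q)) \<and>
     continuous_on ({0..t} \<times> S) (\<lambda>q. ut (fst q) (snd q)) \<and>
     (\<forall>s\<in>{0..t}. \<forall>z\<in>S. ut s z + u2 s z / 2 + \<beta> * u1 s z \<le> 0)"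

lemma half_superD:
  assumes "half_super \<beta> S S' t C u u1 u2 ut"
  shows "s \<in> {0..t} \<Longrightarrow> C2_on C S' (u s) (u1 s) (u2 s)"
    "s \<in> {0..t} \<Longrightarrow> z \<in> S' \<Longrightarrow> ((\<lambda>s. u s z) has_real_derivative ut s z) (at s)"
    "s \<in> {0..t} \<Longrightarrow> z \<in> S' \<Longrightarrow> \<bar>ut s z\<bar> \<le> C"
    "continuous_on ({0..t} \<times> S) (\<lambda>q. u1 (fst q) (snd q))"
    "continuous_on ({0..t} \<times> S) (\<lambda>q. u2 (fst q) (snd q))"
    "continuous_on ({0..t} \<times> S) (\<lambda>q. ut (fst q) (snd q))"
    "s \<in> {0..t} \<Longrightarrow> z \<in> S \<Longrightarrow> ut s z + u2 s z / 2 + \<beta> * u1 s z \<le> 0"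
  using assms unfolding half_super_def by blast+

text \<open>After discretisation the time derivative is taken at an intermediate time and a later
  position, the space derivatives at the left end of the cell. Joint continuity brings these
  evaluations together in the limit.\<close>

lemma half_super_limit:
  assumes h: "half_super \<beta> S S' t C u u1 u2 ut"
    and s: "s \<longlonglongrightarrow> r" "\<And>n. s n \<in> {0..t}" and \<xi>: "\<xi> \<longlonglongrightarrow> r" "\<And>n. \<xi> n \<in> {0..t}"
    and r: "r \<in> {0..t}" and z: "z \<in> S" and y: "y \<longlonglongrightarrow> z" "eventually (\<lambda>n. y n \<in> S) sequentially"
  shows "\<exists>l\<le>0. (\<lambda>n. ut (\<xi> n) (y n) + u2 (s n) z / 2 + u1 (s n) z * \<beta>) \<longlonglongrightarrow> l"
proof (intro exI conjI)
  show "ut r z + u2 r z / 2 + u1 r z * \<beta> \<le> 0" using half_superD(7)[OF h r z] by (simp add: mult.commute)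
  have rz: "(r, z) \<in> {0..t} \<times> S" using r z by simp
  have 1: "(\<lambda>n. ut (\<xi> n) (y n)) \<longlonglongrightarrow> ut r z"
    using continuous_on_tendsto_compose[OF half_superD(6)[OF h] tendsto_Pair[OF \<xi>(1) y(1)] rz] y(2) \<xi>(2)
    by (auto elim: eventually_mono)
  have 2: "(\<lambda>n. u2 (s n) z) \<longlonglongrightarrow> u2 r z"
    using continuous_on_tendsto_compose[OF half_superD(5)[OF h] tendsto_Pair[OF s(1) tendsto_const] rz] s(2) z by auto
  have 3: "(\<lambda>n. u1 (s n) z) \<longlonglongrightarrow> u1 r z"
    using continuous_on_tendsto_compose[OF half_superD(4)[OF h] tendsto_Pair[OF s(1) tendsto_const] rz] s(2) z by auto
  show "(\<lambda>n. ut (\<xi> n) (y n) + u2 (s n) z / 2 + u1 (s n) z * \<beta>) \<longlonglongrightarrow> ut r z + u2 r z / 2 + u1 r z * \<beta>"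
    by (intro tendsto_intros 1 2 3) simp
qed

context skew_core begin

text \<open>
  The kink at \<open>0\<close> contributes \<open>p u' - (1 - p) v'\<close> times an increment of the mean local time, which is
  nonnegative; therefore a sign of the kink suffices.
\<close>

theorem supersolution_bound:
  assumes t: "0 < t"
    and b: "\<And>z. 0 < z \<Longrightarrow> b z = m1" "\<And>z. z < 0 \<Longrightarrow> b z = m2"
    and u: "half_super m1 {0<..} {0..} t C u u1 u2 ut"
    and v: "half_super m2 {..<0} {..0} t C v v1 v2 vt"
    and uv: "\<And>s. s \<in> {0..t} \<Longrightarrow> u s 0 = v s 0"
    and kink: "\<And>s. s \<in> {0..t} \<Longrightarrow> p * u1 s 0 - (1 - p) * v1 s 0 \<le> 0"
  shows "(\<integral>\<omega>. glue (u t) (v t) (Y t \<omega>) \<partial>M) \<le> glue (u 0) (v 0) x"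
proof -
  note U = half_superD[OF u] and V = half_superD[OF v]
  have C: "0 \<le> C" using U(3)[of 0 0] t by simp
  define f where "f s = glue (u s) (v s)" for s
  define f1 where "f1 s = glue (u1 s) (v1 s)" for s
  define f2 where "f2 s = glue (u2 s) (v2 s)" for s
  define ft where "ft s = glue (ut s) (vt s)" for s
  have fb: "\<bar>f s z\<bar> \<le> C" "\<bar>f1 s z\<bar> \<le> C" "\<bar>f2 s z\<bar> \<le> C" if "s \<in> {0..t}" for s z
    unfolding f_def f1_def f2_def using C2_onD(4-6)[OF U(1)[OF that]] C2_onD(4-6)[OF V(1)[OF that]]
    by (auto intro!: glue_bound)
  have fm: "f s \<in> borel_measurable borel" "f1 s \<in> borel_measurable borel" "f2 s \<in> borel_measurable borel"
      if "s \<in> {0..t}" for s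
    unfolding f_def f1_def f2_def using C2_onD(3,7,8)[OF U(1)[OF that]] C2_onD(3,7,8)[OF V(1)[OF that]]
    by (auto intro!: glue_meas)
  have mvt: "\<exists>\<xi>. a \<le> \<xi> \<and> \<xi> \<le> c \<and> (f c y - f a y) / (c - a) = ft \<xi> y" if ac: "0 \<le> a" "a < c" "c \<le> t" for a c y
  proof (cases "0 \<le> y")
    case True
    from MVT2[OF ac(2), of "\<lambda>s. u s y" "\<lambda>s. ut s y"] U(2)[of _ y] ac True
    obtain \<xi> where "a < \<xi>" "\<xi> < c" "u c y - u a y = (c - a) * ut \<xi> y" by auto
    then show ?thesis using True ac by (intro exI[of _ \<xi>]) (auto simp: f_def ft_def glue_def)
  next
    case False
    from MVT2[OF ac(2), of "\<lambda>s. v s y" "\<lambda>s. vt s y"] V(2)[of _ y] ac False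
    obtain \<xi> where "a < \<xi>" "\<xi> < c" "v c y - v a y = (c - a) * vt \<xi> y" by auto
    then show ?thesis using False ac by (intro exI[of _ \<xi>]) (auto simp: f_def ft_def glue_def)
  qed
  have ftb: "\<bar>ft s z\<bar> \<le> C" if "s \<in> {0..t}" for s z
    unfolding ft_def using U(3)[OF that] V(3)[OF that] by (auto intro!: glue_bound)
  define g where "g n k = grid 0 t n k" for n k
  have gb: "0 \<le> g n k" "g n k < g n (Suc k)" "g n (Suc k) \<le> t" "g n k \<in> {0..t}" "g n (Suc k) \<in> {0..t}"
      if "k < n" for n k
    using grid_bounds[of 0 t k n] grid_bounds[of 0 t "Suc k" n] grid_step[OF t, of n k] t that by (auto simp: g_def)
  define a where "a n k \<omega> = (f (g n (Suc k)) (Y (g n (Suc k)) \<omega>) - f (g n k) (Y (g n (Suc k)) \<omega>)) / (g n (Suc k)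
      - g n k)" for n k \<omega>
  \<comment> \<open>Over one cell this integrates to the change of \<open>f\<close> in time, at the
    position reached at the end, plus the drift from Ito's formula with time frozen at the left end.
    By \<open>mvt\<close> the first part is \<open>ft\<close> at an intermediate time.\<close>
  define bb where "bb n k \<omega> r = a n k \<omega> + (f2 (g n k) (Y r \<omega>) / 2 + f1 (g n k) (Y r \<omega>) * b (Y r \<omega>))" for n k \<omega> r
  define C' where "C' = C + (C + C * K)"
  have C': "0 \<le> C'" using C K_nonneg by (simp add: C'_def)
  have ab: "\<bar>a n k \<omega>\<bar> \<le> C" if k: "k < n" for n k \<omega>
  proof -
    obtain \<xi> where "g n k \<le> \<xi>" "\<xi> \<le> g n (Suc k)" "a n k \<omega> = ft \<xi> (Y (g n (Suc k)) \<omega>)"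
      using mvt[OF gb(1-3)[OF k], of "Y (g n (Suc k)) \<omega>"] by (auto simp: a_def)
    then show ?thesis using ftb[of \<xi>] gb[OF k] by auto
  qed
  have Hb: "\<bar>f2 s z / 2 + f1 s z * b z\<bar> \<le> C + C * K" if s: "s \<in> {0..t}" for s z
  proof -
    have "\<bar>f1 s z * b z\<bar> \<le> C * K" unfolding abs_mult by (intro mult_mono fb[OF s] b_bd C) auto
    moreover have "\<bar>f2 s z / 2\<bar> \<le> C" using fb(3)[OF s, of z] C by linarith
    ultimately show ?thesis by linarith
  qed
  have bbb: "\<bar>bb n k \<omega> r\<bar> \<le> C'" if k: "k < n" for n k \<omega> r
    using ab[OF k, of \<omega>] Hb[OF gb(4)[OF k], of "Y r \<omega>"] unfolding bb_def C'_def by linarith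
  have Hm: "(\<lambda>z. f2 (g n k) z / 2 + f1 (g n k) z * b z) \<in> borel_measurable borel" if k: "k < n" for n k
    using fm[OF gb(4)[OF k]] b_meas by measurable
  have am: "a n k \<in> borel_measurable M" if k: "k < n" for n k
    using fm[OF gb(4)[OF k]] fm[OF gb(5)[OF k]] unfolding a_def[abs_def] by measurable
  define S where "S n \<omega> = (\<Sum>k<n. LBINT r:{g n k..g n (Suc k)}. bb n k \<omega> r)" for n \<omega>
  have bb_int: "(LBINT r:{g n k..g n (Suc k)}. bb n k \<omega> r) = (g n (Suc k) - g n k) * a n k \<omega> +
      (LBINT r:{g n k..g n (Suc k)}. f2 (g n k) (Y r \<omega>) / 2 + f1 (g n k) (Y r \<omega>) * b (Y r \<omega>))" if k: "k
          < n" and w: "\<omega> \<in> space M" for n k \<omega>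
  proof -
    have i1: "set_integrable lborel {g n k..g n (Suc k)} (\<lambda>r. a n k \<omega>)"
      by (rule bounded_set_integrable[of _ _ _ C]) (use ab[OF k] in auto)
    have i2: "set_integrable lborel {g n k..g n (Suc k)} (\<lambda>r. f2 (g n k) (Y r \<omega>) / 2
        + f1 (g n k) (Y r \<omega>) * b (Y r \<omega>))"
      by (rule path_int[OF w Hm[OF k] Hb[OF gb(4)[OF k]]])
    show ?thesis unfolding bb_def set_integral_add(2)[OF i1 i2] using gb(2)[OF k] by (simp add: set_lint_const)
  qed
  have Im: "(\<lambda>\<omega>. LBINT r:{g n k..g n (Suc k)}. f2 (g n k) (Y r \<omega>) / 2
      + f1 (g n k) (Y r \<omega>) * b (Y r \<omega>)) \<in> borel_measurable M" if k: "k < n" for n k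
    using int_meas[OF Hm[OF k]] .
  have Sk_m: "(\<lambda>\<omega>. LBINT r:{g n k..g n (Suc k)}. bb n k \<omega> r) \<in> borel_measurable M" if k: "k < n" for n k
    using bb_int[OF k] am[OF k] Im[OF k] by (subst measurable_cong[where g="\<lambda>\<omega>. (g n (Suc k) - g n k) * a n k \<omega> +
      (LBINT r:{g n k..g n (Suc k)}. f2 (g n k) (Y r \<omega>) / 2 + f1 (g n k) (Y r \<omega>) * b (Y r \<omega>))"]) auto
  have Sk_b: "\<bar>LBINT r:{g n k..g n (Suc k)}. bb n k \<omega> r\<bar> \<le> C' * (g n (Suc k) - g n k)" if k: "k < n" for n k \<omega>
    by (rule set_lint_bound) (use bbb[OF k] gb[OF k] in auto)
  have S_m[measurable]: "S n \<in> borel_measurable M" for n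
    unfolding S_def[abs_def] using Sk_m by (intro borel_measurable_sum) auto
  have S_b: "\<bar>S n \<omega>\<bar> \<le> C' * t" if n: "n > 0" for n \<omega>
  proof -
    have "\<bar>S n \<omega>\<bar> \<le> (\<Sum>k<n. C' * (g n (Suc k) - g n k))"
      unfolding S_def using Sk_b by (intro order_trans[OF sum_abs sum_mono]) auto
    also have "\<dots> = C' * t" using n by (simp add: sum_distrib_left[symmetric] sum_lessThan_telescope g_def)
    finally show ?thesis .
  qed
  \<comment> \<open>Every cell is passed in two moves: first the process moves with the function
    frozen, where \<open>kink_ito\<close> applies and the kink term has a sign, then the function
    moves with the process frozen.\<close>
  have step: "(\<integral>\<omega>. f t (Y t \<omega>) \<partial>M) - (\<integral>\<omega>. f 0 (Y 0 \<omega>) \<partial>M) \<le> (\<integral>\<omega>. S n \<omega> \<partial>M)" if n: "n > 0" for n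
  proof -
    have E1: "(\<integral>\<omega>. f (g n (Suc k)) (Y (g n (Suc k)) \<omega>) \<partial>M) - (\<integral>\<omega>. f (g n k) (Y (g n k) \<omega>) \<partial>M)
       \<le> (\<integral>\<omega>. (LBINT r:{g n k..g n (Suc k)}. bb n k \<omega> r) \<partial>M)" if k: "k < n" for k
    proof -
      let ?s = "g n k" and ?s' = "g n (Suc k)"
      note gk = gb[OF k]
      have i1: "integrable M (\<lambda>\<omega>. f ?s' (Y r \<omega>))" "integrable M (\<lambda>\<omega>. f ?s (Y r \<omega>))" for r
        using fb(1)[OF gk(4)] fb(1)[OF gk(5)] fm(1)[OF gk(4)] fm(1)[OF gk(5)] by (auto intro!: E_bound(1)[of _ C])
      have "(\<integral>\<omega>. f ?s (Y ?s' \<omega>) \<partial>M) - (\<integral>\<omega>. f ?s (Y ?s \<omega>) \<partial>M) =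
         (\<integral>\<omega>. (LBINT r:{?s..?s'}. f2 ?s (Y r \<omega>) / 2 + f1 ?s (Y r \<omega>) * b (Y r \<omega>)) \<partial>M)
             + (p * u1 ?s 0 - (1 - p) * v1 ?s 0) * (mean_local_time ?s' - mean_local_time ?s)"
        unfolding f_def f1_def f2_def by (rule kink_ito[OF gk(1,2) U(1)[OF gk(4)] V(1)[OF gk(4)] uv[OF gk(4)]])
      moreover have "(p * u1 ?s 0 - (1 - p) * v1 ?s 0) * (mean_local_time ?s' - mean_local_time ?s) \<le> 0"
        using kink[OF gk(4)] mean_local_time_mono[OF gk(1), of ?s'] gk(2) by (intro mult_nonpos_nonneg) auto
      moreover have "(\<integral>\<omega>. (LBINT r:{?s..?s'}. bb n k \<omega> r) \<partial>M) =
         ((\<integral>\<omega>. f ?s' (Y ?s' \<omega>) \<partial>M) - (\<integral>\<omega>. f ?s (Y ?s' \<omega>) \<partial>M))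
             + (\<integral>\<omega>. (LBINT r:{?s..?s'}. f2 ?s (Y r \<omega>) / 2 + f1 ?s (Y r \<omega>) * b (Y r \<omega>)) \<partial>M)"
      proof -
        have iI: "integrable M (\<lambda>\<omega>. LBINT r:{?s..?s'}. f2 ?s (Y r \<omega>) / 2 + f1 ?s (Y r \<omega>) * b (Y r \<omega>))"
          by (rule E_bound(1)[OF set_lint_bound[OF less_imp_le[OF gk(2)] Hb[OF gk(4)]] Im[OF k]])
        have "(\<integral>\<omega>. (LBINT r:{?s..?s'}. bb n k \<omega> r) \<partial>M) = (\<integral>\<omega>. (f ?s' (Y ?s' \<omega>) - f ?s (Y ?s' \<omega>)) +
           (LBINT r:{?s..?s'}. f2 ?s (Y r \<omega>) / 2 + f1 ?s (Y r \<omega>) * b (Y r \<omega>)) \<partial>M)"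
          using bb_int[OF k] gk(2) by (intro Bochner_Integration.integral_cong) (auto simp: a_def)
        then show ?thesis using i1 iI by simp
      qed
      ultimately show ?thesis by simp
    qed
    have "(\<integral>\<omega>. f t (Y t \<omega>) \<partial>M) - (\<integral>\<omega>. f 0 (Y 0 \<omega>) \<partial>M) =
      (\<Sum>k<n. (\<integral>\<omega>. f (g n (Suc k)) (Y (g n (Suc k)) \<omega>) \<partial>M) - (\<integral>\<omega>. f (g n k) (Y (g n k) \<omega>) \<partial>M))"
      using sum_lessThan_telescope[of "\<lambda>k. \<integral>\<omega>. f (g n k) (Y (g n k) \<omega>) \<partial>M" n] n by (simp add: g_def)
    also have "\<dots> \<le> (\<Sum>k<n. \<integral>\<omega>. (LBINT r:{g n k..g n (Suc k)}. bb n k \<omega> r) \<partial>M)"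
      using E1 by (intro sum_mono) auto
    also have "\<dots> = (\<integral>\<omega>. S n \<omega> \<partial>M)"
      unfolding S_def by (rule Bochner_Integration.integral_sum[symmetric]) (use E_bound(1)[OF Sk_b Sk_m] in auto)
    finally show ?thesis .
  qed
  \<comment> \<open>The integrands converge to limits known only to be nonpositive. So convergence
    to 0 is claimed for positive parts only, which is enough for the inequality.\<close>
  have lim: "AE \<omega> in M. (\<lambda>n. max (S n \<omega>) 0) \<longlonglongrightarrow> 0"
    using AE_avoid[of "{0}", simplified] AE_space
  proof eventually_elim
    case (elim \<omega>)
    note w = elim(2)
    have "(\<lambda>n. \<Sum>k<n. LBINT r:{grid 0 t n k..grid 0 t n (Suc k)}. (if k < n then max (bb n k \<omega> r) 0 else 0))
        \<longlonglongrightarrow> (LBINT r:{0..t}. (0::real))"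
    proof (rule sum_integral_limit[OF t, where C=C'])
      show "(\<lambda>r. if k < n then max (bb n k \<omega> r) 0 else 0) \<in> borel_measurable borel" for n k
        unfolding bb_def using measurable_compose[OF path_meas[OF w] Hm[of k n]] by (cases "k < n") auto
      show "\<bar>if k < n then max (bb n k \<omega> r) 0 else 0\<bar> \<le> C'" for n k r
        using bbb[of k n \<omega> r] C' by auto
      show "AE r in lborel. 0 < r \<longrightarrow> r < t \<longrightarrow> (\<lambda>n. if grid_index 0 t n r
          < n then max (bb n (grid_index 0 t n r) \<omega> r) 0 else 0) \<longlonglongrightarrow> 0"
        using elim(1)
      proof eventually_elim
        case (elim r)
        show ?case
        proof (intro impI)
          assume r: "0 < r" "r < t"
          have z: "Y r \<omega> \<noteq> 0" using elim r by auto
          define k where "k n = grid_index 0 t (Suc n) r" for n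
          have kn: "k n < Suc n" for n unfolding k_def by (rule grid_index_less[OF t]) (use r in auto)
          define s where "s n = g (Suc n) (k n)" for n
          define s' where "s' n = g (Suc n) (Suc (k n))" for n
          have sl: "s \<longlonglongrightarrow> r" "s' \<longlonglongrightarrow> r"
            using LIMSEQ_Suc[OF grid_index_tendsto[OF t, of r "\<lambda>n. grid 0 t n (grid_index 0 t n r)"]]
              LIMSEQ_Suc[OF grid_index_tendsto[OF t, of r "\<lambda>n. grid 0 t n (Suc (grid_index 0 t n r))"]] r
              grid_mono[of 0 t "grid_index 0 t _ r" "Suc (grid_index 0 t _ r)"] t
            by (auto simp: s_def[abs_def] s'_def[abs_def] g_def k_def)
          define y where "y n = Y (s' n) \<omega>" for n
          have "\<exists>\<xi>. s n \<le> \<xi> \<and> \<xi> \<le> s' n \<and> a (Suc n) (k n) \<omega> = ft \<xi> (y n)" for n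
            unfolding a_def s_def s'_def y_def by (rule mvt[OF gb(1-3)[OF kn]])
          then obtain \<xi> where \<xi>: "\<And>n. s n \<le> \<xi> n" "\<And>n. \<xi> n \<le> s' n" "\<And>n. a (Suc n) (k n) \<omega> = ft (\<xi> n) (y n)" by metis
          have xl: "\<xi> \<longlonglongrightarrow> r" by (rule tendsto_sandwich[OF _ _ sl]) (use \<xi> in auto)
          have sI: "s n \<in> {0..t}" for n using gb(4)[OF kn[of n]] by (simp add: s_def)
          have xI: "\<xi> n \<in> {0..t}" for n using \<xi>(1,2)[of n] gb[OF kn[of n]] by (simp add: s_def s'_def)
          have "isCont (\<lambda>t. Y t \<omega>) r" using Y_cont[OF w] by (simp add: continuous_on_eq_continuous_at)
          then have yl: "y \<longlonglongrightarrow> Y r \<omega>"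
            unfolding y_def[abs_def] using sl(2) by (rule isCont_tendsto_compose)
          have "\<exists>l\<le>0. (\<lambda>n. bb (Suc n) (k n) \<omega> r) \<longlonglongrightarrow> l"
          proof (cases "0 < Y r \<omega>")
            case True
            have ev: "eventually (\<lambda>n. y n \<in> {0<..}) sequentially" using order_tendstoD(1)[OF yl True]
                by (simp add: greaterThan_iff)
            obtain l where l: "l \<le> 0" "(\<lambda>n. ut (\<xi> n) (y n) + u2 (s n) (Y r \<omega>) / 2 + u1 (s n) (Y r \<omega>) * m1) \<longlonglongrightarrow> l"
              using half_super_limit[OF u sl(1) sI xl xI _ _ yl ev] r True by auto
            have "(\<lambda>n. bb (Suc n) (k n) \<omega> r) \<longlonglongrightarrow> l"
              by (rule Lim_transform_eventually[OF l(2)], use ev in eventually_elim)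
                (use True b(1)[OF True] in \<open>auto simp: bb_def \<xi>(3) ft_def f1_def f2_def glue_def s_def\<close>)
            then show ?thesis using l(1) by blast
          next
            case False
            then have neg: "Y r \<omega> < 0" using z by simp
            have ev: "eventually (\<lambda>n. y n \<in> {..<0}) sequentially" using order_tendstoD(2)[OF yl neg] by simp
            obtain l where l: "l \<le> 0" "(\<lambda>n. vt (\<xi> n) (y n) + v2 (s n) (Y r \<omega>) / 2 + v1 (s n) (Y r \<omega>) * m2) \<longlonglongrightarrow> l"
              using half_super_limit[OF v sl(1) sI xl xI _ _ yl ev] r neg by auto
            have "(\<lambda>n. bb (Suc n) (k n) \<omega> r) \<longlonglongrightarrow> l"
              by (rule Lim_transform_eventually[OF l(2)], use ev in eventually_elim)
                (use neg b(2)[OF neg] in \<open>auto simp: bb_def \<xi>(3) ft_def f1_def f2_def glue_def s_def\<close>)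
            then show ?thesis using l(1) by blast
          qed
          then obtain l where l: "l \<le> 0" "(\<lambda>n. bb (Suc n) (k n) \<omega> r) \<longlonglongrightarrow> l" by blast
          have "(\<lambda>n. max (bb (Suc n) (k n) \<omega> r) 0) \<longlonglongrightarrow> max l 0" by (intro tendsto_max l tendsto_const)
          then have "(\<lambda>n. if grid_index 0 t (Suc n) r < Suc n then max
              (bb (Suc n) (grid_index 0 t (Suc n) r) \<omega> r) 0 else 0) \<longlonglongrightarrow> 0"
            using kn l(1) by (simp add: k_def)
          then show "(\<lambda>n. if grid_index 0 t n r < n then max (bb n (grid_index 0 t n r) \<omega> r) 0 else 0) \<longlonglongrightarrow> 0"
            by (rule LIMSEQ_imp_Suc)
        qed
      qed
    qed simp
    then have l0: "(\<lambda>n. \<Sum>k<n. LBINT r:{g n k..g n (Suc k)}. (if k < n then max (bb n k \<omega> r) 0 else 0)) \<longlonglongrightarrow> 0"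
      by (simp add: set_lebesgue_integral_def g_def)
    have up: "max (S n \<omega>) 0 \<le> (\<Sum>k<n. LBINT r:{g n k..g n (Suc k)}. (if k < n then max (bb n k \<omega> r) 0 else 0))" for n
    proof -
      have i1: "set_integrable lborel {g n k..g n (Suc k)} (\<lambda>r. bb n k \<omega> r)"
          "set_integrable lborel {g n k..g n (Suc k)} (\<lambda>r. max (bb n k \<omega> r) 0)" if k: "k < n" for k
      proof -
        have [measurable]: "(\<lambda>r. bb n k \<omega> r) \<in> borel_measurable borel"
          unfolding bb_def using measurable_compose[OF path_meas[OF w] Hm[OF k]] by auto
        show "set_integrable lborel {g n k..g n (Suc k)} (\<lambda>r. bb n k \<omega> r)"
            "set_integrable lborel {g n k..g n (Suc k)} (\<lambda>r. max (bb n k \<omega> r) 0)"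
          using bbb[OF k, of \<omega>] C' by (auto intro!: bounded_set_integrable[of _ _ _ C'] simp: abs_le_iff max_def)
      qed
      have "S n \<omega> \<le> (\<Sum>k<n. LBINT r:{g n k..g n (Suc k)}. max (bb n k \<omega> r) 0)"
        unfolding S_def using i1 by (intro sum_mono set_integral_mono) auto
      moreover have "0 \<le> (\<Sum>k<n. LBINT r:{g n k..g n (Suc k)}. max (bb n k \<omega> r) 0)"
        unfolding set_lebesgue_integral_def by (intro sum_nonneg Bochner_Integration.integral_nonneg) auto
      ultimately show ?thesis by simp
    qed
    show ?case
      by (rule tendsto_sandwich[OF _ _ tendsto_const l0]) (use up in auto)
  qed
  have "(\<lambda>n. \<integral>\<omega>. max (S (Suc n) \<omega>) 0 \<partial>M) \<longlonglongrightarrow> (\<integral>\<omega>. 0 \<partial>M)"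
  proof (rule integral_dominated_convergence[where w="\<lambda>_. C' * t"])
    show "AE \<omega> in M. (\<lambda>n. max (S (Suc n) \<omega>) 0) \<longlonglongrightarrow> 0" using lim by eventually_elim (rule LIMSEQ_Suc)
    show "AE \<omega> in M. norm (max (S (Suc n) \<omega>) 0) \<le> C' * t" for n
    proof (rule AE_I2)
      fix \<omega>
      have "0 \<le> C' * t" using C' t by simp
      then show "norm (max (S (Suc n) \<omega>) 0) \<le> C' * t" using S_b[of "Suc n" \<omega>] by (auto simp: abs_le_iff max_def)
    qed
  qed auto
  moreover have "(\<integral>\<omega>. f t (Y t \<omega>) \<partial>M) - (\<integral>\<omega>. f 0 (Y 0 \<omega>) \<partial>M) \<le> (\<integral>\<omega>. max (S (Suc n) \<omega>) 0 \<partial>M)" for n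
  proof -
    have i: "integrable M (S (Suc n))" by (rule E_bound(1)[OF S_b]) auto
    have "(\<integral>\<omega>. S (Suc n) \<omega> \<partial>M) \<le> (\<integral>\<omega>. max (S (Suc n) \<omega>) 0 \<partial>M)"
      using i by (intro integral_mono Bochner_Integration.integrable_max) auto
    then show ?thesis using step[of "Suc n"] by linarith
  qed
  ultimately have "(\<integral>\<omega>. f t (Y t \<omega>) \<partial>M) - (\<integral>\<omega>. f 0 (Y 0 \<omega>) \<partial>M) \<le> 0"
    by (intro LIMSEQ_le_const) auto
  moreover have "(\<integral>\<omega>. f 0 (Y 0 \<omega>) \<partial>M) = f 0 x"
  proof -
    have "(\<integral>\<omega>. f 0 (Y 0 \<omega>) \<partial>M) = (\<integral>\<omega>. f 0 x \<partial>M)"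
      using fm(1)[of 0] t Y_start by (intro integral_cong_AE) (auto elim: eventually_mono)
    then show ?thesis by (simp add: prob_space)
  qed
  ultimately show ?thesis by (simp add: f_def)
qed

end

section \<open>The heat kernel and the excursion kernel\<close>

definition gk :: "real \<Rightarrow> real \<Rightarrow> real" where
  "gk t a = exp (- a\<^sup>2 / (2 * t)) / sqrt (2 * pi * t)"
definition gk1 :: "real \<Rightarrow> real \<Rightarrow> real" where "gk1 t a = - (a / t) * gk t a"
definition gk2 :: "real \<Rightarrow> real \<Rightarrow> real" where "gk2 t a = (a\<^sup>2 / t\<^sup>2 - 1 / t) * gk t a"

lemma gk_pos: "t > 0 \<Longrightarrow> gk t a > 0" by (simp add: gk_def)

lemma gk_deriv: "t > 0 \<Longrightarrow> (gk t has_real_derivative gk1 t a) (at a)"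
  unfolding gk_def[abs_def] gk1_def
  by (auto intro!: derivative_eq_intros simp: field_simps)

lemma gk1_deriv: "t > 0 \<Longrightarrow> (gk1 t has_real_derivative gk2 t a) (at a)"
  unfolding gk1_def[abs_def] gk2_def
  by (auto intro!: derivative_eq_intros gk_deriv simp: gk1_def field_simps power2_eq_square)

lemma gk_time_deriv: assumes t: "t > 0" shows "((\<lambda>t. gk t a) has_real_derivative gk2 t a / 2) (at t)"
proof -
  have s: "sqrt (2 * pi * t) > 0" "(sqrt (2 * pi * t))\<^sup>2 = 2 * pi * t" using t by auto
  have d: "((\<lambda>t. exp (- a\<^sup>2 / (2 * t))) has_real_derivative exp (- a\<^sup>2 / (2 * t)) * (a\<^sup>2 / (2 * t\<^sup>2))) (at t)"
    using t by (auto intro!: derivative_eq_intros simp: field_simps power2_eq_square)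
  have "((\<lambda>t. sqrt (2 * pi * t)) has_real_derivative inverse (sqrt (2 * pi * t)) / 2 * (2 * pi)) (at t)"
    by (rule DERIV_chain2[OF DERIV_real_sqrt]) (use t in \<open>auto intro!: derivative_eq_intros\<close>)
  then have d2: "((\<lambda>t. sqrt (2 * pi * t)) has_real_derivative pi / sqrt (2 * pi * t)) (at t)"
  proof (rule DERIV_cong)
    show "inverse S / 2 * (2 * pi) = pi / S" for S :: real by (cases "S = 0") (auto simp: field_simps)
  qed
  have "((\<lambda>t. exp (- a\<^sup>2 / (2 * t)) / sqrt (2 * pi * t)) has_real_derivative
     (exp (- a\<^sup>2 / (2 * t)) * (a\<^sup>2 / (2 * t\<^sup>2)) * sqrt (2 * pi * t) - exp (- a\<^sup>2 / (2 * t)) * (pi / sqrt (2 * pi * t)))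
      / (sqrt (2 * pi * t) * sqrt (2 * pi * t))) (at t)"
    using s by (intro DERIV_divide d d2) auto
  also have "(exp (- a\<^sup>2 / (2 * t)) * (a\<^sup>2 / (2 * t\<^sup>2)) * sqrt (2 * pi * t)
      - exp (- a\<^sup>2 / (2 * t)) * (pi / sqrt (2 * pi * t)))
      / (sqrt (2 * pi * t) * sqrt (2 * pi * t)) = gk2 t a / 2"
  proof -
    have gen: "(E * A * S - E * (pi / S)) / (S * S) = (2 * A - 1 / t) * (E / S) / 2"
        if "S\<^sup>2 = 2 * pi * t" "S > 0" for E A S :: real
    proof -
      have "(E * A * S - E * (pi / S)) / (S * S) = E / S * (A - pi / S\<^sup>2)"
        using that(2) by (simp add: field_simps power2_eq_square)
      also have "pi / S\<^sup>2 = 1 / (2 * t)" unfolding that(1) using t by simp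
      also have "A - 1 / (2 * t) = (2 * A - 1 / t) / 2" using t by (simp add: field_simps)
      finally show ?thesis by simp
    qed
    show ?thesis unfolding gen[OF s(2,1)] gk2_def gk_def using t by (simp add: field_simps)
  qed
  finally show ?thesis by (simp add: gk_def)
qed

section \<open>Gaussian tails and the integral over the local time variable\<close>

definition normal_tail :: "real \<Rightarrow> real" where "normal_tail w = (LBINT u:{w..}. std_normal_density u)"

lemma std_set_int: "A \<in> sets borel \<Longrightarrow> set_integrable lborel A std_normal_density"
  unfolding set_integrable_def
  using integrable_mult_indicator[of A lborel std_normal_density] integrable_std_normal_moment[of 0] by simp

lemma normal_tail_nonneg: "0 \<le> normal_tail w"
  unfolding normal_tail_def set_lebesgue_integral_def by (intro Bochner_Integration.integral_nonneg)
      (auto simp: indicator_def)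

lemma normal_tail_deriv: "(normal_tail has_real_derivative - std_normal_density w) (at w)"
proof -
  have c: "continuous_on A std_normal_density" for A
    unfolding std_normal_density_def by (intro continuous_intros) auto
  have "((\<lambda>x. integral {w-1..x} std_normal_density) has_real_derivative std_normal_density w)
      (at w within {w-1..w+1})"
    by (rule integral_has_real_derivative[OF c]) auto
  then have d: "((\<lambda>x. integral {w-1..x} std_normal_density) has_real_derivative std_normal_density w) (at w)"
    by (subst (asm) at_within_interior) auto
  have "((\<lambda>x. normal_tail (w-1) - integral {w-1..x} std_normal_density) has_real_derivative 0
      - std_normal_density w) (at w)"
    by (intro DERIV_diff DERIV_const d)
  moreover have "eventually (\<lambda>x. normal_tail (w-1) - integral {w-1..x} std_normal_density = normal_tail x) (nhds w)"
  proof -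
    have "eventually (\<lambda>x. x \<in> {w-1<..}) (nhds w)" by (rule eventually_nhds_in_open) auto
    then show ?thesis
    proof eventually_elim
      case (elim x)
      then have x: "w - 1 \<le> x" by simp
      have "normal_tail (w-1) = (LBINT u:{w-1..<x}. std_normal_density u) + normal_tail x"
      proof -
        have u: "{w-1..} = {w-1..<x} \<union> {x..}" using x by auto
        show ?thesis unfolding normal_tail_def u by (rule set_integral_Un) (auto intro: std_set_int)
      qed
      also have "(LBINT u:{w-1..<x}. std_normal_density u) = (LBINT u:{w-1..x}. std_normal_density u)"
        unfolding set_lebesgue_integral_def
      proof (rule integral_cong_AE)
        show "AE r in lborel. indicator {w-1..<x} r *\<^sub>R std_normal_density r
            = indicator {w-1..x} r *\<^sub>R std_normal_density r"
          using AE_lborel_singleton[of x] by eventually_elim (auto simp: indicator_def)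
      qed auto
      also have "\<dots> = integral {w-1..x} std_normal_density"
        by (rule set_borel_integral_eq_integral(2)) (rule std_set_int, simp)
      finally show ?case by simp
    qed
  qed
  ultimately show ?thesis by (subst DERIV_cong_ev[OF refl _ refl, symmetric]) auto
qed

text \<open>On the range of integration \<open>exp (\<mu> * (u - w)) \<ge> 1\<close>. The density
  times this factor is, after completing the square, a constant times the normal density with mean
  \<open>\<mu>\<close>.\<close>

lemma normal_tail_chernoff: assumes mu: "0 \<le> \<mu>" shows "normal_tail w \<le> exp (- \<mu> * w + \<mu>\<^sup>2 / 2)"
proof -
  have n: "std_normal_density u * exp (\<mu> * (u - w)) = exp (- \<mu> * w + \<mu>\<^sup>2 / 2) * normal_density \<mu> 1 u" for u
    unfolding normal_density_def by (simp add: exp_add[symmetric] power2_eq_square field_simps)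
  have ni: "integrable lborel (normal_density \<mu> 1)" "(\<integral>u. normal_density \<mu> 1 u \<partial>lborel) = 1" by auto
  have "normal_tail w \<le> (\<integral>u. exp (- \<mu> * w + \<mu>\<^sup>2 / 2) * normal_density \<mu> 1 u \<partial>lborel)"
    unfolding normal_tail_def set_lebesgue_integral_def
  proof (rule integral_mono)
    show "integrable lborel (\<lambda>u. indicator {w..} u *\<^sub>R std_normal_density u)"
      using std_set_int[of "{w..}"] by (simp add: set_integrable_def)
    show "integrable lborel (\<lambda>u. exp (- \<mu> * w + \<mu>\<^sup>2 / 2) * normal_density \<mu> 1 u)" using ni(1) by simp
    fix u
    show "indicator {w..} u *\<^sub>R std_normal_density u \<le> exp (- \<mu> * w + \<mu>\<^sup>2 / 2) * normal_density \<mu> 1 u"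
      unfolding n[symmetric] using mu mult_left_mono[of 1 "exp (\<mu> * (u - w))" "std_normal_density u"]
      by (cases "w \<le> u") (auto simp: mult_nonneg_nonneg)
  qed
  also have "\<dots> = exp (- \<mu> * w + \<mu>\<^sup>2 / 2)" using ni(2) by simp
  finally show ?thesis .
qed

text \<open>The integral of \<open>exp (- c * l) * gk t (l + a)\<close> over
  \<open>l \<ge> 0\<close>, evaluated by completing the square.\<close>

definition Ec :: "real \<Rightarrow> real \<Rightarrow> real \<Rightarrow> real" where
  "Ec c t a = exp (c * a + c\<^sup>2 * t / 2) * normal_tail ((a + c * t) / sqrt t)"

text \<open>
  Closed form of the integral over \<open>l\<close> in the theorem, see \<open>Hk_integral\<close>.
\<close>

definition Hk :: "real \<Rightarrow> real \<Rightarrow> real \<Rightarrow> real" where "Hk c t a = gk t a - c * Ec c t a"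
text \<open>The first-order relation between \<open>Hk1\<close>, \<open>Hk\<close> and
  \<open>gk1\<close> does double duty: it provides the primitive in \<open>Hk_integral\<close>, and
  it balances the transmission condition in \<open>kernel_half_super\<close>.\<close>

definition Hk1 :: "real \<Rightarrow> real \<Rightarrow> real \<Rightarrow> real" where "Hk1 c t a = c * Hk c t a + gk1 t a"
definition Hk2 :: "real \<Rightarrow> real \<Rightarrow> real \<Rightarrow> real" where "Hk2 c t a = c\<^sup>2 * Hk c t a + c * gk1 t a + gk2 t a"

text \<open>Completing the square. In all derivatives of \<open>Ec\<close> the term from the tail
  thereby collapses to a multiple of the heat kernel.\<close>

lemma exp_std:
  assumes t: "t > 0"
  shows "exp (c * a + c\<^sup>2 * t / 2) * std_normal_density ((a + c * t) / sqrt t) = sqrt t * gk t a"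
proof -
  have "c * a + c\<^sup>2 * t / 2 - ((a + c * t) / sqrt t)\<^sup>2 / 2 = - a\<^sup>2 / (2 * t)"
    using t by (simp add: power_divide power2_eq_square field_simps)
  then have e: "exp (c * a + c\<^sup>2 * t / 2) * exp (- ((a + c * t) / sqrt t)\<^sup>2 / 2) = exp (- a\<^sup>2 / (2 * t))"
    by (simp add: exp_add[symmetric])
  have s: "sqrt (2 * pi * t) = sqrt (2 * pi) * sqrt t" by (rule real_sqrt_mult)
  have gen: "A * (1 / R * B) = S * (D / (R * S))" if "A * B = D" "S > 0" for A B D R S :: real
    using that by (auto simp: field_simps)
  show ?thesis unfolding std_normal_density_def gk_def s by (rule gen[OF e]) (use t in simp)
qed

lemma Ec_deriv: assumes t: "t > 0" shows "(Ec c t has_real_derivative c * Ec c t a - gk t a) (at a)"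
proof -
  have s: "sqrt t > 0" using t by simp
  have 1: "((\<lambda>a. normal_tail ((a + c * t) / sqrt t)) has_real_derivative
      - std_normal_density ((a + c * t) / sqrt t) * (1 / sqrt t)) (at a)"
    by (rule DERIV_chain2[OF normal_tail_deriv], rule DERIV_cdivide) (auto intro!: derivative_eq_intros)
  have 2: "((\<lambda>a. exp (c * a + c\<^sup>2 * t / 2)) has_real_derivative exp (c * a + c\<^sup>2 * t / 2) * c) (at a)"
    by (auto intro!: derivative_eq_intros)
  have "((\<lambda>a. exp (c * a + c\<^sup>2 * t / 2) * normal_tail ((a + c * t) / sqrt t)) has_real_derivative
     exp (c * a + c\<^sup>2 * t / 2) * c * normal_tail ((a + c * t) / sqrt t) +
     - std_normal_density ((a + c * t) / sqrt t) * (1 / sqrt t) * exp (c * a + c\<^sup>2 * t / 2)) (at a)"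
    by (rule DERIV_mult[OF 2 1])
  also have "exp (c * a + c\<^sup>2 * t / 2) * c * normal_tail ((a + c * t) / sqrt t) +
     - std_normal_density ((a + c * t) / sqrt t) * (1 / sqrt t) * exp (c * a + c\<^sup>2 * t / 2)
     = c * Ec c t a - (exp (c * a + c\<^sup>2 * t / 2) * std_normal_density ((a + c * t) / sqrt t)) / sqrt t"
    by (simp add: Ec_def)
  also have "\<dots> = c * Ec c t a - gk t a" unfolding exp_std[OF t] using s by simp
  finally show ?thesis by (simp add: Ec_def[abs_def])
qed

lemma Ec_time_deriv: assumes t: "t > 0"
  shows "((\<lambda>t. Ec c t a) has_real_derivative c\<^sup>2 / 2 * Ec c t a - gk t a * (c / 2 - a / (2 * t))) (at t)"
proof -
  have s: "sqrt t > 0" "sqrt t * sqrt t = t" using t by auto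
  have w: "((\<lambda>t. (a + c * t) / sqrt t) has_real_derivative (c * sqrt t
      - (a + c * t) * (1 / (2 * sqrt t))) / (sqrt t * sqrt t)) (at t)"
    using t by (auto intro!: derivative_eq_intros simp: field_simps)
  have 1: "((\<lambda>t. normal_tail ((a + c * t) / sqrt t)) has_real_derivative - std_normal_density ((a + c * t) / sqrt t) *
      ((c * sqrt t - (a + c * t) * (1 / (2 * sqrt t))) / (sqrt t * sqrt t))) (at t)"
    by (rule DERIV_chain2[OF normal_tail_deriv w])
  have 2: "((\<lambda>t. exp (c * a + c\<^sup>2 * t / 2)) has_real_derivative exp (c * a + c\<^sup>2 * t / 2) * (c\<^sup>2 / 2)) (at t)"
    by (auto intro!: derivative_eq_intros)
  note DERIV_mult[OF 2 1]
  also have "exp (c * a + c\<^sup>2 * t / 2) * (c\<^sup>2 / 2) * normal_tail ((a + c * t) / sqrt t) +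
     - std_normal_density ((a + c * t) / sqrt t) * ((c * sqrt t
         - (a + c * t) * (1 / (2 * sqrt t))) / (sqrt t * sqrt t)) * exp (c * a + c\<^sup>2 * t / 2)
     = c\<^sup>2 / 2 * Ec c t a - (exp (c * a + c\<^sup>2 * t / 2) * std_normal_density ((a + c * t) / sqrt t))
         * ((c * sqrt t - (a + c * t) * (1 / (2 * sqrt t))) / (sqrt t * sqrt t))"
    by (simp add: Ec_def mult.commute mult.left_commute)
  also have "\<dots> = c\<^sup>2 / 2 * Ec c t a - gk t a * (sqrt t * ((c * sqrt t
      - (a + c * t) * (1 / (2 * sqrt t))) / (sqrt t * sqrt t)))"
    unfolding exp_std[OF t] by simp
  also have "sqrt t * ((c * sqrt t - (a + c * t) * (1 / (2 * sqrt t))) / (sqrt t * sqrt t))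
      = c - (a + c * t) / (2 * t)"
  proof -
    have "S * ((c * S - (a + c * t) * (1 / (2 * S))) / (S * S)) = c - (a + c * t) / (2 * (S * S))"
        if "S > 0" for S :: real
      using that by (simp add: field_simps)
    from this[OF s(1)] show ?thesis unfolding s(2) .
  qed
  also have "c - (a + c * t) / (2 * t) = c / 2 - a / (2 * t)" using t by (simp add: field_simps)
  finally show ?thesis by (simp add: Ec_def[abs_def])
qed

lemma Hk_deriv: assumes t: "t > 0" shows "(Hk c t has_real_derivative Hk1 c t a) (at a)"
proof -
  have "((\<lambda>a. gk t a - c * Ec c t a) has_real_derivative gk1 t a - c * (c * Ec c t a - gk t a)) (at a)"
    by (intro DERIV_diff DERIV_cmult gk_deriv Ec_deriv t)
  then show ?thesis by (simp add: Hk_def[abs_def] Hk1_def algebra_simps)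
qed

lemma Hk1_deriv: assumes t: "t > 0" shows "(Hk1 c t has_real_derivative Hk2 c t a) (at a)"
proof -
  have "((\<lambda>a. c * Hk c t a + gk1 t a) has_real_derivative c * Hk1 c t a + gk2 t a) (at a)"
    by (intro DERIV_add DERIV_cmult gk1_deriv Hk_deriv t)
  then show ?thesis by (simp add: Hk1_def[abs_def] Hk2_def algebra_simps power2_eq_square)
qed

lemma Hk_time_deriv: assumes t: "t > 0" shows "((\<lambda>t. Hk c t a) has_real_derivative Hk2 c t a / 2) (at t)"
proof -
  have "((\<lambda>t. gk t a - c * Ec c t a) has_real_derivative gk2 t a / 2
      - c * (c\<^sup>2 / 2 * Ec c t a - gk t a * (c / 2 - a / (2 * t)))) (at t)"
    by (intro DERIV_diff DERIV_cmult gk_time_deriv Ec_time_deriv t)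
  moreover have "gk2 t a / 2 - c * (c\<^sup>2 / 2 * Ec c t a - gk t a * (c / 2 - a / (2 * t))) = Hk2 c t a / 2"
    using t by (simp add: Hk2_def Hk_def gk1_def field_simps power2_eq_square)
  ultimately show ?thesis unfolding Hk_def[abs_def] by (simp only:)
qed

lemma Ec_bound: assumes t: "t > 0" and a: "a \<ge> 0"
  shows "0 \<le> Ec c t a" "Ec c t a \<le> exp (c\<^sup>2 * t / 2) * exp (- a\<^sup>2 / (2 * t))"
proof -
  show "0 \<le> Ec c t a" by (simp add: Ec_def normal_tail_nonneg)
  \<comment> \<open>With this parameter the Chernoff bound produces \<open>exp (- c * a)\<close>,
    which cancels the prefactor in \<open>Ec\<close>, and full Gaussian decay in \<open>a\<close>,
    whatever the sign of \<open>c\<close>.\<close>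
  let ?\<mu> = "a / sqrt t"
  have s: "sqrt t > 0" "sqrt t * sqrt t = t" using t by auto
  have e: "- ?\<mu> * ((a + c * t) / sqrt t) + ?\<mu>\<^sup>2 / 2 = - c * a - a\<^sup>2 / (2 * t)"
    using t by (simp add: power_divide power2_eq_square field_simps)
  have "normal_tail ((a + c * t) / sqrt t) \<le> exp (- c * a - a\<^sup>2 / (2 * t))"
    using normal_tail_chernoff[of ?\<mu> "(a + c * t) / sqrt t"] s a unfolding e by simp
  then have "Ec c t a \<le> exp (c * a + c\<^sup>2 * t / 2) * exp (- c * a - a\<^sup>2 / (2 * t))"
    unfolding Ec_def by (intro mult_left_mono) auto
  also have "\<dots> = exp (c\<^sup>2 * t / 2) * exp (- a\<^sup>2 / (2 * t))" by (simp add: exp_add[symmetric])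
  finally show "Ec c t a \<le> exp (c\<^sup>2 * t / 2) * exp (- a\<^sup>2 / (2 * t))" .
qed

lemma Hk_bound: assumes t: "t > 0" and a: "a \<ge> 0"
  shows "\<bar>Hk c t a\<bar> \<le> (1 / sqrt (2 * pi * t) + \<bar>c\<bar> * exp (c\<^sup>2 * t / 2)) * exp (- a\<^sup>2 / (2 * t))"
proof -
  have "\<bar>c * Ec c t a\<bar> \<le> \<bar>c\<bar> * (exp (c\<^sup>2 * t / 2) * exp (- a\<^sup>2 / (2 * t)))"
    unfolding abs_mult using Ec_bound[OF t a, of c] by (intro mult_left_mono) auto
  moreover have "\<bar>gk t a\<bar> = 1 / sqrt (2 * pi * t) * exp (- a\<^sup>2 / (2 * t))" using t by (simp add: gk_def)
  ultimately show ?thesis unfolding Hk_def by (simp add: distrib_right)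
qed

text \<open>Since \<open>Hk1 = c * Hk + gk1\<close>, the derivative of
  \<open>exp (- c * l) * Hk c t (l + a)\<close> is \<open>exp (- c * l) * gk1 t (l + a)\<close>, the
  integrand up to a constant. The integrand is nonnegative for \<open>a \<ge> 0\<close>, and
  therefore so is \<open>Hk\<close>; the sign is not obvious from its closed form when
  \<open>c > 0\<close>.\<close>

lemma Hk_integral:
  assumes t: "t > 0" and a: "a \<ge> 0"
  shows "(LBINT l:{0..}. (l + a) * exp (- c * l - (l + a)\<^sup>2 / (2 * t))) = sqrt (2 * pi * t ^ 3) * Hk c t a"
    "0 \<le> Hk c t a"
proof -
  define q where "q l = (l + a) * exp (- c * l - (l + a)\<^sup>2 / (2 * t))" for l
  define Fq where "Fq l = - t * sqrt (2 * pi * t) * (exp (- c * l) * Hk c t (l + a))" for l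
  have st: "sqrt (2 * pi * t ^ 3) = t * sqrt (2 * pi * t)"
  proof -
    have "2 * pi * t ^ 3 = t\<^sup>2 * (2 * pi * t)" by (simp add: power2_eq_square power3_eq_cube)
    then show ?thesis using t by (simp only: real_sqrt_mult real_sqrt_abs)
  qed
  have dF: "(Fq has_real_derivative q l) (at l)" for l
  proof -
    have d1: "((\<lambda>l. Hk c t (l + a)) has_real_derivative Hk1 c t (l + a) * 1) (at l)"
      by (rule DERIV_chain2[OF Hk_deriv[OF t]]) (auto intro!: derivative_eq_intros)
    have d2: "((\<lambda>l. exp (- c * l)) has_real_derivative exp (- c * l) * (- c)) (at l)"
      by (auto intro!: derivative_eq_intros)
    have "(Fq has_real_derivative - t * sqrt (2 * pi * t)
        * (exp (- c * l) * (- c) * Hk c t (l + a) + Hk1 c t (l + a) * 1 * exp (- c * l))) (at l)"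
      unfolding Fq_def[abs_def] by (intro DERIV_cmult DERIV_mult d1 d2)
    moreover have "- t * sqrt (2 * pi * t) * (exp (- c * l) * (- c) * Hk c t (l + a)
        + Hk1 c t (l + a) * 1 * exp (- c * l))
       = - t * sqrt (2 * pi * t) * (exp (- c * l) * gk1 t (l + a))"
      by (simp add: Hk1_def algebra_simps)
    moreover have "- t * sqrt (2 * pi * t) * (exp (- c * l) * gk1 t (l + a)) = q l"
    proof -
      have e: "exp (- c * l - (l + a)\<^sup>2 / (2 * t)) = exp (- c * l) * exp (- (l + a)\<^sup>2 / (2 * t))"
        by (simp add: exp_add[symmetric])
      have "- t * S * (X * (- (v / t) * (E / S))) = v * (X * E)" if "S > 0" for S X v E :: real
        using that t by (simp add: field_simps)
      then show ?thesis unfolding gk1_def gk_def q_def e using t by simp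
    qed
    ultimately show ?thesis by (simp only:)
  qed
  have q0: "0 \<le> q l" if "0 \<le> l" for l using that a by (simp add: q_def)
  \<comment> \<open>\<open>c\<close> may be negative, but the Gaussian decay of \<open>Hk\<close>
    outweighs any exponential.\<close>
  have lim: "(Fq \<longlongrightarrow> 0) at_top"
  proof (rule Lim_null_comparison)
    define A where "A = t * sqrt (2 * pi * t) * (1 / sqrt (2 * pi * t) + \<bar>c\<bar> * exp (c\<^sup>2 * t / 2))"
    show "((\<lambda>l. A * (exp (- c * l) * exp (- l\<^sup>2 / (2 * t)))) \<longlongrightarrow> 0) at_top"
    proof (rule tendsto_mult_right_zero)
      have "((\<lambda>l. exp (- c * l - l\<^sup>2 / (2 * t))) \<longlongrightarrow> 0) at_top"
        using t by real_asymp
      then show "((\<lambda>l. exp (- c * l) * exp (- l\<^sup>2 / (2 * t))) \<longlongrightarrow> 0) at_top" by (simp add: exp_add[symmetric])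
    qed
    show "eventually (\<lambda>l. norm (Fq l) \<le> A * (exp (- c * l) * exp (- l\<^sup>2 / (2 * t)))) at_top"
      using eventually_ge_at_top[of 0]
    proof eventually_elim
      case (elim l)
      have "\<bar>Hk c t (l + a)\<bar> \<le> (1 / sqrt (2 * pi * t) + \<bar>c\<bar> * exp (c\<^sup>2 * t / 2)) * exp (- (l + a)\<^sup>2 / (2 * t))"
        by (rule Hk_bound[OF t]) (use elim a in simp)
      also have "\<dots> \<le> (1 / sqrt (2 * pi * t) + \<bar>c\<bar> * exp (c\<^sup>2 * t / 2)) * exp (- l\<^sup>2 / (2 * t))"
      proof (rule mult_left_mono)
        have "l\<^sup>2 \<le> (l + a)\<^sup>2" using elim a by (intro power_mono) auto
        then show "exp (- (l + a)\<^sup>2 / (2 * t)) \<le> exp (- l\<^sup>2 / (2 * t))" using t by (simp add: divide_right_mono)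
      qed (use t in simp)
      finally have "\<bar>Hk c t (l + a)\<bar> \<le> (1 / sqrt (2 * pi * t) + \<bar>c\<bar> * exp (c\<^sup>2 * t / 2)) * exp (- l\<^sup>2 / (2 * t))" .
      then have "t * sqrt (2 * pi * t) * (exp (- c * l) * \<bar>Hk c t (l + a)\<bar>)
          \<le> t * sqrt (2 * pi * t) * (exp (- c * l) * ((1 / sqrt (2 * pi * t) + \<bar>c\<bar> * exp (c\<^sup>2 * t / 2))
          * exp (- l\<^sup>2 / (2 * t))))"
        using t by (intro mult_left_mono) auto
      then show ?case using t by (simp add: Fq_def A_def abs_mult mult.assoc mult.left_commute)
    qed
  qed
  have F0: "Fq 0 \<le> 0"
  proof (rule tendsto_lowerbound[OF lim])
    show "eventually (\<lambda>l. Fq 0 \<le> Fq l) at_top"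
      using eventually_ge_at_top[of 0]
      by eventually_elim (rule DERIV_nonneg_imp_nondecreasing, use dF q0 in auto)
  qed simp
  have qm: "q \<in> borel_measurable borel" unfolding q_def[abs_def] by measurable
  have int: "has_bochner_integral lborel (\<lambda>l. q l * indicator {0..} l) (0 - Fq 0)"
  proof (rule has_bochner_integral_nn_integral)
    have "(\<integral>\<^sup>+l. ennreal (q l * indicator {0..} l) \<partial>lborel) = (\<integral>\<^sup>+l. ennreal (q l) * indicator {0..} l \<partial>lborel)"
      by (intro nn_integral_cong) (auto simp: indicator_def)
    also have "\<dots> = ennreal (0 - Fq 0)"
      by (rule nn_integral_FTC_atLeast[OF qm dF q0 lim])
    finally show "(\<integral>\<^sup>+l. ennreal (q l * indicator {0..} l) \<partial>lborel) = ennreal (0 - Fq 0)" .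
  qed (use qm F0 q0 in \<open>auto simp: indicator_def\<close>)
  show "(LBINT l:{0..}. (l + a) * exp (- c * l - (l + a)\<^sup>2 / (2 * t))) = sqrt (2 * pi * t ^ 3) * Hk c t a"
    unfolding st using has_bochner_integral_integral_eq[OF int]
    by (simp add: set_lebesgue_integral_def q_def Fq_def mult.commute)
  have "0 < t * sqrt (2 * pi * t)" using t by simp
  moreover have "0 \<le> t * sqrt (2 * pi * t) * Hk c t a" using F0 by (simp add: Fq_def)
  ultimately show "0 \<le> Hk c t a" by (simp only: zero_le_mult_iff) linarith
qed

section \<open>Solutions of the heat equation with Gaussian bounds\<close>

definition heat :: "(real \<Rightarrow> real \<Rightarrow> real) \<Rightarrow> (real \<Rightarrow> real \<Rightarrow> real) \<Rightarrow> (real \<Rightarrow> real \<Rightarrow> real) \<Rightarrow> bool" where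
  "heat P P1 P2 \<longleftrightarrow> (\<forall>t>0. \<forall>a. (P t has_real_derivative P1 t a) (at a) \<and> (P1 t has_real_derivative P2 t a) (at a) \<and>
      ((\<lambda>t. P t a) has_real_derivative P2 t a / 2) (at t)) \<and>
    continuous_on ({0<..} \<times> UNIV) (\<lambda>q. P (fst q) (snd q)) \<and>
    continuous_on ({0<..} \<times> UNIV) (\<lambda>q. P1 (fst q) (snd q)) \<and>
    continuous_on ({0<..} \<times> UNIV) (\<lambda>q. P2 (fst q) (snd q))"

text \<open>The exponent has \<open>4 * T\<close> instead of the \<open>2 * T\<close> of the heat
  kernel. One half of the decay is spent on polynomial prefactors; the other half is left to absorb
  the exponential tilt in \<open>tilt_bound\<close>.\<close>

definition gauss_bd :: "(real \<Rightarrow> real \<Rightarrow> real) \<Rightarrow> real set \<Rightarrow> real \<Rightarrow> real \<Rightarrow> real \<Rightarrow> bool" where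
  "gauss_bd Q S e T A \<longleftrightarrow> (\<forall>\<tau>\<in>{e..T}. \<forall>a\<in>S. \<bar>Q \<tau> a\<bar> \<le> A * exp (- a\<^sup>2 / (4 * T)))"

lemma gk_cont: "continuous_on ({0<..} \<times> UNIV) (\<lambda>q. gk (fst q) (snd q))"
  unfolding gk_def by (intro continuous_intros) auto

lemma gk1_cont: "continuous_on ({0<..} \<times> UNIV) (\<lambda>q. gk1 (fst q) (snd q))"
  unfolding gk1_def by (intro continuous_intros gk_cont) auto

lemma gk2_cont: "continuous_on ({0<..} \<times> UNIV) (\<lambda>q. gk2 (fst q) (snd q))"
  unfolding gk2_def by (intro continuous_intros gk_cont) auto

lemma normal_tail_cont: "continuous_on UNIV normal_tail"
  using normal_tail_deriv by (meson DERIV_isCont continuous_at_imp_continuous_on)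

lemma Hk_cont: "continuous_on ({0<..} \<times> UNIV) (\<lambda>q. Hk c (fst q) (snd q))"
proof -
  have "continuous_on ({0<..} \<times> UNIV) (\<lambda>q. normal_tail ((snd q + c * fst q) / sqrt (fst q :: real)))"
    by (rule continuous_on_compose2[OF normal_tail_cont]) (auto intro!: continuous_intros)
  then show ?thesis unfolding Hk_def Ec_def by (intro continuous_intros gk_cont) auto
qed

lemma gk_heat: "heat gk gk1 gk2"
  unfolding heat_def using gk_deriv gk1_deriv gk_time_deriv gk_cont gk1_cont gk2_cont by blast

lemma Hk_heat: "heat (Hk c) (Hk1 c) (Hk2 c)"
  unfolding heat_def
proof (intro conjI)
  show "continuous_on ({0<..} \<times> UNIV) (\<lambda>q. Hk1 c (fst q) (snd q))"
    unfolding Hk1_def by (intro continuous_intros Hk_cont gk1_cont)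
  show "continuous_on ({0<..} \<times> UNIV) (\<lambda>q. Hk2 c (fst q) (snd q))"
    unfolding Hk2_def by (intro continuous_intros Hk_cont gk1_cont gk2_cont)
qed (use Hk_deriv Hk1_deriv Hk_time_deriv Hk_cont in blast)+

lemma gauss_bd_add:
  assumes "gauss_bd Q S e T A" "gauss_bd R S e T A'"
  shows "gauss_bd (\<lambda>t a. Q t a + R t a) S e T (A + A')"
  unfolding gauss_bd_def
proof (intro ballI)
  fix \<tau> a assume "\<tau> \<in> {e..T}" "a \<in> S"
  then have "\<bar>Q \<tau> a\<bar> \<le> A * exp (- a\<^sup>2 / (4 * T))" "\<bar>R \<tau> a\<bar> \<le> A' * exp (- a\<^sup>2 / (4 * T))"
    using assms unfolding gauss_bd_def by blast+
  then show "\<bar>Q \<tau> a + R \<tau> a\<bar> \<le> (A + A') * exp (- a\<^sup>2 / (4 * T))"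
    unfolding distrib_right by linarith
qed

lemma gauss_bd_cmult:
  assumes "gauss_bd Q S e T A"
  shows "gauss_bd (\<lambda>t a. k * Q t a) S e T (\<bar>k\<bar> * A)"
  unfolding gauss_bd_def
proof (intro ballI)
  fix \<tau> a assume "\<tau> \<in> {e..T}" "a \<in> S"
  then have "\<bar>Q \<tau> a\<bar> \<le> A * exp (- a\<^sup>2 / (4 * T))"
    using assms unfolding gauss_bd_def by blast
  then show "\<bar>k * Q \<tau> a\<bar> \<le> \<bar>k\<bar> * A * exp (- a\<^sup>2 / (4 * T))"
    unfolding abs_mult mult.assoc by (rule mult_left_mono) simp
qed

lemma ex_gauss_bd_add:
  "\<exists>A. gauss_bd Q S e T A \<Longrightarrow> \<exists>A. gauss_bd R S e T A \<Longrightarrow> \<exists>A. gauss_bd (\<lambda>t a. Q t a + R t a) S e T A"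
  using gauss_bd_add by metis

lemma ex_gauss_bd_cmult: "\<exists>A. gauss_bd Q S e T A \<Longrightarrow> \<exists>A. gauss_bd (\<lambda>t a. k * Q t a) S e T A"
  using gauss_bd_cmult by metis

lemma sq_exp_le: fixes a T :: real assumes T: "T > 0" shows "a\<^sup>2 * exp (- a\<^sup>2 / (4 * T)) \<le> 4 * T"
proof -
  have "a\<^sup>2 / (4 * T) \<le> exp (a\<^sup>2 / (4 * T))" using exp_ge_add_one_self[of "a\<^sup>2 / (4 * T)"] by linarith
  then have "a\<^sup>2 \<le> 4 * T * exp (a\<^sup>2 / (4 * T))" using T by (simp add: divide_le_eq mult.commute)
  then have "a\<^sup>2 * exp (- a\<^sup>2 / (4 * T)) \<le> 4 * T * exp (a\<^sup>2 / (4 * T)) * exp (- a\<^sup>2 / (4 * T))"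
      by (rule mult_right_mono) simp
  also have "\<dots> = 4 * T" by (simp add: exp_add[symmetric] mult.assoc)
  finally show ?thesis .
qed

lemma exp_split: fixes a T :: real assumes "T > 0" "0 < \<tau>" "\<tau> \<le> T"
    shows "exp (- a\<^sup>2 / (2 * \<tau>)) \<le> exp (- a\<^sup>2 / (4 * T)) * exp (- a\<^sup>2 / (4 * T))"
proof -
  have "a\<^sup>2 / (2 * T) \<le> a\<^sup>2 / (2 * \<tau>)" using assms by (intro divide_left_mono) auto
  moreover have "exp (- a\<^sup>2 / (4 * T)) * exp (- a\<^sup>2 / (4 * T)) = exp (- (a\<^sup>2 / (2 * T)))"
    unfolding exp_add[symmetric] using assms by (simp add: field_simps)
  ultimately show ?thesis by simp
qed

lemma gk_gauss_bd:
  assumes e: "0 < e" "e \<le> T"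
  shows "\<exists>A. gauss_bd gk S e T A" "\<exists>A. gauss_bd gk1 S e T A" "\<exists>A. gauss_bd gk2 S e T A"
proof -
  define A where "A = (1 / e\<^sup>2 + 1 / e + 1) / sqrt (2 * pi * e)"
  have T: "T > 0" using e by simp
  have A: "0 \<le> A" using e by (simp add: A_def)
  \<comment> \<open>\<open>q\<close> stands for the polynomial prefactors of the heat kernel and of
    its two derivatives, which are treated at once.\<close>
  have key: "\<bar>q\<bar> * gk \<tau> a \<le> A * (1 + 4 * T) * exp (- a\<^sup>2 / (4 * T))"
    if q: "\<bar>q\<bar> \<le> (1 / e\<^sup>2 + 1 / e + 1) * (1 + a\<^sup>2)" and \<tau>: "\<tau> \<in> {e..T}" for q \<tau> a
  proof -
    have s: "1 / sqrt (2 * pi * \<tau>) \<le> 1 / sqrt (2 * pi * e)" using \<tau> e by (intro divide_left_mono) auto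
    have "gk \<tau> a = exp (- a\<^sup>2 / (2 * \<tau>)) * (1 / sqrt (2 * pi * \<tau>))" by (simp add: gk_def)
    also have "\<dots> \<le> exp (- a\<^sup>2 / (4 * T)) * exp (- a\<^sup>2 / (4 * T)) * (1 / sqrt (2 * pi * e))"
      using exp_split[OF T, of \<tau> a] s \<tau> e by (intro mult_mono) auto
    finally have "gk \<tau> a \<le> exp (- a\<^sup>2 / (4 * T)) * exp (- a\<^sup>2 / (4 * T)) * (1 / sqrt (2 * pi * e))" .
    then have "\<bar>q\<bar> * gk \<tau> a \<le> (1 / e\<^sup>2 + 1 / e + 1) * (1 + a\<^sup>2)
        * (exp (- a\<^sup>2 / (4 * T)) * exp (- a\<^sup>2 / (4 * T)) * (1 / sqrt (2 * pi * e)))"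
      using q gk_pos[of \<tau> a] \<tau> e by (intro mult_mono) (auto intro!: mult_nonneg_nonneg add_nonneg_nonneg)
    also have "\<dots> = A * ((exp (- a\<^sup>2 / (4 * T)) + a\<^sup>2 * exp (- a\<^sup>2 / (4 * T))) * exp (- a\<^sup>2 / (4 * T)))"
    proof -
      have "B * (1 + q) * (X * X * (1 / R)) = B / R * ((X + q * X) * X)" for B q X R :: real
        by (simp add: algebra_simps add_divide_distrib)
      then show ?thesis unfolding A_def .
    qed
    also have "\<dots> \<le> A * ((1 + 4 * T) * exp (- a\<^sup>2 / (4 * T)))"
      using sq_exp_le[OF T, of a] T A by (intro mult_left_mono mult_right_mono add_mono) auto
    finally show ?thesis by simp
  qed
  have gkp: "gk \<tau> a > 0" if "\<tau> \<in> {e..T}" for \<tau> a using that e by (intro gk_pos) auto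
  have sq: "0 \<le> 1 / e\<^sup>2" "0 < 1 / e" using e by auto
  have "gauss_bd gk S e T (A * (1 + 4 * T))"
    unfolding gauss_bd_def
  proof (intro ballI)
    fix \<tau> a assume \<tau>: "\<tau> \<in> {e..T}"
    have "1 * 1 \<le> (1 / e\<^sup>2 + 1 / e + 1) * (1 + a\<^sup>2)" using sq by (intro mult_mono) auto
    then show "\<bar>gk \<tau> a\<bar> \<le> A * (1 + 4 * T) * exp (- a\<^sup>2 / (4 * T))"
      using key[of 1 a \<tau>] \<tau> gkp[OF \<tau>, of a] by auto
  qed
  then show "\<exists>A. gauss_bd gk S e T A" by blast
  have "gauss_bd gk1 S e T (A * (1 + 4 * T))"
    unfolding gauss_bd_def
  proof (intro ballI)
    fix \<tau> a assume \<tau>: "\<tau> \<in> {e..T}"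
    have "\<bar>a / \<tau>\<bar> = \<bar>a\<bar> * (1 / \<tau>)" using \<tau> e by (simp add: abs_divide)
    also have "\<dots> \<le> (1 + a\<^sup>2) * (1 / e\<^sup>2 + 1 / e + 1)"
    proof (rule mult_mono)
      have "0 \<le> (\<bar>a\<bar> - 1)\<^sup>2" by simp
      then have "2 * \<bar>a\<bar> \<le> 1 + a\<^sup>2" by (simp add: power2_eq_square algebra_simps)
      then show "\<bar>a\<bar> \<le> 1 + a\<^sup>2" using zero_le_power2[of a] by linarith
      have "1 / \<tau> \<le> 1 / e" using \<tau> e by (intro divide_left_mono) auto
      then show "1 / \<tau> \<le> 1 / e\<^sup>2 + 1 / e + 1" using sq by linarith
    qed (use \<tau> e in auto)
    finally have "\<bar>a / \<tau>\<bar> \<le> (1 / e\<^sup>2 + 1 / e + 1) * (1 + a\<^sup>2)" by (simp add: mult.commute)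
    from key[OF this \<tau>] show "\<bar>gk1 \<tau> a\<bar> \<le> A * (1 + 4 * T) * exp (- a\<^sup>2 / (4 * T))"
      using gkp[OF \<tau>, of a] by (simp add: gk1_def abs_mult)
  qed
  then show "\<exists>A. gauss_bd gk1 S e T A" by blast
  have "gauss_bd gk2 S e T (A * (1 + 4 * T))"
    unfolding gauss_bd_def
  proof (intro ballI)
    fix \<tau> a assume \<tau>: "\<tau> \<in> {e..T}"
    have t1: "0 \<le> 1 / \<tau>" "1 / \<tau> \<le> 1 / e" using \<tau> e by (auto intro!: divide_left_mono)
    have "1 / \<tau>\<^sup>2 \<le> 1 / e\<^sup>2" using power_mono[OF t1(2,1), of 2] by (simp add: power_divide)
    then have t2: "a\<^sup>2 / \<tau>\<^sup>2 \<le> a\<^sup>2 * (1 / e\<^sup>2)" "0 \<le> a\<^sup>2 / \<tau>\<^sup>2" using mult_left_mono[of "1 / \<tau>\<^sup>2" "1 / e\<^sup>2" "a\<^sup>2"] by auto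
    have "\<bar>a\<^sup>2 / \<tau>\<^sup>2 - 1 / \<tau>\<bar> \<le> a\<^sup>2 * (1 / e\<^sup>2) + 1 / e" using t1 t2 by linarith
    also have "\<dots> \<le> (1 / e\<^sup>2 + 1 / e + 1) * (1 + a\<^sup>2)"
    proof -
      have "(1 / e\<^sup>2 + 1 / e + 1) * (1 + a\<^sup>2) = a\<^sup>2 * (1 / e\<^sup>2) + 1 / e + (1 / e\<^sup>2 + 1 + a\<^sup>2 * (1 / e) + a\<^sup>2)"
        by (simp add: algebra_simps add_divide_distrib)
      moreover have "0 \<le> 1 / e\<^sup>2 + 1 + a\<^sup>2 * (1 / e) + a\<^sup>2"
        using e by (intro add_nonneg_nonneg mult_nonneg_nonneg) auto
      ultimately show ?thesis by linarith
    qed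
    finally have "\<bar>a\<^sup>2 / \<tau>\<^sup>2 - 1 / \<tau>\<bar> \<le> (1 / e\<^sup>2 + 1 / e + 1) * (1 + a\<^sup>2)" .
    from key[OF this \<tau>] show "\<bar>gk2 \<tau> a\<bar> \<le> A * (1 + 4 * T) * exp (- a\<^sup>2 / (4 * T))"
      using gkp[OF \<tau>, of a] by (simp add: gk2_def abs_mult)
  qed
  then show "\<exists>A. gauss_bd gk2 S e T A" by blast
qed

lemma Hk_gauss_bd:
  assumes e: "0 < e" "e \<le> T"
  shows "\<exists>A. gauss_bd (Hk c) {0..} e T A" "\<exists>A. gauss_bd (Hk1 c) {0..} e T A" "\<exists>A. gauss_bd (Hk2 c) {0..} e T A"
proof -
  define A where "A = 1 / sqrt (2 * pi * e) + \<bar>c\<bar> * exp (c\<^sup>2 * T / 2)"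
  have T: "T > 0" using e by simp
  have A: "0 \<le> A" using e by (simp add: A_def)
  have "gauss_bd (Hk c) {0..} e T A"
    unfolding gauss_bd_def
  proof (intro ballI)
    fix \<tau> a :: real assume \<tau>: "\<tau> \<in> {e..T}" and a: "a \<in> {0..}"
    have \<tau>0: "0 < \<tau>" using \<tau> e by auto
    have "\<bar>Hk c \<tau> a\<bar> \<le> (1 / sqrt (2 * pi * \<tau>) + \<bar>c\<bar> * exp (c\<^sup>2 * \<tau> / 2)) * exp (- a\<^sup>2 / (2 * \<tau>))"
      by (rule Hk_bound[OF \<tau>0]) (use a in auto)
    also have "\<dots> \<le> A * (exp (- a\<^sup>2 / (4 * T)) * 1)"
    proof (rule mult_mono)
      have "1 / sqrt (2 * pi * \<tau>) \<le> 1 / sqrt (2 * pi * e)" using \<tau> e by (intro divide_left_mono) auto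
      moreover have "\<bar>c\<bar> * exp (c\<^sup>2 * \<tau> / 2) \<le> \<bar>c\<bar> * exp (c\<^sup>2 * T / 2)"
        using \<tau> by (intro mult_left_mono) (auto intro: mult_left_mono)
      ultimately show "1 / sqrt (2 * pi * \<tau>) + \<bar>c\<bar> * exp (c\<^sup>2 * \<tau> / 2) \<le> A" by (simp add: A_def)
      have "exp (- a\<^sup>2 / (4 * T)) \<le> 1" using T by simp
      then show "exp (- a\<^sup>2 / (2 * \<tau>)) \<le> exp (- a\<^sup>2 / (4 * T)) * 1"
        by (intro order_trans[OF exp_split[OF T \<tau>0] mult_left_mono]) (use \<tau> in auto)
    qed (use A in auto)
    finally show "\<bar>Hk c \<tau> a\<bar> \<le> A * exp (- a\<^sup>2 / (4 * T))" by simp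
  qed
  then show H: "\<exists>A. gauss_bd (Hk c) {0..} e T A" by blast
  show "\<exists>A. gauss_bd (Hk1 c) {0..} e T A"
    unfolding Hk1_def[abs_def] by (intro ex_gauss_bd_add ex_gauss_bd_cmult H gk_gauss_bd[OF e])
  show "\<exists>A. gauss_bd (Hk2 c) {0..} e T A"
    unfolding Hk2_def[abs_def] by (intro ex_gauss_bd_add ex_gauss_bd_cmult H gk_gauss_bd[OF e])
qed

section \<open>The comparison kernels\<close>

text \<open>The h-transform by \<open>exp (- m * z)\<close>, which turns a solution of the heat
  equation into one for Brownian motion with drift \<open>m\<close>, in the backward time
  \<open>T - s\<close>. The exact exponential rate would be \<open>m\<^sup>2\<close>;
  \<open>k\<close> takes its place. \<open>\<delta>\<close> orients the half line and
  \<open>\<beta>\<close> is the shift by the end point.\<close>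

definition tilt :: "real \<Rightarrow> real \<Rightarrow> real \<Rightarrow> real \<Rightarrow> real \<Rightarrow> (real \<Rightarrow> real \<Rightarrow> real) \<Rightarrow> real \<Rightarrow> real \<Rightarrow> real" where
  "tilt k m \<delta> \<beta> T Q s z = exp (- k * (T - s) / 2 - m * z) * Q (T - s) (\<beta> + \<delta> * z)"

text \<open>The regularity half of \<open>half_super\<close>. The differential inequality is kept
  apart because it does not survive the negative coefficients that occur in the killed kernel and in
  lower bounds, whereas regularity does.\<close>

definition C12_on :: "real set \<Rightarrow> real \<Rightarrow> real \<Rightarrow> (real \<Rightarrow> real \<Rightarrow> real) \<Rightarrow>
    (real \<Rightarrow> real \<Rightarrow> real) \<Rightarrow> (real \<Rightarrow> real \<Rightarrow> real) \<Rightarrow> (real \<Rightarrow> real \<Rightarrow> real) \<Rightarrow> bool" where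
  "C12_on S' t C u u1 u2 ut \<longleftrightarrow>
     (\<forall>s\<in>{0..t}. C2_on C S' (u s) (u1 s) (u2 s)) \<and>
     (\<forall>s\<in>{0..t}. \<forall>z\<in>S'. ((\<lambda>s. u s z) has_real_derivative ut s z) (at s) \<and> \<bar>ut s z\<bar> \<le> C) \<and>
     continuous_on ({0..t} \<times> UNIV) (\<lambda>q. u1 (fst q) (snd q)) \<and>
     continuous_on ({0..t} \<times> UNIV) (\<lambda>q. u2 (fst q) (snd q)) \<and>
     continuous_on ({0..t} \<times> UNIV) (\<lambda>q. ut (fst q) (snd q))"

lemma C12_on_add:
  assumes u: "C12_on S' t C u u1 u2 ut" and v: "C12_on S' t D v v1 v2 vt"
  shows "C12_on S' t (C + D) (\<lambda>s z. u s z + v s z) (\<lambda>s z. u1 s z + v1 s z) (\<lambda>s z. u2 s z + v2 s z) (\<lambda>s z. ut s z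
      + vt s z)"
  using assms unfolding C12_on_def C2_on_def
  by (auto intro!: continuous_intros derivative_intros order_trans[OF abs_triangle_ineq] add_mono)

lemma C12_on_cmult:
  assumes u: "C12_on S' t C u u1 u2 ut"
  shows "C12_on S' t (\<bar>k\<bar> * C) (\<lambda>s z. k * u s z) (\<lambda>s z. k * u1 s z) (\<lambda>s z. k * u2 s z) (\<lambda>s z. k * ut s z)"
  using assms unfolding C12_on_def C2_on_def
  by (auto intro!: continuous_intros DERIV_cmult mult_left_mono simp: abs_mult)

lemma C12_on_mono: "C12_on S' t C u u1 u2 ut \<Longrightarrow> C \<le> D \<Longrightarrow> C12_on S' t D u u1 u2 ut"
  unfolding C12_on_def C2_on_def by (meson order_trans)

lemma C12_on_half_super:
  assumes "C12_on S' t C u u1 u2 ut" "\<And>s z. s \<in> {0..t} \<Longrightarrow> z \<in> S \<Longrightarrow> ut s z + u2 s z / 2 + \<beta> * u1 s z \<le> 0"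
  shows "half_super \<beta> S S' t C u u1 u2 ut"
  using assms unfolding C12_on_def half_super_def by (auto intro: continuous_on_subset)

text \<open>In the exponent, \<open>\<bar>k\<bar> * T / 2\<close> bounds the time factor,
  \<open>\<bar>m\<bar> * \<bar>\<beta>\<bar>\<close> is the price of passing from \<open>z\<close>
  to the argument \<open>\<beta> + \<delta> * z\<close>, and \<open>m\<^sup>2 * T\<close> is the
  maximum of \<open>\<bar>m\<bar> * \<bar>a\<bar> - a\<^sup>2 / (4 * T)\<close> over
  \<open>a\<close>.\<close>

lemma tilt_bound:
  assumes Q: "gauss_bd Q S e T A" and A: "0 \<le> A" and T: "0 < T" and s: "T - s \<in> {e..T}" and e: "0 < e"
    and d: "\<delta> \<in> {-1, 1}" and z: "\<beta> + \<delta> * z \<in> S"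
  shows "\<bar>tilt k m \<delta> \<beta> T Q s z\<bar> \<le> A * exp (\<bar>k\<bar> * T / 2 + \<bar>m\<bar> * \<bar>\<beta>\<bar> + m\<^sup>2 * T)"
proof -
  let ?a = "\<beta> + \<delta> * z"
  have "\<bar>z\<bar> \<le> \<bar>?a\<bar> + \<bar>\<beta>\<bar>" using d by auto
  then have "\<bar>m\<bar> * \<bar>z\<bar> \<le> \<bar>m\<bar> * (\<bar>?a\<bar> + \<bar>\<beta>\<bar>)" by (intro mult_left_mono) auto
  then have 1: "- m * z \<le> \<bar>m\<bar> * \<bar>?a\<bar> + \<bar>m\<bar> * \<bar>\<beta>\<bar>"
    using abs_ge_minus_self[of "m * z"] by (simp add: abs_mult distrib_left)
  have 2: "\<bar>m\<bar> * \<bar>?a\<bar> - ?a\<^sup>2 / (4 * T) \<le> m\<^sup>2 * T"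
  proof -
    have "0 \<le> (\<bar>?a\<bar> - 2 * T * \<bar>m\<bar>)\<^sup>2" by simp
    then have "4 * T * (\<bar>m\<bar> * \<bar>?a\<bar>) \<le> ?a\<^sup>2 + 4 * T * (m\<^sup>2 * T)"
      by (simp add: power2_diff power_mult_distrib) (simp add: power2_eq_square algebra_simps)
    then show ?thesis using T by (simp add: field_simps)
  qed
  have 3: "- k * (T - s) / 2 \<le> \<bar>k\<bar> * T / 2"
  proof -
    have "- k * (T - s) \<le> \<bar>k\<bar> * (T - s)" using s e by (intro mult_right_mono) auto
    also have "\<dots> \<le> \<bar>k\<bar> * T" using s by (intro mult_left_mono) auto
    finally show ?thesis by simp
  qed
  have "\<bar>tilt k m \<delta> \<beta> T Q s z\<bar> \<le> exp (- k * (T - s) / 2 - m * z) * (A * exp (- ?a\<^sup>2 / (4 * T)))"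
    unfolding tilt_def abs_mult using Q s z unfolding gauss_bd_def by (intro mult_mono) auto
  also have "\<dots> = A * exp (- k * (T - s) / 2 - m * z - ?a\<^sup>2 / (4 * T))"
    by (simp add: exp_add[symmetric] exp_diff exp_minus field_simps)
  also have "\<dots> \<le> A * exp (\<bar>k\<bar> * T / 2 + \<bar>m\<bar> * \<bar>\<beta>\<bar> + m\<^sup>2 * T)"
    using 1 2 3 A by (intro mult_left_mono) auto
  finally show ?thesis .
qed

text \<open>Derivatives of a tilt are tilts of linear combinations of \<open>P\<close>,
  \<open>P1\<close> and \<open>P2\<close>, so one bound and one continuity argument serve for all of
  them. In \<open>tilted2\<close> the identity \<open>\<delta>\<^sup>2 = 1\<close> has been
  used.\<close>

definition tilted1 :: "real \<Rightarrow> real \<Rightarrow> (real \<Rightarrow> real \<Rightarrow> real) \<Rightarrow> (real \<Rightarrow> real \<Rightarrow> real) \<Rightarrow> real \<Rightarrow> real \<Rightarrow> real" where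
  "tilted1 m \<delta> P P1 \<tau> a = - m * P \<tau> a + \<delta> * P1 \<tau> a"
definition tilted2 :: "real \<Rightarrow> real \<Rightarrow> (real \<Rightarrow> real \<Rightarrow> real) \<Rightarrow> (real \<Rightarrow> real \<Rightarrow> real) \<Rightarrow> (real \<Rightarrow> real \<Rightarrow> real) \<Rightarrow> real \<Rightarrow>
    real \<Rightarrow> real" where
  "tilted2 m \<delta> P P1 P2 \<tau> a = m\<^sup>2 * P \<tau> a + (- 2 * m * \<delta>) * P1 \<tau> a + P2 \<tau> a"
definition tilted_t :: "real \<Rightarrow> (real \<Rightarrow> real \<Rightarrow> real) \<Rightarrow> (real \<Rightarrow> real \<Rightarrow> real) \<Rightarrow> real \<Rightarrow> real \<Rightarrow> real" where
  "tilted_t k P P2 \<tau> a = k / 2 * P \<tau> a + (- 1 / 2) * P2 \<tau> a"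

text \<open>The heat equation is already built into \<open>tilted_t\<close>, so the first- and
  second-order terms cancel. What remains vanishes for \<open>k = m\<^sup>2\<close> and otherwise
  has the sign of \<open>k - m\<^sup>2\<close> times that of \<open>P\<close>: the source of super-
  and subsolutions.\<close>

lemma tilt_generator: "tilt k m \<delta> \<beta> T (tilted_t k P P2) s z + tilt k m \<delta> \<beta> T (tilted2 m \<delta> P P1 P2) s z / 2
    + m * tilt k m \<delta> \<beta> T (tilted1 m \<delta> P P1) s z
    = (k - m\<^sup>2) / 2 * tilt k m \<delta> \<beta> T P s z"
  unfolding tilt_def tilted1_def tilted2_def tilted_t_def by (simp add: field_simps power2_eq_square)

text \<open>Because \<open>t < T\<close>, the kernels are evaluated at times in
  \<open>[T - t, T]\<close>, away from their singularity at time 0.\<close>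

lemma tilt_C12_on:
  assumes h: "heat P P1 P2" and bd: "\<exists>A. gauss_bd P S (T - t) T A" "\<exists>A. gauss_bd P1 S (T - t) T A"
      "\<exists>A. gauss_bd P2 S (T - t) T A"
    and t: "0 < t" "t < T" and d: "\<delta> \<in> {-1, 1}" and S: "\<And>z. z \<in> S' \<Longrightarrow> \<beta> + \<delta> * z \<in> S"
  shows "\<exists>C. C12_on S' t C (tilt k m \<delta> \<beta> T P) (tilt k m \<delta> \<beta> T (tilted1 m \<delta> P P1))
      (tilt k m \<delta> \<beta> T (tilted2 m \<delta> P P1 P2)) (tilt k m \<delta> \<beta> T (tilted_t k P P2))"
proof -
  have T: "0 < T" using t by simp
  have H: "(P \<tau> has_real_derivative P1 \<tau> a) (at a)" "(P1 \<tau> has_real_derivative P2 \<tau> a) (at a)"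
      "((\<lambda>t. P t a) has_real_derivative P2 \<tau> a / 2) (at \<tau>)" if "0 < \<tau>" for \<tau> a
    using h that unfolding heat_def by auto
  have bds: "\<exists>A\<ge>0. gauss_bd Q S (T - t) T A" if "\<exists>A. gauss_bd Q S (T - t) T A" for Q
  proof -
    from that obtain A where "gauss_bd Q S (T - t) T A" by blast
    then have "gauss_bd Q S (T - t) T \<bar>A\<bar>"
      unfolding gauss_bd_def by (meson abs_ge_self exp_ge_zero mult_right_mono order_trans)
    then show ?thesis by (intro exI[of _ "\<bar>A\<bar>"]) auto
  qed
  have b1: "\<exists>A. gauss_bd (tilted1 m \<delta> P P1) S (T - t) T A"
    unfolding tilted1_def[abs_def] by (intro ex_gauss_bd_add ex_gauss_bd_cmult bd)
  have b2: "\<exists>A. gauss_bd (tilted2 m \<delta> P P1 P2) S (T - t) T A"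
    unfolding tilted2_def[abs_def] by (intro ex_gauss_bd_add ex_gauss_bd_cmult bd)
  have b3: "\<exists>A. gauss_bd (tilted_t k P P2) S (T - t) T A"
    unfolding tilted_t_def[abs_def] by (intro ex_gauss_bd_add ex_gauss_bd_cmult bd)
  have C: "\<exists>C. \<forall>s\<in>{0..t}. \<forall>z\<in>S'. \<bar>tilt k m \<delta> \<beta> T Q s z\<bar> \<le> C" if ex: "\<exists>A. gauss_bd Q S (T - t) T A" for Q
  proof -
    obtain A where A: "0 \<le> A" "gauss_bd Q S (T - t) T A" using bds[OF ex] by blast
    show ?thesis
      by (intro exI ballI, rule tilt_bound[OF A(2,1) T _ _ d S]) (use t in auto)
  qed
  obtain C0 C1 C2 C3 where Cs:
    "\<And>s z. s \<in> {0..t} \<Longrightarrow> z \<in> S' \<Longrightarrow> \<bar>tilt k m \<delta> \<beta> T P s z\<bar> \<le> C0"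
    "\<And>s z. s \<in> {0..t} \<Longrightarrow> z \<in> S' \<Longrightarrow> \<bar>tilt k m \<delta> \<beta> T (tilted1 m \<delta> P P1) s z\<bar> \<le> C1"
    "\<And>s z. s \<in> {0..t} \<Longrightarrow> z \<in> S' \<Longrightarrow> \<bar>tilt k m \<delta> \<beta> T (tilted2 m \<delta> P P1 P2) s z\<bar> \<le> C2"
    "\<And>s z. s \<in> {0..t} \<Longrightarrow> z \<in> S' \<Longrightarrow> \<bar>tilt k m \<delta> \<beta> T (tilted_t k P P2) s z\<bar> \<le> C3"
    using C[OF bd(1)] C[OF b1] C[OF b2] C[OF b3] by blast
  define D where "D = max (max C0 C1) (max C2 C3)"
  have cts: "continuous_on ({0..t} \<times> UNIV) (\<lambda>q. tilt k m \<delta> \<beta> T Q (fst q) (snd q))"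
    if "continuous_on ({0<..} \<times> UNIV) (\<lambda>q. Q (fst q) (snd q))" for Q
  proof -
    have "continuous_on ({0..t} \<times> UNIV) (\<lambda>q. (\<lambda>q. Q (fst q) (snd q)) (T - fst q, \<beta> + \<delta> * snd q))"
      by (rule continuous_on_compose2[OF that]) (use t in \<open>auto intro!: continuous_intros\<close>)
    then show ?thesis unfolding tilt_def by (intro continuous_intros) auto
  qed
  have hc: "continuous_on ({0<..} \<times> UNIV) (\<lambda>q. P (fst q) (snd q))"
      "continuous_on ({0<..} \<times> UNIV) (\<lambda>q. P1 (fst q) (snd q))"
     "continuous_on ({0<..} \<times> UNIV) (\<lambda>q. P2 (fst q) (snd q))" using h by (auto simp: heat_def)
  have c1: "continuous_on ({0..t} \<times> UNIV) (\<lambda>q. tilt k m \<delta> \<beta> T (tilted1 m \<delta> P P1) (fst q) (snd q))"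
    by (rule cts) (unfold tilted1_def, intro continuous_intros hc)
  have c2: "continuous_on ({0..t} \<times> UNIV) (\<lambda>q. tilt k m \<delta> \<beta> T (tilted2 m \<delta> P P1 P2) (fst q) (snd q))"
    by (rule cts) (unfold tilted2_def, intro continuous_intros hc)
  have c3: "continuous_on ({0..t} \<times> UNIV) (\<lambda>q. tilt k m \<delta> \<beta> T (tilted_t k P P2) (fst q) (snd q))"
    by (rule cts) (unfold tilted_t_def, intro continuous_intros hc)
  have "C12_on S' t D (tilt k m \<delta> \<beta> T P) (tilt k m \<delta> \<beta> T (tilted1 m \<delta> P P1))
      (tilt k m \<delta> \<beta> T (tilted2 m \<delta> P P1 P2)) (tilt k m \<delta> \<beta> T (tilted_t k P P2))"
    unfolding C12_on_def C2_on_def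
  proof (intro conjI ballI allI c1 c2 c3)
    fix s z assume s: "s \<in> {0..t}"
    then have \<tau>: "0 < T - s" using t by auto
    have e: "((\<lambda>z. exp (- k * (T - s) / 2 - m * z)) has_real_derivative exp (- k * (T - s) / 2 - m * z)
        * (- m)) (at z)"
      by (auto intro!: derivative_eq_intros)
    have p0: "((\<lambda>z. P (T - s) (\<beta> + \<delta> * z)) has_real_derivative P1 (T - s) (\<beta> + \<delta> * z) * \<delta>) (at z)"
      by (rule DERIV_chain2[OF H(1)[OF \<tau>]]) (auto intro!: derivative_eq_intros)
    have p1: "((\<lambda>z. P1 (T - s) (\<beta> + \<delta> * z)) has_real_derivative P2 (T - s) (\<beta> + \<delta> * z) * \<delta>) (at z)"
      by (rule DERIV_chain2[OF H(2)[OF \<tau>]]) (auto intro!: derivative_eq_intros)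
    show "(tilt k m \<delta> \<beta> T P s has_real_derivative tilt k m \<delta> \<beta> T (tilted1 m \<delta> P P1) s z) (at z)"
      unfolding tilt_def[abs_def] tilted1_def
      by (rule DERIV_cong[OF DERIV_mult[OF e p0]]) (simp add: algebra_simps)
    show "(tilt k m \<delta> \<beta> T (tilted1 m \<delta> P P1) s has_real_derivative tilt k m \<delta> \<beta> T (tilted2 m \<delta> P P1 P2) s z) (at z)"
    proof -
      have "((\<lambda>z. exp (- k * (T - s) / 2 - m * z) * (- m * P (T - s) (\<beta> + \<delta> * z)
          + \<delta> * P1 (T - s) (\<beta> + \<delta> * z))) has_real_derivative
        exp (- k * (T - s) / 2 - m * z) * (- m) * (- m * P (T - s) (\<beta> + \<delta> * z) + \<delta> * P1 (T - s) (\<beta> + \<delta> * z)) +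
        (- m * (P1 (T - s) (\<beta> + \<delta> * z) * \<delta>) + \<delta> * (P2 (T - s) (\<beta> + \<delta> * z) * \<delta>))
            * exp (- k * (T - s) / 2 - m * z)) (at z)"
        by (intro DERIV_mult e DERIV_add DERIV_cmult p0 p1)
      moreover have "\<delta> * (P2 (T - s) (\<beta> + \<delta> * z) * \<delta>) = P2 (T - s) (\<beta> + \<delta> * z)"
        using d by auto
      ultimately show ?thesis
        unfolding tilt_def[abs_def] tilted1_def tilted2_def
        by (elim DERIV_cong) (simp add: algebra_simps power2_eq_square)
    qed
    have et: "((\<lambda>s. exp (- k * (T - s) / 2 - m * z)) has_real_derivative exp (- k * (T - s) / 2 - m * z)
        * (k / 2)) (at s)"
      by (auto intro!: derivative_eq_intros)
    have pt: "((\<lambda>s. P (T - s) (\<beta> + \<delta> * z)) has_real_derivative P2 (T - s) (\<beta> + \<delta> * z) / 2 * (- 1)) (at s)"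
      by (rule DERIV_chain2[where f="\<lambda>t. P t (\<beta> + \<delta> * z)"
          and g="\<lambda>s. T - s", OF H(3)[OF \<tau>]]) (auto intro!: derivative_eq_intros)
    show "((\<lambda>s. tilt k m \<delta> \<beta> T P s z) has_real_derivative tilt k m \<delta> \<beta> T (tilted_t k P P2) s z) (at s)"
      unfolding tilt_def[abs_def] tilted_t_def
      by (rule DERIV_cong[OF DERIV_mult[OF et pt]]) (simp add: algebra_simps)
    have "continuous_on UNIV (\<lambda>z. (\<lambda>q. tilt k m \<delta> \<beta> T (tilted2 m \<delta> P P1 P2) (fst q) (snd q)) (s, z))"
      by (rule continuous_on_compose2[OF c2]) (use s in \<open>auto intro!: continuous_intros\<close>)
    then show "continuous_on UNIV (tilt k m \<delta> \<beta> T (tilted2 m \<delta> P P1 P2) s)" by simp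
    assume z: "z \<in> S'"
    show "\<bar>tilt k m \<delta> \<beta> T P s z\<bar> \<le> D" "\<bar>tilt k m \<delta> \<beta> T (tilted1 m \<delta> P P1) s z\<bar> \<le> D"
      "\<bar>tilt k m \<delta> \<beta> T (tilted2 m \<delta> P P1 P2) s z\<bar> \<le> D" "\<bar>tilt k m \<delta> \<beta> T (tilted_t k P P2) s z\<bar> \<le> D"
      using Cs[OF s z] by (auto simp: D_def)
  qed
  then show ?thesis by blast
qed

text \<open>The coefficient of the local time variable \<open>l\<close> in the exponents of the
  theorem, and the value of \<open>c\<close> for which the \<open>Hk\<close> terms cancel in the
  transmission condition.\<close>

definition kern_rate :: "real \<Rightarrow> real \<Rightarrow> real \<Rightarrow> real" where "kern_rate p m1 m2 = p * m1 - (1 - p) * m2"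

text \<open>
  The kernels are functions of the starting point \<open>z\<close>, with the end point \<open>y > 0\<close> as a parameter. The
  second summand, the kernel killed at \<open>0\<close>, carries the exact factor \<open>m1\<^sup>2\<close> instead of \<open>k\<close>.
\<close>

definition kpos :: "real \<Rightarrow> real \<Rightarrow> real \<Rightarrow> real \<Rightarrow> real \<Rightarrow> real \<Rightarrow> real \<Rightarrow> real" where
  "kpos k p m1 m2 y \<tau> z = 2 * p * exp (m1 * y) * (exp (- k * \<tau> / 2 - m1 * z) * Hk (kern_rate p m1 m2) \<tau> (y + z))
     + exp (m1 * y) * (exp (- m1\<^sup>2 * \<tau> / 2 - m1 * z) * (gk \<tau> (z - y) - gk \<tau> (y + z)))"
definition kneg :: "real \<Rightarrow> real \<Rightarrow> real \<Rightarrow> real \<Rightarrow> real \<Rightarrow> real \<Rightarrow> real \<Rightarrow> real" where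
  "kneg k p m1 m2 y \<tau> z = 2 * p * exp (m1 * y) * (exp (- k * \<tau> / 2 - m2 * z) * Hk (kern_rate p m1 m2) \<tau> (y - z))"

lemma gk_even: "gk t (- a) = gk t a" by (simp add: gk_def)
lemma gk1_odd: "gk1 t (- a) = - gk1 t a" by (simp add: gk1_def gk_even)

text \<open>
  \<open>\<epsilon> = 1\<close> gives upper bounds, \<open>\<epsilon> = -1\<close> lower bounds.
\<close>

lemma kernel_half_super:
  assumes p: "0 < p" "p < 1" and y: "0 < y" and t: "0 < t" "t < T" and \<epsilon>: "\<epsilon> \<in> {-1, 1::real}"
    and k: "\<epsilon> * (k - m1\<^sup>2) \<le> 0" "\<epsilon> * (k - m2\<^sup>2) \<le> 0"
  shows "\<exists>C u1 u2 ut v1 v2 vt.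
     half_super m1 {0<..} {0..} t C (\<lambda>s z. \<epsilon> * kpos k p m1 m2 y (T - s) z) u1 u2 ut \<and>
     half_super m2 {..<0} {..0} t C (\<lambda>s z. \<epsilon> * kneg k p m1 m2 y (T - s) z) v1 v2 vt \<and>
     (\<forall>s\<in>{0..t}. p * u1 s 0 - (1 - p) * v1 s 0 \<le> 0)"
proof -
  define c where "c = kern_rate p m1 m2"
  define E where "E = exp (m1 * y)"
  have E: "E > 0" by (simp add: E_def)
  have tT: "0 < T - t" "T - t \<le> T" using t by auto
  note G = gk_gauss_bd[OF tT] and H = Hk_gauss_bd[OF tT]
  define A where "A = tilt k m1 1 y T (Hk c)"
  define A1 where "A1 = tilt k m1 1 y T (tilted1 m1 1 (Hk c) (Hk1 c))"
  define A2 where "A2 = tilt k m1 1 y T (tilted2 m1 1 (Hk c) (Hk1 c) (Hk2 c))"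
  define At where "At = tilt k m1 1 y T (tilted_t k (Hk c) (Hk2 c))"
  obtain CA where hA: "C12_on {0..} t CA A A1 A2 At"
    using tilt_C12_on[OF Hk_heat H t, of 1 "{0..}" y k m1 c] y unfolding A_def A1_def A2_def At_def by auto
  \<comment> \<open>\<open>B (-y)\<close> and \<open>B y\<close> are the direct and the reflected
    Gaussian of the killed kernel. With rate \<open>m1\<^sup>2\<close> both solve the equation
    exactly, so their difference, whose terms have opposite signs, causes no error.\<close>
  define B where "B \<beta> = tilt (m1\<^sup>2) m1 1 \<beta> T gk" for \<beta>
  define B1 where "B1 \<beta> = tilt (m1\<^sup>2) m1 1 \<beta> T (tilted1 m1 1 gk gk1)" for \<beta>
  define B2 where "B2 \<beta> = tilt (m1\<^sup>2) m1 1 \<beta> T (tilted2 m1 1 gk gk1 gk2)" for \<beta>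
  define Bt where "Bt \<beta> = tilt (m1\<^sup>2) m1 1 \<beta> T (tilted_t (m1\<^sup>2) gk gk2)" for \<beta>
  have hB: "\<exists>C. C12_on {0..} t C (B \<beta>) (B1 \<beta>) (B2 \<beta>) (Bt \<beta>)" for \<beta>
    using tilt_C12_on[OF gk_heat G[where S=UNIV] t, of 1 "{0..}" \<beta> "m1\<^sup>2" m1]
        unfolding B_def B1_def B2_def Bt_def by auto
  obtain C1 C2 where hB1: "C12_on {0..} t C1 (B (-y)) (B1 (-y)) (B2 (-y)) (Bt (-y))" and hB2:
      "C12_on {0..} t C2 (B y) (B1 y) (B2 y) (Bt y)"
    using hB by meson
  define V where "V = tilt k m2 (-1) y T (Hk c)"
  define V1 where "V1 = tilt k m2 (-1) y T (tilted1 m2 (-1) (Hk c) (Hk1 c))"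
  define V2 where "V2 = tilt k m2 (-1) y T (tilted2 m2 (-1) (Hk c) (Hk1 c) (Hk2 c))"
  define Vt where "Vt = tilt k m2 (-1) y T (tilted_t k (Hk c) (Hk2 c))"
  obtain CV where hV: "C12_on {..0} t CV V V1 V2 Vt"
    using tilt_C12_on[OF Hk_heat H t, of "-1" "{..0}" y k m2 c] y unfolding V_def V1_def V2_def Vt_def by auto
  define \<kappa> where "\<kappa> = \<epsilon> * (2 * p * E)"
  define \<mu> where "\<mu> = \<epsilon> * E"
  let ?lc = "\<lambda>f g h s z. \<kappa> * f s z + (\<mu> * g s z + (- \<mu>) * h s z)"
  have hu: "C12_on {0..} t (\<bar>\<kappa>\<bar> * CA + (\<bar>\<mu>\<bar> * C1 + \<bar>- \<mu>\<bar>
      * C2)) (?lc A (B (-y)) (B y)) (?lc A1 (B1 (-y)) (B1 y)) (?lc A2 (B2 (-y)) (B2 y))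
      (?lc At (Bt (-y)) (Bt y))"
    by (intro C12_on_add C12_on_cmult hA hB1 hB2)
  have hv: "C12_on {..0} t (\<bar>\<kappa>\<bar> * CV) (\<lambda>s z. \<kappa> * V s z) (\<lambda>s z. \<kappa> * V1 s z) (\<lambda>s z. \<kappa> * V2 s z) (\<lambda>s z. \<kappa> * Vt s z)"
    by (intro C12_on_cmult hV)
  define C where "C = max (\<bar>\<kappa>\<bar> * CA + (\<bar>\<mu>\<bar> * C1 + \<bar>- \<mu>\<bar> * C2)) (\<bar>\<kappa>\<bar> * CV)"
  have ueq: "(\<lambda>s z. \<epsilon> * kpos k p m1 m2 y (T - s) z) = ?lc A (B (-y)) (B y)"
    by (intro ext) (simp add: kpos_def A_def B_def tilt_def \<kappa>_def \<mu>_def E_def c_def algebra_simps)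
  have veq: "(\<lambda>s z. \<epsilon> * kneg k p m1 m2 y (T - s) z) = (\<lambda>s z. \<kappa> * V s z)"
    by (intro ext) (simp add: kneg_def V_def tilt_def \<kappa>_def E_def c_def)
  have gA: "At s z + A2 s z / 2 + m1 * A1 s z = (k - m1\<^sup>2) / 2 * A s z" for s z
    unfolding A_def A1_def A2_def At_def by (rule tilt_generator)
  have gB: "Bt \<beta> s z + B2 \<beta> s z / 2 + m1 * B1 \<beta> s z = 0" for \<beta> s z
    unfolding B_def B1_def B2_def Bt_def tilt_generator by simp
  have gV: "Vt s z + V2 s z / 2 + m2 * V1 s z = (k - m2\<^sup>2) / 2 * V s z" for s z
    unfolding V_def V1_def V2_def Vt_def by (rule tilt_generator)
  have pE: "0 < 2 * p * E" using p E by simp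
  have su: "half_super m1 {0<..} {0..} t C (?lc A (B (-y)) (B y)) (?lc A1 (B1 (-y)) (B1 y))
      (?lc A2 (B2 (-y)) (B2 y)) (?lc At (Bt (-y)) (Bt y))"
  proof (rule C12_on_half_super[OF C12_on_mono[OF hu]])
    show "\<bar>\<kappa>\<bar> * CA + (\<bar>\<mu>\<bar> * C1 + \<bar>- \<mu>\<bar> * C2) \<le> C" by (simp add: C_def)
    fix s z :: real assume s: "s \<in> {0..t}" and z: "z \<in> {0<..}"
    have "?lc At (Bt (-y)) (Bt y) s z + ?lc A2 (B2 (-y)) (B2 y) s z / 2 + m1 * ?lc A1 (B1 (-y)) (B1 y) s z =
       \<kappa> * (At s z + A2 s z / 2 + m1 * A1 s z) + \<mu> * (Bt (-y) s z + B2 (-y) s z / 2 + m1 * B1 (-y) s z)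
       - \<mu> * (Bt y s z + B2 y s z / 2 + m1 * B1 y s z)" by (simp add: field_simps)
    also have "\<dots> = (2 * p * E) * (\<epsilon> * (k - m1\<^sup>2)) / 2 * A s z"
      unfolding gA gB by (simp add: \<kappa>_def)
    also have "\<dots> \<le> 0"
    proof (rule mult_nonpos_nonneg)
      show "(2 * p * E) * (\<epsilon> * (k - m1\<^sup>2)) / 2 \<le> 0" using mult_nonneg_nonpos[OF less_imp_le[OF pE] k(1)] by linarith
      show "0 \<le> A s z" unfolding A_def tilt_def using Hk_integral(2)[of "T - s" "y + 1 * z" c] s z t y by simp
    qed
    finally show "?lc At (Bt (-y)) (Bt y) s z + ?lc A2 (B2 (-y)) (B2 y) s z / 2
        + m1 * ?lc A1 (B1 (-y)) (B1 y) s z \<le> 0" .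
  qed
  have sv: "half_super m2 {..<0} {..0} t C (\<lambda>s z. \<kappa> * V s z) (\<lambda>s z. \<kappa> * V1 s z) (\<lambda>s z. \<kappa> * V2 s z) (\<lambda>s z. \<kappa> * Vt s z)"
  proof (rule C12_on_half_super[OF C12_on_mono[OF hv]])
    show "\<bar>\<kappa>\<bar> * CV \<le> C" by (simp add: C_def)
    fix s z assume s: "s \<in> {0..t}" and z: "z \<in> {..<0::real}"
    have "\<kappa> * Vt s z + \<kappa> * V2 s z / 2 + m2 * (\<kappa> * V1 s z) = \<kappa> * (Vt s z + V2 s z / 2 + m2 * V1 s z)"
        by (simp add: field_simps)
    also have "\<dots> = (2 * p * E) * (\<epsilon> * (k - m2\<^sup>2)) / 2 * V s z"
      unfolding gV by (simp add: \<kappa>_def)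
    also have "\<dots> \<le> 0"
    proof (rule mult_nonpos_nonneg)
      show "(2 * p * E) * (\<epsilon> * (k - m2\<^sup>2)) / 2 \<le> 0" using mult_nonneg_nonpos[OF less_imp_le[OF pE] k(2)] by linarith
      show "0 \<le> V s z" unfolding V_def tilt_def using Hk_integral(2)[of "T - s" "y + - 1 * z" c] s z t y by simp
    qed
    finally show "\<kappa> * Vt s z + \<kappa> * V2 s z / 2 + m2 * (\<kappa> * V1 s z) \<le> 0" .
  qed
  \<comment> \<open>By the choice of \<open>c\<close> all terms with \<open>H0\<close> cancel. The
    slopes \<open>h\<close> of the excursion part add up to \<open>ek * h\<close>, against which the
    killed part puts \<open>e1 * h\<close>. As \<open>h \<le> 0\<close>, the sign is decided by
    comparing \<open>ek\<close> with \<open>e1\<close>, that is \<open>k\<close> with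
    \<open>m1\<^sup>2\<close>.\<close>
  have kink: "p * ?lc A1 (B1 (-y)) (B1 y) s 0 - (1 - p) * (\<kappa> * V1 s 0) \<le> 0" if s: "s \<in> {0..t}" for s
  proof -
    define \<tau> where "\<tau> = T - s"
    have \<tau>: "0 < \<tau>" using s t by (simp add: \<tau>_def)
    define ek where "ek = exp (- k * \<tau> / 2)"
    define e1 where "e1 = exp (- m1\<^sup>2 * \<tau> / 2)"
    define h where "h = gk1 \<tau> y"
    define H0 where "H0 = Hk c \<tau> y"
    have h: "h \<le> 0" using y \<tau> gk_pos[OF \<tau>, of y] by (simp add: h_def gk1_def)
    have a: "A1 s 0 = ek * (- m1 * H0 + (c * H0 + h))"
      by (simp add: A1_def tilt_def tilted1_def Hk1_def ek_def H0_def h_def \<tau>_def)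
    have b: "B1 (-y) s 0 = e1 * (- m1 * gk \<tau> y - h)" "B1 y s 0 = e1 * (- m1 * gk \<tau> y + h)"
      by (simp_all add: B1_def tilt_def tilted1_def e1_def h_def \<tau>_def gk_even gk1_odd)
    have v: "V1 s 0 = ek * (- m2 * H0 - (c * H0 + h))"
      by (simp add: V1_def tilt_def tilted1_def Hk1_def ek_def H0_def h_def \<tau>_def)
    have "p * ?lc A1 (B1 (-y)) (B1 y) s 0 - (1 - p) * (\<kappa> * V1 s 0)
       = 2 * p * E * (\<epsilon> * (h * (ek - e1))) + 2 * p * E * \<epsilon> * ek * H0 * (c - (p * m1 - (1 - p) * m2))"
      unfolding a b v \<kappa>_def \<mu>_def by (simp add: algebra_simps)
    also have "\<dots> = 2 * p * E * (\<epsilon> * (h * (ek - e1)))" by (simp add: c_def kern_rate_def)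
    also have "\<epsilon> * (h * (ek - e1)) = h * (\<epsilon> * (ek - e1))" by simp
    also have "2 * p * E * (h * (\<epsilon> * (ek - e1))) \<le> 0"
    proof -
      have "0 \<le> \<epsilon> * (ek - e1)"
      proof (cases "\<epsilon> = 1")
        case True
        then have "k \<le> m1\<^sup>2" using k by simp
        then have "k * \<tau> \<le> m1\<^sup>2 * \<tau>" using \<tau> by (intro mult_right_mono) auto
        then show ?thesis using True by (simp add: ek_def e1_def)
      next
        case False
        then have e: "\<epsilon> = -1" using \<epsilon> by auto
        then have "m1\<^sup>2 \<le> k" using k by simp
        then have "m1\<^sup>2 * \<tau> \<le> k * \<tau>" using \<tau> by (intro mult_right_mono) auto
        then show ?thesis using e by (simp add: ek_def e1_def)
      qed
      then show ?thesis using h pE by (intro mult_nonneg_nonpos mult_nonpos_nonneg) auto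
    qed
    finally show ?thesis .
  qed
  show ?thesis unfolding ueq veq using su sv kink by blast
qed

lemma kpos_kneg_0: "kpos k p m1 m2 y \<tau> 0 = kneg k p m1 m2 y \<tau> 0"
  by (simp add: kpos_def kneg_def gk_even)

section \<open>Reflection, and mean inequalities for the kernels\<close>

lemma half_super_reflect:
  assumes "half_super \<beta> S S' t C u u1 u2 ut"
  shows "half_super (- \<beta>) (uminus ` S) (uminus ` S') t C (\<lambda>s z. u s (- z)) (\<lambda>s z.
      - u1 s (- z)) (\<lambda>s z. u2 s (- z)) (\<lambda>s z. ut s (- z))"
proof -
  note U = half_superD[OF assms]
  have cts: "continuous_on ({0..t} \<times> uminus ` S) (\<lambda>q. f (fst q) (- snd q))"
    if "continuous_on ({0..t} \<times> S) (\<lambda>q. f (fst q) (snd q))" for f :: "real \<Rightarrow> real \<Rightarrow> real"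
  proof -
    have "continuous_on ({0..t} \<times> uminus ` S) (\<lambda>q. (\<lambda>q. f (fst q) (snd q)) (fst q, - snd q))"
      by (rule continuous_on_compose2[OF that]) (auto intro!: continuous_intros)
    then show ?thesis by simp
  qed
  have d: "((\<lambda>z. f (- z)) has_real_derivative - f' (- z)) (at z)"
      if "\<And>z. (f has_real_derivative f' z) (at z)" for f f' z
    by (rule DERIV_cong[OF DERIV_chain2[where f=f and g=uminus, OF that DERIV_minus[OF DERIV_ident]]]) simp
  show ?thesis
    unfolding half_super_def C2_on_def
  proof (intro conjI ballI allI)
    fix s z assume s: "s \<in> {0..t}"
    note P = C2_onD[OF U(1)[OF s]]
    show "((\<lambda>z. u s (- z)) has_real_derivative - u1 s (- z)) (at z)" by (rule d[OF P(1)])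
    show "((\<lambda>z. - u1 s (- z)) has_real_derivative u2 s (- z)) (at z)" using DERIV_minus[OF d[OF P(2)]] by simp
    show "continuous_on UNIV (\<lambda>z. u2 s (- z))"
      by (rule continuous_on_compose2[OF P(3)]) (auto intro!: continuous_intros)
    show "z \<in> uminus ` S' \<Longrightarrow> \<bar>u s (- z)\<bar> \<le> C" "z \<in> uminus ` S' \<Longrightarrow> \<bar>- u1 s (- z)\<bar> \<le> C"
        "z \<in> uminus ` S' \<Longrightarrow> \<bar>u2 s (- z)\<bar> \<le> C"
      using P(4-6) by auto
    show "z \<in> uminus ` S' \<Longrightarrow> ((\<lambda>s. u s (- z)) has_real_derivative ut s (- z)) (at s)"
        "z \<in> uminus ` S' \<Longrightarrow> \<bar>ut s (- z)\<bar> \<le> C"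
      using U(2,3)[OF s] by auto
    show "z \<in> uminus ` S \<Longrightarrow> ut s (- z) + u2 s (- z) / 2 + - \<beta> * - u1 s (- z) \<le> 0"
      using U(7)[OF s] by auto
  qed (use cts[OF U(4)] cts[OF U(5)] cts[OF U(6)] in \<open>auto intro: continuous_on_minus\<close>)
qed

definition kern :: "real \<Rightarrow> real \<Rightarrow> real \<Rightarrow> real \<Rightarrow> real \<Rightarrow> real \<Rightarrow> real \<Rightarrow> real" where
  "kern k p m1 m2 y \<tau> = glue (kpos k p m1 m2 y \<tau>) (kneg k p m1 m2 y \<tau>)"

context skew_core begin

text \<open>\<open>supersolution_bound\<close> with final time \<open>T = t + r\<close>: at time
  \<open>t\<close> the kernel still has time \<open>r > 0\<close> left and is bounded. Letting
  \<open>r\<close> tend to 0 is postponed until the kernel is integrated over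
  \<open>y\<close>.\<close>

lemma kernel_bound:
  assumes p: "0 < p" "p < 1" and b: "\<And>z. 0 < z \<Longrightarrow> b z = m1" "\<And>z. z < 0 \<Longrightarrow> b z = m2"
    and y: "0 < y" and t: "0 < t" and r: "0 < r" and \<epsilon>: "\<epsilon> \<in> {-1, 1::real}"
    and k: "\<epsilon> * (k - m1\<^sup>2) \<le> 0" "\<epsilon> * (k - m2\<^sup>2) \<le> 0"
  shows "\<epsilon> * (\<integral>\<omega>. kern k p m1 m2 y r (Y t \<omega>) \<partial>M) \<le> \<epsilon> * kern k p m1 m2 y (t + r) x"
proof -
  have T: "t < t + r" using r by simp
  obtain C u1 u2 ut v1 v2 vt where h:
    "half_super m1 {0<..} {0..} t C (\<lambda>s z. \<epsilon> * kpos k p m1 m2 y (t + r - s) z) u1 u2 ut"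
    "half_super m2 {..<0} {..0} t C (\<lambda>s z. \<epsilon> * kneg k p m1 m2 y (t + r - s) z) v1 v2 vt"
    "\<And>s. s \<in> {0..t} \<Longrightarrow> p * u1 s 0 - (1 - p) * v1 s 0 \<le> 0"
    using kernel_half_super[OF p y t T \<epsilon> k] by blast
  have g: "glue (\<lambda>z. \<epsilon> * kpos k p m1 m2 y \<tau> z) (\<lambda>z. \<epsilon> * kneg k p m1 m2 y \<tau> z) = (\<lambda>z. \<epsilon> * kern k p m1 m2 y \<tau> z)" for \<tau>
    by (auto simp: glue_def kern_def)
  have "(\<integral>\<omega>. glue (\<lambda>z. \<epsilon> * kpos k p m1 m2 y (t + r - t) z) (\<lambda>z. \<epsilon> * kneg k p m1 m2 y (t + r - t) z) (Y t \<omega>) \<partial>M)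
      \<le> glue (\<lambda>z. \<epsilon> * kpos k p m1 m2 y (t + r - 0) z) (\<lambda>z. \<epsilon> * kneg k p m1 m2 y (t + r - 0) z) x"
    by (rule supersolution_bound[OF t b h(1,2) _ h(3)]) (auto simp: kpos_kneg_0)
  then show ?thesis unfolding g by simp
qed

text \<open>Instead of showing that \<open>- Y\<close> solves a skew equation with parameters
  \<open>1 - p\<close>, \<open>- m2\<close>, \<open>- m1\<close>, the supersolutions for these
  parameters are reflected and applied to \<open>Y\<close> itself. Reflection exchanges the two
  halves, and the sign change of the slopes turns the kink condition into the one for
  \<open>p\<close>.\<close>

lemma kernel_bound_reflected:
  assumes p: "0 < p" "p < 1" and b: "\<And>z. 0 < z \<Longrightarrow> b z = m1" "\<And>z. z < 0 \<Longrightarrow> b z = m2"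
    and y: "0 < y" and t: "0 < t" and r: "0 < r" and \<epsilon>: "\<epsilon> \<in> {-1, 1::real}"
    and k: "\<epsilon> * (k - m1\<^sup>2) \<le> 0" "\<epsilon> * (k - m2\<^sup>2) \<le> 0"
  shows "\<epsilon> * (\<integral>\<omega>. kern k (1 - p) (- m2) (- m1) y r (- Y t \<omega>) \<partial>M) \<le> \<epsilon> * kern k (1 - p) (- m2) (- m1) y (t + r) (- x)"
proof -
  have T: "t < t + r" using r by simp
  have p': "0 < 1 - p" "1 - p < 1" using p by auto
  have k': "\<epsilon> * (k - (- m2)\<^sup>2) \<le> 0" "\<epsilon> * (k - (- m1)\<^sup>2) \<le> 0" using k by auto
  let ?P = "kpos k (1 - p) (- m2) (- m1) y" and ?N = "kneg k (1 - p) (- m2) (- m1) y"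
  obtain C u1 u2 ut v1 v2 vt where h:
    "half_super (- m2) {0<..} {0..} t C (\<lambda>s z. \<epsilon> * ?P (t + r - s) z) u1 u2 ut"
    "half_super (- m1) {..<0} {..0} t C (\<lambda>s z. \<epsilon> * ?N (t + r - s) z) v1 v2 vt"
    "\<And>s. s \<in> {0..t} \<Longrightarrow> (1 - p) * u1 s 0 - (1 - (1 - p)) * v1 s 0 \<le> 0"
    using kernel_half_super[OF p' y t T \<epsilon> k'] by blast
  have im: "uminus ` {0<..} = ({..<0} :: real set)" "uminus ` {0..} = ({..0} :: real set)"
      "uminus ` {..<0} = ({0<..} :: real set)" "uminus ` {..0} = ({0..} :: real set)"
    by (auto simp: image_iff intro!: bexI[of _ "- _"])
  note hr = half_super_reflect[OF h(1), unfolded im minus_minus] half_super_reflect[OF h(2), unfolded im minus_minus]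
  have g: "glue (\<lambda>z. \<epsilon> * ?N \<tau> (- z)) (\<lambda>z. \<epsilon> * ?P \<tau> (- z)) = (\<lambda>z. \<epsilon> * kern k (1 - p) (- m2) (- m1) y \<tau> (- z))" for \<tau>
  proof
    fix z show "glue (\<lambda>z. \<epsilon> * ?N \<tau> (- z)) (\<lambda>z. \<epsilon> * ?P \<tau> (- z)) z = \<epsilon> * kern k (1 - p) (- m2) (- m1) y \<tau> (- z)"
      using kpos_kneg_0[of k "1 - p" "- m2" "- m1" y \<tau>]
          by (cases z "0::real" rule: linorder_cases) (auto simp: glue_def kern_def)
  qed
  have "(\<integral>\<omega>. glue (\<lambda>z. \<epsilon> * ?N (t + r - t) (- z)) (\<lambda>z. \<epsilon> * ?P (t + r - t) (- z)) (Y t \<omega>) \<partial>M)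
      \<le> glue (\<lambda>z. \<epsilon> * ?N (t + r - 0) (- z)) (\<lambda>z. \<epsilon> * ?P (t + r - 0) (- z)) x"
  proof (rule supersolution_bound[OF t b hr(2,1)])
    show "p * - v1 s (- 0) - (1 - p) * - u1 s (- 0) \<le> 0" if "s \<in> {0..t}" for s using h(3)[OF that] by simp
  qed (auto simp: kpos_kneg_0)
  then show ?thesis unfolding g by simp
qed

end

section \<open>From kernels to transition densities\<close>

text \<open>Lebesgue differentiation. As \<open>d\<close> is integrable only on intervals away from
  0, it is cut off at a level \<open>l > 0\<close>, and the levels \<open>1 / Suc n\<close> exhaust
  the half line.\<close>

lemma AE_nonneg_if_interval_integrals_nonneg:
  fixes d :: "real \<Rightarrow> real"
  assumes i: "\<And>a b. 0 < a \<Longrightarrow> a \<le> b \<Longrightarrow> set_integrable lborel {a..b} d"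
    and nn: "\<And>a b. 0 < a \<Longrightarrow> a \<le> b \<Longrightarrow> 0 \<le> (LBINT y:{a..b}. d y)"
  shows "AE y in lborel. 0 < y \<longrightarrow> 0 \<le> d y"
proof -
  have l: "AE y in lborel. l < y \<longrightarrow> 0 \<le> d y" if l: "0 < l" for l
  proof -
    define f where "f y = indicator {l..} y * d y" for y
    have "f integrable_on cbox a b" for a b
    proof (cases "max a l \<le> b")
      case True
      have "set_integrable lborel {max a l..b} d" by (rule i) (use l True in auto)
      moreover have "(\<lambda>y. indicator {a..b} y *\<^sub>R f y) = (\<lambda>y. indicator {max a l..b} y *\<^sub>R d y)"
        by (auto simp: f_def indicator_def fun_eq_iff)
      ultimately have "set_integrable lborel {a..b} f" by (simp add: set_integrable_def)
      then show ?thesis using set_borel_integral_eq_integral(1)[of "{a..b}" f] by simp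
    next
      case False
      then have "f y = 0" if "y \<in> cbox a b" for y using that by (auto simp: f_def indicator_def)
      then show ?thesis using integrable_cong[of "cbox a b" f "\<lambda>_. 0"] by auto
    qed
    then obtain N where N: "negligible N" "\<And>x e. \<lbrakk>x \<notin> N; 0 < e\<rbrakk> \<Longrightarrow>
        \<exists>d>0. \<forall>h. 0 < h \<and> h < d \<longrightarrow> norm (integral (cbox x (x + h *\<^sub>R One)) f /\<^sub>R h ^ DIM(real) - f x) < e"
      by (rule integrable_ccontinuous_explicit) blast
    have "AE y in lebesgue. y \<notin> N" using N(1) by (intro AE_not_in) (simp add: negligible_iff_null_sets)
    then have "AE y in lborel. y \<notin> N" by (simp add: AE_completion_iff)
    then show ?thesis
    proof eventually_elim
      case (elim y)
      show ?case
      proof (intro impI, rule ccontr)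
        assume y: "l < y" and neg: "\<not> 0 \<le> d y"
        obtain \<delta> where \<delta>: "\<delta> > 0" "\<And>h. 0 < h \<Longrightarrow> h < \<delta> \<Longrightarrow> norm (integral (cbox y (y + h *\<^sub>R One)) f /\<^sub>R h ^ DIM(real)
            - f y) < - d y"
          using N(2)[OF elim, of "- d y"] neg by auto
        define h where "h = \<delta> / 2"
        have h: "0 < h" "h < \<delta>" using \<delta>(1) by (auto simp: h_def)
        have fy: "f y = d y" using y by (simp add: f_def)
        have "integral {y..y+h} f = integral {y..y+h} d"
          by (rule integral_cong) (use y in \<open>auto simp: f_def\<close>)
        also have "\<dots> = (LBINT r:{y..y+h}. d r)"
          by (rule set_borel_integral_eq_integral(2)[symmetric], rule i) (use y l h in auto)
        also have "\<dots> \<ge> 0" by (rule nn) (use y l h in auto)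
        finally have "0 \<le> integral {y..y+h} f / h" using h by simp
        moreover have "\<bar>integral {y..y+h} f / h - d y\<bar> < - d y"
          using \<delta>(2)[OF h] by (simp add: fy divide_inverse mult.commute)
        ultimately show False using neg by linarith
      qed
    qed
  qed
  have "AE y in lborel. \<forall>n::nat. 1 / real (Suc n) < y \<longrightarrow> 0 \<le> d y"
    by (subst AE_all_countable) (intro allI l, simp)
  then show ?thesis
  proof eventually_elim
    case (elim y)
    show ?case
    proof
      assume "0 < y"
      then obtain n where "inverse (real (Suc n)) < y" using reals_Archimedean by blast
      then show "0 \<le> d y" using elim by (auto simp: inverse_eq_divide)
    qed
  qed
qed

section \<open>The short-time kernel as an approximate identity\<close>

lemma gk_meas: assumes "0 < t" shows "gk t \<in> borel_measurable borel"
  using gk_deriv[OF assms] by (meson DERIV_isCont borel_measurable_continuous_onI continuous_at_imp_continuous_on)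

lemma Hk_meas: assumes "0 < t" shows "Hk c t \<in> borel_measurable borel"
  using Hk_deriv[OF assms] by (meson DERIV_isCont borel_measurable_continuous_onI continuous_at_imp_continuous_on)

lemma kern_meas: assumes t: "0 < t"
  shows "(\<lambda>q. kern k p m1 m2 (snd q) t (fst q)) \<in> borel_measurable (borel \<Otimes>\<^sub>M borel)"
proof -
  note [measurable] = gk_meas[OF t] Hk_meas[OF t]
  show ?thesis unfolding kern_def glue_def kpos_def kneg_def by measurable
qed

lemma kern_time_space_cont: "continuous_on ({0<..} \<times> {0<..}) (\<lambda>q. kern k p m1 m2 (fst q) (snd q) x)"
proof (cases "0 \<le> x")
  case True
  have "continuous_on ({0<..} \<times> {0<..}) (\<lambda>q. kpos k p m1 m2 (fst q) (snd q) x)"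
    unfolding kpos_def
    by (intro continuous_intros continuous_on_compose2[OF Hk_cont, of _ "\<lambda>q. (snd q, fst q + x)", simplified]
       continuous_on_compose2[OF gk_cont, of _ "\<lambda>q. (snd q, x - fst q)", simplified]
       continuous_on_compose2[OF gk_cont, of _ "\<lambda>q. (snd q, fst q + x)", simplified]) auto
  then show ?thesis using True by (simp add: kern_def glue_def)
next
  case False
  have "continuous_on ({0<..} \<times> {0<..}) (\<lambda>q. kneg k p m1 m2 (fst q) (snd q) x)"
    unfolding kneg_def
    by (intro continuous_intros continuous_on_compose2[OF Hk_cont, of _ "\<lambda>q. (snd q, fst q - x)", simplified]) auto
  then show ?thesis using False by (simp add: kern_def glue_def)
qed

definition kern_tail :: "real \<Rightarrow> real \<Rightarrow> real \<Rightarrow> real \<Rightarrow> real" where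
  "kern_tail a R D \<tau> = R * ((1 / sqrt (2 * pi * \<tau>) + D) * exp (- a\<^sup>2 / (4 * \<tau>)))"

text \<open>Half of the Gaussian exponent absorbs the tilt:
  \<open>\<bar>m\<bar> * w - w\<^sup>2 / 4 \<le> m\<^sup>2\<close>, and
  \<open>\<tau> \<le> 1\<close> makes the available half at least as large. The other half is
  monotone in \<open>w\<close> and leaves \<open>exp (- a\<^sup>2 / (4 * \<tau>))\<close>,
  independent of \<open>z\<close>.\<close>

lemma tail_bound:
  assumes a: "0 < a" "a \<le> w" and z: "\<bar>z\<bar> \<le> w" and \<tau>: "0 < \<tau>" "\<tau> \<le> 1" and D: "0 \<le> D"
  shows "exp (- m * z) * ((1 / sqrt (2 * pi * \<tau>) + D) * exp (- w\<^sup>2 / (2 * \<tau>)))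
      \<le> exp (m\<^sup>2) * ((1 / sqrt (2 * pi * \<tau>) + D) * exp (- a\<^sup>2 / (4 * \<tau>)))"
proof -
  have "- m * z \<le> \<bar>m\<bar> * w" using z mult_left_mono[OF z, of "\<bar>m\<bar>"] abs_ge_minus_self[of "m * z"]
      by (simp add: abs_mult)
  moreover have "\<bar>m\<bar> * w - w\<^sup>2 / 4 \<le> m\<^sup>2"
    using zero_le_power2[of "w / 2 - \<bar>m\<bar>"] by (simp add: power2_diff power_divide algebra_simps)
  moreover have "w\<^sup>2 / 4 \<le> w\<^sup>2 / (4 * \<tau>)" using \<tau> by (intro divide_left_mono) auto
  moreover have "a\<^sup>2 / (4 * \<tau>) \<le> w\<^sup>2 / (4 * \<tau>)" using a \<tau> by (intro divide_right_mono power_mono) auto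
  moreover have "w\<^sup>2 / (2 * \<tau>) = w\<^sup>2 / (4 * \<tau>) + w\<^sup>2 / (4 * \<tau>)" by (simp add: field_simps)
  ultimately have "- m * z + - w\<^sup>2 / (2 * \<tau>) \<le> m\<^sup>2 + - a\<^sup>2 / (4 * \<tau>)" by (simp only: minus_divide_left[symmetric])
  then have e: "exp (- m * z) * exp (- w\<^sup>2 / (2 * \<tau>)) \<le> exp (m\<^sup>2) * exp (- a\<^sup>2 / (4 * \<tau>))"
    unfolding exp_add[symmetric] by simp
  have "0 \<le> 1 / sqrt (2 * pi * \<tau>) + D" using \<tau> D by simp
  from mult_left_mono[OF e this] show ?thesis by (simp add: mult.left_commute)
qed

text \<open>The direct Gaussian of \<open>kpos\<close>: for \<open>z \<ge> 0\<close> the transition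
  density of Brownian motion with drift \<open>m1\<close>, as if there were no skew point.\<close>

definition kern_main :: "real \<Rightarrow> real \<Rightarrow> real \<Rightarrow> real \<Rightarrow> real" where
  "kern_main m1 y \<tau> z = (if 0 \<le> z then normal_density (z + m1 * \<tau>) (sqrt \<tau>) y else 0)"

lemma kern_main_eq:
  assumes "0 < \<tau>"
  shows "exp (m1 * y) * (exp (- m1\<^sup>2 * \<tau> / 2 - m1 * z) * gk \<tau> (z - y)) = normal_density (z + m1 * \<tau>) (sqrt \<tau>) y"
proof -
  have "m1 * y + (- m1\<^sup>2 * \<tau> / 2 - m1 * z) + - (z - y)\<^sup>2 / (2 * \<tau>) = - (y - (z + m1 * \<tau>))\<^sup>2 / (2 * \<tau>)"
    using assms by (simp add: field_simps power2_eq_square)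
  then have "exp (m1 * y) * exp (- m1\<^sup>2 * \<tau> / 2 - m1 * z) * exp (- (z - y)\<^sup>2 / (2 * \<tau>))
      = exp (- (y - (z + m1 * \<tau>))\<^sup>2 / (2 * \<tau>))"
    unfolding exp_add[symmetric] by simp
  then show ?thesis using assms by (simp add: gk_def normal_density_def mult.assoc[symmetric])
qed

text \<open>All terms except the direct Gaussian depend on \<open>y + \<bar>z\<bar>\<close>, which
  is at least \<open>a\<close>. They are therefore exponentially small as \<open>\<tau>\<close>
  tends to 0, uniformly in \<open>z\<close> and in \<open>y\<close> from a compact interval away
  from 0. In \<open>R\<close>, \<open>E\<close> bounds the factor \<open>exp (m1 * y)\<close> and
  \<open>G\<close> covers the tilts by \<open>m1\<close> and \<open>m2\<close>.\<close>

lemma kern_approx: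
  assumes p: "0 < p" "p < 1" and a: "0 < a"
  shows "\<exists>R D. 0 \<le> R \<and> 0 \<le> D \<and> (\<forall>y\<in>{a..b}. \<forall>z. \<forall>\<tau>. 0 < \<tau> \<longrightarrow> \<tau> \<le> 1 \<longrightarrow> \<bar>kern k p m1 m2 y \<tau> z - kern_main m1 y \<tau> z\<bar>
      \<le> kern_tail a R D \<tau>)"
proof -
  define c where "c = kern_rate p m1 m2"
  define D where "D = \<bar>c\<bar> * exp (c\<^sup>2 / 2)"
  define E where "E = exp (\<bar>m1\<bar> * b)"
  define G where "G = exp (m1\<^sup>2) + exp (m2\<^sup>2)"
  define R where "R = 2 * p * E * (exp (\<bar>k\<bar> / 2) * G) + E * G"
  have D: "0 \<le> D" by (simp add: D_def)
  have E: "0 \<le> E" "0 \<le> G" by (auto simp: E_def G_def add_nonneg_nonneg)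
  have R: "0 \<le> R" using p E by (simp add: R_def)
  have "\<bar>kern k p m1 m2 y \<tau> z - kern_main m1 y \<tau> z\<bar> \<le> kern_tail a R D \<tau>"
      if y: "y \<in> {a..b}" and \<tau>: "0 < \<tau>" "\<tau> \<le> 1" for y z \<tau>
  proof -
    define r where "r = (1 / sqrt (2 * pi * \<tau>) + D) * exp (- a\<^sup>2 / (4 * \<tau>))"
    have r: "0 \<le> r" using \<tau> D by (simp add: r_def)
    have ey: "0 \<le> exp (m1 * y)" "exp (m1 * y) \<le> E"
    proof -
      have "m1 * y \<le> \<bar>m1\<bar> * y" using y a by (intro mult_right_mono) auto
      also have "\<dots> \<le> \<bar>m1\<bar> * b" using y by (intro mult_left_mono) auto
      finally show "0 \<le> exp (m1 * y)" "exp (m1 * y) \<le> E" by (auto simp: E_def)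
    qed
    have ek: "exp (- k * \<tau> / 2) \<le> exp (\<bar>k\<bar> / 2)"
    proof -
      have "- k * \<tau> \<le> \<bar>k\<bar> * \<tau>" using \<tau> by (intro mult_right_mono) auto
      also have "\<dots> \<le> \<bar>k\<bar> * 1" using \<tau> by (intro mult_left_mono) auto
      finally show ?thesis by simp
    qed
    have H: "\<bar>Hk c \<tau> w\<bar> \<le> (1 / sqrt (2 * pi * \<tau>) + D) * exp (- w\<^sup>2 / (2 * \<tau>))" if "0 \<le> w" for w
    proof -
      have "\<bar>c\<bar> * exp (c\<^sup>2 * \<tau> / 2) \<le> D" unfolding D_def using \<tau> mult_left_mono[of \<tau> 1 "c\<^sup>2"]
          by (intro mult_left_mono) auto
      then have "(1 / sqrt (2 * pi * \<tau>) + \<bar>c\<bar> * exp (c\<^sup>2 * \<tau> / 2)) * exp (- w\<^sup>2 / (2 * \<tau>))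
          \<le> (1 / sqrt (2 * pi * \<tau>) + D) * exp (- w\<^sup>2 / (2 * \<tau>))"
        by (intro mult_right_mono add_left_mono) auto
      then show ?thesis using Hk_bound[OF \<tau>(1) that, of c] by linarith
    qed
    have cross: "\<bar>2 * p * exp (m1 * y) * (exp (- k * \<tau> / 2 - m * z) * Hk c \<tau> w)\<bar>
        \<le> 2 * p * E * (exp (\<bar>k\<bar> / 2) * G) * r"
      if w: "a \<le> w" "\<bar>z\<bar> \<le> w" and m: "m \<in> {m1, m2}" for w m
    proof -
      have "exp (- m * z) * \<bar>Hk c \<tau> w\<bar> \<le> exp (- m * z) * ((1 / sqrt (2 * pi * \<tau>) + D) * exp (- w\<^sup>2 / (2 * \<tau>)))"
        using H[of w] w a by (intro mult_left_mono) auto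
      also have "\<dots> \<le> exp (m\<^sup>2) * r" unfolding r_def by (rule tail_bound[OF a w \<tau> D])
      also have "\<dots> \<le> G * r" using m r by (intro mult_right_mono) (auto simp: G_def)
      finally have 1: "exp (- m * z) * \<bar>Hk c \<tau> w\<bar> \<le> G * r" .
      have "\<bar>2 * p * exp (m1 * y) * (exp (- k * \<tau> / 2 - m * z) * Hk c \<tau> w)\<bar>
          = 2 * p * exp (m1 * y) * (exp (- k * \<tau> / 2) * (exp (- m * z) * \<bar>Hk c \<tau> w\<bar>))"
      proof -
        have "exp (- k * \<tau> / 2 - m * z) = exp (- k * \<tau> / 2) * exp (- m * z)" by (simp add: exp_add[symmetric])
        then show ?thesis using p by (simp only: abs_mult abs_of_pos abs_exp_cancel mult.assoc zero_less_numeral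
            abs_numeral)
      qed
      also have "\<dots> \<le> 2 * p * E * (exp (\<bar>k\<bar> / 2) * (G * r))"
      proof -
        have gen: "2 * p * u * (v * w) \<le> 2 * p * U * (V * W')"
          if "0 \<le> u" "u \<le> U" "0 \<le> v" "v \<le> V" "0 \<le> w" "w \<le> W'" for u v w U V W' :: real
          using that p by (intro mult_mono mult_nonneg_nonneg) auto
        show ?thesis by (rule gen[OF ey _ ek _ 1]) auto
      qed
      finally show ?thesis by (simp add: mult.assoc)
    qed
    have S: "\<bar>exp (m1 * y) * (exp (- m1\<^sup>2 * \<tau> / 2 - m1 * z) * gk \<tau> w)\<bar> \<le> E * G * r" if w: "a \<le> w" "\<bar>z\<bar> \<le> w" for w
    proof -
      have "gk \<tau> w = 1 / sqrt (2 * pi * \<tau>) * exp (- w\<^sup>2 / (2 * \<tau>))" by (simp add: gk_def)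
      also have "\<dots> \<le> (1 / sqrt (2 * pi * \<tau>) + D) * exp (- w\<^sup>2 / (2 * \<tau>))" using D by (intro mult_right_mono) auto
      finally have "exp (- m1 * z) * gk \<tau> w \<le> exp (- m1 * z) * ((1 / sqrt (2 * pi * \<tau>) + D) * exp (- w\<^sup>2 / (2 * \<tau>)))"
        by (intro mult_left_mono) auto
      also have "\<dots> \<le> exp (m1\<^sup>2) * r" unfolding r_def by (rule tail_bound[OF a w \<tau> D])
      also have "\<dots> \<le> G * r" using r by (intro mult_right_mono) (auto simp: G_def)
      finally have 1: "exp (- m1 * z) * gk \<tau> w \<le> G * r" .
      have g: "0 < gk \<tau> w" by (rule gk_pos[OF \<tau>(1)])
      have "\<bar>exp (m1 * y) * (exp (- m1\<^sup>2 * \<tau> / 2 - m1 * z) * gk \<tau> w)\<bar>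
          = exp (m1 * y) * (exp (- m1\<^sup>2 * \<tau> / 2) * (exp (- m1 * z) * gk \<tau> w))"
      proof -
        have "exp (- m1\<^sup>2 * \<tau> / 2 - m1 * z) = exp (- m1\<^sup>2 * \<tau> / 2) * exp (- m1 * z)" by (simp add: exp_add[symmetric])
        then show ?thesis using g by (simp only: abs_mult abs_of_pos abs_exp_cancel mult.assoc)
      qed
      also have "\<dots> \<le> E * (1 * (G * r))"
      proof -
        have gen: "u * (v * w) \<le> U * (V * W')"
          if "0 \<le> u" "u \<le> U" "0 \<le> v" "v \<le> V" "0 \<le> w" "w \<le> W'" for u v w U V W' :: real
          using that by (intro mult_mono mult_nonneg_nonneg) auto
        show ?thesis by (rule gen[OF ey _ _ _ 1]) (use \<tau> g in auto)
      qed
      finally show ?thesis by (simp add: mult.assoc)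
    qed
    have kern_tail: "kern_tail a R D \<tau> = 2 * p * E * (exp (\<bar>k\<bar> / 2) * G) * r + E * G * r"
      by (simp add: kern_tail_def R_def r_def distrib_right)
    have nnS: "0 \<le> E * G * r" using E r by simp
    show ?thesis
    proof (cases "0 \<le> z")
      case True
      have "kern k p m1 m2 y \<tau> z - kern_main m1 y \<tau> z = 2 * p * exp (m1 * y)
          * (exp (- k * \<tau> / 2 - m1 * z) * Hk c \<tau> (y + z))
         - exp (m1 * y) * (exp (- m1\<^sup>2 * \<tau> / 2 - m1 * z) * gk \<tau> (y + z))"
        using True kern_main_eq[OF \<tau>(1), of m1 y z] by (simp add: kern_def glue_def kpos_def kern_main_def c_def
            right_diff_distrib)
      then show ?thesis using cross[of "y + z" m1] S[of "y + z"] True y a unfolding kern_tail by auto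
    next
      case False
      then have "kern k p m1 m2 y \<tau> z - kern_main m1 y \<tau> z
          = 2 * p * exp (m1 * y) * (exp (- k * \<tau> / 2 - m2 * z) * Hk c \<tau> (y - z))"
        by (simp add: kern_def glue_def kneg_def kern_main_def c_def)
      then show ?thesis using cross[of "y - z" m2] False y a nnS unfolding kern_tail by auto
    qed
  qed
  then show ?thesis using D R by blast
qed

lemma kern_tail_lim: assumes a: "0 < a" shows "(\<lambda>n. kern_tail a R D (1 / real (Suc n))) \<longlonglongrightarrow> 0"
proof -
  have "(\<lambda>n. (1 / sqrt (2 * pi * (1 / real (Suc n))) + D) * exp (- a\<^sup>2 / (4 * (1 / real (Suc n))))) \<longlonglongrightarrow> 0"
  proof -
    have a2: "a\<^sup>2 > 0" using a by simp
    then have "(\<lambda>n. (1 / sqrt (2 * pi * (1 / real (Suc n))) + D) * exp (- A / (4 * (1 / real (Suc n))))) \<longlonglongrightarrow> 0"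
        if "A > 0" for A
      using that by real_asymp
    from this[OF a2] show ?thesis .
  qed
  from tendsto_mult_right_zero[OF this] show ?thesis unfolding kern_tail_def .
qed

lemma kern_main_integral:
  assumes \<tau>: "0 < \<tau>" and z: "0 \<le> z"
  shows "(LBINT y:{a..b}. kern_main m1 y \<tau> z) = (\<integral>u. std_normal_density u
      * indicator {a..b} (z + m1 * \<tau> + sqrt \<tau> * u) \<partial>lborel)"
proof -
  let ?\<mu> = "z + m1 * \<tau>" and ?s = "sqrt \<tau>"
  have s: "?s > 0" using \<tau> by simp
  have "(LBINT y:{a..b}. kern_main m1 y \<tau> z) = \<bar>?s\<bar> *\<^sub>R (\<integral>u. indicator {a..b} (?\<mu> + ?s * u) *\<^sub>R kern_main m1 (?\<mu>
      + ?s * u) \<tau> z \<partial>lborel)"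
    unfolding set_lebesgue_integral_def by (rule lborel_integral_real_affine) (use s in simp)
  also have "\<dots> = (\<integral>u. ?s * (indicator {a..b} (?\<mu> + ?s * u) * kern_main m1 (?\<mu> + ?s * u) \<tau> z) \<partial>lborel)" using s by simp
  also have "\<dots> = (\<integral>u. std_normal_density u * indicator {a..b} (?\<mu> + ?s * u) \<partial>lborel)"
  proof (rule Bochner_Integration.integral_cong[OF refl])
    fix u
    have "?s * normal_density ?\<mu> ?s (?\<mu> + ?s * u) = std_normal_density u"
      using s \<tau> by (simp add: normal_density_def power_mult_distrib real_sqrt_mult)
    then show "?s * (indicator {a..b} (?\<mu> + ?s * u) * kern_main m1 (?\<mu> + ?s * u) \<tau> z)
        = std_normal_density u * indicator {a..b} (?\<mu> + ?s * u)"
      using z by (simp add: kern_main_def indicator_def)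
  qed
  finally show ?thesis .
qed

lemma kern_main_integral_bounds:
  assumes \<tau>: "0 < \<tau>"
  shows "\<bar>LBINT y:{a..b}. kern_main m1 y \<tau> z\<bar> \<le> 1"
proof (cases "0 \<le> z")
  case True
  have i: "integrable lborel std_normal_density" "(\<integral>u. std_normal_density u \<partial>lborel) = 1" by auto
  have "\<bar>\<integral>u. std_normal_density u * indicator {a..b} (z + m1 * \<tau> + sqrt \<tau> * u) \<partial>lborel\<bar>
      \<le> (\<integral>u. \<bar>std_normal_density u * indicator {a..b} (z + m1 * \<tau> + sqrt \<tau> * u)\<bar> \<partial>lborel)"
    by (rule integral_abs_bound)
  also have "\<dots> \<le> (\<integral>u. std_normal_density u \<partial>lborel)"
  proof (rule integral_mono[OF _ i(1)])
    show "integrable lborel (\<lambda>u. \<bar>std_normal_density u * indicator {a..b} (z + m1 * \<tau> + sqrt \<tau> * u)\<bar>)"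
      by (rule Bochner_Integration.integrable_bound[OF i(1)]) (auto simp: indicator_def)
  qed (auto simp: indicator_def)
  finally show ?thesis unfolding kern_main_integral[OF \<tau> True] using i(2) by simp
qed (simp add: kern_main_def set_lebesgue_integral_def)

text \<open>In the standardised variable the normal law concentrates at \<open>z\<close>, so the
  indicator is eventually constant for every \<open>u\<close>. At the end points of the interval
  this fails, hence their exclusion.\<close>

lemma kern_main_integral_lim:
  assumes z: "z \<noteq> a" "z \<noteq> b" and a: "0 < a"
  shows "(\<lambda>n. LBINT y:{a..b}. kern_main m1 y (1 / real (Suc n)) z) \<longlonglongrightarrow> indicator {a..b} z"
proof (cases "0 \<le> z")
  case True
  have i: "integrable lborel std_normal_density" "(\<integral>u. std_normal_density u \<partial>lborel) = 1" by auto
  have "(\<lambda>n. \<integral>u. std_normal_density u * indicator {a..b} (z + m1 * (1 / real (Suc n))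
      + sqrt (1 / real (Suc n)) * u) \<partial>lborel)
     \<longlonglongrightarrow> (\<integral>u. std_normal_density u * indicator {a..b} z \<partial>lborel)"
  proof (rule integral_dominated_convergence[OF _ _ i(1)])
    show "AE u in lborel. (\<lambda>n. std_normal_density u * indicator {a..b} (z + m1 * (1 / real (Suc n))
        + sqrt (1 / real (Suc n)) * u)) \<longlonglongrightarrow> std_normal_density u * indicator {a..b} z"
    proof (intro AE_I2 tendsto_mult tendsto_const)
      fix u :: real
      let ?w = "\<lambda>n. z + m1 * (1 / real (Suc n)) + sqrt (1 / real (Suc n)) * u"
      have w: "?w \<longlonglongrightarrow> z" by real_asymp
      have "eventually (\<lambda>n. indicator {a..b} (?w n) = (indicator {a..b} z :: real)) sequentially"
      proof (cases "z \<in> {a..b}")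
        case True
        then have "a < z" "z < b" using z by auto
        from order_tendstoD(1)[OF w this(1)] order_tendstoD(2)[OF w this(2)]
        show ?thesis by eventually_elim (use True in \<open>auto simp: indicator_def\<close>)
      next
        case False
        then consider "z < a" | "b < z" by force
        then show ?thesis
        proof cases
          case 1
          from order_tendstoD(2)[OF w 1] show ?thesis by eventually_elim (use False in \<open>auto simp: indicator_def\<close>)
        next
          case 2
          from order_tendstoD(1)[OF w 2] show ?thesis by eventually_elim (use False in \<open>auto simp: indicator_def\<close>)
        qed
      qed
      then show "(\<lambda>n. indicator {a..b} (?w n) :: real) \<longlonglongrightarrow> indicator {a..b} z" by (rule tendsto_eventually)
    qed
  qed (auto simp: indicator_def)
  moreover have "(\<integral>u. std_normal_density u * indicator {a..b} z \<partial>lborel) = indicator {a..b} z" using i(2) by simp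
  ultimately show ?thesis using kern_main_integral[OF _ True] by simp
next
  case False
  then show ?thesis using a by (simp add: kern_main_def set_lebesgue_integral_def indicator_def)
qed

lemma kern_main_bound: "0 < \<tau> \<Longrightarrow> \<bar>kern_main m1 y \<tau> z\<bar> \<le> 1 / sqrt (2 * pi * \<tau>)"
proof -
  assume \<tau>: "0 < \<tau>"
  have "normal_density \<mu> (sqrt \<tau>) y \<le> 1 / sqrt (2 * pi * \<tau>)" for \<mu>
    using \<tau> by (simp add: normal_density_def divide_right_mono)
  then show ?thesis using \<tau> by (auto simp: kern_main_def)
qed

text \<open>The kernel inequality is integrated over \<open>y\<close> in \<open>[a, b]\<close>.
  After Fubini, the integral of the short-time kernel tends to the indicator of
  \<open>[a, b]\<close> at \<open>Z\<close>, so the left side becomes the integral of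
  \<open>q\<close> over the interval; on the right the kernel is continuous in time. Interval
  inequalities then give the bound almost everywhere. \<open>Z\<close> is kept general to serve both
  \<open>Y t\<close> and \<open>- Y t\<close>.\<close>

lemma (in prob_space) density_compare:
  fixes Z :: "'a \<Rightarrow> real"
  assumes p: "0 < p" "p < 1" and Z[measurable]: "Z \<in> borel_measurable M" and t: "0 < t"
    and q: "\<And>A. A \<in> sets borel \<Longrightarrow> set_integrable lborel A q"
        "\<And>A. A \<in> sets borel \<Longrightarrow> (LBINT y:A. q y) = prob {\<omega> \<in> space M. Z \<omega> \<in> A}"
    and le: "\<And>y r. 0 < y \<Longrightarrow> 0 < r \<Longrightarrow> \<epsilon> * (\<integral>\<omega>. kern k p m1 m2 y r (Z \<omega>) \<partial>M) \<le> \<epsilon> * kern k p m1 m2 y (t + r) x"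
  shows "AE y in lborel. 0 < y \<longrightarrow> \<epsilon> * q y \<le> \<epsilon> * kern k p m1 m2 y t x"
proof -
  have kc: "continuous_on {0<..} (\<lambda>y. kern k p m1 m2 y s x)" if "0 < s" for s
  proof -
    have "continuous_on {0<..} (\<lambda>y. (\<lambda>q. kern k p m1 m2 (fst q) (snd q) x) (y, s))"
      by (rule continuous_on_compose2[OF kern_time_space_cont]) (use that in \<open>auto intro!: continuous_intros\<close>)
    then show ?thesis by simp
  qed
  have ki: "set_integrable lborel {a..b} (\<lambda>y. kern k p m1 m2 y s x)" if "0 < s" "0 < a" for s a b
    unfolding set_integrable_def
    by (rule borel_integrable_compact) (use that in \<open>auto intro: continuous_on_subset[OF kc]\<close>)
  have main: "\<epsilon> * (LBINT y:{a..b}. q y) \<le> \<epsilon> * (LBINT y:{a..b}. kern k p m1 m2 y t x)" if a: "0 < a" "a \<le> b" for a b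
  proof -
    obtain R D where RD: "0 \<le> R" "0 \<le> D" "\<And>y z \<tau>. y \<in> {a..b} \<Longrightarrow> 0 < \<tau> \<Longrightarrow> \<tau> \<le> 1
        \<Longrightarrow> \<bar>kern k p m1 m2 y \<tau> z - kern_main m1 y \<tau> z\<bar> \<le> kern_tail a R D \<tau>"
      using kern_approx[OF p a(1), of b k m1 m2] by blast
    define \<tau> where "\<tau> n = 1 / real (Suc n)" for n
    have \<tau>: "0 < \<tau> n" "\<tau> n \<le> 1" for n by (auto simp: \<tau>_def)
    define I where "I n z = (LBINT y:{a..b}. kern k p m1 m2 y (\<tau> n) z)" for n z
    define J where "J n z = (LBINT y:{a..b}. kern_main m1 y (\<tau> n) z)" for n z
    have kb: "\<bar>kern k p m1 m2 y (\<tau> n) z\<bar> \<le> kern_tail a R D (\<tau> n) + 1 / sqrt (2 * pi * \<tau> n)" if "y \<in> {a..b}" for y n z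
      using RD(3)[OF that \<tau>, of n z] kern_main_bound[OF \<tau>(1), of m1 y n z] by linarith
    have kmy: "(\<lambda>y. kern k p m1 m2 y (\<tau> n) z) \<in> borel_measurable borel" for n z
      using measurable_compose[OF _ kern_meas[OF \<tau>(1)[of n]], of "\<lambda>y. (z, y)" borel k p m1 m2] by simp
    have mmy: "(\<lambda>y. kern_main m1 y (\<tau> n) z) \<in> borel_measurable borel" for n z
      unfolding kern_main_def by measurable
    have i1: "set_integrable lborel {a..b} (\<lambda>y. kern k p m1 m2 y (\<tau> n) z)" for n z
      by (rule bounded_set_integrable[OF kmy kb])
    have i2: "set_integrable lborel {a..b} (\<lambda>y. kern_main m1 y (\<tau> n) z)" for n z
      by (rule bounded_set_integrable[OF mmy kern_main_bound[OF \<tau>(1)]])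
    have IJ: "\<bar>I n z - J n z\<bar> \<le> kern_tail a R D (\<tau> n) * (b - a)" for n z
    proof -
      have "I n z - J n z = (LBINT y:{a..b}. kern k p m1 m2 y (\<tau> n) z - kern_main m1 y (\<tau> n) z)"
        unfolding I_def J_def by (rule set_integral_diff(2)[OF i1 i2, symmetric])
      then show ?thesis using set_lint_bound[OF a(2) RD(3)[OF _ \<tau>]] by simp
    qed
    have rho0: "(\<lambda>n. kern_tail a R D (\<tau> n)) \<longlonglongrightarrow> 0" unfolding \<tau>_def by (rule kern_tail_lim[OF a(1)])
    \<comment> \<open>A convergent sequence is bounded; this yields a dominating constant for all
      \<open>n\<close> at once.\<close>
    obtain B0 where B0: "\<And>n. \<bar>kern_tail a R D (\<tau> n)\<bar> \<le> B0"
        using rho0 convergent_imp_Bseq[of "\<lambda>n. kern_tail a R D (\<tau> n)"]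
      by (auto simp: convergent_def Bseq_def)
    have Ib: "\<bar>I n z\<bar> \<le> B0 * (b - a) + 1" for n z
    proof -
      have "kern_tail a R D (\<tau> n) * (b - a) \<le> B0 * (b - a)" using B0[of n] a by (intro mult_right_mono) auto
      moreover have "\<bar>J n z\<bar> \<le> 1" unfolding J_def by (rule kern_main_integral_bounds[OF \<tau>(1)])
      ultimately show ?thesis using IJ[of n z] by linarith
    qed
    have Il: "(\<lambda>n. I n z) \<longlonglongrightarrow> indicator {a..b} z" if z: "z \<noteq> a" "z \<noteq> b" for z
    proof -
      have "(\<lambda>n. I n z - J n z) \<longlonglongrightarrow> 0"
        by (rule Lim_null_comparison[OF _ tendsto_mult_left_zero[OF rho0, of "b - a"]]) (use IJ in auto)
      moreover have "(\<lambda>n. J n z) \<longlonglongrightarrow> indicator {a..b} z" unfolding J_def \<tau>_def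
          by (rule kern_main_integral_lim[OF z a(1)])
      ultimately have "(\<lambda>n. (I n z - J n z) + J n z) \<longlonglongrightarrow> 0 + indicator {a..b} z" by (rule tendsto_add)
      then show ?thesis by simp
    qed
    have kj: "(\<lambda>q. kern k p m1 m2 (snd q) (\<tau> n) (Z (fst q))) \<in> borel_measurable (M \<Otimes>\<^sub>M lborel)" for n
      using measurable_compose[OF _ kern_meas[OF \<tau>(1)[of n]], of "\<lambda>q. (Z (fst q), snd q)"
          "M \<Otimes>\<^sub>M lborel" k p m1 m2] by simp
    have kjm: "(\<lambda>(\<omega>, y). indicator {a..b} y *\<^sub>R kern k p m1 m2 y (\<tau> n) (Z \<omega>)) \<in> borel_measurable (M \<Otimes>\<^sub>M lborel)" for n
      using kj[of n] unfolding split_beta' by measurable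
    have Im: "(\<lambda>\<omega>. I n (Z \<omega>)) \<in> borel_measurable M" for n
      unfolding I_def set_lebesgue_integral_def by (rule lborel.borel_measurable_lebesgue_integral[OF kjm])
    interpret P: pair_sigma_finite M lborel ..
    have fub: "(LBINT y:{a..b}. (\<integral>\<omega>. kern k p m1 m2 y (\<tau> n) (Z \<omega>) \<partial>M)) = (\<integral>\<omega>. I n (Z \<omega>) \<partial>M)"
      and ifub: "set_integrable lborel {a..b} (\<lambda>y. \<integral>\<omega>. kern k p m1 m2 y (\<tau> n) (Z \<omega>) \<partial>M)" for n
    proof -
      define C where "C = kern_tail a R D (\<tau> n) + 1 / sqrt (2 * pi * \<tau> n)"
      have ij: "integrable (M \<Otimes>\<^sub>M lborel) (\<lambda>(\<omega>, y). indicator {a..b} y *\<^sub>R kern k p m1 m2 y (\<tau> n) (Z \<omega>))"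
      proof (rule Bochner_Integration.integrable_bound[OF _ kjm])
        have "emeasure (M \<Otimes>\<^sub>M lborel) (space M \<times> {a..b}) = emeasure M (space M) * emeasure lborel {a..b}"
          by (rule lborel.emeasure_pair_measure_Times) auto
        then have "integrable (M \<Otimes>\<^sub>M lborel) (indicator (space M \<times> {a..b}) :: _ \<Rightarrow> real)"
        proof -
          assume "emeasure (M \<Otimes>\<^sub>M lborel) (space M \<times> {a..b}) = emeasure M (space M) * emeasure lborel {a..b}"
          moreover have "space M \<times> {a..b} \<inter> space M \<times> UNIV = space M \<times> {a..b}" by auto
          ultimately show ?thesis
            using a by (subst integrable_indicator_iff) (auto simp: emeasure_space_1 space_pair_measure)
        qed
        then show "integrable (M \<Otimes>\<^sub>M lborel) (\<lambda>q. C * indicator (space M \<times> {a..b}) q)" by simp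
        show "AE q in M \<Otimes>\<^sub>M lborel. norm (case q of (\<omega>, y) \<Rightarrow> indicator {a..b} y *\<^sub>R kern k p m1 m2 y (\<tau> n) (Z \<omega>))
            \<le> norm (C * indicator (space M \<times> {a..b}) q)"
        proof (rule AE_I2)
          fix q assume q: "q \<in> space (M \<Otimes>\<^sub>M (lborel :: real measure))"
          obtain \<omega> y where qe: "q = (\<omega>, y)" by (cases q)
          have "\<omega> \<in> space M" using q qe by (simp add: space_pair_measure)
          then show "norm (case q of (\<omega>, y) \<Rightarrow> indicator {a..b} y *\<^sub>R kern k p m1 m2 y (\<tau> n) (Z \<omega>))
              \<le> norm (C * indicator (space M \<times> {a..b}) q)"
            using kb[of y n "Z \<omega>"] by (cases "y \<in> {a..b}") (auto simp: qe C_def)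
        qed
      qed
      have sw: "(\<integral>\<omega>. indicator {a..b} y *\<^sub>R kern k p m1 m2 y (\<tau> n) (Z \<omega>) \<partial>M)
          = indicator {a..b} y *\<^sub>R (\<integral>\<omega>. kern k p m1 m2 y (\<tau> n) (Z \<omega>) \<partial>M)" for y
        by simp
      show "(LBINT y:{a..b}. (\<integral>\<omega>. kern k p m1 m2 y (\<tau> n) (Z \<omega>) \<partial>M)) = (\<integral>\<omega>. I n (Z \<omega>) \<partial>M)"
        unfolding set_lebesgue_integral_def sw[symmetric] I_def by (rule P.Fubini_integral[OF ij])
      show "set_integrable lborel {a..b} (\<lambda>y. \<integral>\<omega>. kern k p m1 m2 y (\<tau> n) (Z \<omega>) \<partial>M)"
        unfolding set_integrable_def sw[symmetric] by (rule P.integrable_snd[OF ij])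
    qed
    have step: "\<epsilon> * (\<integral>\<omega>. I n (Z \<omega>) \<partial>M) \<le> \<epsilon> * (LBINT y:{a..b}. kern k p m1 m2 y (t + \<tau> n) x)" for n
    proof -
      have "(LBINT y:{a..b}. \<epsilon> * (\<integral>\<omega>. kern k p m1 m2 y (\<tau> n) (Z \<omega>) \<partial>M))
          \<le> (LBINT y:{a..b}. \<epsilon> * kern k p m1 m2 y (t + \<tau> n) x)"
        using ifub[of n] ki[of "t + \<tau> n" a b] t \<tau>(1)[of n] a le
        by (intro set_integral_mono set_integrable_mult_right) auto
      then show ?thesis using fub[of n] by simp
    qed
    have lim1: "(\<lambda>n. \<integral>\<omega>. I n (Z \<omega>) \<partial>M) \<longlonglongrightarrow> (\<integral>\<omega>. indicator {a..b} (Z \<omega>) \<partial>M)"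
    proof (rule integral_dominated_convergence[where w="\<lambda>_. B0 * (b - a) + 1"])
      \<comment> \<open>\<open>Z\<close> has the density \<open>q\<close> and so does not charge the
        end points, where \<open>Il\<close> says nothing.\<close>
      have na: "AE \<omega> in M. Z \<omega> \<noteq> c" for c
      proof -
        have "(LBINT y:{c}. q y) = 0"
          unfolding set_lebesgue_integral_def
          by (rule integral_eq_zero_AE) (use AE_lborel_singleton[of c] in \<open>eventually_elim, auto simp: indicator_def\<close>)
        then have "prob {\<omega> \<in> space M. Z \<omega> \<in> {c}} = 0" using q(2)[of "{c}"] by simp
        then show ?thesis by (subst (asm) prob_eq_0) auto
      qed
      show "AE \<omega> in M. (\<lambda>n. I n (Z \<omega>)) \<longlonglongrightarrow> indicator {a..b} (Z \<omega>)"
        using na[of a] na[of b] by eventually_elim (rule Il)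
      show "AE \<omega> in M. norm (I n (Z \<omega>)) \<le> B0 * (b - a) + 1" for n using Ib by (intro AE_I2) auto
    qed (use Im in auto)
    have "(\<integral>\<omega>. indicator {a..b} (Z \<omega>) \<partial>M) = (LBINT y:{a..b}. q y)"
    proof -
      have "(\<integral>\<omega>. indicator {a..b} (Z \<omega>) \<partial>M) = (\<integral>\<omega>. indicator {\<omega> \<in> space M. Z \<omega> \<in> {a..b}} \<omega> \<partial>M)"
        by (intro Bochner_Integration.integral_cong) (auto simp: indicator_def)
      also have "\<dots> = prob {\<omega> \<in> space M. Z \<omega> \<in> {a..b}}" by simp
      finally show ?thesis using q(2)[of "{a..b}"] by simp
    qed
    note lim1 = lim1[unfolded this]
    have lim2: "(\<lambda>n. LBINT y:{a..b}. kern k p m1 m2 y (t + \<tau> n) x) \<longlonglongrightarrow> (LBINT y:{a..b}. kern k p m1 m2 y t x)"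
    proof -
      have "compact ((\<lambda>q. kern k p m1 m2 (fst q) (snd q) x) ` ({a..b} \<times> {t..t+1}))"
        by (rule compact_continuous_image[OF continuous_on_subset[OF kern_time_space_cont]])
            (use a t in \<open>auto intro!: compact_Times\<close>)
      from compact_imp_bounded[OF this] obtain C where
        C': "\<forall>v\<in>(\<lambda>q. kern k p m1 m2 (fst q) (snd q) x) ` ({a..b} \<times> {t..t+1}). norm v \<le> C"
        unfolding bounded_iff by blast
      have C: "\<bar>kern k p m1 m2 y s x\<bar> \<le> C" if "y \<in> {a..b}" "s \<in> {t..t+1}" for y s
        using C'[rule_format, OF imageI, of "(y, s)"] that by simp
      have tl: "(\<lambda>n. t + \<tau> n) \<longlonglongrightarrow> t" unfolding \<tau>_def by real_asymp
      show ?thesis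
        unfolding set_lebesgue_integral_def
      proof (rule integral_dominated_convergence[where w="\<lambda>y. indicator {a..b} y *\<^sub>R C"])
        show "integrable lborel (\<lambda>y. indicator {a..b} y *\<^sub>R C)" using a by (auto simp: integrable_indicator_iff)
        show "(\<lambda>y. indicator {a..b} y *\<^sub>R kern k p m1 m2 y t x) \<in> borel_measurable lborel"
          using ki[OF t a(1), of b] by (simp add: set_integrable_def borel_measurable_integrable)
        show "(\<lambda>y. indicator {a..b} y *\<^sub>R kern k p m1 m2 y (t + \<tau> n) x) \<in> borel_measurable lborel" for n
          using ki[OF _ a(1), of "t + \<tau> n" b] t \<tau>(1)[of n]
              by (simp add: set_integrable_def borel_measurable_integrable)
        show "AE y in lborel. (\<lambda>n. indicator {a..b} y *\<^sub>R kern k p m1 m2 y (t + \<tau> n) x)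
            \<longlonglongrightarrow> indicator {a..b} y *\<^sub>R kern k p m1 m2 y t x"
        proof (rule AE_I2)
          fix y
          show "(\<lambda>n. indicator {a..b} y *\<^sub>R kern k p m1 m2 y (t + \<tau> n) x) \<longlonglongrightarrow> indicator {a..b} y *\<^sub>R kern k p m1 m2 y t x"
          proof (cases "y \<in> {a..b}")
            case True
            have "(\<lambda>n. kern k p m1 m2 (fst (y, t + \<tau> n)) (snd (y, t + \<tau> n)) x)
                \<longlonglongrightarrow> kern k p m1 m2 (fst (y, t)) (snd (y, t)) x"
              by (rule continuous_on_tendsto_compose[OF kern_time_space_cont tendsto_Pair[OF tendsto_const tl]])
                (use True a t add_pos_pos[OF t \<tau>(1)] in auto)
            then show ?thesis using True by simp
          qed simp
        qed
        show "AE y in lborel. norm (indicator {a..b} y *\<^sub>R kern k p m1 m2 y (t + \<tau> n) x)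
            \<le> indicator {a..b} y *\<^sub>R C" for n
          using C[of _ "t + \<tau> n"] \<tau>[of n] by (intro AE_I2) (auto simp: indicator_def)
      qed
    qed
    show ?thesis
      by (rule LIMSEQ_le[OF tendsto_mult[OF tendsto_const lim1] tendsto_mult[OF tendsto_const lim2]])
          (use step in auto)
  qed
  have "AE y in lborel. 0 < y \<longrightarrow> 0 \<le> \<epsilon> * kern k p m1 m2 y t x - \<epsilon> * q y"
  proof (rule AE_nonneg_if_interval_integrals_nonneg)
    fix a b :: real assume a: "0 < a" "a \<le> b"
    have j: "set_integrable lborel {a..b} (\<lambda>y. \<epsilon> * kern k p m1 m2 y t x)" "set_integrable lborel {a..b} (\<lambda>y. \<epsilon> * q y)"
      using ki[OF t a(1), of b] q(1)[of "{a..b}"] by auto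
    show "set_integrable lborel {a..b} (\<lambda>y. \<epsilon> * kern k p m1 m2 y t x - \<epsilon> * q y)"
      by (rule set_integral_diff(1)[OF j])
    show "0 \<le> (LBINT y:{a..b}. \<epsilon> * kern k p m1 m2 y t x - \<epsilon> * q y)"
      using main[OF a] by (simp add: set_integral_diff(2)[OF j])
  qed
  then show ?thesis by eventually_elim simp
qed

section \<open>From the stochastic equation to \<open>skew_core\<close>\<close>

lemma Rats_between: "a < b \<Longrightarrow> \<exists>r\<in>\<rat>. a < r \<and> r < (b::real)"
  using Rats_dense_in_real by blast

text \<open>The limit of occupation times exists outside a null set that depends on the time, so
  only countably many times can be used along one path. At rational times monotonicity and flatness
  pass from the occupation times to the limit; continuity of \<open>w\<close> extends them to all
  times.\<close>

lemma local_time_limit_path: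
  fixes y w :: "real \<Rightarrow> real"
  assumes cy: "continuous_on UNIV y" and cw: "continuous_on UNIV w" and c: "0 \<le> \<sigma> * c"
    and lim: "\<And>q. q \<in> \<rat> \<Longrightarrow> 0 \<le> q \<Longrightarrow>
      ((\<lambda>\<epsilon>. c * (1 / (2 * \<epsilon>) * (LBINT s:{0..q}. indicator {-\<epsilon>..\<epsilon>} (y s)))) \<longlongrightarrow> w q) (at_right 0)"
  shows "0 \<le> u \<Longrightarrow> u \<le> v \<Longrightarrow> \<sigma> * w u \<le> \<sigma> * w v"
    and "0 \<le> u \<Longrightarrow> u \<le> v \<Longrightarrow> (\<And>r. r \<in> {u..v} \<Longrightarrow> y r \<noteq> 0) \<Longrightarrow> w u = w v"
proof -
  have my: "y \<in> borel_measurable borel" using cy by (rule borel_measurable_continuous_onI)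
  define occ where "occ q \<epsilon> = (LBINT s:{0..q}. indicator {-\<epsilon>..\<epsilon>} (y s) :: real)" for q \<epsilon>
  have occ_m: "(\<lambda>s. indicator {-\<epsilon>..\<epsilon>} (y s) :: real) \<in> borel_measurable borel" for \<epsilon>
    using my by measurable
  have occ_split: "occ v \<epsilon> = occ u \<epsilon> + (LBINT s:{u..v}. indicator {-\<epsilon>..\<epsilon>} (y s))" if "0 \<le> u" "u \<le> v" for u v \<epsilon>
    unfolding occ_def by (rule set_lint_split[of _ 1]) (use occ_m that in \<open>auto simp: indicator_def\<close>)
  have occ_mono: "occ u \<epsilon> \<le> occ v \<epsilon>" if "0 \<le> u" "u \<le> v" for u v \<epsilon>
  proof -
    have "0 \<le> (LBINT s:{u..v}. indicator {-\<epsilon>..\<epsilon>} (y s) :: real)"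
      unfolding set_lebesgue_integral_def by (intro Bochner_Integration.integral_nonneg) (auto simp: indicator_def)
    then show ?thesis using occ_split[OF that, of \<epsilon>] by simp
  qed
  have lim': "((\<lambda>\<epsilon>. c * (1 / (2 * \<epsilon>) * occ q \<epsilon>)) \<longlongrightarrow> w q) (at_right 0)" if "q \<in> \<rat>" "0 \<le> q" for q
    unfolding occ_def by (rule lim[OF that])
  have near: "\<exists>d>0. \<forall>r. \<bar>r - t\<bar> < d \<longrightarrow> \<bar>w r - w t\<bar> < e" if "0 < e" for t e
  proof -
    have "isCont w t" using cw by (simp add: continuous_on_eq_continuous_at)
    then show ?thesis using that unfolding continuous_at_eps_delta by (auto simp: dist_real_def)
  qed
  have ratm: "\<sigma> * w u \<le> \<sigma> * w v" if "u \<in> \<rat>" "v \<in> \<rat>" "0 \<le> u" "u \<le> v" for u v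
  proof (rule tendsto_le)
    show "((\<lambda>\<epsilon>. \<sigma> * (c * (1 / (2 * \<epsilon>) * occ v \<epsilon>))) \<longlongrightarrow> \<sigma> * w v) (at_right 0)"
      by (rule tendsto_mult[OF tendsto_const lim'[OF that(2)]]) (use that in simp)
    show "((\<lambda>\<epsilon>. \<sigma> * (c * (1 / (2 * \<epsilon>) * occ u \<epsilon>))) \<longlongrightarrow> \<sigma> * w u) (at_right 0)"
      by (rule tendsto_mult[OF tendsto_const lim'[OF that(1,3)]])
    show "eventually (\<lambda>\<epsilon>. \<sigma> * (c * (1 / (2 * \<epsilon>) * occ u \<epsilon>)) \<le> \<sigma> * (c * (1 / (2 * \<epsilon>) * occ v \<epsilon>))) (at_right 0)"
      using eventually_at_right_less[of 0]
    proof eventually_elim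
      case (elim \<epsilon>)
      have "1 / (2 * \<epsilon>) * occ u \<epsilon> \<le> 1 / (2 * \<epsilon>) * occ v \<epsilon>" using occ_mono[OF that(3,4), of \<epsilon>] elim
          by (intro mult_left_mono) auto
      then have "(\<sigma> * c) * (1 / (2 * \<epsilon>) * occ u \<epsilon>) \<le> (\<sigma> * c) * (1 / (2 * \<epsilon>) * occ v \<epsilon>)" using c
          by (rule mult_left_mono)
      then show ?case by (simp only: mult.assoc)
    qed
  qed simp
  have ratf: "w u = w v" if uv: "u \<in> \<rat>" "v \<in> \<rat>" "0 \<le> u" "u \<le> v" and nz: "\<And>r. r \<in> {u..v} \<Longrightarrow> y r \<noteq> 0" for u v
  proof -
    have "continuous_on {u..v} (\<lambda>r. \<bar>y r\<bar>)" using cy by (intro continuous_intros) (auto intro: continuous_on_subset)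
    \<comment> \<open>By compactness \<open>y\<close> stays away from 0 on the interval; once
      \<open>\<epsilon>\<close> is below the minimum of \<open>\<bar>y\<bar>\<close>, no occupation
      time is gained there.\<close>
    then obtain r0 where r0: "r0 \<in> {u..v}" "\<And>r. r \<in> {u..v} \<Longrightarrow> \<bar>y r0\<bar> \<le> \<bar>y r\<bar>"
      using continuous_attains_inf[of "{u..v}" "\<lambda>r. \<bar>y r\<bar>"] uv by auto
    have m: "0 < \<bar>y r0\<bar>" using nz[OF r0(1)] by simp
    have "eventually (\<lambda>\<epsilon>. \<epsilon> < \<bar>y r0\<bar>) (at_right 0)" using eventually_at_right_real[OF m] by eventually_elim auto
    then have "eventually (\<lambda>\<epsilon>. c * (1 / (2 * \<epsilon>) * occ u \<epsilon>) = c * (1 / (2 * \<epsilon>) * occ v \<epsilon>)) (at_right 0)"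
    proof eventually_elim
      case (elim \<epsilon>)
      have "(LBINT s:{u..v}. indicator {-\<epsilon>..\<epsilon>} (y s) :: real) = (LBINT s:{u..v}. 0)"
      proof (rule set_lebesgue_integral_cong)
        show "\<forall>s. s \<in> {u..v} \<longrightarrow> indicator {-\<epsilon>..\<epsilon>} (y s) = (0::real)"
          using r0(2) elim by (force simp: indicator_def)
      qed simp
      then show ?case using occ_split[OF uv(3,4), of \<epsilon>] by (simp add: set_lebesgue_integral_def)
    qed
    from Lim_transform_eventually[OF lim'[of u] this] uv have
        "((\<lambda>\<epsilon>. c * (1 / (2 * \<epsilon>) * occ v \<epsilon>)) \<longlongrightarrow> w u) (at_right 0)" by simp
    moreover have "((\<lambda>\<epsilon>. c * (1 / (2 * \<epsilon>) * occ v \<epsilon>)) \<longlongrightarrow> w v) (at_right 0)" using lim'[of v] uv by simp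
    ultimately show ?thesis by (intro tendsto_unique[OF _ _ _]) auto
  qed
  show "\<sigma> * w u \<le> \<sigma> * w v" if uv: "0 \<le> u" "u \<le> v"
  proof (cases "u = v")
    case False
    then have uv': "u < v" using uv by simp
    show ?thesis
    proof (rule field_le_epsilon)
      fix e :: real assume e: "0 < e"
      define e' where "e' = e / (2 * (\<bar>\<sigma>\<bar> + 1))"
      have s1: "\<bar>\<sigma>\<bar> + 1 > 0" by simp
      have e': "0 < e'" using e s1 by (simp add: e'_def)
      have se: "\<bar>\<sigma>\<bar> * e' \<le> e / 2"
      proof -
        have "\<bar>\<sigma>\<bar> * e' \<le> (\<bar>\<sigma>\<bar> + 1) * e'" using e' by (intro mult_right_mono) auto
        also have "\<dots> = e / 2" using s1 unfolding e'_def by (simp add: field_simps)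
        finally show ?thesis .
      qed
      obtain d1 where d1: "d1 > 0" "\<And>r. \<bar>r - u\<bar> < d1 \<Longrightarrow> \<bar>w r - w u\<bar> < e'" using near[OF e'] by blast
      obtain d2 where d2: "d2 > 0" "\<And>r. \<bar>r - v\<bar> < d2 \<Longrightarrow> \<bar>w r - w v\<bar> < e'" using near[OF e'] by blast
      \<comment> \<open>The rational approximants lie to the right of \<open>u\<close> and of
        \<open>v\<close>, with \<open>u' < v < v'\<close>; so they are nonnegative and in the right
        order.\<close>
      obtain u' where u': "u' \<in> \<rat>" "u < u'" "u' < min (u + d1) v"
          using Rats_between[of u "min (u + d1) v"] d1 uv' by auto
      obtain v' where v': "v' \<in> \<rat>" "v < v'" "v' < v + d2" using Rats_between[of v "v + d2"] d2 by auto
      have 1: "\<sigma> * w u' \<le> \<sigma> * w v'" using u' v' uv by (intro ratm) auto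
      have "\<bar>w u' - w u\<bar> < e'" by (rule d1(2)) (use u' in auto)
      then have "\<bar>\<sigma> * (w u' - w u)\<bar> \<le> \<bar>\<sigma>\<bar> * e'" unfolding abs_mult by (intro mult_left_mono) auto
      moreover have "\<bar>w v' - w v\<bar> < e'" by (rule d2(2)) (use v' in auto)
      then have "\<bar>\<sigma> * (w v' - w v)\<bar> \<le> \<bar>\<sigma>\<bar> * e'" unfolding abs_mult by (intro mult_left_mono) auto
      ultimately show "\<sigma> * w u \<le> \<sigma> * w v + e" using 1 se unfolding right_diff_distrib by linarith
    qed
  qed simp
  show "w u = w v" if uv: "0 \<le> u" "u \<le> v" and nz: "\<And>r. r \<in> {u..v} \<Longrightarrow> y r \<noteq> 0"
  proof (cases "u = v")
    case False
    then have uv': "u < v" using uv by simp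
    have "\<bar>w u - w v\<bar> \<le> 0"
    proof (rule field_le_epsilon)
      fix e :: real assume e: "0 < e"
      have e': "0 < e / 2" using e by simp
      obtain d1 where d1: "d1 > 0" "\<And>r. \<bar>r - u\<bar> < d1 \<Longrightarrow> \<bar>w r - w u\<bar> < e / 2" using near[OF e'] by blast
      obtain d2 where d2: "d2 > 0" "\<And>r. \<bar>r - v\<bar> < d2 \<Longrightarrow> \<bar>w r - w v\<bar> < e / 2" using near[OF e'] by blast
      \<comment> \<open>Now both approximants are taken inside the interval, where \<open>y\<close>
        has no zero.\<close>
      obtain u' where u': "u' \<in> \<rat>" "u < u'" "u' < min (u + d1) v"
          using Rats_between[of u "min (u + d1) v"] d1 uv' by auto
      obtain v' where v': "v' \<in> \<rat>" "max u' (v - d2) < v'" "v' < v"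
          using Rats_between[of "max u' (v - d2)" v] d2 u' by auto
      have 1: "w u' = w v'" using u' v' uv by (intro ratf nz) auto
      have "\<bar>w u' - w u\<bar> < e / 2" by (rule d1(2)) (use u' in auto)
      moreover have "\<bar>w v' - w v\<bar> < e / 2" by (rule d2(2)) (use v' in auto)
      ultimately show "\<bar>w u - w v\<bar> \<le> 0 + e" using 1 by linarith
    qed
    then show ?thesis by simp
  qed simp
qed

lemma drift_meas: "two_valued_drift m1 m2 \<in> borel_measurable borel"
  unfolding two_valued_drift_def[abs_def] by measurable

lemma drift_bound: "\<bar>two_valued_drift m1 m2 z\<bar> \<le> \<bar>m1\<bar> + \<bar>m2\<bar>"
  unfolding two_valued_drift_def by (auto simp: indicator_def)

context skew_bm_two_valued_drift begin

text \<open>By the equation and \<open>B 0 = 0\<close>, the corrector agrees almost surely with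
  \<open>(2 * p - 1) * L\<close> at all times, hence it inherits the limit of occupation times. Its
  continuity holds on every path, because it is composed of \<open>Y\<close>, \<open>B\<close> and a
  Lipschitz time integral; together with the rational times this gives monotonicity and
  flatness.\<close>

lemma skew_core_extension:
  assumes no_atom: "\<And>t z. 0 < t \<Longrightarrow> AE \<omega> in M. Y t \<omega> \<noteq> z"
  shows "skew_core M F (\<lambda>t. B (max 0 t)) (\<lambda>t. Y (max 0 t)) (two_valued_drift m1 m2) (\<bar>m1\<bar> + \<bar>m2\<bar>) x p (if 0
      \<le> 2 * p - 1 then 1 else -1)"
proof -
  let ?B = "\<lambda>t. B (max 0 t)" and ?Y = "\<lambda>t. Y (max 0 t)" and ?b = "two_valued_drift m1 m2"
  let ?\<sigma> = "if 0 \<le> 2 * p - 1 then 1 else -1 :: real"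
  define W where "W = drift_corrector ?B ?Y ?b"
  have ext: "continuous_on UNIV (\<lambda>t. f (max 0 t))" if "continuous_on {0..} f" for f :: "real \<Rightarrow> real"
    by (rule continuous_on_compose2[OF that]) (auto intro!: continuous_intros)
  have cY: "continuous_on UNIV (\<lambda>t. ?Y t \<omega>)" and cB: "continuous_on UNIV (\<lambda>t. ?B t \<omega>)" if "\<omega> \<in> space M" for \<omega>
    using ext[OF Y_continuous[OF that]] ext[OF B_continuous[OF that]] by auto
  have icong_b: "(LBINT s:{0..t}. ?b (?Y s \<omega>)) = (LBINT s:{0..t}. ?b (Y s \<omega>))" for t \<omega>
    by (rule set_lebesgue_integral_cong) auto
  have icong_i: "(LBINT s:{0..t}. indicator {-e..e} (?Y s \<omega>))
      = (LBINT s:{0..t}. indicator {-e..e} (Y s \<omega>) :: real)" for t e \<omega>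
    by (rule set_lebesgue_integral_cong) auto
  have W_eq: "AE \<omega> in M. \<forall>t\<ge>0. W t \<omega> = (2 * p - 1) * L t \<omega>"
    using Y_sde B_zero
  proof eventually_elim
    case (elim \<omega>)
    show ?case
    proof (intro allI impI)
      fix t :: real assume t: "0 \<le> t"
      then have "Y t \<omega> = Y 0 \<omega> + B t \<omega> + (LBINT s:{0..t}. ?b (Y s \<omega>)) + (2 * p - 1) * L t \<omega>"
        using elim(1) by blast
      then show "W t \<omega> = (2 * p - 1) * L t \<omega>"
        unfolding W_def drift_corrector_def icong_b using t elim(2) by simp
    qed
  qed
  have W_loc: "AE \<omega> in M. ((\<lambda>\<epsilon>. (2 * p - 1) * (1 / (2 * \<epsilon>)
      * (LBINT s:{0..t}. indicator {-\<epsilon>..\<epsilon>} (?Y s \<omega>)))) \<longlongrightarrow> W t \<omega>) (at_right 0)" if t: "t \<ge> 0" for t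
  proof -
    have "AE \<omega> in M. ((\<lambda>\<epsilon>. 1 / (2 * \<epsilon>) * (LBINT s:{0..t}. indicator {-\<epsilon>..\<epsilon>} (Y s \<omega>))) \<longlongrightarrow> L t \<omega>) (at_right 0)"
      using L_local_time t unfolding is_symmetric_local_time_def by blast
    then show ?thesis using W_eq
    proof eventually_elim
      case (elim \<omega>)
      have "W t \<omega> = (2 * p - 1) * L t \<omega>" using elim(2) t by blast
      then show ?case unfolding icong_i
        using tendsto_mult[OF tendsto_const elim(1), of "2 * p - 1"] by (simp only:)
    qed
  qed
  have "AE \<omega> in M. \<forall>q\<in>\<rat> \<inter> {0..}. ((\<lambda>\<epsilon>. (2 * p - 1) * (1 / (2 * \<epsilon>)
      * (LBINT s:{0..q}. indicator {-\<epsilon>..\<epsilon>} (?Y s \<omega>)))) \<longlongrightarrow> W q \<omega>) (at_right 0)"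
    by (subst AE_ball_countable) (use W_loc countable_rat in auto)
  then have path: "AE \<omega> in M. (\<forall>u v. 0 \<le> u \<longrightarrow> u \<le> v \<longrightarrow> ?\<sigma> * W u \<omega> \<le> ?\<sigma> * W v \<omega>) \<and>
     (\<forall>u v. 0 \<le> u \<longrightarrow> u \<le> v \<longrightarrow> (\<forall>r\<in>{u..v}. ?Y r \<omega> \<noteq> 0) \<longrightarrow> W u \<omega> = W v \<omega>)"
    using AE_space
  proof eventually_elim
    case (elim \<omega>)
    note w = elim(2)
    have pm: "(\<lambda>r. ?b (?Y r \<omega>)) \<in> borel_measurable borel"
      using measurable_compose[OF borel_measurable_continuous_onI[OF cY[OF w]] drift_meas] .
    define w where "w t = W (max 0 t) \<omega>" for t
    define I where "I t = (LBINT r:{0..max 0 t}. ?b (?Y r \<omega>))" for t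
    have Il: "\<bar>I v - I u\<bar> \<le> (\<bar>m1\<bar> + \<bar>m2\<bar>) * \<bar>v - u\<bar>" if uv: "u \<le> v" for u v
    proof -
      have "I v = I u + (LBINT r:{max 0 u..max 0 v}. ?b (?Y r \<omega>))"
        unfolding I_def by (rule set_lint_split[OF pm drift_bound]) (use uv in auto)
      moreover have "\<bar>LBINT r:{max 0 u..max 0 v}. ?b (?Y r \<omega>)\<bar> \<le> (\<bar>m1\<bar> + \<bar>m2\<bar>) * (max 0 v - max 0 u)"
        by (rule set_lint_bound) (use uv drift_bound in auto)
      moreover have "(\<bar>m1\<bar> + \<bar>m2\<bar>) * (max 0 v - max 0 u) \<le> (\<bar>m1\<bar> + \<bar>m2\<bar>) * \<bar>v - u\<bar>"
        using uv by (intro mult_left_mono) auto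
      ultimately show ?thesis by linarith
    qed
    have "(\<bar>m1\<bar> + \<bar>m2\<bar>)-lipschitz_on UNIV I"
    proof (rule lipschitz_onI)
      fix u v show "dist (I u) (I v) \<le> (\<bar>m1\<bar> + \<bar>m2\<bar>) * dist u v"
        using Il[of u v] Il[of v u] by (cases "u \<le> v") (auto simp: dist_real_def abs_minus_commute)
    qed simp
    then have cI: "continuous_on UNIV I" by (rule lipschitz_on_continuous_on)
    have weq: "w = (\<lambda>t. ?Y t \<omega> - Y 0 \<omega> - (?B t \<omega> - B 0 \<omega>) - I t)"
      by (auto simp: w_def W_def drift_corrector_def I_def fun_eq_iff)
    have cw: "continuous_on UNIV w" unfolding weq by (intro continuous_intros cI cY cB \<open>\<omega> \<in> space M\<close>)
    have c: "0 \<le> ?\<sigma> * (2 * p - 1)" by auto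
    have lim: "((\<lambda>\<epsilon>. (2 * p - 1) * (1 / (2 * \<epsilon>) * (LBINT s:{0..q}. indicator {-\<epsilon>..\<epsilon>} (?Y s \<omega>)))) \<longlongrightarrow> w q) (at_right 0)"
      if "q \<in> \<rat>" "0 \<le> q" for q using elim(1) that by (simp add: w_def)
    show ?case
    proof (intro conjI allI impI)
      fix u v :: real assume uv: "0 \<le> u" "u \<le> v"
      have "?\<sigma> * w u \<le> ?\<sigma> * w v"
        by (rule local_time_limit_path(1)[OF cY[OF \<open>\<omega> \<in> space M\<close>] cw c _ uv]) (rule lim)
      then show "?\<sigma> * W u \<omega> \<le> ?\<sigma> * W v \<omega>" using uv by (simp add: w_def)
      assume nz: "\<forall>r\<in>{u..v}. ?Y r \<omega> \<noteq> 0"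
      have "w u = w v"
        by (rule local_time_limit_path(2)[OF cY[OF \<open>\<omega> \<in> space M\<close>] cw c _ uv]) (use lim nz in blast)+
      then show "W u \<omega> = W v \<omega>" using uv by (simp add: w_def)
    qed
  qed
  show ?thesis
  proof unfold_locales
    show "subalgebra M (F t)" if "t \<ge> 0" for t by (rule sub[OF that])
    show "?Y t \<in> borel_measurable (F t)" if "t \<ge> 0" for t using Y_adapted[OF that] that by simp
    show "?B t \<in> borel_measurable (F t)" if "t \<ge> 0" for t using B_adapted[OF that] that by simp
    show "distributed M lborel (\<lambda>\<omega>. ?B t \<omega> - ?B s \<omega>) (normal_density 0 (sqrt (t - s)))" if "0 \<le> s" "s < t" for s t
      using B_increment[OF that] that by simp
    show "indep_set (sets (F s)) {(\<lambda>\<omega>. ?B t \<omega> - ?B s \<omega>) -` A \<inter> space M |A. A \<in> sets borel}" if "0 \<le> s" "s < t" for s t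
      using B_indep[OF that] that by simp
    show "AE \<omega> in M. ?Y 0 \<omega> = x" using Y_start by simp
    show "AE \<omega> in M. ?Y t \<omega> \<noteq> z" if "0 < t" for t z using no_atom[OF that] that by simp
    show "AE \<omega> in M. \<forall>u v. 0 \<le> u \<longrightarrow> u \<le> v \<longrightarrow> ?\<sigma> * drift_corrector ?B ?Y ?b u \<omega> \<le> ?\<sigma> * drift_corrector ?B ?Y ?b v \<omega>"
      using path unfolding W_def by eventually_elim blast
    show "AE \<omega> in M. \<forall>u v. 0 \<le> u \<longrightarrow> u \<le> v \<longrightarrow> (\<forall>r\<in>{u..v}. ?Y r \<omega> \<noteq> 0) \<longrightarrow> drift_corrector ?B ?Y ?b u \<omega>
        = drift_corrector ?B ?Y ?b v \<omega>"
      using path unfolding W_def by eventually_elim blast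
    show "AE \<omega> in M. ((\<lambda>\<epsilon>. (2 * p - 1) * (1 / (2 * \<epsilon>) * (LBINT s:{0..t}. indicator {-\<epsilon>..\<epsilon>} (?Y s \<omega>)))) \<longlongrightarrow>
        drift_corrector ?B ?Y ?b t \<omega>) (at_right 0)" if "t \<ge> 0" for t
      using W_loc[OF that] unfolding W_def .
  qed (use cY cB drift_meas drift_bound in auto)
qed

text \<open>The density enters twice: it excludes atoms at all positive times, which makes
  \<open>skew_core\<close> available, and it is compared with the kernel. For \<open>y < 0\<close>
  the comparison is made for \<open>- Y t\<close>, whose density is \<open>q t (- y)\<close>, and
  carried back by the reflection invariance of Lebesgue measure.\<close>

lemma density_bounds:
  assumes p: "0 < p" "p < 1" and t: "0 < t"
    and d: "\<And>s A. 0 < s \<Longrightarrow> A \<in> sets borel \<Longrightarrow> set_integrable lborel A (q s) \<and> (LBINT y:A. q s y)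
        = measure M {\<omega> \<in> space M. Y s \<omega> \<in> A}"
    and \<epsilon>: "\<epsilon> \<in> {-1, 1::real}" and k: "\<epsilon> * (k - m1\<^sup>2) \<le> 0" "\<epsilon> * (k - m2\<^sup>2) \<le> 0"
  shows "AE y in lborel. 0 < y \<longrightarrow> \<epsilon> * q t y \<le> \<epsilon> * kern k p m1 m2 y t x"
    and "AE y in lborel. y < 0 \<longrightarrow> \<epsilon> * q t y \<le> \<epsilon> * kern k (1 - p) (- m2) (- m1) (- y) t (- x)"
proof -
  have YM: "Y s \<in> borel_measurable M" if "0 \<le> s" for s
    using Y_adapted[OF that] sub[OF that] measurable_from_subalg by blast
  have no_atom: "AE \<omega> in M. Y s \<omega> \<noteq> z" if s: "0 < s" for s z
  proof -
    have "(LBINT y:{z}. q s y) = 0"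
      unfolding set_lebesgue_integral_def
      by (rule integral_eq_zero_AE) (use AE_lborel_singleton[of z] in \<open>eventually_elim, auto simp: indicator_def\<close>)
    then have "prob {\<omega> \<in> space M. Y s \<omega> \<in> {z}} = 0" using d[OF s, of "{z}"] by simp
    moreover have "{\<omega> \<in> space M. Y s \<omega> \<in> {z}} \<in> events"
    proof -
      note [measurable] = YM[OF less_imp_le[OF s]]
      show ?thesis by measurable
    qed
    ultimately show ?thesis by (subst (asm) prob_eq_0) auto
  qed
  interpret C: skew_core M F "\<lambda>t. B (max 0 t)" "\<lambda>t. Y (max 0 t)" "two_valued_drift m1 m2" "\<bar>m1\<bar> + \<bar>m2\<bar>" x p
      "if 0 \<le> 2 * p - 1 then 1 else -1"
    by (rule skew_core_extension[OF no_atom])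
  have b: "two_valued_drift m1 m2 z = m1" if "0 < z" for z using that by (simp add: two_valued_drift_def)
  have b': "two_valued_drift m1 m2 z = m2" if "z < 0" for z using that by (simp add: two_valued_drift_def)
  note Yt = YM[OF less_imp_le[OF t]]
  show "AE y in lborel. 0 < y \<longrightarrow> \<epsilon> * q t y \<le> \<epsilon> * kern k p m1 m2 y t x"
  proof (rule density_compare[OF p Yt t])
    show "\<epsilon> * (\<integral>\<omega>. kern k p m1 m2 y r (Y t \<omega>) \<partial>M) \<le> \<epsilon> * kern k p m1 m2 y (t + r) x" if "0 < y" "0 < r" for y r
      using C.kernel_bound[OF p b b' that(1) t that(2) \<epsilon> k] t by simp
  qed (use d[OF t] in auto)
  have "AE y in lborel. 0 < y \<longrightarrow> \<epsilon> * q t (- y) \<le> \<epsilon> * kern k (1 - p) (- m2) (- m1) y t (- x)"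
  proof (rule density_compare[where Z="\<lambda>\<omega>. - Y t \<omega>"])
    show "\<epsilon> * (\<integral>\<omega>. kern k (1 - p) (- m2) (- m1) y r (- Y t \<omega>) \<partial>M)
        \<le> \<epsilon> * kern k (1 - p) (- m2) (- m1) y (t + r) (- x)" if "0 < y" "0 < r" for y r
      using C.kernel_bound_reflected[OF p b b' that(1) t that(2) \<epsilon> k] t by simp
    fix A :: "real set" assume A: "A \<in> sets borel"
    define A' where "A' = {z. - z \<in> A}"
    have A': "A' \<in> sets borel"
    proof -
      have "uminus -` A \<inter> space borel \<in> sets (borel :: real measure)" by (rule measurable_sets[OF _ A]) measurable
      then show ?thesis by (simp add: A'_def vimage_def)
    qed
    have "integrable lborel (\<lambda>y. indicator A' y *\<^sub>R q t y)" using d[OF t A'] by (simp add: set_integrable_def)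
    then have "integrable lborel (\<lambda>y. indicator A' (0 + (-1) * y) *\<^sub>R q t (0 + (-1) * y))"
      by (subst lborel_integrable_real_affine_iff[of "-1" "\<lambda>y. indicator A' y *\<^sub>R q t y" 0]) auto
    then show "set_integrable lborel A (\<lambda>y. q t (- y))" by (simp add: set_integrable_def A'_def indicator_def)
    have "(LBINT y:A. q t (- y)) = (LBINT y:A'. q t y)"
      unfolding A'_def by (subst set_integral_reflect) simp
    also have "\<dots> = prob {\<omega> \<in> space M. - Y t \<omega> \<in> A}" using d[OF t A'] by (simp add: A'_def)
    finally show "(LBINT y:A. q t (- y)) = prob {\<omega> \<in> space M. - Y t \<omega> \<in> A}" .
  qed (use p t Yt in auto)
  then have "AE y in distr lborel borel uminus. 0 < y \<longrightarrow> \<epsilon> * q t (- y) \<le> \<epsilon> * kern k (1 - p) (- m2) (- m1) y t (- x)"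
    unfolding lborel_distr_uminus .
  from AE_distrD[OF _ this]
  have "AE y in lborel. 0 < - y \<longrightarrow> \<epsilon> * q t (- (- y)) \<le> \<epsilon> * kern k (1 - p) (- m2) (- m1) (- y) t (- x)" by simp
  then show "AE y in lborel. y < 0 \<longrightarrow> \<epsilon> * q t y \<le> \<epsilon> * kern k (1 - p) (- m2) (- m1) (- y) t (- x)" by simp
qed

end

section \<open>Explicit form of the kernels\<close>

lemma excursion_integral:
  assumes t: "0 < t" and w: "0 \<le> w" and f: "\<And>l. f l = l + w"
  shows "Hk (kern_rate p m1 m2) t w = 1 / sqrt (2 * pi * t ^ 3)
      * (LBINT l:{0..}. f l * exp (- l * p * m1 + l * (1 - p) * m2 - (f l)\<^sup>2 / (2 * t)))"
proof -
  \<comment> \<open>\<open>f\<close> is left abstract so that the four spellings of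
    \<open>l + w\<close> in the theorem match without rearrangement.\<close>
  have "(LBINT l:{0..}. f l * exp (- l * p * m1 + l * (1 - p) * m2 - (f l)\<^sup>2 / (2 * t)))
     = (LBINT l:{0..}. (l + w) * exp (- kern_rate p m1 m2 * l - (l + w)\<^sup>2 / (2 * t)))"
  proof -
    have "- l * p * m1 + l * (1 - p) * m2 = - kern_rate p m1 m2 * l" for l by (simp add: kern_rate_def algebra_simps)
    then show ?thesis unfolding f by simp
  qed
  then show ?thesis using Hk_integral(1)[OF t w, of "kern_rate p m1 m2"] t by simp
qed

text \<open>This invariance is why the exponent in \<open>l\<close> is the same in all four cases of
  the theorem.\<close>

lemma kern_rate_reflect: "kern_rate (1 - p) (- m2) (- m1) = kern_rate p m1 m2"
  by (simp add: kern_rate_def algebra_simps)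

lemma kern_forms:
  assumes t: "0 < t"
  shows "0 < x \<Longrightarrow> y < 0 \<Longrightarrow> kern k (1 - p) (- m2) (- m1) (- y) t (- x) =
      2 * (1 - p) / sqrt (2 * pi * t ^ 3) * exp (- m1 * x + m2 * y - k * t / 2) *
        (LBINT l:{0..}. (l - y + x) * exp (- l * p * m1 + l * (1 - p) * m2 - (l - y + x)\<^sup>2 / (2 * t)))"
    "0 < x \<Longrightarrow> 0 < y \<Longrightarrow> kern k p m1 m2 y t x =
      2 * p / sqrt (2 * pi * t ^ 3) * exp (m1 * (y - x) - k * t / 2) *
        (LBINT l:{0..}. (l + y + x) * exp (- l * p * m1 + l * (1 - p) * m2 - (l + y + x)\<^sup>2 / (2 * t)))
      + exp (- m1\<^sup>2 * t / 2 + m1 * (y - x)) / sqrt (2 * pi * t)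
          * (exp (- \<bar>x - y\<bar>\<^sup>2 / (2 * t)) - exp (- \<bar>x + y\<bar>\<^sup>2 / (2 * t)))"
    "x < 0 \<Longrightarrow> 0 < y \<Longrightarrow> kern k p m1 m2 y t x =
      2 * p / sqrt (2 * pi * t ^ 3) * exp (- m2 * x + m1 * y - k * t / 2) *
        (LBINT l:{0..}. (l + y - x) * exp (- l * p * m1 + l * (1 - p) * m2 - (l + y - x)\<^sup>2 / (2 * t)))"
    "x < 0 \<Longrightarrow> y < 0 \<Longrightarrow> kern k (1 - p) (- m2) (- m1) (- y) t (- x) =
      2 * (1 - p) / sqrt (2 * pi * t ^ 3) * exp (m2 * (y - x) - k * t / 2) *
        (LBINT l:{0..}. (l - y - x) * exp (- l * p * m1 + l * (1 - p) * m2 - (l - y - x)\<^sup>2 / (2 * t)))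
      + exp (- m2\<^sup>2 * t / 2 + m2 * (y - x)) / sqrt (2 * pi * t)
          * (exp (- \<bar>x - y\<bar>\<^sup>2 / (2 * t)) - exp (- \<bar>x + y\<bar>\<^sup>2 / (2 * t)))"
proof -
  \<comment> \<open>The summands of the kernels are treated separately: \<open>crossing\<close> is
    the term with the integral over local time, belonging to paths that reach 0,
    \<open>killed\<close> the difference of Gaussians, belonging to paths that avoid it.\<close>
  have crossing: "2 * r * exp u * (exp v * (1 / s * I)) = 2 * r / s * exp w * I"
      if "u + v = w" for r u v w s I :: real
    using that by (simp add: exp_add[symmetric])
  have killed: "exp u * (exp v * (gk t a - gk t c)) = exp w / sqrt (2 * pi * t)
      * (exp (- \<bar>x - y\<bar>\<^sup>2 / (2 * t)) - exp (- \<bar>x + y\<bar>\<^sup>2 / (2 * t)))"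
    if "u + v = w" "a\<^sup>2 = (x - y)\<^sup>2" "c\<^sup>2 = (x + y)\<^sup>2" for u v w a c
    using that unfolding gk_def power2_abs by (simp add: exp_add[symmetric] diff_divide_distrib[symmetric]
        mult.assoc[symmetric])
  show "kern k (1 - p) (- m2) (- m1) (- y) t (- x) =
      2 * (1 - p) / sqrt (2 * pi * t ^ 3) * exp (- m1 * x + m2 * y - k * t / 2) *
        (LBINT l:{0..}. (l - y + x) * exp (- l * p * m1 + l * (1 - p) * m2 - (l - y + x)\<^sup>2 / (2 * t)))" if xy: "0
            < x" "y < 0"
  proof -
    have H: "Hk (kern_rate p m1 m2) t (x - y) = 1 / sqrt (2 * pi * t ^ 3) *
        (LBINT l:{0..}. (l - y + x) * exp (- l * p * m1 + l * (1 - p) * m2 - (l - y + x)\<^sup>2 / (2 * t)))"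
      by (rule excursion_integral[OF t]) (use xy in auto)
    have "kern k (1 - p) (- m2) (- m1) (- y) t (- x) = 2 * (1 - p) * exp (- m2 * - y)
        * (exp (- k * t / 2 - - m1 * - x) * Hk (kern_rate p m1 m2) t (x - y))"
      using xy by (simp add: kern_def glue_def kneg_def kern_rate_reflect)
    then show ?thesis unfolding H by (subst (asm) crossing[where w="- m1 * x + m2 * y - k * t / 2"]) simp_all
  qed
  show "kern k p m1 m2 y t x =
      2 * p / sqrt (2 * pi * t ^ 3) * exp (m1 * (y - x) - k * t / 2) *
        (LBINT l:{0..}. (l + y + x) * exp (- l * p * m1 + l * (1 - p) * m2 - (l + y + x)\<^sup>2 / (2 * t)))
      + exp (- m1\<^sup>2 * t / 2 + m1 * (y - x)) / sqrt (2 * pi * t)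
          * (exp (- \<bar>x - y\<bar>\<^sup>2 / (2 * t)) - exp (- \<bar>x + y\<bar>\<^sup>2 / (2 * t)))" if xy: "0 < x" "0 < y"
  proof -
    have H: "Hk (kern_rate p m1 m2) t (y + x) = 1 / sqrt (2 * pi * t ^ 3) *
        (LBINT l:{0..}. (l + y + x) * exp (- l * p * m1 + l * (1 - p) * m2 - (l + y + x)\<^sup>2 / (2 * t)))"
      by (rule excursion_integral[OF t]) (use xy in auto)
    have "kern k p m1 m2 y t x = 2 * p * exp (m1 * y) * (exp (- k * t / 2 - m1 * x)
        * Hk (kern_rate p m1 m2) t (y + x))
        + exp (m1 * y) * (exp (- m1\<^sup>2 * t / 2 - m1 * x) * (gk t (x - y) - gk t (y + x)))"
      using xy by (simp add: kern_def glue_def kpos_def)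
    moreover have "exp (m1 * y) * (exp (- m1\<^sup>2 * t / 2 - m1 * x) * (gk t (x - y) - gk t (y + x)))
        = exp (- m1\<^sup>2 * t / 2 + m1 * (y - x)) / sqrt (2 * pi * t)
            * (exp (- \<bar>x - y\<bar>\<^sup>2 / (2 * t)) - exp (- \<bar>x + y\<bar>\<^sup>2 / (2 * t)))"
      by (rule killed) (simp_all add: algebra_simps)
    moreover have "2 * p * exp (m1 * y) * (exp (- k * t / 2 - m1 * x) * Hk (kern_rate p m1 m2) t (y + x)) =
       2 * p / sqrt (2 * pi * t ^ 3) * exp (m1 * (y - x) - k * t / 2) *
        (LBINT l:{0..}. (l + y + x) * exp (- l * p * m1 + l * (1 - p) * m2 - (l + y + x)\<^sup>2 / (2 * t)))"
      unfolding H by (rule crossing) (simp add: algebra_simps)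
    ultimately show ?thesis by (simp only:)
  qed
  show "kern k p m1 m2 y t x =
      2 * p / sqrt (2 * pi * t ^ 3) * exp (- m2 * x + m1 * y - k * t / 2) *
        (LBINT l:{0..}. (l + y - x) * exp (- l * p * m1 + l * (1 - p) * m2 - (l + y - x)\<^sup>2 / (2 * t)))" if xy: "x
            < 0" "0 < y"
  proof -
    have H: "Hk (kern_rate p m1 m2) t (y - x) = 1 / sqrt (2 * pi * t ^ 3) *
        (LBINT l:{0..}. (l + y - x) * exp (- l * p * m1 + l * (1 - p) * m2 - (l + y - x)\<^sup>2 / (2 * t)))"
      by (rule excursion_integral[OF t]) (use xy in auto)
    have "kern k p m1 m2 y t x = 2 * p * exp (m1 * y) * (exp (- k * t / 2 - m2 * x)
        * Hk (kern_rate p m1 m2) t (y - x))"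
      using xy by (simp add: kern_def glue_def kneg_def)
    also have "\<dots> = 2 * p / sqrt (2 * pi * t ^ 3) * exp (- m2 * x + m1 * y - k * t / 2) *
        (LBINT l:{0..}. (l + y - x) * exp (- l * p * m1 + l * (1 - p) * m2 - (l + y - x)\<^sup>2 / (2 * t)))"
      unfolding H by (rule crossing) (simp add: algebra_simps)
    finally show ?thesis .
  qed
  show "kern k (1 - p) (- m2) (- m1) (- y) t (- x) =
      2 * (1 - p) / sqrt (2 * pi * t ^ 3) * exp (m2 * (y - x) - k * t / 2) *
        (LBINT l:{0..}. (l - y - x) * exp (- l * p * m1 + l * (1 - p) * m2 - (l - y - x)\<^sup>2 / (2 * t)))
      + exp (- m2\<^sup>2 * t / 2 + m2 * (y - x)) / sqrt (2 * pi * t)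
          * (exp (- \<bar>x - y\<bar>\<^sup>2 / (2 * t)) - exp (- \<bar>x + y\<bar>\<^sup>2 / (2 * t)))" if xy: "x < 0" "y < 0"
  proof -
    have H: "Hk (kern_rate p m1 m2) t (- y + - x) = 1 / sqrt (2 * pi * t ^ 3) *
        (LBINT l:{0..}. (l - y - x) * exp (- l * p * m1 + l * (1 - p) * m2 - (l - y - x)\<^sup>2 / (2 * t)))"
      by (rule excursion_integral[OF t]) (use xy in auto)
    have "kern k (1 - p) (- m2) (- m1) (- y) t (- x) = 2 * (1 - p) * exp (m2 * y)
        * (exp (- k * t / 2 - m2 * x) * Hk (kern_rate p m1 m2) t (- y + - x))
        + exp (m2 * y) * (exp (- m2\<^sup>2 * t / 2 - m2 * x) * (gk t (- x - - y) - gk t (- y + - x)))"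
      using xy by (simp add: kern_def glue_def kpos_def kern_rate_reflect)
    moreover have "exp (m2 * y) * (exp (- m2\<^sup>2 * t / 2 - m2 * x) * (gk t (- x - - y) - gk t (- y + - x)))
        = exp (- m2\<^sup>2 * t / 2 + m2 * (y - x)) / sqrt (2 * pi * t)
            * (exp (- \<bar>x - y\<bar>\<^sup>2 / (2 * t)) - exp (- \<bar>x + y\<bar>\<^sup>2 / (2 * t)))"
      by (rule killed) (simp_all add: algebra_simps power2_eq_square)
    moreover have "2 * (1 - p) * exp (m2 * y) * (exp (- k * t / 2 - m2 * x) * Hk (kern_rate p m1 m2) t (- y + - x)) =
       2 * (1 - p) / sqrt (2 * pi * t ^ 3) * exp (m2 * (y - x) - k * t / 2) *
        (LBINT l:{0..}. (l - y - x) * exp (- l * p * m1 + l * (1 - p) * m2 - (l - y - x)\<^sup>2 / (2 * t)))"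
      unfolding H by (rule crossing) (simp add: algebra_simps)
    ultimately show ?thesis by (simp only:)
  qed
qed

theorem theorem1p1:
  fixes p m1 m2 :: real
    and M :: "real \<Rightarrow> 'a measure" and F :: "real \<Rightarrow> real \<Rightarrow> 'a measure"
    and B Y L :: "real \<Rightarrow> real \<Rightarrow> 'a \<Rightarrow> real"
    and q :: "real \<Rightarrow> real \<Rightarrow> real \<Rightarrow> real"
  assumes "0 < p" and "p < 1"
    and "\<And>x. skew_bm_two_valued_drift (M x) (F x) (B x) (Y x) (L x) p m1 m2 x"
    and "is_transition_density M Y q"
  shows "\<forall>t>0.
      (\<forall>x>0. AE y in lborel. y \<le> 0 \<longrightarrow>
             2 * (1 - p) / sqrt (2 * pi * t ^ 3) *
               exp (- m1 * x + m2 * y - (max \<bar>m1\<bar> \<bar>m2\<bar>)\<^sup>2 * t / 2) *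
               (LBINT l:{0..}. (l - y + x) * exp (- l * p * m1 + l * (1 - p) * m2 - (l - y + x)\<^sup>2 / (2 * t)))
           \<le> q t x y \<and>
           q t x y \<le>
             2 * (1 - p) / sqrt (2 * pi * t ^ 3) *
               exp (- m1 * x + m2 * y - (min \<bar>m1\<bar> \<bar>m2\<bar>)\<^sup>2 * t / 2) *
               (LBINT l:{0..}. (l - y + x) * exp (- l * p * m1 + l * (1 - p) * m2 - (l - y + x)\<^sup>2 / (2 * t)))) \<and>
      (\<forall>x>0. AE y in lborel. y > 0 \<longrightarrow>
             2 * p / sqrt (2 * pi * t ^ 3) *
               exp (m1 * (y - x) - (max \<bar>m1\<bar> \<bar>m2\<bar>)\<^sup>2 * t / 2) *
               (LBINT l:{0..}. (l + y + x) * exp (- l * p * m1 + l * (1 - p) * m2 - (l + y + x)\<^sup>2 / (2 * t)))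
             + exp (- m1\<^sup>2 * t / 2 + m1 * (y - x)) / sqrt (2 * pi * t) *
               (exp (- \<bar>x - y\<bar>\<^sup>2 / (2 * t)) - exp (- \<bar>x + y\<bar>\<^sup>2 / (2 * t)))
           \<le> q t x y \<and>
           q t x y \<le>
             2 * p / sqrt (2 * pi * t ^ 3) *
               exp (m1 * (y - x) - (min \<bar>m1\<bar> \<bar>m2\<bar>)\<^sup>2 * t / 2) *
               (LBINT l:{0..}. (l + y + x) * exp (- l * p * m1 + l * (1 - p) * m2 - (l + y + x)\<^sup>2 / (2 * t)))
             + exp (- m1\<^sup>2 * t / 2 + m1 * (y - x)) / sqrt (2 * pi * t) *
               (exp (- \<bar>x - y\<bar>\<^sup>2 / (2 * t)) - exp (- \<bar>x + y\<bar>\<^sup>2 / (2 * t)))) \<and>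
      (\<forall>x<0. AE y in lborel. y \<ge> 0 \<longrightarrow>
             2 * p / sqrt (2 * pi * t ^ 3) *
               exp (- m2 * x + m1 * y - (max \<bar>m1\<bar> \<bar>m2\<bar>)\<^sup>2 * t / 2) *
               (LBINT l:{0..}. (l + y - x) * exp (- l * p * m1 + l * (1 - p) * m2 - (l + y - x)\<^sup>2 / (2 * t)))
           \<le> q t x y \<and>
           q t x y \<le>
             2 * p / sqrt (2 * pi * t ^ 3) *
               exp (- m2 * x + m1 * y - (min \<bar>m1\<bar> \<bar>m2\<bar>)\<^sup>2 * t / 2) *
               (LBINT l:{0..}. (l + y - x) * exp (- l * p * m1 + l * (1 - p) * m2 - (l + y - x)\<^sup>2 / (2 * t)))) \<and>
      (\<forall>x<0. AE y in lborel. y < 0 \<longrightarrow>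
             2 * (1 - p) / sqrt (2 * pi * t ^ 3) *
               exp (m2 * (y - x) - (max \<bar>m1\<bar> \<bar>m2\<bar>)\<^sup>2 * t / 2) *
               (LBINT l:{0..}. (l - y - x) * exp (- l * p * m1 + l * (1 - p) * m2 - (l - y - x)\<^sup>2 / (2 * t)))
             + exp (- m2\<^sup>2 * t / 2 + m2 * (y - x)) / sqrt (2 * pi * t) *
               (exp (- \<bar>x - y\<bar>\<^sup>2 / (2 * t)) - exp (- \<bar>x + y\<bar>\<^sup>2 / (2 * t)))
           \<le> q t x y \<and>
           q t x y \<le>
             2 * (1 - p) / sqrt (2 * pi * t ^ 3) *
               exp (m2 * (y - x) - (min \<bar>m1\<bar> \<bar>m2\<bar>)\<^sup>2 * t / 2) *
               (LBINT l:{0..}. (l - y - x) * exp (- l * p * m1 + l * (1 - p) * m2 - (l - y - x)\<^sup>2 / (2 * t)))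
             + exp (- m2\<^sup>2 * t / 2 + m2 * (y - x)) / sqrt (2 * pi * t) *
               (exp (- \<bar>x - y\<bar>\<^sup>2 / (2 * t)) - exp (- \<bar>x + y\<bar>\<^sup>2 / (2 * t))))"
proof -
  let ?hi = "(max \<bar>m1\<bar> \<bar>m2\<bar>)\<^sup>2" and ?lo = "(min \<bar>m1\<bar> \<bar>m2\<bar>)\<^sup>2"
  have sq: "?lo \<le> m1\<^sup>2" "?lo \<le> m2\<^sup>2" "m1\<^sup>2 \<le> ?hi" "m2\<^sup>2 \<le> ?hi"
    by (auto simp: min_def max_def abs_le_square_iff)
  have dens: "set_integrable lborel A (q s x) \<and> (LBINT y:A. q s x y) = measure (M x) {\<omega> \<in> space (M x). Y x s \<omega> \<in> A}"
    if "0 < s" "A \<in> sets borel" for s x A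
    using assms(4) that unfolding is_transition_density_def by blast
  \<comment> \<open>Two of the four ranges of \<open>y\<close> contain 0, which the kernel bounds
    leave out; it is a null set.\<close>
  have AE0: "AE y in lborel. y \<noteq> (0::real)" by (rule AE_lborel_singleton)
  have bounds:
    "AE y in lborel. 0 < y \<longrightarrow> kern ?hi p m1 m2 y t x \<le> q t x y \<and> q t x y \<le> kern ?lo p m1 m2 y t x"
    "AE y in lborel. y < 0 \<longrightarrow> kern ?hi (1 - p) (- m2) (- m1) (- y) t (- x) \<le> q t x y \<and>
       q t x y \<le> kern ?lo (1 - p) (- m2) (- m1) (- y) t (- x)" if t: "0 < t" for t x
  proof -
    interpret S: skew_bm_two_valued_drift "M x" "F x" "B x" "Y x" "L x" p m1 m2 x by (rule assms(3))
    have d: "set_integrable lborel A ((\<lambda>s. q s x) s) \<and> (LBINT y:A. (\<lambda>s. q s x) s y)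
        = measure (M x) {\<omega> \<in> space (M x). Y x s \<omega> \<in> A}"
      if "0 < s" "A \<in> sets borel" for s A
      using dens[OF that] by simp
    \<comment> \<open>Upper bounds take \<open>\<epsilon> = 1\<close> and the smaller square, lower
      bounds \<open>\<epsilon> = -1\<close> and the larger one; in both cases the sign conditions
      compare \<open>k\<close> with both squared drifts.\<close>
    have U: "(1::real) \<in> {-1, 1}" "1 * (?lo - m1\<^sup>2) \<le> 0" "1 * (?lo - m2\<^sup>2) \<le> 0"
      and D: "(-1::real) \<in> {-1, 1}" "-1 * (?hi - m1\<^sup>2) \<le> 0" "-1 * (?hi - m2\<^sup>2) \<le> 0"
      using sq by simp_all
    have up1: "AE y in lborel. 0 < y \<longrightarrow> 1 * q t x y \<le> 1 * kern ?lo p m1 m2 y t x"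
      by (rule S.density_bounds(1)[where q = "\<lambda>s. q s x", OF assms(1,2) t _ U]) (rule d)
    have low1: "AE y in lborel. 0 < y \<longrightarrow> -1 * q t x y \<le> -1 * kern ?hi p m1 m2 y t x"
      by (rule S.density_bounds(1)[where q = "\<lambda>s. q s x", OF assms(1,2) t _ D]) (rule d)
    have up2: "AE y in lborel. y < 0 \<longrightarrow> 1 * q t x y \<le> 1 * kern ?lo (1 - p) (- m2) (- m1) (- y) t (- x)"
      by (rule S.density_bounds(2)[where q = "\<lambda>s. q s x", OF assms(1,2) t _ U]) (rule d)
    have low2: "AE y in lborel. y < 0 \<longrightarrow> -1 * q t x y \<le> -1 * kern ?hi (1 - p) (- m2) (- m1) (- y) t (- x)"
      by (rule S.density_bounds(2)[where q = "\<lambda>s. q s x", OF assms(1,2) t _ D]) (rule d)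
    show "AE y in lborel. 0 < y \<longrightarrow> kern ?hi p m1 m2 y t x \<le> q t x y \<and> q t x y \<le> kern ?lo p m1 m2 y t x"
      using up1 low1 by eventually_elim simp
    show "AE y in lborel. y < 0 \<longrightarrow> kern ?hi (1 - p) (- m2) (- m1) (- y) t (- x) \<le> q t x y \<and>
       q t x y \<le> kern ?lo (1 - p) (- m2) (- m1) (- y) t (- x)"
      using up2 low2 by eventually_elim simp
  qed
  show ?thesis
  proof (intro allI impI conjI, goal_cases)
    case (1 t x)
    note tx = this
    show ?case using bounds(2)[OF tx(1), of x] AE0
    proof eventually_elim
      case (elim y)
      show ?case
      proof (rule impI, goal_cases)
        case 1
        with elim have y: "y < 0" by linarith
        from elim(1)[rule_format, OF y] show ?case unfolding kern_forms(1)[OF tx y] .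
      qed
    qed
  next
    case (2 t x)
    note tx = this
    show ?case using bounds(1)[OF tx(1), of x]
    proof eventually_elim
      case (elim y)
      show ?case
      proof (rule impI, goal_cases)
        case 1
        with elim have y: "0 < y" by linarith
        from elim[rule_format, OF y] show ?case unfolding kern_forms(2)[OF tx y] .
      qed
    qed
  next
    case (3 t x)
    note tx = this
    show ?case using bounds(1)[OF tx(1), of x] AE0
    proof eventually_elim
      case (elim y)
      show ?case
      proof (rule impI, goal_cases)
        case 1
        with elim have y: "0 < y" by linarith
        from elim(1)[rule_format, OF y] show ?case unfolding kern_forms(3)[OF tx y] .
      qed
    qed
  next
    case (4 t x)
    note tx = this
    show ?case using bounds(2)[OF tx(1), of x]
    proof eventually_elim
      case (elim y)
      show ?case
      proof (rule impI, goal_cases)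
        case 1
        with elim have y: "y < 0" by linarith
        from elim[rule_format, OF y] show ?case unfolding kern_forms(4)[OF tx y] .
      qed
    qed
  qed
qed

end
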